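(* Let $\Omega$ be a non-empty open subset of $\ell^2$, let $m\in\mathbb{N}$ and $p\in[1,\infty)$. Then $C^{\infty}_{\ell^2}(\Omega,\mathbb{R})\cap W^{m,p}(\Omega,P)\cap C^{\infty}_{\mathscr F}(\Omega,loc)$ is dense in $W^{m,p}(\Omega,P)$ (with respect to the norm $\|\cdot\|_{W^{m,p}(\Omega,P)}$).
   Context: Setting. $\ell^2$ is the real Hilbert space of square-summable sequences $\mathbf{x}=(x_i)_{i\in\mathbb{N}}$ with norm $\|\cdot\|$; $B_R$ is the open ball of radius $R$ about $\mathbf 0$; $\mathbf e_i$ is the $i$-th unit vector. Fix a sequence of positive numbers $(a_i)_{i\ge1}$ with $\sum_i a_i<\infty$. $P$ is the Borel probability measure on $\ell^2$ obtained by restricting to $\ell^2$ the product measure $\prod_{i}\mathcal N_{a_i}$ on $\mathbb{R}^{\mathbb{N}}$, where $\mathcal N_a$ is the centered Gaussian measure on $\mathbb{R}$ with variance $a^2$. Multi-indices. $\mathbb{N}_0^{(\mathbb{N})}$ is the set of finitely supported sequences $\alpha=(\alpha_i)$ of non-negative integers; $|\alpha|=\sum_i\alpha_i$, $\mathbf a^\alpha=\prod_i a_i^{\alpha_i}$. $\frac{\partial f}{\partial x_i}$ is the partial derivative along $\mathbf e_i$, $D^\alpha f=\frac{\partial^{|\alpha|}f}{\partial x_1^{\alpha_1}\partial x_2^{\alpha_2}\cdots}$, $\delta_i f(\mathbf x)=\frac{\partial f}{\partial x_i}(\mathbf x)-\frac{x_i}{a_i^2}f(\mathbf x)$, $\delta^\alpha=\delta_1^{\alpha_1}\delta_2^{\alpha_2}\cdots$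 (with $D^0f=\delta^0f=f$). Uniform inclusion. For $S,V\subset\ell^2$, $S\stackrel{\circ}{\subset}V$ means there are $r,R\in(0,\infty)$ with $\bigcup_{\mathbf z\in S}B(\mathbf z,r)\subset V$ and $S\subset B_R$. Test functions. $C^k(\Omega)$: real functions which together with all partial derivatives up to order $k$ are continuous on $\Omega$ for the $\ell^2$ topology; $C^\infty(\Omega)=\bigcap_k C^k(\Omega)$. $C^k_b(\Omega)$: $f\in C^k(\Omega)$ with $f$ and each partial derivative up to order $k$ bounded. $C^k_0(\Omega)=\{f\in C^k_b(\Omega):\mathrm{supp} f\stackrel{\circ}{\subset}\Omega\}$, $C_0^\infty(\Omega)=\bigcap_kC_0^k(\Omega)$. $C^1_F(\Omega)=\{f\in C^1(\Omega):\sup_E(|f|+\sum_{i}|\partial f/\partial x_i|^2)<\infty\ \forall E\stackrel{\circ}{\subset}\Omega\}$. $C^\infty_{F^\infty}(\Omega)=\{f\in C^\infty(\Omega):D^\alpha f\in C^1_F(\Omega)\ \forall\alpha\}$, $C^\infty_{0,F^\infty}(\Omega)=C_0^\infty(\Omega)\cap C^\infty_{F^\infty}(\Omega)$. Sobolev space. For $f,g\in L^p(\Omega,P)$, $D^\alpha f=g$ (weakly) means $\int_\Omega f\,\delta^\alpha\phi\,dP=(-1)^{|\alpha|}\int_\Omega g\phi\,dP$ for all $\phi\in C^\infty_{0,F^\infty}(\Omega)$. $W^{m,p}(\Omega,P)$ is the set of $f\in L^p(\Omega,P)$ having $D^\alpha f\in L^p(\Omega,P)$ for all $|\alpha|\le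 m$ with $\|f\|_{W^{m,p}(\Omega,P)}:=\big(\sum_{|\alpha|\le m}\int_\Omega|\mathbf a^\alpha D^\alpha f|^p\,dP\big)^{1/p}<\infty$. Smooth classes. $C^\infty_{\ell^2}(\Omega,\mathbb{R})$: infinitely Fréchet differentiable real functions on $\Omega$ (with respect to the $\ell^2$ norm). A real function $f$ on $\Omega$ is $\mathcal F$-continuous if for all $\mathbf x\in\Omega$, $n\in\mathbb{N}$, the map $(s_1,\dots,s_n)\mapsto f(\mathbf x+\sum_{j\le n}s_j\mathbf e_j)$ is continuous on the open set of those $s\in\mathbb{R}^n$ for which the argument lies in $\Omega$. $C^k_{\mathcal F}(\Omega)$: $\mathcal F$-continuous Borel functions all of whose partial derivatives of order up to $k$ exist and are $\mathcal F$-continuous and Borel. For $k\in\mathbb{N}$, $q\ge1$: $C^{k,q}_{\mathscr F}(\Omega)=\{g\in C^k_{\mathcal F}(\Omega):\sup_\Omega\sum_{|\alpha|\le k}|\mathbf a^\alpha D^\alpha g|^q<\infty\}$; $C^{k,q}_{\mathscr F}(\Omega,loc)=\{f\in C^k_{\mathcal F}(\Omega): f|_V\in C^{k,q}_{\mathscr F}(V)\text{ for every non-empty open }V\stackrel{\circ}{\subset}\Omega\}$; $C^\infty_{\mathscr F}(\Omega,loc)=\bigcap_{k\in\mathbb{N},q\ge1}C^{k,q}_{\mathscr F}(\Omega,loc)$. *)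

theory Defs
  imports "HOL-Probability.Probability" "HOL-Library.Poly_Mapping"
begin

section \<open>The real Hilbert space of square-summable sequences\<close>

typedef ell2 = "{x :: nat \<Rightarrow> real. summable (\<lambda>i. (x i)\<^sup>2)}"
  morphisms coord Abs_ell2
  by (rule exI[of _ "\<lambda>_. 0"]) simp

setup_lifting type_definition_ell2

lemma summable_coord_sq: "summable (\<lambda>i. (coord x i)\<^sup>2)"
  using coord[of x] by simp

lemma summable_mult_sq:
  fixes x y :: "nat \<Rightarrow> real"
  assumes "summable (\<lambda>i. (x i)\<^sup>2)" "summable (\<lambda>i. (y i)\<^sup>2)"
  shows "summable (\<lambda>i. x i * y i)"
proof (rule summable_comparison_test'[where N = 0])
  show "summable (\<lambda>i. (x i)\<^sup>2 + (y i)\<^sup>2)"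
    using assms by (rule summable_add)
  show "norm (x i * y i) \<le> (x i)\<^sup>2 + (y i)\<^sup>2" for i
  proof -
    have "2 * (\<bar>x i\<bar> * \<bar>y i\<bar>) \<le> \<bar>x i\<bar>\<^sup>2 + \<bar>y i\<bar>\<^sup>2"
      using sum_squares_bound[of "\<bar>x i\<bar>" "\<bar>y i\<bar>"] by (simp add: mult.assoc)
    moreover have "0 \<le> \<bar>x i\<bar> * \<bar>y i\<bar>" by simp
    ultimately show ?thesis unfolding real_norm_def abs_mult power2_abs by linarith
  qed
qed

lemma summable_add_sq:
  fixes x y :: "nat \<Rightarrow> real"
  assumes "summable (\<lambda>i. (x i)\<^sup>2)" "summable (\<lambda>i. (y i)\<^sup>2)"
  shows "summable (\<lambda>i. (x i + y i)\<^sup>2)"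
proof -
  have "summable (\<lambda>i. (x i)\<^sup>2 + (y i)\<^sup>2 + 2 * (x i * y i))"
    using assms summable_mult_sq[OF assms] by (intro summable_add summable_mult)
  then show ?thesis by (simp add: power2_sum algebra_simps)
qed

lemma summable_scale_sq:
  fixes x :: "nat \<Rightarrow> real"
  assumes "summable (\<lambda>i. (x i)\<^sup>2)"
  shows "summable (\<lambda>i. (c * x i)\<^sup>2)"
  using summable_mult[OF assms, of "c\<^sup>2"] by (simp add: power_mult_distrib)

instantiation ell2 :: real_inner
begin

lift_definition zero_ell2 :: ell2 is "\<lambda>_. 0" by simp
lift_definition plus_ell2 :: "ell2 \<Rightarrow> ell2 \<Rightarrow> ell2" is "\<lambda>x y i. x i + y i"
  by (rule summable_add_sq)
lift_definition uminus_ell2 :: "ell2 \<Rightarrow> ell2" is "\<lambda>x i. - x i" by simp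
lift_definition minus_ell2 :: "ell2 \<Rightarrow> ell2 \<Rightarrow> ell2" is "\<lambda>x y i. x i - y i"
  subgoal for x y using summable_add_sq[of x "\<lambda>i. - y i"] by simp
  done
lift_definition scaleR_ell2 :: "real \<Rightarrow> ell2 \<Rightarrow> ell2" is "\<lambda>c x i. c * x i"
  by (rule summable_scale_sq)

definition inner_ell2 :: "ell2 \<Rightarrow> ell2 \<Rightarrow> real"
  where "inner_ell2 x y = suminf (\<lambda>i. coord x i * coord y i)"
definition norm_ell2 :: "ell2 \<Rightarrow> real" where "norm_ell2 x = sqrt (inner x x)"
definition dist_ell2 :: "ell2 \<Rightarrow> ell2 \<Rightarrow> real" where "dist_ell2 x y = norm (x - y)"
definition sgn_ell2 :: "ell2 \<Rightarrow> ell2" where "sgn_ell2 x = inverse (norm x) *\<^sub>R x"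
definition uniformity_ell2 :: "(ell2 \<times> ell2) filter"
  where "uniformity_ell2 = (INF e\<in>{0<..}. principal {(x, y). dist x y < e})"
definition open_ell2 :: "ell2 set \<Rightarrow> bool"
  where "open_ell2 U = (\<forall>x\<in>U. eventually (\<lambda>(x', y). x' = x \<longrightarrow> y \<in> U) uniformity)"

lemmas coord_simps =
  zero_ell2.rep_eq plus_ell2.rep_eq uminus_ell2.rep_eq minus_ell2.rep_eq scaleR_ell2.rep_eq

instance
proof
  fix x y z :: ell2 and c d :: real
  have sm: "summable (\<lambda>i. coord u i * coord v i)" for u v
    by (rule summable_mult_sq) (rule summable_coord_sq)+
  show "x + y + z = x + (y + z)" by transfer (simp add: add.assoc)
  show "x + y = y + x" by transfer (simp add: add.commute)
  show "0 + x = x" by transfer simp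
  show "- x + x = 0" by transfer simp
  show "x - y = x + - y" by transfer simp
  show "c *\<^sub>R (x + y) = c *\<^sub>R x + c *\<^sub>R y" by transfer (simp add: algebra_simps)
  show "(c + d) *\<^sub>R x = c *\<^sub>R x + d *\<^sub>R x" by transfer (simp add: algebra_simps)
  show "c *\<^sub>R d *\<^sub>R x = (c * d) *\<^sub>R x" by transfer (simp add: algebra_simps)
  show "1 *\<^sub>R x = x" by transfer simp
  show "dist x y = norm (x - y)" by (rule dist_ell2_def)
  show "sgn x = inverse (norm x) *\<^sub>R x" by (rule sgn_ell2_def)
  show "uniformity = (INF e\<in>{0<..}. principal {(x, y :: ell2). dist x y < e})"
    by (rule uniformity_ell2_def)
  show "open U = (\<forall>x\<in>U. \<forall>\<^sub>F (x', y) in uniformity. x' = x \<longrightarrow> y \<in> U)" for U :: "ell2 set"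
    by (rule open_ell2_def)
  show "x \<bullet> y = y \<bullet> x" by (simp add: inner_ell2_def mult.commute)
  show "(x + y) \<bullet> z = x \<bullet> z + y \<bullet> z"
    by (simp add: inner_ell2_def coord_simps distrib_right suminf_add[OF sm sm])
  show "(c *\<^sub>R x) \<bullet> y = c * (x \<bullet> y)"
    by (simp add: inner_ell2_def coord_simps mult.assoc suminf_mult[OF sm])
  show "0 \<le> x \<bullet> x"
    unfolding inner_ell2_def by (rule suminf_nonneg[OF sm]) simp
  show "(x \<bullet> x = 0) = (x = 0)"
  proof -
    have "(x \<bullet> x = 0) = (\<forall>i. coord x i * coord x i = 0)"
      unfolding inner_ell2_def by (rule suminf_eq_zero_iff[OF sm]) simp
    then show ?thesis
      by (simp add: coord_inject[symmetric] coord_simps fun_eq_iff)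
  qed
  show "norm x = sqrt (x \<bullet> x)" by (rule norm_ell2_def)
qed

end

lemma norm_ell2_sq: "(norm (x :: ell2))\<^sup>2 = suminf (\<lambda>i. (coord x i)\<^sup>2)"
  unfolding power2_norm_eq_inner inner_ell2_def by (simp add: power2_eq_square)

lemma sum_coord_sq_le: "(\<Sum>i<n. (coord x i)\<^sup>2) \<le> (norm x)\<^sup>2"
  unfolding norm_ell2_sq by (rule sum_le_suminf[OF summable_coord_sq]) auto

lemma abs_coord_le_norm: "\<bar>coord x i\<bar> \<le> norm x"
proof -
  have "(coord x i)\<^sup>2 \<le> (\<Sum>j<Suc i. (coord x j)\<^sup>2)"
    by (rule member_le_sum[of i "{..<Suc i}" "\<lambda>j. (coord x j)\<^sup>2"]) auto
  also have "\<dots> \<le> (norm x)\<^sup>2" by (rule sum_coord_sq_le)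
  finally show ?thesis by (metis abs_le_square_iff abs_norm_cancel)
qed

instance ell2 :: complete_space
proof
  fix X :: "nat \<Rightarrow> ell2"
  assume X: "Cauchy X"
  have "convergent (\<lambda>m. coord (X m) i)" for i
  proof (rule Cauchy_convergent, rule CauchyI)
    fix e :: real assume "0 < e"
    then obtain N where N: "\<And>m n. m \<ge> N \<Longrightarrow> n \<ge> N \<Longrightarrow> norm (X m - X n) < e"
      using CauchyD[OF X, of e] by blast
    have "norm (coord (X m) i - coord (X n) i) < e" if "m \<ge> N" "n \<ge> N" for m n
      using abs_coord_le_norm[of "X m - X n" i] N[OF that] by (simp add: coord_simps)
    then show "\<exists>M. \<forall>m\<ge>M. \<forall>n\<ge>M. norm (coord (X m) i - coord (X n) i) < e" by blast
  qed
  then obtain l where l: "\<And>i. (\<lambda>m. coord (X m) i) \<longlonglongrightarrow> l i"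
    using choice[of "\<lambda>i L. (\<lambda>m. coord (X m) i) \<longlonglongrightarrow> L"] unfolding convergent_def by blast
  have bound: "\<exists>N. \<forall>m\<ge>N. \<forall>n. (\<Sum>i<n. (coord (X m) i - l i)\<^sup>2) \<le> e\<^sup>2" if "0 < e" for e :: real
  proof -
    obtain N where N: "\<And>m n. m \<ge> N \<Longrightarrow> n \<ge> N \<Longrightarrow> norm (X m - X n) < e"
      using CauchyD[OF X, of e] \<open>0 < e\<close> by blast
    have "(\<Sum>i<n. (coord (X m) i - l i)\<^sup>2) \<le> e\<^sup>2" if m: "m \<ge> N" for m n
    proof (rule tendsto_upperbound)
      show "(\<lambda>k. \<Sum>i<n. (coord (X m) i - coord (X k) i)\<^sup>2)
              \<longlonglongrightarrow> (\<Sum>i<n. (coord (X m) i - l i)\<^sup>2)"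
        by (intro tendsto_intros l)
      show "\<forall>\<^sub>F k in sequentially. (\<Sum>i<n. (coord (X m) i - coord (X k) i)\<^sup>2) \<le> e\<^sup>2"
      proof (rule eventually_sequentiallyI[of N])
        fix k assume k: "N \<le> k"
        have "(\<Sum>i<n. (coord (X m) i - coord (X k) i)\<^sup>2) \<le> (norm (X m - X k))\<^sup>2"
          using sum_coord_sq_le[of "X m - X k" n] by (simp add: coord_simps)
        also have "\<dots> \<le> e\<^sup>2" using N[OF m k] by (intro power_mono) auto
        finally show "(\<Sum>i<n. (coord (X m) i - coord (X k) i)\<^sup>2) \<le> e\<^sup>2" .
      qed
    qed simp
    then show ?thesis by blast
  qed
  have sd: "summable (\<lambda>i. (coord (X m) i - l i)\<^sup>2)"
    if "\<forall>n. (\<Sum>i<n. (coord (X m) i - l i)\<^sup>2) \<le> C" for m C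
    using that by (intro summableI_nonneg_bounded) auto
  obtain N1 where N1: "\<forall>m\<ge>N1. \<forall>n. (\<Sum>i<n. (coord (X m) i - l i)\<^sup>2) \<le> 1\<^sup>2"
    using bound[of 1] by auto
  have "summable (\<lambda>i. (coord (X N1) i + - 1 * (coord (X N1) i - l i))\<^sup>2)"
    by (intro summable_add_sq summable_scale_sq summable_coord_sq sd[of N1 "1\<^sup>2"]) (use N1 in auto)
  then have sl: "summable (\<lambda>i. (l i)\<^sup>2)" by simp
  have cl: "coord (Abs_ell2 l) = l" using sl by (simp add: Abs_ell2_inverse)
  have "X \<longlonglongrightarrow> Abs_ell2 l"
  proof (rule LIMSEQ_I)
    fix e :: real assume "0 < e"
    then obtain N where N: "\<forall>m\<ge>N. \<forall>n. (\<Sum>i<n. (coord (X m) i - l i)\<^sup>2) \<le> (e / 2)\<^sup>2"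
      using bound[of "e / 2"] by auto
    have "norm (X m - Abs_ell2 l) < e" if "m \<ge> N" for m
    proof -
      have "(norm (X m - Abs_ell2 l))\<^sup>2 \<le> (e / 2)\<^sup>2"
        unfolding norm_ell2_sq
        using N that by (intro suminf_le_const summable_coord_sq) (auto simp: coord_simps cl)
      then have "norm (X m - Abs_ell2 l) \<le> e / 2"
        using \<open>0 < e\<close> by (simp add: power2_le_iff_abs_le)
      then show ?thesis using \<open>0 < e\<close> by simp
    qed
    then show "\<exists>N. \<forall>m\<ge>N. norm (X m - Abs_ell2 l) < e" by blast
  qed
  then show "convergent X" unfolding convergent_def by blast
qed

lift_definition unit_vec :: "nat \<Rightarrow> ell2" is "\<lambda>i j. if j = i then 1 else 0"
  subgoal for i by (rule summable_finite[of "{i}"]) auto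
  done


section \<open>The Gaussian measure\<close>

text \<open>The second argument of \<^const>\<open>normal_density\<close> is the standard deviation, so the
  \<open>i\<close>-th factor has variance \<open>(a i)\<^sup>2\<close>. The restriction of the product measure to the square-summable
  sequences is transported to the type \<^typ>\<open>ell2\<close>, with its Borel sets, along the bijection
  \<^const>\<open>Abs_ell2\<close>.\<close>

definition gaussian_product :: "(nat \<Rightarrow> real) \<Rightarrow> (nat \<Rightarrow> real) measure" where
  "gaussian_product a = (\<Pi>\<^sub>M i\<in>UNIV. density lborel (normal_density 0 (a i)))"

definition gaussian_ell2 :: "(nat \<Rightarrow> real) \<Rightarrow> ell2 measure" where
  "gaussian_ell2 a = distr (restrict_space (gaussian_product a) (range coord)) borel Abs_ell2"


section \<open>Multi-indices and partial derivatives\<close>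

text \<open>Functions on an open set \<open>\<Omega>\<close> are modelled by total functions on \<^typ>\<open>ell2\<close>; all notions below
  depend only on the values in \<open>\<Omega>\<close>.\<close>

type_synonym multi_index = "nat \<Rightarrow>\<^sub>0 nat"

definition mi_order :: "multi_index \<Rightarrow> nat" where
  "mi_order \<alpha> = (\<Sum>i\<in>Poly_Mapping.keys \<alpha>. Poly_Mapping.lookup \<alpha> i)"

definition mi_power :: "(nat \<Rightarrow> real) \<Rightarrow> multi_index \<Rightarrow> real" where
  "mi_power a \<alpha> = (\<Prod>i\<in>Poly_Mapping.keys \<alpha>. a i ^ Poly_Mapping.lookup \<alpha> i)"

text \<open>The increasing list containing each \<open>i\<close> exactly \<open>\<alpha>\<^sub>i\<close> times.\<close>

definition mi_list :: "multi_index \<Rightarrow> nat list" where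
  "mi_list \<alpha> = concat (map (\<lambda>i. replicate (Poly_Mapping.lookup \<alpha> i) i)
                         (sorted_list_of_set (Poly_Mapping.keys \<alpha>)))"

definition has_pd :: "nat \<Rightarrow> (ell2 \<Rightarrow> real) \<Rightarrow> ell2 \<Rightarrow> bool" where
  "has_pd i f x \<longleftrightarrow> (\<lambda>t. f (x + t *\<^sub>R unit_vec i)) differentiable (at 0)"

definition pd :: "nat \<Rightarrow> (ell2 \<Rightarrow> real) \<Rightarrow> ell2 \<Rightarrow> real" where
  "pd i f x = deriv (\<lambda>t. f (x + t *\<^sub>R unit_vec i)) 0"

definition delta :: "(nat \<Rightarrow> real) \<Rightarrow> nat \<Rightarrow> (ell2 \<Rightarrow> real) \<Rightarrow> ell2 \<Rightarrow> real" where
  "delta a i f x = pd i f x - coord x i / (a i)\<^sup>2 * f x"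

text \<open>Iterated partial derivatives in an arbitrary order of differentiation; the head of the list is
  the outermost derivative.\<close>

definition pds :: "nat list \<Rightarrow> (ell2 \<Rightarrow> real) \<Rightarrow> ell2 \<Rightarrow> real" where
  "pds is f = foldr pd is f"

definition pds_exist :: "nat \<Rightarrow> ell2 set \<Rightarrow> (ell2 \<Rightarrow> real) \<Rightarrow> bool" where
  "pds_exist k \<Omega> f \<longleftrightarrow> (\<forall>is i. length is < k \<longrightarrow> (\<forall>x\<in>\<Omega>. has_pd i (pds is f) x))"

definition Dmi :: "multi_index \<Rightarrow> (ell2 \<Rightarrow> real) \<Rightarrow> ell2 \<Rightarrow> real" where
  "Dmi \<alpha> f = foldr pd (mi_list \<alpha>) f"

definition delta_mi :: "(nat \<Rightarrow> real) \<Rightarrow> multi_index \<Rightarrow> (ell2 \<Rightarrow> real) \<Rightarrow> ell2 \<Rightarrow> real" where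
  "delta_mi a \<alpha> f = foldr (delta a) (mi_list \<alpha>) f"


section \<open>Test functions\<close>

definition unif_incl :: "ell2 set \<Rightarrow> ell2 set \<Rightarrow> bool" where
  "unif_incl S V \<longleftrightarrow> (\<exists>r>0. \<exists>R>0. (\<Union>z\<in>S. ball z r) \<subseteq> V \<and> S \<subseteq> ball 0 R)"

definition C_k :: "nat \<Rightarrow> ell2 set \<Rightarrow> (ell2 \<Rightarrow> real) set" where
  "C_k k \<Omega> = {f. pds_exist k \<Omega> f \<and> (\<forall>is. length is \<le> k \<longrightarrow> continuous_on \<Omega> (pds is f))}"

definition C_infty :: "ell2 set \<Rightarrow> (ell2 \<Rightarrow> real) set" where
  "C_infty \<Omega> = (\<Inter>k. C_k k \<Omega>)"

definition C_b :: "nat \<Rightarrow> ell2 set \<Rightarrow> (ell2 \<Rightarrow> real) set" where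
  "C_b k \<Omega> = {f \<in> C_k k \<Omega>. \<forall>is. length is \<le> k \<longrightarrow> bounded (pds is f ` \<Omega>)}"

text \<open>The support of a function on \<open>\<Omega>\<close>, closed relative to \<open>\<Omega>\<close>.\<close>

definition supp_in :: "ell2 set \<Rightarrow> (ell2 \<Rightarrow> real) \<Rightarrow> ell2 set" where
  "supp_in \<Omega> f = \<Omega> \<inter> closure {x \<in> \<Omega>. f x \<noteq> 0}"

definition C_0 :: "nat \<Rightarrow> ell2 set \<Rightarrow> (ell2 \<Rightarrow> real) set" where
  "C_0 k \<Omega> = {f \<in> C_b k \<Omega>. unif_incl (supp_in \<Omega> f) \<Omega>}"

definition C_0_infty :: "ell2 set \<Rightarrow> (ell2 \<Rightarrow> real) set" where
  "C_0_infty \<Omega> = (\<Inter>k. C_0 k \<Omega>)"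

definition C1_F :: "ell2 set \<Rightarrow> (ell2 \<Rightarrow> real) set" where
  "C1_F \<Omega> = {f \<in> C_k 1 \<Omega>. \<forall>E. unif_incl E \<Omega> \<longrightarrow>
      (SUP x\<in>E. ennreal \<bar>f x\<bar> + suminf (\<lambda>i. ennreal (\<bar>pd i f x\<bar>\<^sup>2))) < \<infinity>}"

definition C_infty_F :: "ell2 set \<Rightarrow> (ell2 \<Rightarrow> real) set" where
  "C_infty_F \<Omega> = {f \<in> C_infty \<Omega>. \<forall>\<alpha>. Dmi \<alpha> f \<in> C1_F \<Omega>}"

definition test_fun :: "ell2 set \<Rightarrow> (ell2 \<Rightarrow> real) set" where
  "test_fun \<Omega> = C_0_infty \<Omega> \<inter> C_infty_F \<Omega>"


section \<open>Sobolev spaces\<close>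

text \<open>Elements of the Lebesgue and Sobolev spaces are represented by functions rather than by
  equivalence classes modulo null sets.\<close>

definition Lp_on :: "real \<Rightarrow> (nat \<Rightarrow> real) \<Rightarrow> ell2 set \<Rightarrow> (ell2 \<Rightarrow> real) set" where
  "Lp_on p a \<Omega> = {f. set_borel_measurable (gaussian_ell2 a) \<Omega> f \<and>
                     set_integrable (gaussian_ell2 a) \<Omega> (\<lambda>x. \<bar>f x\<bar> powr p)}"

definition has_weak_D ::
  "real \<Rightarrow> (nat \<Rightarrow> real) \<Rightarrow> ell2 set \<Rightarrow> multi_index \<Rightarrow> (ell2 \<Rightarrow> real) \<Rightarrow> (ell2 \<Rightarrow> real) \<Rightarrow> bool"
where
  "has_weak_D p a \<Omega> \<alpha> f g \<longleftrightarrow> f \<in> Lp_on p a \<Omega> \<and> g \<in> Lp_on p a \<Omega> \<and>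
     (\<forall>\<phi>\<in>test_fun \<Omega>.
        (LINT x:\<Omega>|gaussian_ell2 a. f x * delta_mi a \<alpha> \<phi> x) =
        (- 1) ^ mi_order \<alpha> * (LINT x:\<Omega>|gaussian_ell2 a. g x * \<phi> x))"

text \<open>Weak derivatives are unique up to null sets, so the integrals below do not depend on the
  choice.\<close>

definition weak_D ::
  "real \<Rightarrow> (nat \<Rightarrow> real) \<Rightarrow> ell2 set \<Rightarrow> multi_index \<Rightarrow> (ell2 \<Rightarrow> real) \<Rightarrow> ell2 \<Rightarrow> real" where
  "weak_D p a \<Omega> \<alpha> f = (SOME g. has_weak_D p a \<Omega> \<alpha> f g)"

definition sobolev_sum ::
  "nat \<Rightarrow> real \<Rightarrow> (nat \<Rightarrow> real) \<Rightarrow> ell2 set \<Rightarrow> (ell2 \<Rightarrow> real) \<Rightarrow> ennreal" where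
  "sobolev_sum m p a \<Omega> f =
     (\<Sum>\<^sub>\<infinity>\<alpha>\<in>{\<alpha>. mi_order \<alpha> \<le> m}.
        \<integral>\<^sup>+x\<in>\<Omega>. ennreal (\<bar>mi_power a \<alpha> * weak_D p a \<Omega> \<alpha> f x\<bar> powr p) \<partial>gaussian_ell2 a)"

definition sobolev ::
  "nat \<Rightarrow> real \<Rightarrow> (nat \<Rightarrow> real) \<Rightarrow> ell2 set \<Rightarrow> (ell2 \<Rightarrow> real) set" where
  "sobolev m p a \<Omega> = {f \<in> Lp_on p a \<Omega>.
     (\<forall>\<alpha>. mi_order \<alpha> \<le> m \<longrightarrow> (\<exists>g. has_weak_D p a \<Omega> \<alpha> f g)) \<and> sobolev_sum m p a \<Omega> f < \<infinity>}"

definition sobolev_norm ::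
  "nat \<Rightarrow> real \<Rightarrow> (nat \<Rightarrow> real) \<Rightarrow> ell2 set \<Rightarrow> (ell2 \<Rightarrow> real) \<Rightarrow> real" where
  "sobolev_norm m p a \<Omega> f = enn2real (sobolev_sum m p a \<Omega> f) powr (1 / p)"


section \<open>Smooth classes\<close>

text \<open>The \<open>k\<close>-th Frechet derivative, an element of
  \<open>L(\<ell>\<^sup>2, L(\<ell>\<^sup>2, \<dots>, L(\<ell>\<^sup>2, \<real>)\<dots>))\<close>, is identified as usual with a bounded \<open>k\<close>-linear form, here
  acting on lists of length \<open>k\<close>.\<close>

definition bounded_multilinear :: "nat \<Rightarrow> (ell2 list \<Rightarrow> real) \<Rightarrow> bool" where
  "bounded_multilinear k T \<longleftrightarrow>
     (\<forall>vs j. length vs = k \<longrightarrow> j < k \<longrightarrow> linear (\<lambda>v. T (vs[j := v]))) \<and>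
     (\<exists>C. \<forall>vs. length vs = k \<longrightarrow> \<bar>T vs\<bar> \<le> C * prod_list (map norm vs))"

text \<open>\<open>F (Suc k) x\<close> is the Frechet derivative of \<open>F k\<close> at \<open>x\<close> with respect to the operator norm on
  \<open>k\<close>-linear forms.\<close>

definition frechet_smooth :: "ell2 set \<Rightarrow> (ell2 \<Rightarrow> real) set" where
  "frechet_smooth \<Omega> = {f. \<exists>F :: nat \<Rightarrow> ell2 \<Rightarrow> ell2 list \<Rightarrow> real.
     (\<forall>x\<in>\<Omega>. F 0 x [] = f x) \<and>
     (\<forall>k. \<forall>x\<in>\<Omega>. bounded_multilinear k (F k x)) \<and>
     (\<forall>k. \<forall>x\<in>\<Omega>. \<forall>\<epsilon>>0. \<forall>\<^sub>F h in at 0. \<forall>vs. length vs = k \<longrightarrow>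
        \<bar>F k (x + h) vs - F k x vs - F (Suc k) x (h # vs)\<bar> \<le> \<epsilon> * norm h * prod_list (map norm vs))}"

text \<open>A vector \<open>s \<in> \<real>\<^sup>n\<close> is encoded as a function on \<^typ>\<open>nat\<close> vanishing from \<open>n\<close> on; on these functions
  the product topology of \<^typ>\<open>nat \<Rightarrow> real\<close> is the Euclidean topology.\<close>

definition F_continuous :: "ell2 set \<Rightarrow> (ell2 \<Rightarrow> real) \<Rightarrow> bool" where
  "F_continuous \<Omega> f \<longleftrightarrow> (\<forall>x\<in>\<Omega>. \<forall>n.
     continuous_on {s :: nat \<Rightarrow> real. (\<forall>j\<ge>n. s j = 0) \<and> x + (\<Sum>j<n. s j *\<^sub>R unit_vec j) \<in> \<Omega>}
       (\<lambda>s. f (x + (\<Sum>j<n. s j *\<^sub>R unit_vec j))))"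

definition CF :: "nat \<Rightarrow> ell2 set \<Rightarrow> (ell2 \<Rightarrow> real) set" where
  "CF k \<Omega> = {f. pds_exist k \<Omega> f \<and> (\<forall>is. length is \<le> k \<longrightarrow>
      F_continuous \<Omega> (pds is f) \<and> set_borel_measurable borel \<Omega> (pds is f))}"

definition CF_kq :: "(nat \<Rightarrow> real) \<Rightarrow> nat \<Rightarrow> real \<Rightarrow> ell2 set \<Rightarrow> (ell2 \<Rightarrow> real) set" where
  "CF_kq a k q \<Omega> = {g \<in> CF k \<Omega>.
     (SUP x\<in>\<Omega>. \<Sum>\<^sub>\<infinity>\<alpha>\<in>{\<alpha>. mi_order \<alpha> \<le> k}. ennreal (\<bar>mi_power a \<alpha> * Dmi \<alpha> g x\<bar> powr q)) < \<infinity>}"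

definition CF_kq_loc :: "(nat \<Rightarrow> real) \<Rightarrow> nat \<Rightarrow> real \<Rightarrow> ell2 set \<Rightarrow> (ell2 \<Rightarrow> real) set" where
  "CF_kq_loc a k q \<Omega> = {f \<in> CF k \<Omega>.
     \<forall>V. V \<noteq> {} \<longrightarrow> open V \<longrightarrow> unif_incl V \<Omega> \<longrightarrow> f \<in> CF_kq a k q V}"

definition CF_infty_loc :: "(nat \<Rightarrow> real) \<Rightarrow> ell2 set \<Rightarrow> (ell2 \<Rightarrow> real) set" where
  "CF_infty_loc a \<Omega> = (\<Inter>k\<in>{1..}. \<Inter>q\<in>{1..}. CF_kq_loc a k q \<Omega>)"

end

(* A Sobolev function is cut into countably many pieces h = tau f by a partition of unity whose members
have support uniformly inside the domain, and each piece is approximated separately with an error that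
decays fast enough to sum. The pieces are smoothed by the Mehler (Ornstein-Uhlenbeck) operator T n in the
first n coordinates: weak derivatives pass through T n up to powers of the contraction factor, since the
derivatives of its kernel in one variable are the operators delta in the other, and T n tends to the
identity in L^p. As T n h depends on finitely many coordinates it is Frechet smooth, but it is no longer
supported in the domain. It is therefore multiplied by a Frechet smooth cutoff: a partially smooth cutoff
psi (a Gaussian smoothing of a Lipschitz function) is composed with the projection to the first N
coordinates and multiplied by a cutoff of the tail of x. All cutoffs have derivatives whose squares,
weighted by the a i, are uniformly summable; with sum a i finite this makes the Leibniz formula bounded
on the weighted L^p sums and lets the cutoff error tend to zero. The approximants are glued by a locally
finite sum. *)

theory Submission
 imports Defs "HOL-Real_Asymp.Real_Asymp"
begin

section \<open>Iterated directional derivatives\<close>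

text \<open>The obstacle is the cutoffs. On \<open>\<ell>^2\<close> a Lipschitz function has a
  square-summable gradient, but nothing bounds its higher derivatives. Averaging over a Gaussian
  with variances proportional to \<open>a i\<close> gains one order: its normalised coordinates are
  orthonormal, so Bessel's inequality controls infinitely many first derivatives of the average at
  once, with the same bound. Order \<open>m\<close> takes about \<open>m\<close> averages.

  Such averages are differentiated along coordinates only. Projecting to finitely many coordinates
  gives Frechet smoothness but turns the support into a cylinder, hence the tail cutoff. Scaled by
  the tail sum of the \<open>a i\<close>, it has bounds independent of \<open>N\<close>; and since
  \<open>\<Sum> x_i^2 / a_i\<close> is finite almost surely, almost every point ends up where it
  equals 1.

  Weighted squares become weighted first powers through \<open>|u| \<le> 1 + u^2\<close> and the
  finiteness of \<open>\<Sum> a^\<alpha>\<close> over bounded order, and then p-th powers. Each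
  piece carries a second cutoff, equal to 1 on the support of the first: times the Mehler kernel it
  is a test function, which is how weak derivatives get through the smoothing.\<close>

definition dd :: "'a::real_normed_vector \<Rightarrow> ('a \<Rightarrow> real) \<Rightarrow> 'a \<Rightarrow> real" where
 "dd v f x = deriv (\<lambda>t. f (x + t *\<^sub>R v)) 0"

definition has_dd :: "'a::real_normed_vector \<Rightarrow> ('a \<Rightarrow> real) \<Rightarrow> 'a \<Rightarrow> bool" where
 "has_dd v f x \<longleftrightarrow> (\<lambda>t. f (x + t *\<^sub>R v)) differentiable (at 0)"

definition dds :: "'a::real_normed_vector list \<Rightarrow> ('a \<Rightarrow> real) \<Rightarrow> 'a \<Rightarrow> real" where
 "dds vs f = foldr dd vs f"

lemma pd_eq_dd: "pd i f = dd (unit_vec i) f"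
 by (rule ext) (simp only: pd_def dd_def)

lemma has_pd_eq: "has_pd i f x = has_dd (unit_vec i) f x"
 by (simp only: has_pd_def has_dd_def)

lemma pds_eq_dds: "pds is f = dds (map unit_vec is) f"
 by (induction "is" arbitrary: f) (simp_all add: pds_def dds_def pd_eq_dd)

lemma dds_Nil [simp]: "dds [] f = f"
 and dds_Cons [simp]: "dds (v # vs) f = dd v (dds vs f)"
 and dds_append: "dds (us @ vs) f = dds us (dds vs f)"
 by (simp_all add: dds_def)

lemma pds_Nil [simp]: "pds [] f = f"
 and pds_Cons [simp]: "pds (i # is) f = pd i (pds is f)"
 and pds_append: "pds (is @ js) f = pds is (pds js f)"
 by (simp_all add: pds_def)

lemma has_dd_DERIV:
 "has_dd v f x \<longleftrightarrow> DERIV (\<lambda>t. f (x + t *\<^sub>R v)) 0 :> dd v f x"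
 by (simp add: has_dd_def dd_def DERIV_deriv_iff_real_differentiable)

lemma dd_eqI:
 assumes "DERIV (\<lambda>t. f (x + t *\<^sub>R v)) 0 :> D"
 shows "has_dd v f x" "dd v f x = D"
 using assms by (auto simp: has_dd_def dd_def DERIV_imp_deriv real_differentiable_def)

lemma has_dd_at:
 assumes "has_dd v f (x + s *\<^sub>R v)"
 shows "DERIV (\<lambda>t. f (x + t *\<^sub>R v)) s :> dd v f (x + s *\<^sub>R v)"
proof -
 have "DERIV (\<lambda>t. f (x + (t + s) *\<^sub>R v)) 0 :> dd v f (x + s *\<^sub>R v)"
  using assms unfolding has_dd_DERIV by (simp add: algebra_simps)
 then show ?thesis
  using DERIV_shift[of "\<lambda>t. f (x + t *\<^sub>R v)" "dd v f (x + s *\<^sub>R v)" 0 s] by simp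
qed

lemma dd_cong_local:
 assumes "open U" "x \<in> U" "\<And>y. y \<in> U ==> f y = g y"
 shows "dd v f x = dd v g x" "has_dd v f x = has_dd v g x"
proof -
 have "((\<lambda>t. x + t *\<^sub>R v) \<longlongrightarrow> x + 0 *\<^sub>R v) (nhds 0)"
  by (intro tendsto_intros) (simp add: filterlim_ident)
 then have "\<forall>\<^sub>F t in nhds 0. x + t *\<^sub>R v \<in> U"
  using assms(1,2) by (intro topological_tendstoD) auto
 then have ev: "\<forall>\<^sub>F t in nhds 0. f (x + t *\<^sub>R v) = g (x + t *\<^sub>R v)"
  by eventually_elim (use assms(3) in auto)
 have eq: "DERIV (\<lambda>t. f (x + t *\<^sub>R v)) 0 :> D \<longleftrightarrow>
   DERIV (\<lambda>t. g (x + t *\<^sub>R v)) 0 :> D" for D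
  by (rule DERIV_cong_ev) (use ev in auto)
 show "has_dd v f x = has_dd v g x"
  unfolding has_dd_def real_differentiable_def eq ..
 show "dd v f x = dd v g x"
  unfolding dd_def deriv_def eq ..
qed

lemma dds_cong_local:
 assumes "open U" "x \<in> U" "\<And>y. y \<in> U ==> f y = g y"
 shows "dds vs f x = dds vs g x"
 using assms(2)
proof (induction vs arbitrary: x)
 case (Cons v vs)
 show ?case using dd_cong_local(1)[OF assms(1) Cons.prems Cons.IH] by simp
qed (use assms in auto)

lemma pds_cong_local:
 assumes "open U" "x \<in> U" "\<And>y. y \<in> U ==> f y = g y"
 shows "pds is f x = pds is g x"
 unfolding pds_eq_dds by (rule dds_cong_local[OF assms])

lemma dd_const [simp]: "dd v (\<lambda>x. c) = (\<lambda>x. 0)"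
 by (simp add: dd_def fun_eq_iff)

lemma dds_const: "vs \<noteq> [] ==> dds vs (\<lambda>x. c) = (\<lambda>x. 0)"
proof (induction vs)
 case (Cons v vs)
 then show ?case by (cases "vs = []") simp_all
qed simp

lemma dds_zero [simp]: "dds vs (\<lambda>x. 0) = (\<lambda>x. 0)"
 by (induction vs) simp_all

lemma pds_zero [simp]: "pds is (\<lambda>x. 0) = (\<lambda>x. 0)"
 by (simp add: pds_eq_dds)

lemma dd_add:
 assumes "has_dd v f x" "has_dd v g x"
 shows "has_dd v (\<lambda>x. f x + g x) x" "dd v (\<lambda>x. f x + g x) x = dd v f x + dd v g x"
 using dd_eqI[OF DERIV_add[OF assms[unfolded has_dd_DERIV]]] by auto

lemma dd_cmult:
 assumes "has_dd v f x"
 shows "has_dd v (\<lambda>x. c * f x) x" "dd v (\<lambda>x. c * f x) x = c * dd v f x"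
 using dd_eqI[OF DERIV_cmult[OF assms[unfolded has_dd_DERIV], of c]] by auto

lemma dd_mult:
 assumes "has_dd v f x" "has_dd v g x"
 shows "has_dd v (\<lambda>x. f x * g x) x"
  "dd v (\<lambda>x. f x * g x) x = dd v f x * g x + f x * dd v g x"
 using dd_eqI[OF DERIV_mult[OF assms[unfolded has_dd_DERIV]]] by (auto simp: algebra_simps)

lemma dd_chain:
 assumes "has_dd v f x" "DERIV h (f x) :> D"
 shows "has_dd v (\<lambda>x. h (f x)) x" "dd v (\<lambda>x. h (f x)) x = D * dd v f x"
proof -
 have "DERIV (\<lambda>t. h (f (x + t *\<^sub>R v))) 0 :> D * dd v f x"
  using DERIV_chain2[of h D "\<lambda>t. f (x + t *\<^sub>R v)" 0 "dd v f x" UNIV] assms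
  by (simp add: has_dd_DERIV)
 from dd_eqI[OF this] show "has_dd v (\<lambda>x. h (f x)) x" "dd v (\<lambda>x. h (f x)) x = D * dd v f x"
  by auto
qed

lemma dd_affine:
 assumes "has_dd v f (w + c *\<^sub>R x)"
 shows "has_dd v (\<lambda>x. f (w + c *\<^sub>R x)) x" "dd v (\<lambda>x. f (w + c *\<^sub>R x)) x = c * dd v f (w + c *\<^sub>R x)"
proof -
 have "DERIV (\<lambda>t. f (w + c *\<^sub>R x + (c * t) *\<^sub>R v)) 0 :> dd v f (w + c *\<^sub>R x) * c"
  by (rule DERIV_chain2[where f = "\<lambda>t. f (w + c *\<^sub>R x + t *\<^sub>R v)" and g = "\<lambda>t. c * t"])
   (use assms in \<open>auto simp: has_dd_DERIV intro!: derivative_eq_intros\<close>)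
 then have "DERIV (\<lambda>t. f (w + c *\<^sub>R (x + t *\<^sub>R v))) 0 :> c * dd v f (w + c *\<^sub>R x)"
  by (simp add: algebra_simps)
 from dd_eqI[OF this] show "has_dd v (\<lambda>x. f (w + c *\<^sub>R x)) x"
  "dd v (\<lambda>x. f (w + c *\<^sub>R x)) x = c * dd v f (w + c *\<^sub>R x)" by auto
qed

lemma dd_scale_dir:
 assumes "has_dd v f x"
 shows "has_dd (c *\<^sub>R v) f x" "dd (c *\<^sub>R v) f x = c * dd v f x"
proof -
 have "DERIV (\<lambda>t. f (x + (c * t) *\<^sub>R v)) 0 :> dd v f x * c"
  by (rule DERIV_chain2[where f = "\<lambda>t. f (x + t *\<^sub>R v)" and g = "\<lambda>t. c * t"])
   (use assms in \<open>auto simp: has_dd_DERIV intro!: derivative_eq_intros\<close>)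
 then have "DERIV (\<lambda>t. f (x + t *\<^sub>R (c *\<^sub>R v))) 0 :> c * dd v f x"
  by (simp add: algebra_simps)
 from dd_eqI[OF this] show "has_dd (c *\<^sub>R v) f x" "dd (c *\<^sub>R v) f x = c * dd v f x" by auto
qed

text \<open>Directional differentiability alone is not additive in the direction. Here the increment
  along \<open>w\<close>, started at \<open>x + t v\<close>, is \<open>t\<close> times
  \<open>dd w f\<close> at a point that tends to \<open>x\<close> (mean value theorem), and
  continuity of \<open>dd w f\<close> at \<open>x\<close> identifies the limit.\<close>

lemma dd_add_dir:
 assumes v: "has_dd v f x" and w: "\<And>y. has_dd w f y" and c: "continuous (at x) (dd w f)"
 shows "has_dd (v + w) f x" "dd (v + w) f x = dd v f x + dd w f x"
proof -
 have mv: "\<exists>\<xi>. \<bar>\<xi>\<bar> \<le> \<bar>t\<bar> \<and>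
   f (x + t *\<^sub>R (v + w)) - f (x + t *\<^sub>R v) = t * dd w f (x + t *\<^sub>R v + \<xi> *\<^sub>R w)" for t
 proof -
  let ?g = "\<lambda>s. f (x + t *\<^sub>R v + s *\<^sub>R w)"
  have d: "DERIV (?g) s :> dd w f (x + t *\<^sub>R v + s *\<^sub>R w)" for s
   by (rule has_dd_at[OF w])
  have "\<exists>\<xi>. \<bar>\<xi>\<bar> \<le> \<bar>t\<bar> \<and> ?g t - ?g 0 = t * dd w f (x + t *\<^sub>R v + \<xi> *\<^sub>R w)"
  proof (cases t "0::real" rule: linorder_cases)
   case less
   then obtain z where "t < z" "z < 0" "?g 0 - ?g t = (0 - t) * dd w f (x + t *\<^sub>R v + z *\<^sub>R w)"
    using MVT2[of t 0 ?g "\<lambda>s. dd w f (x + t *\<^sub>R v + s *\<^sub>R w)"] d by blast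
   then show ?thesis by (intro exI[of _ z]) auto
  next
   case greater
   then obtain z where "0 < z" "z < t" "?g t - ?g 0 = (t - 0) * dd w f (x + t *\<^sub>R v + z *\<^sub>R w)"
    using MVT2[of 0 t ?g "\<lambda>s. dd w f (x + t *\<^sub>R v + s *\<^sub>R w)"] d by blast
   then show ?thesis by (intro exI[of _ z]) auto
  qed (auto intro: exI[of _ 0])
  then show ?thesis by (simp add: algebra_simps)
 qed
 then obtain \<xi> where xi: "\<And>t. \<bar>\<xi> t\<bar> \<le> \<bar>t\<bar>"
  and eq: "\<And>t. f (x + t *\<^sub>R (v + w)) - f (x + t *\<^sub>R v) = t * dd w f (x + t *\<^sub>R v + \<xi> t *\<^sub>R w)"
  by metis
 have "(\<xi> \<longlongrightarrow> 0) (at 0)"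
  by (rule Lim_null_comparison[where g = "\<lambda>t. \<bar>t\<bar>"]) (use xi in \<open>auto intro!: tendsto_eq_intros\<close>)
 then have "((\<lambda>t. x + t *\<^sub>R v + \<xi> t *\<^sub>R w) \<longlongrightarrow> x + 0 *\<^sub>R v + 0 *\<^sub>R w) (at 0)"
  by (intro tendsto_intros)
 then have lim: "((\<lambda>t. dd w f (x + t *\<^sub>R v + \<xi> t *\<^sub>R w)) \<longlongrightarrow> dd w f x) (at 0)"
  using c by (intro isCont_tendsto_compose[where g = "dd w f" and l = x]) auto
 have "DERIV (\<lambda>t. f (x + t *\<^sub>R (v + w)) - f (x + t *\<^sub>R v)) 0 :> dd w f x"
  unfolding has_field_derivative_iff
 proof (rule Lim_transform_eventually[OF lim])
  show "\<forall>\<^sub>F t in at 0. dd w f (x + t *\<^sub>R v + \<xi> t *\<^sub>R w) =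
    (f (x + t *\<^sub>R (v + w)) - f (x + t *\<^sub>R v) - (f (x + 0 *\<^sub>R (v + w)) - f (x + 0 *\<^sub>R v))) / (t - 0)"
   unfolding eq by (auto simp: eventually_at_filter)
 qed
 from DERIV_add[OF this v[unfolded has_dd_DERIV]]
 have "DERIV (\<lambda>t. f (x + t *\<^sub>R (v + w))) 0 :> dd w f x + dd v f x"
  by simp
 from dd_eqI[OF this] show "has_dd (v + w) f x" "dd (v + w) f x = dd v f x + dd w f x" by auto
qed

lemma dd_mean_value:
 assumes d: "\<And>s. 0 \<le> s ==> s \<le> 1 ==> has_dd h f (x + s *\<^sub>R h)"
 shows "\<exists>s. 0 < s \<and> s < 1 \<and> f (x + h) - f x = dd h f (x + s *\<^sub>R h)"
proof -
 obtain z where "0 < z" "z < 1" "f (x + 1 *\<^sub>R h) - f (x + 0 *\<^sub>R h) = (1 - 0) * dd h f (x + z *\<^sub>R h)"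
  using MVT2[of 0 1 "\<lambda>t. f (x + t *\<^sub>R h)" "\<lambda>t. dd h f (x + t *\<^sub>R h)"] has_dd_at[OF d]
  by force
 then show ?thesis by auto
qed

subsection \<open>Regularity classes\<close>

text \<open>\<open>Q\<close> is a property demanded of the function and all its iterated derivatives
  along \<open>D\<close>. One calculus thus serves for several classes: locally Lipschitz
  (\<open>lipb\<close>), bounded Lipschitz (\<open>bl\<close>), bounded continuous with bounded
  support (\<open>QT\<close>), or no condition at all.\<close>

primrec reg :: "(('a \<Rightarrow> real) \<Rightarrow> bool) \<Rightarrow> nat \<Rightarrow> 'a::real_normed_vector set \<Rightarrow> ('a \<Rightarrow> real) \<Rightarrow> bool" where
 "reg Q 0 D f \<longleftrightarrow> Q f"
| "reg Q (Suc k) D f \<longleftrightarrow> Q f \<and> (\<forall>v\<in>D. (\<forall>x. has_dd v f x) \<and> reg Q k D (dd v f))"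

definition regular :: "(('a \<Rightarrow> real) \<Rightarrow> bool) \<Rightarrow> 'a::real_normed_vector set \<Rightarrow> ('a \<Rightarrow> real) \<Rightarrow> bool" where
 "regular Q D f \<longleftrightarrow> (\<forall>k. reg Q k D f)"

lemma reg_base: "reg Q k D f ==> Q f"
 by (cases k) auto

lemma reg_dec: "reg Q (Suc k) D f ==> reg Q k D f"
 by (induction k arbitrary: f) auto

lemma reg_mono:
 assumes "reg Q k D f" "\<And>f. Q f ==> Q' f" "D' \<subseteq> D"
 shows "reg Q' k D' f"
 using assms(1) by (induction k arbitrary: f) (use assms(2,3) in auto)

lemma reg_add:
 assumes "\<And>f g. Q f ==> Q g ==> Q (\<lambda>x. f x + g x)" "reg Q k D f" "reg Q k D g"
 shows "reg Q k D (\<lambda>x. f x + g x)"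
 using assms(2,3)
proof (induction k arbitrary: f g)
 case (Suc k)
 have "dd v (\<lambda>x. f x + g x) = (\<lambda>x. dd v f x + dd v g x)" if "v \<in> D" for v
  using Suc.prems that by (auto simp: fun_eq_iff dd_add)
 then show ?case using Suc assms(1) by (auto simp: dd_add)
qed (use assms(1) in auto)

text \<open>Three predicates because the factors may belong to different classes: later a
  \<open>lipb\<close> factor times a \<open>QT\<close> factor is \<open>QT\<close>.\<close>

lemma reg_mult:
 assumes m: "\<And>f g. P f ==> Q g ==> R (\<lambda>x. f x * g x)"
  and a: "\<And>f g. R f ==> R g ==> R (\<lambda>x. f x + g x)"
  and "reg P k D f" "reg Q k D g"
 shows "reg R k D (\<lambda>x. f x * g x)"
 using assms(3,4)
proof (induction k arbitrary: f g)
 case (Suc k)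
 have eq: "dd v (\<lambda>x. f x * g x) = (\<lambda>x. dd v f x * g x + f x * dd v g x)" if "v \<in> D" for v
  using Suc.prems that by (auto simp: fun_eq_iff dd_mult)
 have "reg R k D (\<lambda>x. dd v f x * g x + f x * dd v g x)" if "v \<in> D" for v
  using Suc.prems that by (intro reg_add a Suc.IH) (auto intro: reg_dec)
 then show ?case using Suc.prems m by (auto simp: dd_mult eq)
qed (use m in auto)

text \<open>The outer function comes as the sequence of all its derivatives, so that the chain rule
  stays inside the family and the induction runs over all \<open>n\<close> at once.\<close>

lemma reg_compose:
 assumes m: "\<And>f g. Q f ==> Q g ==> Q (\<lambda>x. f x * g x)"
  and a: "\<And>f g. Q f ==> Q g ==> Q (\<lambda>x. f x + g x)"
  and th: "\<And>n t. DERIV (th n) t :> th (Suc n) t"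
  and c: "\<And>n. Q (\<lambda>x. th n (f x))"
  and f: "reg Q k D f"
 shows "reg Q k D (\<lambda>x. th n (f x))"
 using f
proof (induction k arbitrary: n)
 case (Suc k)
 have eq: "dd v (\<lambda>x. th n (f x)) = (\<lambda>x. th (Suc n) (f x) * dd v f x)" if "v \<in> D" for v
  using Suc.prems that by (auto simp: fun_eq_iff dd_chain(2)[OF _ th])
 have "reg Q k D (\<lambda>x. th (Suc n) (f x) * dd v f x)" if "v \<in> D" for v
  by (rule reg_mult[where P = Q and Q = Q, OF m a Suc.IH])
   (use Suc.prems that in \<open>auto intro: reg_dec\<close>)
 then show ?case using Suc.prems c by (auto simp: dd_chain(1)[OF _ th] eq)
qed (use c in auto)

lemma regular_base: "regular Q D f ==> Q f"
 by (auto simp: regular_def dest: reg_base)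

lemma regular_has_dd: "regular Q D f ==> v \<in> D ==> has_dd v f x"
 unfolding regular_def by (drule spec[of _ "Suc 0"]) auto

lemma regular_dd: "regular Q D f ==> v \<in> D ==> regular Q D (dd v f)"
 unfolding regular_def by (metis reg.simps(2))

lemma regular_dds: "regular Q D f ==> vs \<in> lists D ==> regular Q D (dds vs f)"
 by (induction vs) (auto intro: regular_dd)

text \<open>Regularity is shown by exhibiting a family closed under differentiation, for instance
  all convolutions of one function with polynomial kernels.\<close>

lemma regular_coinduct:
 assumes "f \<in> C" "\<And>f. f \<in> C ==> Q f" "\<And>f v x. f \<in> C ==> v \<in> D ==> has_dd v f x"
  "\<And>f v. f \<in> C ==> v \<in> D ==> dd v f \<in> C"
 shows "regular Q D f"
proof -
 have "f \<in> C ==> reg Q k D f" for k f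
  by (induction k arbitrary: f) (use assms in auto)
 then show ?thesis using assms(1) by (simp add: regular_def)
qed

lemma regularI:
 assumes "\<And>vs. vs \<in> lists D ==> Q (dds vs f)"
  and "\<And>vs v x. vs \<in> lists D ==> v \<in> D ==> has_dd v (dds vs f) x"
 shows "regular Q D f"
proof (rule regular_coinduct[where C = "{dds vs f | vs. vs \<in> lists D}"])
 show "f \<in> {dds vs f |vs. vs \<in> lists D}" by (auto intro: exI[of _ "[]"])
 fix g v assume "g \<in> {dds vs f |vs. vs \<in> lists D}" "v \<in> D"
 then obtain vs where "g = dds vs f" "vs \<in> lists D" by blast
 with \<open>v \<in> D\<close> show "dd v g \<in> {dds vs f |vs. vs \<in> lists D}"
  by (auto intro!: exI[of _ "v # vs"])
qed (use assms in auto)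

lemma regular_mono:
 assumes "regular Q D f" "\<And>f. Q f ==> Q' f" "D' \<subseteq> D"
 shows "regular Q' D' f"
 using reg_mono[of Q _ D f Q' D'] assms unfolding regular_def by simp

lemma regular_add:
 assumes "\<And>f g. Q f ==> Q g ==> Q (\<lambda>x. f x + g x)" "regular Q D f" "regular Q D g"
 shows "regular Q D (\<lambda>x. f x + g x)"
 using reg_add[of Q _ D f g] assms unfolding regular_def by simp

lemma regular_mult:
 assumes "\<And>f g. P f ==> Q g ==> R (\<lambda>x. f x * g x)"
  and "\<And>f g. R f ==> R g ==> R (\<lambda>x. f x + g x)"
  and "regular P D f" "regular Q D g"
 shows "regular R D (\<lambda>x. f x * g x)"
 using reg_mult[of P Q R _ D f g] assms unfolding regular_def by simp

lemma regular_compose: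
 assumes "\<And>f g. Q f ==> Q g ==> Q (\<lambda>x. f x * g x)"
  and "\<And>f g. Q f ==> Q g ==> Q (\<lambda>x. f x + g x)"
  and "\<And>n t. DERIV (th n) t :> th (Suc n) t"
  and "\<And>n. Q (\<lambda>x. th n (f x))" and "regular Q D f"
 shows "regular Q D (\<lambda>x. th n (f x))"
 using reg_compose[of Q th f _ D n] assms unfolding regular_def by simp

lemma regular_const:
 assumes "\<And>c. Q (\<lambda>x. c)"
 shows "regular Q D (\<lambda>x. c)"
 by (rule regular_coinduct[where C = "range (\<lambda>c x. c)"]) (auto simp: assms has_dd_def)

lemma dds_add:
 assumes "regular Q D f" "regular Q' D g" "vs \<in> lists D"
 shows "dds vs (\<lambda>x. f x + g x) = (\<lambda>x. dds vs f x + dds vs g x)"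
 using assms(3)
proof (induction vs)
 case (Cons v vs)
 then show ?case
  using regular_has_dd[OF regular_dds[OF assms(1)], of vs v] regular_has_dd[OF regular_dds[OF assms(2)], of vs v]
  by (auto simp: dd_add)
qed auto

lemma dds_cmult:
 assumes "regular Q D f" "vs \<in> lists D"
 shows "dds vs (\<lambda>x. c * f x) = (\<lambda>x. c * dds vs f x)"
 using assms(2)
proof (induction vs)
 case (Cons v vs)
 then show ?case
  using regular_has_dd[OF regular_dds[OF assms(1)], of vs v] by (auto simp: dd_cmult)
qed auto

lemma regular_affine:
 assumes f: "regular Q D f" and Q: "\<And>c' g. Q g ==> Q' (\<lambda>x. c' * g (w + c *\<^sub>R x))"
 shows "regular Q' D (\<lambda>x. f (w + c *\<^sub>R x))"
  "vs \<in> lists D ==> dds vs (\<lambda>x. f (w + c *\<^sub>R x)) = (\<lambda>x. c ^ length vs * dds vs f (w + c *\<^sub>R x))"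
proof -
 have *: "dds vs (\<lambda>x. f (w + c *\<^sub>R x)) = (\<lambda>x. c ^ length vs * dds vs f (w + c *\<^sub>R x))"
  if "vs \<in> lists D" for vs
  using that
 proof (induction vs)
  case (Cons v vs)
  then have "has_dd v (dds vs f) y" for y
   using regular_has_dd[OF regular_dds[OF f]] by auto
  with Cons show ?case
   by (auto simp: dd_affine dd_cmult)
 qed auto
 show "vs \<in> lists D ==> dds vs (\<lambda>x. f (w + c *\<^sub>R x)) = (\<lambda>x. c ^ length vs * dds vs f (w + c *\<^sub>R x))"
  by (rule *)
 show "regular Q' D (\<lambda>x. f (w + c *\<^sub>R x))"
 proof (rule regularI)
  fix vs assume vs: "vs \<in> lists D"
  show "Q' (dds vs (\<lambda>x. f (w + c *\<^sub>R x)))"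
   unfolding *[OF vs] by (rule Q) (rule regular_base[OF regular_dds[OF f vs]])
  fix v x assume "v \<in> D"
  then show "has_dd v (dds vs (\<lambda>x. f (w + c *\<^sub>R x))) x"
   unfolding *[OF vs] using regular_has_dd[OF regular_dds[OF f vs]] by (intro dd_cmult dd_affine)
 qed
qed

subsection \<open>The Leibniz rule\<close>

text \<open>Index list of the Leibniz rule. Repetitions in it play the part of the binomial
  coefficients of the multi-index formula, and since the order of the entries is kept, sorted lists
  split into sorted lists.\<close>

primrec splits :: "'b list \<Rightarrow> ('b list \<times> 'b list) list" where
 "splits [] = [([], [])]"
| "splits (v # vs) = map (\<lambda>(a, b). (v # a, b)) (splits vs) @ map (\<lambda>(a, b). (a, v # b)) (splits vs)"

lemma length_splits [simp]: "length (splits vs) = 2 ^ length vs"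
 by (induction vs) auto

lemma splits_mset: "(a, b) \<in> set (splits vs) ==> mset vs = mset a + mset b"
 by (induction vs arbitrary: a b) auto

lemma splits_length: "(a, b) \<in> set (splits vs) ==> length vs = length a + length b"
 by (metis size_mset size_union splits_mset)

lemma splits_set: "(a, b) \<in> set (splits vs) ==> set a \<subseteq> set vs \<and> set b \<subseteq> set vs"
 by (metis Un_upper1 Un_upper2 set_mset_mset set_mset_union splits_mset)

lemma splits_sorted: "(a, b) \<in> set (splits vs) ==> sorted vs ==> sorted a \<and> sorted b"
proof (induction vs arbitrary: a b)
 case (Cons v vs)
 from Cons.prems(1) obtain a' b' where ab: "(a', b') \<in> set (splits vs)"
  "a = v # a' \<and> b = b' \<or> a = a' \<and> b = v # b'" by auto
 have "sorted a'" "sorted b'" using Cons.IH[OF ab(1)] Cons.prems(2) by auto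
 moreover have "\<forall>x\<in>set a' \<union> set b'. v \<le> x"
  using splits_set[OF ab(1)] Cons.prems(2) by auto
 ultimately show ?case using ab(2) by auto
qed auto

lemma splits_prod:
 fixes w :: "'b \<Rightarrow> 'c::comm_monoid_mult"
 shows "(a, b) \<in> set (splits vs) ==>
  prod_list (map w vs) = prod_list (map w a) * prod_list (map w b)"
 by (induction vs arbitrary: a b) (auto simp: ac_simps)

lemma splits_map: "splits (map h vs) = map (\<lambda>(a, b). (map h a, map h b)) (splits vs)"
 by (induction vs) (auto simp: o_def case_prod_beta)

lemma DERIV_sum_list:
 assumes "\<And>p. p \<in> set ps ==> DERIV (F p) t :> F' p"
 shows "DERIV (\<lambda>t. \<Sum>p\<leftarrow>ps. F p t) t :> (\<Sum>p\<leftarrow>ps. F' p)"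
 using assms by (induction ps) (auto intro!: derivative_intros)

lemma dd_sum_list:
 assumes "\<And>p. p \<in> set ps ==> has_dd v (F p) x"
 shows "has_dd v (\<lambda>x. \<Sum>p\<leftarrow>ps. F p x) x" "dd v (\<lambda>x. \<Sum>p\<leftarrow>ps. F p x) x = (\<Sum>p\<leftarrow>ps. dd v (F p) x)"
 using dd_eqI[OF DERIV_sum_list[of ps "\<lambda>p t. F p (x + t *\<^sub>R v)" "\<lambda>p. dd v (F p) x"]] assms
 by (auto simp: has_dd_DERIV)

lemma dds_mult:
 assumes f: "regular Q D f" and g: "regular Q' D g" and "vs \<in> lists D"
 shows "dds vs (\<lambda>x. f x * g x) = (\<lambda>x. \<Sum>(a, b)\<leftarrow>splits vs. dds a f x * dds b g x)"
 using assms(3)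
proof (induction vs rule: list.induct)
 case (Cons v vs)
 then have v: "v \<in> D" "set vs \<subseteq> D" by auto
 have ab: "has_dd v (dds (fst p) f) x" "has_dd v (dds (snd p) g) x" if "p \<in> set (splits vs)" for p x
 proof -
  have "fst p \<in> lists D" "snd p \<in> lists D"
   using splits_set[of "fst p" "snd p" vs] that v by auto
  then show "has_dd v (dds (fst p) f) x" "has_dd v (dds (snd p) g) x"
   using regular_has_dd[OF regular_dds[OF f]] regular_has_dd[OF regular_dds[OF g]] v by auto
 qed
 show ?case
 proof
  fix x
  have "dds (v # vs) (\<lambda>x. f x * g x) x =
    dd v (\<lambda>x. \<Sum>p\<leftarrow>splits vs. dds (fst p) f x * dds (snd p) g x) x"
   using Cons by (simp add: case_prod_beta)
  also have "\<dots> = (\<Sum>p\<leftarrow>splits vs. dd v (\<lambda>x. dds (fst p) f x * dds (snd p) g x) x)"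
   by (rule dd_sum_list(2)) (intro dd_mult ab)
  also have "\<dots> = (\<Sum>p\<leftarrow>splits vs. dd v (dds (fst p) f) x * dds (snd p) g x
    + dds (fst p) f x * dd v (dds (snd p) g) x)"
   by (intro arg_cong[where f = sum_list] map_cong refl dd_mult ab)
  also have "\<dots> = (\<Sum>(a, b)\<leftarrow>splits (v # vs). dds a f x * dds b g x)"
   by (simp add: case_prod_beta sum_list_addf o_def)
  finally show "dds (v # vs) (\<lambda>x. f x * g x) x = (\<Sum>(a, b)\<leftarrow>splits (v # vs). dds a f x * dds b g x)" .
 qed
qed auto

section \<open>The sequence space and its Gaussian measures\<close>

lemmas bint_diff = Bochner_Integration.integral_diff
lemmas bint_bound = Bochner_Integration.integrable_bound

abbreviation bmeas :: "('a::topological_space \<Rightarrow> 'b::topological_space) \<Rightarrow> bool" where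
 "bmeas f \<equiv> f \<in> borel_measurable borel"

lemma coord_unit_vec [simp]: "coord (unit_vec i) j = (if j = i then 1 else 0)"
 by (simp add: unit_vec.rep_eq)

lemma coord_sum: "coord (\<Sum>i\<in>A. f i) j = (\<Sum>i\<in>A. coord (f i) j)"
 by (induction A rule: infinite_finite_induct) (auto simp: coord_simps)

lemma ell2_eqI: "(\<And>i. coord x i = coord y i) ==> x = y"
 by (simp add: coord_inject[symmetric] fun_eq_iff)

lemma inner_unit_vec [simp]: "inner x (unit_vec i) = coord x i"
proof -
 have "inner x (unit_vec i) = (\<Sum>j\<in>{i}. coord x j * coord (unit_vec i) j)"
  unfolding inner_ell2_def by (intro suminf_finite) auto
 then show ?thesis by simp
qed

lemma norm_unit_vec [simp]: "norm (unit_vec i) = 1"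
 by (simp add: norm_ell2_def)

lemma continuous_on_coord [continuous_intros]:
 "continuous_on S f ==> continuous_on S (\<lambda>x. coord (f x) i)"
 unfolding inner_unit_vec[symmetric] by (intro continuous_intros)

lemma borel_measurable_coord [measurable]: "bmeas (\<lambda>x. coord x i)"
 by (intro borel_measurable_continuous_onI continuous_intros)

definition trunc :: "nat \<Rightarrow> ell2 \<Rightarrow> ell2" where
 "trunc n x = (\<Sum>i<n. coord x i *\<^sub>R unit_vec i)"

lemma coord_trunc [simp]: "coord (trunc n x) i = (if i < n then coord x i else 0)"
 by (simp add: trunc_def coord_sum coord_simps if_distrib sum.delta cong: if_cong)

lemma norm_trunc_diff: "(norm (x - trunc n x))^2 = (norm x)^2 - (\<Sum>i<n. (coord x i)^2)"
proof -
 have "(norm (x - trunc n x))^2 = (suminf (\<lambda>i. (coord x i)^2 - (if i < n then (coord x i)^2 else 0)))"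
  unfolding norm_ell2_sq by (intro suminf_cong) (auto simp: coord_simps)
 also have "\<dots> = (norm x)^2 - (suminf (\<lambda>i. if i < n then (coord x i)^2 else 0))"
  unfolding norm_ell2_sq
  by (intro suminf_diff[symmetric] summable_coord_sq summable_finite[of "{..<n}"]) auto
 also have "(suminf (\<lambda>i. if i < n then (coord x i)^2 else 0)) = (\<Sum>i<n. (coord x i)^2)"
  by (subst suminf_finite[of "{..<n}"]) auto
 finally show ?thesis .
qed

lemma trunc_tendsto: "(\<lambda>n. trunc n x) \<longlonglongrightarrow> x"
proof -
 have "(\<lambda>n. (norm (x - trunc n x))^2) \<longlonglongrightarrow> (norm x)^2 - (norm x)^2"
  unfolding norm_trunc_diff
  by (intro tendsto_intros) (use summable_LIMSEQ[OF summable_coord_sq] in \<open>simp add: norm_ell2_sq\<close>)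
 then have "(\<lambda>n. sqrt ((norm (x - trunc n x))^2)) \<longlonglongrightarrow> sqrt 0"
  by (intro tendsto_intros) simp
 then have "(\<lambda>n. norm (trunc n x - x)) \<longlonglongrightarrow> 0"
  by (simp add: norm_minus_commute)
 then show ?thesis by (simp add: LIM_zero_iff tendsto_norm_zero_iff)
qed

lemma norm_trunc_le: "norm (trunc n x) \<le> norm x"
proof (rule power2_le_imp_le)
 show "(norm (trunc n x))^2 \<le> (norm x)^2"
  unfolding norm_ell2_sq by (intro suminf_le summable_coord_sq) auto
qed simp

lemma continuous_on_trunc [continuous_intros]:
 "continuous_on S f ==> continuous_on S (\<lambda>x. trunc n (f x))"
 unfolding trunc_def by (intro continuous_intros)

text \<open>Finitely supported vectors with rational entries are dense. Second countability makes
  sums of Borel maps into this space measurable, as the convolutions and Fubini arguments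
  require.\<close>

instance ell2 :: second_countable_topology
proof
 define rv :: "rat list \<Rightarrow> ell2" where
  "rv = (\<lambda>l. \<Sum>i<length l. of_rat (l ! i) *\<^sub>R unit_vec i)"
 have dense: "\<exists>l. dist x (rv l) < e" if "e > 0" for x and e :: real
 proof -
  obtain n where n: "dist (trunc n x) x < e / 2"
   using trunc_tendsto[of x] half_gt_zero[OF \<open>e > 0\<close>] unfolding lim_sequentially by blast
  have "\<exists>q. \<bar>coord x i - of_rat q\<bar> < e / (2 * (real n + 1))" for i
  proof -
   obtain r where "r \<in> \<rat>" "coord x i - e / (2 * (real n + 1)) < r" "r < coord x i"
    using Rats_dense_in_real[of "coord x i - e / (2 * (real n + 1))" "coord x i"] \<open>e > 0\<close> by auto
   then show ?thesis by (auto elim!: Rats_cases) (metis abs_of_pos add.commute diff_gt_0_iff_gt diff_less_eq)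
  qed
  then obtain q where q: "\<And>i. \<bar>coord x i - of_rat (q i)\<bar> < e / (2 * (real n + 1))" by metis
  define l where "l = map q [0..<n]"
  have "trunc n x - rv l = (\<Sum>i<n. (coord x i - of_rat (q i)) *\<^sub>R unit_vec i)"
   unfolding trunc_def rv_def l_def by (simp add: sum_subtractf algebra_simps)
  also have "norm \<dots> \<le> (\<Sum>i<n. \<bar>coord x i - of_rat (q i)\<bar>)"
   by (rule order_trans[OF norm_sum]) simp
  also have "\<dots> \<le> (\<Sum>i<n. e / (2 * (real n + 1)))"
   by (intro sum_mono less_imp_le q)
  also have "\<dots> \<le> e / 2" using \<open>e > 0\<close> by (simp add: field_simps)
  finally have "dist (trunc n x) (rv l) \<le> e / 2" by (simp add: dist_norm)
  then have "dist x (rv l) < e"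
   using n dist_triangle[of x "rv l" "trunc n x"] by (simp add: dist_commute)
  then show ?thesis by blast
 qed
 define B where "B = (\<lambda>(l, q). ball (rv l) (of_rat q)) ` (UNIV :: (rat list \<times> rat) set)"
 have "topological_basis B"
 proof (rule topological_basisI)
  show "\<And>U. U \<in> B ==> open U" by (auto simp: B_def)
  fix U and x :: ell2 assume "open U" "x \<in> U"
  then obtain e where e: "e > 0" "ball x e \<subseteq> U" by (auto simp: open_contains_ball)
  obtain r where r: "r \<in> \<rat>" "e / 4 < r" "r < e / 2" using Rats_dense_in_real[of "e/4" "e/2"] e by auto
  obtain q where q: "r = of_rat q" using r by (auto elim: Rats_cases)
  obtain l where l: "dist x (rv l) < e / 4" using dense[of "e/4" x] e by auto
  have "x \<in> ball (rv l) r" using l r by (simp add: dist_commute)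
  moreover have "ball (rv l) r \<subseteq> ball x e"
  proof
   fix y assume "y \<in> ball (rv l) r"
   then show "y \<in> ball x e" using dist_triangle[of x y "rv l"] l r by simp
  qed
  ultimately show "\<exists>V\<in>B. x \<in> V \<and> V \<subseteq> U" using e q unfolding B_def by blast
 qed
 then have "open = generate_topology B" by (rule topological_basis_imp_subbasis)
 moreover have "countable B" unfolding B_def by (intro countable_image) simp
 ultimately show "\<exists>B::ell2 set set. countable B \<and> open = generate_topology B" by blast
qed

lemma range_coord: "range coord = {x. summable (\<lambda>i. (x i)^2)}"
 using type_definition.Rep_range[OF type_definition_ell2] .

lemma sets_range_coord [measurable]: "range coord \<in> sets (PiM UNIV (\<lambda>_. borel))"
proof -
 have "range coord = {x \<in> space (PiM UNIV (\<lambda>_. borel)). (suminf (\<lambda>i. ennreal ((x i)^2))) \<noteq> \<top>}"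
  unfolding range_coord by (auto simp: space_PiM intro: summable_suminf_not_top)
   (auto simp: suminf_ennreal2)
 also have "\<dots> \<in> sets (PiM UNIV (\<lambda>_. borel))" by measurable
 finally show ?thesis .
qed

text \<open>A pointwise norm limit of finite combinations of coordinates; this links the product
  sigma-algebra, which sees coordinates only, with the Borel sets of the norm.\<close>

lemma measurable_Abs_ell2:
 assumes "sets M = sets (PiM UNIV (\<lambda>_. borel))"
 shows "Abs_ell2 \<in> borel_measurable (restrict_space M (range coord))"
proof (rule borel_measurable_LIMSEQ_metric)
 have [measurable]: "(\<lambda>\<omega>. \<omega> i) \<in> borel_measurable (restrict_space M (range coord))" for i
  by (intro measurable_restrict_space1) (simp add: measurable_cong_sets[OF assms refl])
 show "(\<lambda>\<omega>. \<Sum>i<n. \<omega> i *\<^sub>R unit_vec i) \<in> borel_measurable (restrict_space M (range coord))" for n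
  by measurable
 fix \<omega> assume "\<omega> \<in> space (restrict_space M (range coord))"
 then obtain x where "\<omega> = coord x" by (auto simp: space_restrict_space)
 then show "(\<lambda>n. \<Sum>i<n. \<omega> i *\<^sub>R unit_vec i) \<longlonglongrightarrow> Abs_ell2 \<omega>"
  using trunc_tendsto[of x] by (simp add: trunc_def coord_inverse)
qed

section \<open>Resampling, translations and exponential moments of the Gaussian measure\<close>

lemma nn_integral_normal_sq:
 assumes "\<sigma> > 0"
 shows "(\<integral>\<^sup>+t. ennreal ((t - \<mu>)^2) \<partial>density lborel (normal_density \<mu> \<sigma>)) = ennreal (\<sigma>^2)"
proof -
 have *: "has_bochner_integral lborel (\<lambda>x. normal_density \<mu> \<sigma> x * (x - \<mu>)^2) (\<sigma>^2)"
  using normal_moment_even[OF assms, of \<mu> 1] by (simp add: power2_eq_square fact_2)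
 have "(\<integral>\<^sup>+t. ennreal ((t - \<mu>)^2) \<partial>density lborel (normal_density \<mu> \<sigma>)) =
  (\<integral>\<^sup>+x. ennreal (normal_density \<mu> \<sigma> x * (x - \<mu>)^2) \<partial>lborel)"
  by (subst nn_integral_density) (auto simp: ennreal_mult)
 also have "\<dots> = ennreal (\<sigma>^2)"
  using * by (subst nn_integral_eq_integral) (auto simp: has_bochner_integral_iff)
 finally show ?thesis .
qed

text \<open>The standard deviations are a parameter: \<open>b = a\<close> gives the measure of the
  theorem, and \<open>b i = \<delta> * sqrt (a i)\<close> the kernels that smooth cutoffs.\<close>

locale gaussian_seq =
 fixes b :: "nat \<Rightarrow> real"
 assumes pos: "b i > 0" and sq_summable: "summable (\<lambda>i. (b i)^2)"
begin

abbreviation nd :: "nat \<Rightarrow> real measure" where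
 "nd i \<equiv> density lborel (normal_density 0 (b i))"

sublocale nd: prob_space "nd i" for i
 by (rule prob_space_normal_density[OF pos])

sublocale pp: product_prob_space nd UNIV
 by unfold_locales

abbreviation G :: "ell2 measure" where "G \<equiv> gaussian_ell2 b"

lemma gaussian_product_eq: "gaussian_product b = PiM UNIV nd"
 by (simp add: gaussian_product_def)

lemma sets_gaussian_product: "sets (gaussian_product b) = sets (PiM UNIV (\<lambda>_. borel))"
 unfolding gaussian_product_eq by (intro sets_PiM_cong) auto

lemma measurable_component: "(\<lambda>\<omega>. \<omega> i) \<in> borel_measurable (gaussian_product b)"
 unfolding measurable_cong_sets[OF sets_gaussian_product refl] by measurable

text \<open>The sum of the squared coordinates has expectation \<open>\<Sum> (b i)^2\<close>, which
  is finite. Hence the restriction to square-summable sequences loses no mass.\<close>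

lemma AE_range_coord: "AE \<omega> in gaussian_product b. \<omega> \<in> range coord"
proof -
 note measurable_component[measurable]
 have "(\<integral>\<^sup>+\<omega>. ennreal ((\<omega> i)^2) \<partial>gaussian_product b) = ennreal ((b i)^2)" for i
 proof -
  have "(\<integral>\<^sup>+\<omega>. ennreal ((\<omega> i)^2) \<partial>gaussian_product b) =
    (\<integral>\<^sup>+t. ennreal ((t - 0)^2) \<partial>distr (PiM UNIV nd) (nd i) (\<lambda>\<omega>. \<omega> i))"
   using measurable_component[of i] unfolding gaussian_product_eq by (subst nn_integral_distr) auto
  also have "distr (PiM UNIV nd) (nd i) (\<lambda>\<omega>. \<omega> i) = nd i" by (rule pp.PiM_component) simp
  finally show ?thesis by (simp only: nn_integral_normal_sq[OF pos])
 qed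
 then have "(\<integral>\<^sup>+\<omega>. (suminf (\<lambda>i. ennreal ((\<omega> i)^2))) \<partial>gaussian_product b) = (suminf (\<lambda>i. ennreal ((b i)^2)))"
  by (subst nn_integral_suminf) auto
 then have "(\<integral>\<^sup>+\<omega>. (suminf (\<lambda>i. ennreal ((\<omega> i)^2))) \<partial>gaussian_product b) \<noteq> \<infinity>"
  using sq_summable by (simp add: suminf_ennreal2)
 then have "AE \<omega> in gaussian_product b. (suminf (\<lambda>i. ennreal ((\<omega> i)^2))) \<noteq> \<infinity>"
  by (intro nn_integral_noteq_infinite) auto
 then show ?thesis
  by eventually_elim (auto simp: range_coord intro: summable_suminf_not_top)
qed

lemma measurable_Abs: "Abs_ell2 \<in> borel_measurable (restrict_space (gaussian_product b) (range coord))"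
 by (rule measurable_Abs_ell2[OF sets_gaussian_product])

lemma range_coord_measurable [measurable]: "range coord \<in> sets (gaussian_product b)"
 using sets_range_coord sets_gaussian_product by simp

lemma sets_G [measurable_cong, simp]: "sets G = sets borel"
 and space_G [simp]: "space G = UNIV"
 by (simp_all add: gaussian_ell2_def)

lemma nn_integral_G:
 assumes "bmeas F"
 shows "(\<integral>\<^sup>+x. F x \<partial>G) = (\<integral>\<^sup>+\<omega>. F (Abs_ell2 \<omega>) * indicator (range coord) \<omega> \<partial>gaussian_product b)"
 unfolding gaussian_ell2_def using measurable_Abs assms
 by (subst nn_integral_distr) (auto simp: nn_integral_restrict_space)

sublocale G: prob_space G
proof
 have "emeasure G (space G) = (\<integral>\<^sup>+x. 1 \<partial>G)" by simp
 also have "\<dots> = (\<integral>\<^sup>+\<omega>. 1 * indicator (range coord) \<omega> \<partial>gaussian_product b)"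
  by (subst nn_integral_G) auto
 also have "\<dots> = (\<integral>\<^sup>+\<omega>. 1 \<partial>gaussian_product b)"
  by (intro nn_integral_cong_AE) (use AE_range_coord in eventually_elim, auto)
 also have "\<dots> = 1" by (simp add: gaussian_product_eq pp.emeasure_space_1)
 finally show "emeasure G (space G) = 1" .
qed

text \<open>Replacing one coordinate by an independent copy preserves the measure. Moments,
  translations and the Mehler kernel are all reduced to one-dimensional integrals by this identity,
  so that the product measure need not be opened again.\<close>

lemma resample:
 assumes F: "bmeas F"
 shows "(\<integral>\<^sup>+x. F x \<partial>G) = (\<integral>\<^sup>+x. (\<integral>\<^sup>+t. F (x + (t - coord x i) *\<^sub>R unit_vec i) \<partial>nd i) \<partial>G)"
proof -
 let ?PP = "PiM UNIV nd"
 let ?H = "\<lambda>\<omega>. F (Abs_ell2 \<omega>) * indicator (range coord) \<omega>"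
 have H [measurable]: "?H \<in> borel_measurable ?PP"
 proof -
  have "(\<lambda>\<omega>. F (Abs_ell2 \<omega>)) \<in> borel_measurable (restrict_space ?PP (range coord))"
   using measurable_compose[OF measurable_Abs F] by (simp add: gaussian_product_eq)
  then show ?thesis
   using range_coord_measurable
   by (subst (asm) borel_measurable_restrict_space_iff_ennreal) (auto simp: gaussian_product_eq)
 qed
 interpret pair_sigma_finite "nd i" ?PP by unfold_locales
 have upd [measurable]: "(\<lambda>(t, \<omega>). fun_upd \<omega> i t) \<in> measurable (nd i \<Otimes>\<^sub>M ?PP) ?PP"
  unfolding case_prod_beta' by (rule measurable_fun_upd[where J = UNIV]) auto
 have dist: "distr (nd i \<Otimes>\<^sub>M ?PP) ?PP (\<lambda>(t, \<omega>). fun_upd \<omega> i t) = ?PP"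
  using distr_pair_PiM_eq_PiM[of UNIV nd i] nd.prob_space_axioms by simp
 have "(\<integral>\<^sup>+x. F x \<partial>G) = (\<integral>\<^sup>+\<omega>. ?H \<omega> \<partial>?PP)"
  by (simp add: nn_integral_G[OF F] gaussian_product_eq)
 also have "\<dots> = (\<integral>\<^sup>+\<omega>. ?H \<omega> \<partial>distr (nd i \<Otimes>\<^sub>M ?PP) ?PP (\<lambda>(t, \<omega>). fun_upd \<omega> i t))"
  by (simp only: dist)
 also have "\<dots> = (\<integral>\<^sup>+p. ?H ((\<lambda>(t, \<omega>). fun_upd \<omega> i t) p) \<partial>(nd i \<Otimes>\<^sub>M ?PP))"
  by (rule nn_integral_distr[OF upd]) (use H in simp)
 also have "\<dots> = (\<integral>\<^sup>+\<omega>. (\<integral>\<^sup>+t. ?H ((\<lambda>(t, \<omega>). fun_upd \<omega> i t) (t, \<omega>)) \<partial>nd i) \<partial>?PP)"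
  by (rule nn_integral_snd[symmetric])
   (use measurable_compose[OF upd H] in \<open>simp add: o_def case_prod_beta'\<close>)
 also have "\<dots> = (\<integral>\<^sup>+\<omega>. (\<integral>\<^sup>+t. F (Abs_ell2 \<omega> + (t - coord (Abs_ell2 \<omega>) i) *\<^sub>R unit_vec i) \<partial>nd i)
   * indicator (range coord) \<omega> \<partial>?PP)"
 proof (rule nn_integral_cong)
  fix \<omega> assume "\<omega> \<in> space ?PP"
  show "(\<integral>\<^sup>+t. ?H ((\<lambda>(t, \<omega>). fun_upd \<omega> i t) (t, \<omega>)) \<partial>nd i) =
   (\<integral>\<^sup>+t. F (Abs_ell2 \<omega> + (t - coord (Abs_ell2 \<omega>) i) *\<^sub>R unit_vec i) \<partial>nd i)
   * indicator (range coord) \<omega>"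
  proof (cases "\<omega> \<in> range coord")
   case True
   then obtain x where x: "\<omega> = coord x" by auto
   have c: "fun_upd \<omega> i t = coord (x + (t - coord x i) *\<^sub>R unit_vec i)" for t
    by (auto simp: x coord_simps)
   show ?thesis using True by (simp add: c) (simp add: x coord_inverse)
  next
   case False
   \<comment> \<open>Changing a single entry affects square-summability in neither direction, so the
     indicator passes through the inner integral.\<close>
   have "fun_upd \<omega> i t \<notin> range coord" for t
   proof
    assume "fun_upd \<omega> i t \<in> range coord"
    then obtain x where x: "fun_upd \<omega> i t = coord x" by auto
    have "\<omega> = coord (x + (\<omega> i - t) *\<^sub>R unit_vec i)"
     using x[THEN fun_cong] by (auto simp: coord_simps fun_eq_iff) (metis fun_upd_apply)+
    then show False using False by blast
   qed
   then show ?thesis using False by simp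
  qed
 qed
 also have "\<dots> = (\<integral>\<^sup>+x. (\<integral>\<^sup>+t. F (x + (t - coord x i) *\<^sub>R unit_vec i) \<partial>nd i) \<partial>G)"
 proof -
  have [measurable]: "bmeas F" by fact
  have "bmeas (\<lambda>x. \<integral>\<^sup>+t. F (x + (t - coord x i) *\<^sub>R unit_vec i) \<partial>nd i)"
   by measurable
  from nn_integral_G[OF this] show ?thesis by (simp add: gaussian_product_eq)
 qed
 finally show ?thesis .
qed

lemma nn_integral_coord:
 assumes [measurable]: "bmeas f"
 shows "(\<integral>\<^sup>+x. f (coord x i) \<partial>G) = (\<integral>\<^sup>+t. f t \<partial>nd i)"
proof -
 have "(\<integral>\<^sup>+x. f (coord x i) \<partial>G) = (\<integral>\<^sup>+x. (\<integral>\<^sup>+t. f t \<partial>nd i) \<partial>G)"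
  by (subst resample[where i = i]) (auto simp: coord_simps)
 then show ?thesis by (simp add: G.emeasure_space_1[simplified])
qed

lemma nn_integral_coord_sq: "(\<integral>\<^sup>+x. ennreal ((coord x i)^2) \<partial>G) = ennreal ((b i)^2)"
 using nn_integral_coord[of "\<lambda>t. ennreal (t^2)" i] nn_integral_normal_sq[OF pos, of 0 i] by simp

lemma nn_integral_norm_sq: "(\<integral>\<^sup>+x. ennreal ((norm x)^2) \<partial>G) = ennreal (suminf (\<lambda>i. (b i)^2))"
proof -
 have "ennreal ((norm x)^2) = (suminf (\<lambda>i. ennreal ((coord x i)^2)))" for x
  unfolding norm_ell2_sq by (intro suminf_ennreal2[symmetric] summable_coord_sq) auto
 then have "(\<integral>\<^sup>+x. ennreal ((norm x)^2) \<partial>G) = (suminf (\<lambda>i. ennreal ((b i)^2)))"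
  by (simp add: nn_integral_suminf nn_integral_coord_sq)
 then show ?thesis by (simp add: suminf_ennreal2 sq_summable)
qed

text \<open>The weighted sum has finite expectation. Used for \<open>b = a\<close> with
  \<open>w i = 1 / a i\<close>, where the condition becomes summability of \<open>a\<close>.\<close>

lemma AE_summable_weighted:
 assumes w: "\<And>i. w i \<ge> 0" "summable (\<lambda>i. w i * (b i)^2)"
 shows "AE x in G. summable (\<lambda>i. w i * (coord x i)^2)"
proof -
 have "(\<integral>\<^sup>+x. (suminf (\<lambda>i. ennreal (w i * (coord x i)^2))) \<partial>G) = (suminf (\<lambda>i. ennreal (w i * (b i)^2)))"
  using w by (simp add: nn_integral_suminf ennreal_mult nn_integral_cmult nn_integral_coord_sq)
 also have "\<dots> \<noteq> \<infinity>" using w by (simp add: suminf_ennreal2)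
 finally have "AE x in G. (suminf (\<lambda>i. ennreal (w i * (coord x i)^2))) \<noteq> \<infinity>"
  by (intro nn_integral_noteq_infinite) auto
 then show ?thesis
  by eventually_elim (use w in \<open>auto intro!: summable_suminf_not_top\<close>)
qed

text \<open>The Cameron-Martin density of the translation by \<open>s\<close> along the
  \<open>i\<close>-th unit vector.\<close>

definition cm :: "nat \<Rightarrow> real \<Rightarrow> ell2 \<Rightarrow> real" where
 "cm i s x = exp (s * coord x i / (b i)^2 - s^2 / (2 * (b i)^2))"

lemma cm_nonneg [simp]: "0 \<le> cm i s x" and cm_0 [simp]: "cm i 0 x = 1"
 by (simp_all add: cm_def)

lemma measurable_cm [measurable]: "bmeas (cm i s)"
 unfolding cm_def by measurable

text \<open>After resampling coordinate \<open>i\<close> this is the substitution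
  \<open>t + s\<close> in a one-dimensional normal integral; completing the square produces
  \<open>cm\<close>.\<close>

lemma nn_integral_shift:
 assumes F [measurable]: "bmeas F"
 shows "(\<integral>\<^sup>+x. F (x + s *\<^sub>R unit_vec i) \<partial>G) = (\<integral>\<^sup>+x. ennreal (cm i s x) * F x \<partial>G)"
proof -
 let ?N = "normal_density 0 (b i)"
 have N: "?N (t - s) = ?N t * exp (s * t / (b i)^2 - s^2 / (2 * (b i)^2))" for t
 proof -
  have e: "- (t - s - 0)\<^sup>2 / (2 * (b i)\<^sup>2) =
    - (t - 0)\<^sup>2 / (2 * (b i)\<^sup>2) + (s * t / (b i)\<^sup>2 - s\<^sup>2 / (2 * (b i)\<^sup>2))"
   using pos[of i] by (simp add: field_simps power2_eq_square)
  show ?thesis unfolding normal_density_def e exp_add by simp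
 qed
 have one: "(\<integral>\<^sup>+t. f (t + s) \<partial>nd i) = (\<integral>\<^sup>+t. ennreal (exp (s * t / (b i)^2 - s^2 / (2 * (b i)^2))) * f t \<partial>nd i)"
  if [measurable]: "bmeas f" for f :: "real \<Rightarrow> ennreal"
 proof -
  have "(\<integral>\<^sup>+t. f (t + s) \<partial>nd i) = (\<integral>\<^sup>+t. ennreal (?N t) * f (t + s) \<partial>lborel)"
   by (subst nn_integral_density) auto
  also have "\<dots> = (\<integral>\<^sup>+t. ennreal (?N (t - s)) * f t \<partial>lborel)"
   by (subst nn_integral_real_affine[where c = 1 and t = "- s"]) (auto simp: algebra_simps)
  also have "\<dots> = (\<integral>\<^sup>+t. ennreal (?N t) * (ennreal (exp (s * t / (b i)^2 - s^2 / (2 * (b i)^2))) * f t) \<partial>lborel)"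
   by (simp add: N ennreal_mult mult.assoc)
  also have "\<dots> = (\<integral>\<^sup>+t. ennreal (exp (s * t / (b i)^2 - s^2 / (2 * (b i)^2))) * f t \<partial>nd i)"
   by (subst nn_integral_density) auto
  finally show ?thesis .
 qed
 have "(\<integral>\<^sup>+x. F (x + s *\<^sub>R unit_vec i) \<partial>G) =
   (\<integral>\<^sup>+x. (\<integral>\<^sup>+t. F (x + ((t + s) - coord x i) *\<^sub>R unit_vec i) \<partial>nd i) \<partial>G)"
  by (subst resample[where i = i]) (auto simp: algebra_simps)
 also have "\<dots> = (\<integral>\<^sup>+x. (\<integral>\<^sup>+t. ennreal (cm i s (x + (t - coord x i) *\<^sub>R unit_vec i)) *
   F (x + (t - coord x i) *\<^sub>R unit_vec i) \<partial>nd i) \<partial>G)"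
  by (subst one) (auto simp: cm_def coord_simps)
 also have "\<dots> = (\<integral>\<^sup>+x. ennreal (cm i s x) * F x \<partial>G)"
  by (rule resample[symmetric]) auto
 finally show ?thesis .
qed

lemma distr_shift: "distr G borel (\<lambda>x. x + s *\<^sub>R unit_vec i) = density G (cm i s)"
proof (rule measure_eqI)
 fix A assume "A \<in> sets (distr G borel (\<lambda>x. x + s *\<^sub>R unit_vec i))"
 then have [measurable]: "A \<in> sets borel" by simp
 have "emeasure (distr G borel (\<lambda>x. x + s *\<^sub>R unit_vec i)) A =
   (\<integral>\<^sup>+x. indicator A x \<partial>distr G borel (\<lambda>x. x + s *\<^sub>R unit_vec i))"
  by simp
 also have "\<dots> = (\<integral>\<^sup>+x. indicator A (x + s *\<^sub>R unit_vec i) \<partial>G)"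
  by (rule nn_integral_distr) auto
 also have "\<dots> = emeasure (density G (cm i s)) A"
  by (subst nn_integral_shift) (auto simp: emeasure_density)
 finally show "emeasure (distr G borel (\<lambda>x. x + s *\<^sub>R unit_vec i)) A = emeasure (density G (cm i s)) A" .
qed simp

lemma integral_shift:
 fixes F :: "ell2 \<Rightarrow> real"
 assumes [measurable]: "bmeas F"
 shows "(\<integral>x. F (x + s *\<^sub>R unit_vec i) \<partial>G) = (\<integral>x. cm i s x * F x \<partial>G)"
  "integrable G (\<lambda>x. F (x + s *\<^sub>R unit_vec i)) \<longleftrightarrow> integrable G (\<lambda>x. cm i s x * F x)"
proof -
 have "(\<integral>x. F (x + s *\<^sub>R unit_vec i) \<partial>G) = (\<integral>x. F x \<partial>distr G borel (\<lambda>x. x + s *\<^sub>R unit_vec i))"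
  by (subst integral_distr) auto
 then show "(\<integral>x. F (x + s *\<^sub>R unit_vec i) \<partial>G) = (\<integral>x. cm i s x * F x \<partial>G)"
  unfolding distr_shift by (subst (asm) integral_density) auto
 have "integrable G (\<lambda>x. F (x + s *\<^sub>R unit_vec i)) \<longleftrightarrow> integrable (distr G borel (\<lambda>x. x + s *\<^sub>R unit_vec i)) F"
  by (subst integrable_distr_eq) auto
 then show "integrable G (\<lambda>x. F (x + s *\<^sub>R unit_vec i)) \<longleftrightarrow> integrable G (\<lambda>x. cm i s x * F x)"
  unfolding distr_shift by (subst (asm) integrable_density) auto
qed

text \<open>For \<open>s = c * (b i)^2\<close> the function is a constant multiple of the density
  \<open>cm i s\<close>, whose integrability is that of a translated constant.\<close>

lemma integrable_exp_coord: "integrable G (\<lambda>x. exp (c * coord x i))"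
proof -
 define s where "s = c * (b i)^2"
 have "integrable G (\<lambda>x. cm i s x * 1)"
  by (subst integral_shift(2)[symmetric]) auto
 then have "integrable G (\<lambda>x. exp (s^2 / (2 * (b i)^2)) * (cm i s x * 1))"
  by (rule integrable_mult_right)
 moreover have "(\<lambda>x. exp (s^2 / (2 * (b i)^2)) * (cm i s x * 1)) = (\<lambda>x. exp (c * coord x i))"
  using pos[of i] by (simp add: cm_def s_def exp_add[symmetric])
 ultimately show ?thesis by (simp only:)
qed

lemma integrable_exp_abs_coord: "integrable G (\<lambda>x. exp (c * \<bar>coord x i\<bar>))"
proof (rule bint_bound)
 show "integrable G (\<lambda>x. exp (c * coord x i) + exp ((- c) * coord x i))"
  by (intro Bochner_Integration.integrable_add integrable_exp_coord)
 show "AE x in G. norm (exp (c * \<bar>coord x i\<bar>)) \<le> norm (exp (c * coord x i) + exp ((- c) * coord x i))"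
 proof (intro AE_I2)
  fix x
  have "0 < exp (c * coord x i)" "0 < exp ((- c) * coord x i)" by simp_all
  then show "norm (exp (c * \<bar>coord x i\<bar>)) \<le> norm (exp (c * coord x i) + exp ((- c) * coord x i))"
   by (cases "coord x i < 0") (simp_all add: abs_if del: exp_gt_zero)
 qed
qed simp

text \<open>The sum of \<open>n\<close> absolute values is at most \<open>n\<close> times the
  largest one, so for \<open>c \<ge> 0\<close> its exponential is at most a sum of exponentials of
  single coordinates. For \<open>c < 0\<close> it is bounded by 1.\<close>

lemma integrable_exp_sum_coord: "integrable G (\<lambda>x. exp (c * (\<Sum>i<n. \<bar>coord x i\<bar>)))"
proof (cases "c \<ge> 0 \<and> n > 0")
 case True
 show ?thesis
 proof (rule bint_bound)
  show "integrable G (\<lambda>x. \<Sum>i<n. exp (c * real n * \<bar>coord x i\<bar>))"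
   by (intro Bochner_Integration.integrable_sum integrable_exp_abs_coord)
  show "AE x in G. norm (exp (c * (\<Sum>i<n. \<bar>coord x i\<bar>))) \<le> norm (\<Sum>i<n. exp (c * real n * \<bar>coord x i\<bar>))"
  proof (intro AE_I2)
   fix x
   define M where "M = Max ((\<lambda>i. \<bar>coord x i\<bar>) ` {..<n})"
   have ne: "(\<lambda>i. \<bar>coord x i\<bar>) ` {..<n} \<noteq> {}" using True by auto
   have "M \<in> (\<lambda>i. \<bar>coord x i\<bar>) ` {..<n}"
    unfolding M_def by (intro Max_in ne) auto
   then obtain j where j: "j < n" "M = \<bar>coord x j\<bar>" by auto
   have "(\<Sum>i<n. \<bar>coord x i\<bar>) \<le> (\<Sum>i<n. M)" unfolding M_def by (intro sum_mono Max_ge) auto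
   then have "c * (\<Sum>i<n. \<bar>coord x i\<bar>) \<le> c * real n * \<bar>coord x j\<bar>"
    using True j by (simp add: mult.assoc mult_left_mono)
   then have "exp (c * (\<Sum>i<n. \<bar>coord x i\<bar>)) \<le> exp (c * real n * \<bar>coord x j\<bar>)" by simp
   also have "\<dots> \<le> (\<Sum>i<n. exp (c * real n * \<bar>coord x i\<bar>))"
    by (rule member_le_sum) (use j in auto)
   finally show "norm (exp (c * (\<Sum>i<n. \<bar>coord x i\<bar>))) \<le> norm (\<Sum>i<n. exp (c * real n * \<bar>coord x i\<bar>))"
    by (simp add: sum_nonneg)
  qed
 qed simp
next
 case False
 show ?thesis
 proof (rule bint_bound[of G "\<lambda>x. 1::real"])
  have "c * (\<Sum>i<n. \<bar>coord x i\<bar>) \<le> 0" for x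
   using False by (cases "n = 0") (auto intro!: mult_nonpos_nonneg sum_nonneg)
  then show "AE x in G. norm (exp (c * (\<Sum>i<n. \<bar>coord x i\<bar>))) \<le> norm (1::real)" by auto
 qed auto
qed

end

section \<open>A smooth step function\<close>

lemma poly_times_exp_tendsto_0: "((\<lambda>u::real. poly p u * exp (- u)) \<longlongrightarrow> 0) at_top"
proof -
 have "((\<lambda>u::real. \<Sum>i\<le>degree p. coeff p i * (u ^ i / exp u)) \<longlongrightarrow> (\<Sum>i\<le>degree p. coeff p i * 0)) at_top"
  by (intro tendsto_intros tendsto_power_div_exp_0)
 then show ?thesis
  by (simp add: poly_altdef sum_distrib_right exp_minus divide_inverse mult.assoc)
qed

text \<open>If \<open>p(1/t) * exp (- 1/t)\<close> is differentiated, the result is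
  \<open>(1/t)^2 * (p - p')(1/t) * exp (- 1/t)\<close>; the factor \<open>[:0, 0, 1:]\<close> is
  that square.\<close>

primrec expinv_poly :: "nat \<Rightarrow> real poly" where
 "expinv_poly 0 = 1"
| "expinv_poly (Suc n) = [:0, 0, 1:] * (expinv_poly n - pderiv (expinv_poly n))"

text \<open>The \<open>n\<close>-th derivative of \<open>exp (- 1 / t)\<close>, extended by \<open>0\<close> to \<open>t \<le> 0\<close>.\<close>

definition expinv :: "nat \<Rightarrow> real \<Rightarrow> real" where
 "expinv n t = (if t > 0 then poly (expinv_poly n) (inverse t) * exp (- inverse t) else 0)"

lemma DERIV_expinv: "DERIV (expinv n) t :> expinv (Suc n) t"
proof (cases t "0::real" rule: linorder_cases)
 case less
 have "DERIV (\<lambda>_. 0) t :> expinv (Suc n) t" using less by (simp add: expinv_def)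
 then show ?thesis
  by (rule DERIV_cong_ev[THEN iffD1, rotated -1])
   (use less in \<open>auto simp: expinv_def eventually_nhds intro!: exI[of _ "{..<0}"]\<close>)
next
 case greater
 have "DERIV (\<lambda>t. poly (expinv_poly n) (inverse t) * exp (- inverse t)) t :> expinv (Suc n) t"
  using greater
  by (auto intro!: derivative_eq_intros poly_DERIV[THEN DERIV_chain2] simp: expinv_def field_simps power2_eq_square)
 then show ?thesis
  by (rule DERIV_cong_ev[THEN iffD1, rotated -1])
   (use greater in \<open>auto simp: expinv_def eventually_nhds intro!: exI[of _ "{0<..}"]\<close>)
next
 case equal
 \<comment> \<open>From the right, the difference quotient at 0 is again a polynomial in
   \<open>1/t\<close> times \<open>exp (- 1/t)\<close>, of one degree more.\<close>
 have "((\<lambda>t. poly ([:0, 1:] * expinv_poly n) (inverse t) * exp (- inverse t)) \<longlongrightarrow> 0) (at_right 0)"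
  by (rule filterlim_compose[OF poly_times_exp_tendsto_0 filterlim_inverse_at_top_right])
 then have r: "((\<lambda>t. expinv n t / t) \<longlongrightarrow> 0) (at_right 0)"
  by (rule Lim_transform_eventually)
   (auto simp: eventually_at_filter expinv_def divide_inverse)
 have l: "((\<lambda>t. expinv n t / t) \<longlongrightarrow> 0) (at_left 0)"
  by (rule Lim_transform_eventually[OF tendsto_const]) (auto simp: eventually_at_filter expinv_def)
 have "((\<lambda>t. expinv n t / t) \<longlongrightarrow> 0) (at 0)" using l r by (simp add: filterlim_split_at)
 then show ?thesis by (simp add: equal has_field_derivative_iff expinv_def)
qed

lemma regular_real_DERIV:
 fixes f :: "real \<Rightarrow> real"
 assumes "regular Q {1} f"
 shows "DERIV (dds (replicate n 1) f) t :> dds (replicate (Suc n) 1) f t"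
proof -
 have "regular Q {1} (dds (replicate n 1) f)"
  by (rule regular_dds[OF assms]) auto
 from has_dd_at[OF regular_has_dd[OF this], of 1 0 t] show ?thesis by simp
qed

text \<open>The primitive of the bump \<open>expinv 0 t * expinv 0 (1 - t)\<close>, normalised to
  end at 1. Its whole sequence of derivatives is handed over because the composition lemmas consume
  such a sequence.\<close>

lemma smooth_step_exists:
 obtains th :: "nat \<Rightarrow> real \<Rightarrow> real" where
  "\<And>n t. DERIV (th n) t :> th (Suc n) t"
  "\<And>t. t \<le> 0 ==> th 0 t = 0" "\<And>t. t \<ge> 1 ==> th 0 t = 1" "\<And>n. bounded (range (th n))"
proof -
 define g where "g t = expinv 0 t * expinv 0 (1 + (- 1) *\<^sub>R t)" for t
 have f: "regular (\<lambda>_. True) {1} (expinv n)" for n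
 proof (rule regular_coinduct[where C = "range expinv"])
  fix f :: "real \<Rightarrow> real" and v x :: real assume "f \<in> range expinv" "v \<in> {1}"
  then obtain n where n: "f = expinv n" "v = 1" by auto
  have "DERIV (\<lambda>t. expinv n (x + t *\<^sub>R 1)) 0 :> expinv (Suc n) x * 1" for x
   by (rule DERIV_chain2[where f = "expinv n"])
    (use DERIV_expinv[of n x] in \<open>auto intro!: derivative_eq_intros\<close>)
  from dd_eqI[OF this] have d: "has_dd 1 (expinv n) x" "dd 1 (expinv n) x = expinv (Suc n) x" for x
   by auto
  then have "dd 1 (expinv n) = expinv (Suc n)" by auto
  then show "has_dd v f x" "dd v f \<in> range expinv" using d n by auto
 qed auto
 have g: "regular (\<lambda>_. True) {1} g"
  unfolding g_def by (intro regular_mult[where P = "\<lambda>_. True" and Q = "\<lambda>_. True"] regular_affine[where Q = "\<lambda>_. True"] f) auto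
 have expinv_pos: "t > 0 ==> expinv 0 t > 0" and expinv_nn: "expinv 0 t \<ge> 0" for t
  by (auto simp: expinv_def)
 have g0: "t \<le> 0 \<or> t \<ge> 1 ==> g t = 0" for t by (auto simp: g_def expinv_def)
 have gpos: "0 < t ==> t < 1 ==> g t > 0" and gnn: "g t \<ge> 0" for t
  by (auto simp: g_def expinv_pos expinv_nn)
 have gd: "DERIV g t :> dds [1] g t" for t
  using regular_real_DERIV[OF g, of 0 t] by simp
 have gc: "continuous_on S g" for S
  using gd DERIV_isCont continuous_at_imp_continuous_on by blast
 \<comment> \<open>The lower limit lies to the left of the support, so that every
   \<open>t \<ge> 0\<close> is interior to the interval of integration and the derivative there is
   two-sided.\<close>
 define I where "I t = integral {-1..t} g" for t
 have I0: "I t = 0" if "t \<le> 0" for t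
  unfolding I_def by (rule integral_unique, rule has_integral_is_0) (use that g0 in auto)
 have I_der: "DERIV I t :> g t" for t
 proof (cases "t < 0")
  case True
  have "DERIV (\<lambda>_. 0) t :> g t" using g0 True by simp
  then show ?thesis
   by (rule DERIV_cong_ev[THEN iffD1, rotated -1])
    (use True I0 in \<open>auto simp: eventually_nhds intro!: exI[of _ "{..<0}"]\<close>)
 next
  case False
  have "(I has_real_derivative g t) (at t within {-1..t+1})"
   unfolding I_def by (rule integral_has_real_derivative) (use False gc in auto)
  then show ?thesis
   by (subst (asm) at_within_interior) (use False in auto)
 qed
 have mono: "I x \<le> I y" if "x \<le> y" for x y
  by (rule DERIV_nonneg_imp_nondecreasing[OF that]) (use I_der gnn in blast)
 obtain z where z: "1/4 < z" "z < 3/4" "I (3/4) - I (1/4) = (3/4 - 1/4) * g z"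
  using MVT2[of "1/4" "3/4" I g] I_der by auto
 have "I 1 > 0"
  using z gpos[of z] mono[of 0 "1/4"] mono[of "3/4" 1] I0[of 0] by auto
 have I1: "I t = I 1" if "t \<ge> 1" for t
 proof -
  have "I t = I 1 + integral {1..t} g"
   unfolding I_def using that
   by (intro Henstock_Kurzweil_Integration.integral_combine[symmetric] integrable_continuous_real gc) auto
  also have "integral {1..t} g = 0"
   by (rule integral_unique, rule has_integral_is_0) (use g0 in auto)
  finally show ?thesis by simp
 qed
 define th where "th n t = (case n of 0 \<Rightarrow> I t / I 1 | Suc k \<Rightarrow> dds (replicate k 1) g t / I 1)" for n t
 have d: "DERIV (th n) t :> th (Suc n) t" for n t
 proof (cases n)
  case 0
  then show ?thesis unfolding th_def using DERIV_cdivide[OF I_der[of t], of "I 1"] by simp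
 next
  case (Suc k)
  then show ?thesis unfolding th_def using DERIV_cdivide[OF regular_real_DERIV[OF g, of k t], of "I 1"] by simp
 qed
 moreover have "t \<le> 0 ==> th 0 t = 0" "t \<ge> 1 ==> th 0 t = 1" for t
  using I0 I1[of t] \<open>I 1 > 0\<close> by (auto simp: th_def)
 moreover have "bounded (range (th n))" for n
 proof -
  have "dds (replicate k 1) g t = 0" if "t < 0 \<or> t > 1" for k t
  proof -
   have "dds (replicate k 1) g t = dds (replicate k 1) (\<lambda>_. 0) t"
    using that
   proof
    assume "t < 0" then show ?thesis
     by (intro dds_cong_local[of "{..<0}"]) (auto simp: g0)
   next
    assume "t > 1" then show ?thesis
     by (intro dds_cong_local[of "{1<..}"]) (auto simp: g0)
   qed
   then show ?thesis by simp
  qed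
  then have out: "th n t \<in> {0, 1}" if "t < 0 \<or> t > 1" for t
   using that I0 I1[of t] \<open>I 1 > 0\<close> by (auto simp: th_def split: nat.split)
  have "continuous_on {0..1} (th n)"
   using d DERIV_isCont continuous_at_imp_continuous_on by blast
  then have "bounded (th n ` {0..1})"
   by (intro compact_imp_bounded compact_continuous_image) auto
  then have "bounded (th n ` {0..1} \<union> {0, 1})" by auto
  moreover have "range (th n) \<subseteq> th n ` {0..1} \<union> {0, 1}"
  proof
   fix y assume "y \<in> range (th n)"
   then obtain t where t: "y = th n t" by auto
   show "y \<in> th n ` {0..1} \<union> {0, 1}"
   proof (cases "t < 0 \<or> t > 1")
    case True
    then show ?thesis using out[OF True] t by auto
   next
    case False
    then have "t \<in> {0..1}" by auto
    then show ?thesis using t by auto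
   qed
  qed
  ultimately show ?thesis by (rule bounded_subset)
 qed
 ultimately show ?thesis by (rule that)
qed

section \<open>Functions with locally bounded derivatives\<close>

text \<open>Balls are not compact in infinite dimensions, so the Lipschitz constants are required to
  be uniform on each ball; boundedness on balls then follows.\<close>

definition lipb :: "('a::real_normed_vector \<Rightarrow> real) \<Rightarrow> bool" where
 "lipb f \<longleftrightarrow> (\<forall>R. \<exists>L\<ge>0. \<forall>x y. norm x < R \<longrightarrow> norm y < R \<longrightarrow> \<bar>f x - f y\<bar> \<le> L * norm (x - y))"

lemma lipbE:
 assumes "lipb f"
 obtains L where "L \<ge> 0" "\<And>x y. norm x < R ==> norm y < R ==> \<bar>f x - f y\<bar> \<le> L * norm (x - y)"
 using assms unfolding lipb_def by metis

lemma lipb_boundedE: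
 assumes "lipb f"
 obtains C where "C \<ge> 0" "\<And>x. norm x < R ==> \<bar>f x\<bar> \<le> C"
proof -
 obtain L where L: "L \<ge> 0" "\<And>x y. norm x < R ==> norm y < R ==> \<bar>f x - f y\<bar> \<le> L * norm (x - y)"
  using lipbE[OF assms] by blast
 have "\<bar>f x\<bar> \<le> \<bar>f 0\<bar> + L * \<bar>R\<bar>" if "norm x < R" for x
 proof -
  have "0 < R" using that norm_ge_zero[of x] by linarith
  then have "\<bar>f x - f 0\<bar> \<le> L * norm (x - 0)" using L(2)[of x 0] that by simp
  moreover have "L * norm (x - 0) \<le> L * \<bar>R\<bar>" using L(1) that by (intro mult_left_mono) auto
  ultimately show ?thesis by linarith
 qed
 moreover have "0 \<le> \<bar>f 0\<bar> + L * \<bar>R\<bar>" using L(1) by simp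
 ultimately show ?thesis using that by blast
qed

lemma lipb_continuous: "lipb f ==> continuous_on S f"
proof -
 assume f: "lipb f"
 have "isCont f x" for x
 proof -
  obtain L where L: "L \<ge> 0"
   "\<And>y z. norm y < norm x + 1 ==> norm z < norm x + 1 ==> \<bar>f y - f z\<bar> \<le> L * norm (y - z)"
   using lipbE[OF f] by blast
  have "((\<lambda>y. f y - f x) \<longlongrightarrow> 0) (at x)"
  proof (rule Lim_null_comparison)
   show "\<forall>\<^sub>F y in at x. norm (f y - f x) \<le> L * norm (y - x)"
    unfolding eventually_at
   proof (intro exI[of _ 1] conjI ballI impI)
    fix y assume "y \<noteq> x \<and> dist y x < 1"
    then have "norm y < norm x + 1" using norm_triangle_sub[of y x] by (simp add: dist_norm)
    then show "norm (f y - f x) \<le> L * norm (y - x)" using L(2)[of y x] by simp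
   qed simp
   have "((\<lambda>y. L * norm (y - x)) \<longlongrightarrow> L * norm (x - x)) (at x)" by (intro tendsto_intros)
   then show "((\<lambda>y. L * norm (y - x)) \<longlongrightarrow> 0) (at x)" by simp
  qed
  then show ?thesis unfolding isCont_def by (simp add: LIM_zero_iff)
 qed
 then show ?thesis using continuous_at_imp_continuous_on by blast
qed

lemma lipb_const [simp]: "lipb (\<lambda>x. c)"
 by (auto simp: lipb_def intro!: exI[of _ 0])

lemma lipb_add: "lipb f ==> lipb g ==> lipb (\<lambda>x. f x + g x)"
proof -
 assume f: "lipb f" and g: "lipb g"
 show "lipb (\<lambda>x. f x + g x)"
  unfolding lipb_def
 proof
  fix R
  obtain L where L: "L \<ge> 0" "\<And>x y. norm x < R ==> norm y < R ==> \<bar>f x - f y\<bar> \<le> L * norm (x - y)"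
   using lipbE[OF f] by blast
  obtain M where M: "M \<ge> 0" "\<And>x y. norm x < R ==> norm y < R ==> \<bar>g x - g y\<bar> \<le> M * norm (x - y)"
   using lipbE[OF g] by blast
  have "\<bar>f x + g x - (f y + g y)\<bar> \<le> (L + M) * norm (x - y)" if "norm x < R" "norm y < R" for x y
   using L(2)[OF that] M(2)[OF that] by (simp add: algebra_simps abs_le_iff)
  then show "\<exists>L\<ge>0. \<forall>x y. norm x < R \<longrightarrow> norm y < R \<longrightarrow> \<bar>f x + g x - (f y + g y)\<bar> \<le> L * norm (x - y)"
   using L M by (intro exI[of _ "L + M"]) auto
 qed
qed

lemma lipb_mult: "lipb f ==> lipb g ==> lipb (\<lambda>x. f x * g x)"
proof -
 assume f: "lipb f" and g: "lipb g"
 show "lipb (\<lambda>x. f x * g x)"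
  unfolding lipb_def
 proof
  fix R
  obtain L where L: "L \<ge> 0" "\<And>x y. norm x < R ==> norm y < R ==> \<bar>f x - f y\<bar> \<le> L * norm (x - y)"
   using lipbE[OF f] by blast
  obtain M where M: "M \<ge> 0" "\<And>x y. norm x < R ==> norm y < R ==> \<bar>g x - g y\<bar> \<le> M * norm (x - y)"
   using lipbE[OF g] by blast
  obtain A where A: "A \<ge> 0" "\<And>x. norm x < R ==> \<bar>f x\<bar> \<le> A" using lipb_boundedE[OF f] by blast
  obtain B where B: "B \<ge> 0" "\<And>x. norm x < R ==> \<bar>g x\<bar> \<le> B" using lipb_boundedE[OF g] by blast
  have "\<bar>f x * g x - f y * g y\<bar> \<le> (L * B + A * M) * norm (x - y)" if "norm x < R" "norm y < R" for x y
  proof -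
   have "f x * g x - f y * g y = (f x - f y) * g x + f y * (g x - g y)" by (simp add: algebra_simps)
   also have "\<bar>\<dots>\<bar> \<le> \<bar>f x - f y\<bar> * \<bar>g x\<bar> + \<bar>f y\<bar> * \<bar>g x - g y\<bar>"
    by (metis abs_mult abs_triangle_ineq)
   also have "\<dots> \<le> (L * norm (x - y)) * B + A * (M * norm (x - y))"
    using L M A B that by (intro add_mono mult_mono) auto
   finally show ?thesis by (simp add: algebra_simps)
  qed
  then show "\<exists>L\<ge>0. \<forall>x y. norm x < R \<longrightarrow> norm y < R \<longrightarrow> \<bar>f x * g x - f y * g y\<bar> \<le> L * norm (x - y)"
   using L A M B by (intro exI[of _ "L * B + A * M"]) auto
 qed
qed

lemma DERIV_bounded_interval:
 assumes "\<And>n t. DERIV (th n) t :> th (Suc n) t"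
 obtains C :: real where "C \<ge> 0" "\<And>t. \<bar>t\<bar> \<le> A ==> \<bar>th n t\<bar> \<le> C"
proof -
 have "continuous_on {-A..A} (th n)"
  using assms DERIV_isCont continuous_at_imp_continuous_on by blast
 then have "bounded (th n ` {-A..A})" by (intro compact_imp_bounded compact_continuous_image) auto
 then obtain C where "C > 0" "\<And>t. t \<in> {-A..A} ==> \<bar>th n t\<bar> \<le> C" unfolding bounded_pos by auto
 then show ?thesis using that[of C] by (auto simp: abs_le_iff)
qed

text \<open>On a ball the values of \<open>f\<close> stay in a compact interval, where the
  continuous function \<open>th (Suc n)\<close> is bounded.\<close>

lemma lipb_compose:
 assumes th: "\<And>n t. DERIV (th n) t :> th (Suc n) t" and f: "lipb f"
 shows "lipb (\<lambda>x. th n (f x))"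
 unfolding lipb_def
proof
 fix R
 obtain L where L: "L \<ge> 0" "\<And>x y. norm x < R ==> norm y < R ==> \<bar>f x - f y\<bar> \<le> L * norm (x - y)"
  using lipbE[OF f] by blast
 obtain A where A: "A \<ge> 0" "\<And>x. norm x < R ==> \<bar>f x\<bar> \<le> A" using lipb_boundedE[OF f] by blast
 obtain C where C: "C \<ge> 0" "\<And>t. \<bar>t\<bar> \<le> A ==> \<bar>th (Suc n) t\<bar> \<le> C"
  using DERIV_bounded_interval[where th = th and n = "Suc n" and A = A] th by metis
 have "\<bar>th n s - th n t\<bar> \<le> C * \<bar>s - t\<bar>" if "\<bar>s\<bar> \<le> A" "\<bar>t\<bar> \<le> A" for s t
 proof -
  have "norm (th n s - th n t) \<le> C * norm (s - t)"
   by (rule field_differentiable_bound[of "{-A..A}" "th n" "th (Suc n)"])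
    (use th C that in \<open>auto intro: has_field_derivative_at_within simp: abs_le_iff\<close>)
  then show ?thesis by simp
 qed
 then have "\<bar>th n (f x) - th n (f y)\<bar> \<le> C * L * norm (x - y)" if "norm x < R" "norm y < R" for x y
  using A(2)[OF that(1)] A(2)[OF that(2)] mult_left_mono[OF L(2)[OF that] C(1)]
  by (metis mult.assoc order_trans)
 then show "\<exists>L\<ge>0. \<forall>x y. norm x < R \<longrightarrow> norm y < R \<longrightarrow> \<bar>th n (f x) - th n (f y)\<bar> \<le> L * norm (x - y)"
  using C(1) L(1) by (intro exI[of _ "C * L"]) auto
qed

text \<open>Derivatives are taken along unit vectors only. The Lipschitz condition on each of them
  stands in for a Frechet derivative: it makes gradients square-summable and finite combinations of
  directions additive.\<close>

abbreviation tame :: "(ell2 \<Rightarrow> real) \<Rightarrow> bool" where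
 "tame \<equiv> regular lipb (range unit_vec)"

lemma tame_lipb: "tame f ==> lipb f"
 by (rule regular_base)

lemma tame_const: "tame (\<lambda>x. c)"
 by (rule regular_const) simp

lemma tame_add: "tame f ==> tame g ==> tame (\<lambda>x. f x + g x)"
 by (rule regular_add[where Q = lipb, OF lipb_add])

lemma tame_mult: "tame f ==> tame g ==> tame (\<lambda>x. f x * g x)"
 by (rule regular_mult[where P = lipb and Q = lipb and R = lipb, OF lipb_mult lipb_add])

lemma tame_cmult: "tame f ==> tame (\<lambda>x. c * f x)"
 by (rule tame_mult[OF tame_const])

lemma tame_diff: "tame f ==> tame g ==> tame (\<lambda>x. f x - g x)"
 using tame_add[OF _ tame_cmult[of g "- 1"], of f] by simp

lemma tame_sum: "(\<And>i. i \<in> A ==> tame (f i)) ==> tame (\<lambda>x. \<Sum>i\<in>A. f i x)"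
 by (induction A rule: infinite_finite_induct) (auto intro: tame_add tame_const)

lemma tame_compose:
 "(\<And>n t. DERIV (th n) t :> th (Suc n) t) ==> tame f ==> tame (\<lambda>x. th n (f x))"
 by (rule regular_compose[where Q = lipb and th = th, OF lipb_mult lipb_add _ lipb_compose[where th = th, OF _ tame_lipb]])

lemma tame_pd: "tame f ==> tame (pd i f)"
 unfolding pd_eq_dd by (rule regular_dd) auto

lemma tame_pds: "tame f ==> tame (pds is f)"
 by (induction "is") (auto intro: tame_pd)

lemma tame_has_pd: "tame f ==> has_pd i f x"
 unfolding has_pd_eq by (rule regular_has_dd) auto

lemma tame_continuous: "tame f ==> continuous_on S f"
 by (rule lipb_continuous[OF tame_lipb])

lemma tame_measurable: "tame f ==> f \<in> borel_measurable borel"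
 by (rule borel_measurable_continuous_onI[OF tame_continuous])

lemma map_unit_vec_lists [simp]: "map unit_vec is \<in> lists (range unit_vec)"
 by auto

section \<open>Directional derivatives and gradients of tame functions\<close>

lemma tame_dd_finite:
 assumes f: "tame f"
 shows "has_dd (\<Sum>i<n. c i *\<^sub>R unit_vec i) f x \<and> dd (\<Sum>i<n. c i *\<^sub>R unit_vec i) f x = (\<Sum>i<n. c i * pd i f x)"
proof (induction n arbitrary: x)
 case 0
 have "DERIV (\<lambda>t. f (x + t *\<^sub>R (0::ell2))) 0 :> 0" by simp
 from dd_eqI[OF this] show ?case by simp
next
 case (Suc n)
 have h: "has_dd (unit_vec n) f y" for y using tame_has_pd[OF f] by (simp add: has_pd_eq)
 note s = dd_scale_dir[OF h, of "c n"]
 have "dd (c n *\<^sub>R unit_vec n) f = (\<lambda>x. c n * pd n f x)" by (simp add: fun_eq_iff s pd_eq_dd)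
 then have "continuous (at x) (dd (c n *\<^sub>R unit_vec n) f)"
  using tame_continuous[OF tame_cmult[OF tame_pd[OF f]], of UNIV "c n" n] by (simp add: continuous_on_eq_continuous_at)
 from dd_add_dir[OF _ s(1) this] Suc s show ?case by (simp add: pd_eq_dd)
qed

lemma dd_lipschitz_bound:
 assumes "has_dd v f x" "r > 0" "\<And>y. norm (y - x) < r ==> \<bar>f y - f x\<bar> \<le> L * norm (y - x)"
 shows "\<bar>dd v f x\<bar> \<le> L * norm v"
proof (rule tendsto_upperbound)
 have "((\<lambda>t. (f (x + t *\<^sub>R v) - f x) / t) \<longlongrightarrow> dd v f x) (at 0)"
  using assms(1) by (simp add: has_dd_DERIV has_field_derivative_iff)
 then show "((\<lambda>t. \<bar>(f (x + t *\<^sub>R v) - f x) / t\<bar>) \<longlongrightarrow> \<bar>dd v f x\<bar>) (at 0)"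
  by (rule tendsto_rabs)
 have "\<bar>(f (x + t *\<^sub>R v) - f x) / t\<bar> \<le> L * norm v" if "t \<noteq> 0" "\<bar>t\<bar> < r / (norm v + 1)" for t
 proof -
  have "\<bar>t\<bar> * norm v \<le> \<bar>t\<bar> * (norm v + 1)" by (intro mult_left_mono) auto
  also have "\<dots> < r" using that(2) by (simp add: pos_less_divide_eq add_nonneg_pos)
  finally have "norm (x + t *\<^sub>R v - x) < r" by simp
  from assms(3)[OF this] have "\<bar>f (x + t *\<^sub>R v) - f x\<bar> \<le> \<bar>t\<bar> * (L * norm v)" by (simp add: ac_simps)
  then show ?thesis using that(1) by (simp add: abs_divide pos_divide_le_eq mult.commute)
 qed
 then show "\<forall>\<^sub>F t in at 0. \<bar>(f (x + t *\<^sub>R v) - f x) / t\<bar> \<le> L * norm v"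
  unfolding eventually_at using assms(2)
  by (intro exI[of _ "r / (norm v + 1)"]) (auto simp: dist_real_def add_nonneg_pos)
qed simp

text \<open>Differentiate along the truncated gradient \<open>v\<close> itself: the derivative
  equals \<open>(norm v)^2\<close>, while the Lipschitz bound gives at most
  \<open>L * norm v\<close>.\<close>

lemma tame_gradE:
 assumes f: "tame f"
 obtains C where "C \<ge> 0" "\<And>x n. norm x < R ==> (\<Sum>i<n. (pd i f x)^2) \<le> C"
proof -
 obtain L where L: "L \<ge> 0"
  "\<And>x y. norm x < R + 1 ==> norm y < R + 1 ==> \<bar>f x - f y\<bar> \<le> L * norm (x - y)"
  using lipbE[OF tame_lipb[OF f]] by blast
 have "(\<Sum>i<n. (pd i f x)^2) \<le> L^2" if x: "norm x < R" for x n
 proof -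
  define v where "v = (\<Sum>i<n. pd i f x *\<^sub>R unit_vec i)"
  define S where "S = (\<Sum>i<n. (pd i f x)^2)"
  have v: "has_dd v f x" "dd v f x = S"
   unfolding v_def S_def using tame_dd_finite[OF f] by (auto simp: power2_eq_square)
  have "coord v i = (if i < n then pd i f x else 0)" for i
   by (simp add: v_def coord_sum coord_simps if_distrib sum.delta cong: if_cong)
  then have "(norm v)^2 = suminf (\<lambda>i. if i < n then (pd i f x)^2 else 0)"
   unfolding norm_ell2_sq by (intro suminf_cong) auto
  also have "\<dots> = S" unfolding S_def by (subst suminf_finite[of "{..<n}"]) auto
  finally have nv: "(norm v)^2 = S" .
  have "\<bar>dd v f x\<bar> \<le> L * norm v"
  proof (rule dd_lipschitz_bound[OF v(1)])
   fix y assume "norm (y - x) < 1"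
   then have "norm y < R + 1" using norm_triangle_sub[of y x] x by simp
   then show "\<bar>f y - f x\<bar> \<le> L * norm (y - x)" using L(2) x by simp
  qed simp
  then have "(norm v)^2 \<le> L * norm v" using v(2) nv by simp
  then have "norm v \<le> L" using L(1) by (cases "norm v = 0") (auto simp: power2_eq_square)
  then show ?thesis using nv unfolding S_def by (metis norm_ge_zero power_mono)
 qed
 then show ?thesis using that[of "L^2"] by simp
qed

section \<open>Functions with multilinear bounds on all directional derivatives\<close>

abbreviation pn :: "'a::real_normed_vector list \<Rightarrow> real" where
 "pn vs \<equiv> prod_list (map norm vs)"

text \<open>A condition for Frechet smoothness in terms of directional derivatives alone; the bound
  by the product of norms, uniform on balls, replaces operator norms and is stable under products
  and compositions.\<close>

definition bsmooth :: "('a::real_normed_vector \<Rightarrow> real) \<Rightarrow> bool" where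
 "bsmooth f \<longleftrightarrow> regular (\<lambda>_. True) UNIV f \<and>
  (\<forall>R k. \<exists>C\<ge>0. \<forall>x vs. norm x < R \<longrightarrow> length vs \<le> k \<longrightarrow> \<bar>dds vs f x\<bar> \<le> C * pn vs)"

lemma bsmooth_regular: "bsmooth f ==> regular (\<lambda>_. True) UNIV f"
 by (simp add: bsmooth_def)

lemma bsmooth_has_dd: "bsmooth f ==> has_dd v (dds vs f) x"
 by (rule regular_has_dd[OF regular_dds[OF bsmooth_regular]]) auto

lemma bsmoothE:
 assumes "bsmooth f"
 obtains C where "C \<ge> 0"
  "\<And>x vs. norm x < R ==> length vs \<le> k ==> \<bar>dds vs f x\<bar> \<le> C * pn vs"
 using assms unfolding bsmooth_def by metis

lemma prod_list_norm_nonneg [simp]: "0 \<le> pn vs"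
 by (induction vs) auto

lemma prod_list_norm_unit [simp]: "prod_list (map norm (map unit_vec is)) = 1"
 by (induction "is") auto

lemma bsmooth_lipb: "bsmooth f ==> lipb (dds vs f)"
 unfolding lipb_def
proof
 fix R assume f: "bsmooth f"
 obtain C where C: "C \<ge> 0"
  "\<And>x ws. norm x < R ==> length ws \<le> Suc (length vs) ==> \<bar>dds ws f x\<bar> \<le> C * prod_list (map norm ws)"
  using bsmoothE[OF f] by blast
 have "\<bar>dds vs f x - dds vs f y\<bar> \<le> C * pn vs * norm (x - y)"
  if xy: "norm x < R" "norm y < R" for x y
 proof -
  obtain s where s: "0 < s" "s < 1" "dds vs f (y + (x - y)) - dds vs f y = dd (x - y) (dds vs f) (y + s *\<^sub>R (x - y))"
   using dd_mean_value[of "x - y" "dds vs f" y] bsmooth_has_dd[OF f] by blast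
  have "y + s *\<^sub>R (x - y) = (1 - s) *\<^sub>R y + s *\<^sub>R x" by (simp add: algebra_simps)
  moreover have "(1 - s) *\<^sub>R y + s *\<^sub>R x \<in> ball 0 R"
   by (rule convexD_alt[OF convex_ball]) (use xy s in auto)
  ultimately have "norm (y + s *\<^sub>R (x - y)) < R" by simp
  from C(2)[OF this, of "(x - y) # vs"] s show ?thesis by (simp add: ac_simps)
 qed
 then show "\<exists>L\<ge>0. \<forall>x y. norm x < R \<longrightarrow> norm y < R \<longrightarrow> \<bar>dds vs f x - dds vs f y\<bar> \<le> L * norm (x - y)"
  using C(1) by (intro exI[of _ "C * pn vs"]) auto
qed

lemma bsmooth_regular_lipb: "bsmooth f ==> regular lipb UNIV f"
 by (rule regularI) (auto intro: bsmooth_lipb bsmooth_has_dd)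

lemma bsmooth_tame: "bsmooth f ==> tame f"
 by (rule regular_mono[OF bsmooth_regular_lipb]) auto

lemma bsmooth_const: "bsmooth (\<lambda>x. c)"
 unfolding bsmooth_def
proof (intro conjI allI)
 fix R :: real and k
 have "\<bar>dds vs (\<lambda>x. c) x\<bar> \<le> \<bar>c\<bar> * pn vs" for vs and x :: 'a
  by (cases "vs = []") (auto simp: dds_const)
 then show "\<exists>C\<ge>0. \<forall>(x::'a) vs. norm x < R \<longrightarrow> length vs \<le> k \<longrightarrow> \<bar>dds vs (\<lambda>x. c) x\<bar> \<le> C * pn vs"
  by (intro exI[of _ "\<bar>c\<bar>"]) auto
qed (rule regular_const, simp)

lemma bsmooth_add:
 assumes f: "bsmooth f" and g: "bsmooth g"
 shows "bsmooth (\<lambda>x. f x + g x)"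
 unfolding bsmooth_def
proof (intro conjI allI)
 show "regular (\<lambda>_. True) UNIV (\<lambda>x. f x + g x)"
  using f g by (intro regular_add bsmooth_regular) auto
 fix R k
 obtain C where C: "C \<ge> 0" "\<And>x vs. norm x < R ==> length vs \<le> k ==> \<bar>dds vs f x\<bar> \<le> C * pn vs"
  using bsmoothE[OF f] by blast
 obtain D where D: "D \<ge> 0" "\<And>x vs. norm x < R ==> length vs \<le> k ==> \<bar>dds vs g x\<bar> \<le> D * pn vs"
  using bsmoothE[OF g] by blast
 have "\<bar>dds vs (\<lambda>x. f x + g x) x\<bar> \<le> (C + D) * pn vs" if "norm x < R" "length vs \<le> k" for x vs
  using C(2)[OF that] D(2)[OF that]
  by (subst dds_add[OF bsmooth_regular[OF f] bsmooth_regular[OF g]]) (auto simp: algebra_simps)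
 then show "\<exists>C\<ge>0. \<forall>x vs. norm x < R \<longrightarrow> length vs \<le> k \<longrightarrow> \<bar>dds vs (\<lambda>x. f x + g x) x\<bar> \<le> C * pn vs"
  using C(1) D(1) by (intro exI[of _ "C + D"]) auto
qed

lemma sum_list_abs_bound:
 fixes F :: "'b \<Rightarrow> real"
 assumes "\<And>p. p \<in> set ps ==> \<bar>F p\<bar> \<le> B"
 shows "\<bar>\<Sum>p\<leftarrow>ps. F p\<bar> \<le> real (length ps) * B"
 using assms
proof (induction ps)
 case (Cons p ps)
 then have "\<bar>F p\<bar> \<le> B" "\<bar>\<Sum>p\<leftarrow>ps. F p\<bar> \<le> real (length ps) * B" by auto
 then show ?case by (simp add: algebra_simps)
qed simp

lemma leibniz_bound:
 fixes F G :: "'a::real_normed_vector list \<Rightarrow> real"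
 assumes C: "C \<ge> 0" "\<And>a. length a \<le> length vs ==> \<bar>F a\<bar> \<le> C * prod_list (map norm a)"
  and D: "D \<ge> 0" "\<And>b. length b \<le> length vs ==> \<bar>G b\<bar> \<le> D * prod_list (map norm b)"
 shows "\<bar>\<Sum>(a, b)\<leftarrow>splits vs. F a * G b\<bar> \<le> 2 ^ length vs * (C * D) * pn vs"
proof -
 have "\<bar>\<Sum>p\<leftarrow>splits vs. F (fst p) * G (snd p)\<bar> \<le> real (length (splits vs)) * (C * D * pn vs)"
 proof (rule sum_list_abs_bound)
  fix p assume "p \<in> set (splits vs)"
  then have ab: "(fst p, snd p) \<in> set (splits vs)" by simp
  note l = splits_length[OF ab]
  have "\<bar>F (fst p) * G (snd p)\<bar> \<le> (C * prod_list (map norm (fst p))) * (D * prod_list (map norm (snd p)))"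
   unfolding abs_mult using C D l by (intro mult_mono) auto
  also have "\<dots> = C * D * pn vs"
   by (simp add: splits_prod[OF ab, of norm] ac_simps)
  finally show "\<bar>F (fst p) * G (snd p)\<bar> \<le> C * D * pn vs" .
 qed
 then show ?thesis by (simp add: case_prod_unfold mult.assoc)
qed

lemma bsmooth_mult:
 assumes f: "bsmooth f" and g: "bsmooth g"
 shows "bsmooth (\<lambda>x. f x * g x)"
 unfolding bsmooth_def
proof (intro conjI allI)
 show "regular (\<lambda>_. True) UNIV (\<lambda>x. f x * g x)"
  by (rule regular_mult[OF _ _ bsmooth_regular[OF f] bsmooth_regular[OF g]]) auto
 fix R k
 obtain C where C: "C \<ge> 0" "\<And>x vs. norm x < R ==> length vs \<le> k ==> \<bar>dds vs f x\<bar> \<le> C * pn vs"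
  using bsmoothE[OF f] by blast
 obtain D where D: "D \<ge> 0" "\<And>x vs. norm x < R ==> length vs \<le> k ==> \<bar>dds vs g x\<bar> \<le> D * pn vs"
  using bsmoothE[OF g] by blast
 have "\<bar>dds vs (\<lambda>x. f x * g x) x\<bar> \<le> 2 ^ k * (C * D) * pn vs"
  if "norm x < R" "length vs \<le> k" for x vs
 proof -
  have "\<bar>dds vs (\<lambda>x. f x * g x) x\<bar> \<le> 2 ^ length vs * (C * D) * pn vs"
   using that
   by (subst dds_mult[OF bsmooth_regular[OF f] bsmooth_regular[OF g]])
    (auto intro!: leibniz_bound[where F = "\<lambda>a. dds a f x" and G = "\<lambda>b. dds b g x"] C D)
  also have "\<dots> \<le> 2 ^ k * (C * D) * pn vs"
   using that C D by (intro mult_right_mono power_increasing) auto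
  finally show ?thesis .
 qed
 then show "\<exists>C\<ge>0. \<forall>x vs. norm x < R \<longrightarrow> length vs \<le> k \<longrightarrow> \<bar>dds vs (\<lambda>x. f x * g x) x\<bar> \<le> C * pn vs"
  using C(1) D(1) by (intro exI[of _ "2 ^ k * (C * D)"]) auto
qed

lemma bsmooth_cmult: "bsmooth f ==> bsmooth (\<lambda>x. c * f x)"
 by (rule bsmooth_mult[OF bsmooth_const])

lemma bsmooth_diff: "bsmooth f ==> bsmooth g ==> bsmooth (\<lambda>x. f x - g x)"
 using bsmooth_add[OF _ bsmooth_cmult[of g "- 1"], of f] by simp

lemma bsmooth_sum: "(\<And>i. i \<in> A ==> bsmooth (f i)) ==> bsmooth (\<lambda>x. \<Sum>i\<in>A. f i x)"
 by (induction A rule: infinite_finite_induct) (auto intro: bsmooth_add bsmooth_const)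

lemma bsmooth_compose:
 assumes th: "\<And>n t. DERIV (th n) t :> th (Suc n) t" and f: "bsmooth f"
 shows "bsmooth (\<lambda>x. th n (f x))"
proof -
 have reg: "regular (\<lambda>_. True) UNIV (\<lambda>x. th n (f x))" for n
  by (rule regular_compose[where Q = "\<lambda>_. True" and th = th, OF _ _ th _ bsmooth_regular[OF f]]) auto
 have "\<exists>C\<ge>0. \<forall>x vs. norm x < R \<longrightarrow> length vs \<le> k \<longrightarrow> \<bar>dds vs (\<lambda>x. th n (f x)) x\<bar> \<le> C * pn vs" for R k n
 proof (induction k arbitrary: n)
  case 0
  obtain A where A: "A \<ge> 0" "\<And>x. norm x < R ==> \<bar>f x\<bar> \<le> A"
   using lipb_boundedE[of f] bsmooth_lipb[OF f, of "[]"] by auto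
  obtain C where C: "C \<ge> 0" "\<And>t. \<bar>t\<bar> \<le> A ==> \<bar>th n t\<bar> \<le> C"
   using DERIV_bounded_interval[where th = th and n = n and A = A] th by metis
  then show ?case using A by (intro exI[of _ C]) auto
 next
  case (Suc k)
  obtain C where C: "C \<ge> 0" "\<And>x vs. norm x < R ==> length vs \<le> k ==> \<bar>dds vs (\<lambda>x. th (Suc n) (f x)) x\<bar> \<le> C * pn vs"
   using Suc.IH[of "Suc n"] by blast
  obtain C' where C': "C' \<ge> 0" "\<And>x vs. norm x < R ==> length vs \<le> k ==> \<bar>dds vs (\<lambda>x. th n (f x)) x\<bar> \<le> C' * pn vs"
   using Suc.IH[of n] by blast
  obtain D where D: "D \<ge> 0" "\<And>x vs. norm x < R ==> length vs \<le> Suc k ==> \<bar>dds vs f x\<bar> \<le> D * pn vs"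
   using bsmoothE[OF f] by blast
  define K where "K = C' + 2 ^ k * (C * D)"
  have K: "C' \<le> K" "2 ^ k * (C * D) \<le> K" "K \<ge> 0" using C D C' by (auto simp: K_def)
  have "\<bar>dds vs (\<lambda>x. th n (f x)) x\<bar> \<le> K * pn vs" if x: "norm x < R" and vs: "length vs \<le> Suc k" for x vs
  proof (cases vs rule: rev_exhaust)
   case Nil
   then show ?thesis using C'(2)[OF x, of "[]"] K by simp
  next
   \<comment> \<open>The list is split at the innermost derivative: the chain rule applies to
     \<open>v\<close>, and the remaining derivatives \<open>us\<close> fall on a product, one order
     lower for each factor.\<close>
   case (snoc us v)
   have "dd v (\<lambda>x. th n (f x)) = (\<lambda>x. th (Suc n) (f x) * dd v f x)"
    using bsmooth_has_dd[OF f, of v "[]"] by (auto simp: fun_eq_iff dd_chain(2)[OF _ th])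
   then have "dds vs (\<lambda>x. th n (f x)) x = dds us (\<lambda>x. th (Suc n) (f x) * dd v f x) x"
    by (simp add: snoc dds_append)
   also have "\<dots> = (\<Sum>(a, b)\<leftarrow>splits us. dds a (\<lambda>x. th (Suc n) (f x)) x * dds b (dd v f) x)"
    by (subst dds_mult[OF reg regular_dd[OF bsmooth_regular[OF f]]]) auto
   also have "\<bar>\<dots>\<bar> \<le> 2 ^ length us * (C * (D * norm v)) * prod_list (map norm us)"
   proof (rule leibniz_bound[where F = "\<lambda>a. dds a (\<lambda>x. th (Suc n) (f x)) x" and G = "\<lambda>b. dds b (dd v f) x"])
    fix b :: "'a list" assume "length b \<le> length us"
    then have "\<bar>dds (b @ [v]) f x\<bar> \<le> D * prod_list (map norm (b @ [v]))"
     using vs snoc by (intro D(2)[OF x]) auto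
    then show "\<bar>dds b (dd v f) x\<bar> \<le> D * norm v * prod_list (map norm b)"
     by (simp add: dds_append ac_simps)
   qed (use C D vs snoc x in auto)
   also have "\<dots> \<le> 2 ^ k * (C * (D * norm v)) * prod_list (map norm us)"
    using vs snoc C D by (intro mult_right_mono power_increasing) auto
   also have "\<dots> = (2 ^ k * (C * D)) * pn vs" by (simp add: snoc ac_simps)
   also have "\<dots> \<le> K * pn vs" by (intro mult_right_mono K) simp
   finally show ?thesis .
  qed
  then show ?case using K by (intro exI[of _ K]) auto
 qed
 then show ?thesis unfolding bsmooth_def using reg by blast
qed

lemma dd_inner_left: "dd v (\<lambda>x. inner w x + c) = (\<lambda>x. inner w v)" "has_dd v (\<lambda>x. inner w x + c) x"
proof -
 have "DERIV (\<lambda>t. inner w (x + t *\<^sub>R v) + c) 0 :> inner w v" for x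
  by (auto simp: inner_add_right intro!: derivative_eq_intros)
 from dd_eqI[OF this] show "dd v (\<lambda>x. inner w x + c) = (\<lambda>x. inner w v)" "has_dd v (\<lambda>x. inner w x + c) x"
  by auto
qed

text \<open>The additive constant closes the family under differentiation: a derivative is the
  member with \<open>w = 0\<close> and \<open>c = inner w v\<close>.\<close>

lemma regular_inner: "regular (\<lambda>_. True) UNIV (\<lambda>x. inner w x + c)"
proof (rule regular_coinduct[where C = "{(\<lambda>x. inner w x + c) | w c. True}"])
 fix f v x assume "f \<in> {(\<lambda>x. inner w x + c) | w c. True}"
 then obtain w c where f: "f = (\<lambda>x. inner w x + c)" by blast
 show "has_dd v f x" unfolding f by (rule dd_inner_left)
 show "dd v f \<in> {(\<lambda>x. inner w x + c) | w c. True}"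
  unfolding f dd_inner_left by (auto intro!: exI[of _ 0] exI[of _ "inner w v"] simp: fun_eq_iff)
qed auto

lemma dds_inner_bound:
 assumes "norm x < R"
 shows "\<bar>dds vs (\<lambda>x. inner w x) x\<bar> \<le> (1 + R) * norm w * pn vs"
proof (cases vs rule: rev_exhaust)
 case Nil
 have "\<bar>inner w x\<bar> \<le> norm w * norm x" by (rule Cauchy_Schwarz_ineq2)
 also have "\<dots> \<le> norm w * (1 + R)" using assms by (intro mult_left_mono) auto
 finally show ?thesis by (simp add: Nil ac_simps)
next
 case (snoc us v)
 have R: "0 < R" using assms norm_ge_zero[of x] by linarith
 have d: "dd v (\<lambda>x. inner w x) = (\<lambda>x. inner w v)" using dd_inner_left(1)[of v w 0] by simp
 show ?thesis
 proof (cases "us = []")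
  case True
  have "\<bar>inner w v\<bar> \<le> norm w * norm v" by (rule Cauchy_Schwarz_ineq2)
  also have "\<dots> \<le> (1 + R) * (norm w * norm v)" using R by (auto simp: algebra_simps)
  finally show ?thesis using True by (simp add: snoc d ac_simps)
 next
  case False
  then show ?thesis using R by (simp add: snoc d dds_append dds_const)
 qed
qed

lemma bsmooth_inner: "bsmooth (\<lambda>x. inner w x)"
 unfolding bsmooth_def
proof (intro conjI allI)
 show "regular (\<lambda>_. True) UNIV (inner w)" using regular_inner[of w 0] by simp
 fix R :: real and k
 show "\<exists>C\<ge>0. \<forall>x vs. norm x < R \<longrightarrow> length vs \<le> k \<longrightarrow> \<bar>dds vs (inner w) x\<bar> \<le> C * pn vs"
  using dds_inner_bound[of _ "\<bar>R\<bar>" _ w] by (intro exI[of _ "(1 + \<bar>R\<bar>) * norm w"]) force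
qed

lemma bsmooth_coord: "bsmooth (\<lambda>x. coord x i)"
 using bsmooth_inner[of "unit_vec i"] by (simp add: inner_commute[of "unit_vec i"])

lemma bsmooth_norm_sq: "bsmooth (\<lambda>x. (norm (x::'a::real_inner))^2)"
proof -
 have d: "has_dd v (\<lambda>x. (norm x)^2) x" "dd v (\<lambda>x. (norm x)^2) x = inner (2 *\<^sub>R v) x" for v x :: 'a
 proof -
  have "DERIV (\<lambda>t. (norm (x + t *\<^sub>R v))^2) 0 :> inner (2 *\<^sub>R v) x"
   by (auto simp: power2_norm_eq_inner inner_add_right inner_add_left inner_commute
    intro!: derivative_eq_intros)
  from dd_eqI[OF this] show "has_dd v (\<lambda>x. (norm x)^2) x" "dd v (\<lambda>x. (norm x)^2) x = inner (2 *\<^sub>R v) x"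
   by auto
 qed
 have d': "dd v (\<lambda>x. (norm x)^2) = inner (2 *\<^sub>R v)" for v :: 'a using d by auto
 have "reg (\<lambda>_. True) k UNIV (\<lambda>x::'a. (norm x)^2)" for k
  using bsmooth_regular[OF bsmooth_inner] by (cases k) (auto simp: d d' regular_def)
 then have "regular (\<lambda>_. True) UNIV (\<lambda>x::'a. (norm x)^2)" by (simp add: regular_def)
 moreover have "\<exists>C\<ge>0. \<forall>(x::'a) vs. norm x < R \<longrightarrow> length vs \<le> k \<longrightarrow> \<bar>dds vs (\<lambda>x. (norm x)^2) x\<bar> \<le> C * pn vs" for R k
 proof (intro exI[of _ "R^2 + 2 * (1 + \<bar>R\<bar>)"] conjI allI impI)
  fix x :: 'a and vs :: "'a list" assume x: "norm x < R"
  show "\<bar>dds vs (\<lambda>x. (norm x)^2) x\<bar> \<le> (R^2 + 2 * (1 + \<bar>R\<bar>)) * pn vs"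
  proof (cases vs rule: rev_exhaust)
   case Nil
   have "(norm x)^2 \<le> R^2" using x by (intro power_mono) auto
   then show ?thesis by (simp add: Nil)
  next
   case (snoc us v)
   have "\<bar>dds us (inner (2 *\<^sub>R v)) x\<bar> \<le> (1 + \<bar>R\<bar>) * norm (2 *\<^sub>R v) * prod_list (map norm us)"
    by (rule dds_inner_bound) (use x in linarith)
   also have "\<dots> = (2 * (1 + \<bar>R\<bar>)) * pn vs" by (simp add: snoc ac_simps)
   also have "\<dots> \<le> (R^2 + 2 * (1 + \<bar>R\<bar>)) * pn vs" by (intro mult_right_mono) auto
   finally show ?thesis by (simp add: snoc dds_append d')
  qed
 qed auto
 ultimately show ?thesis unfolding bsmooth_def by blast
qed

subsection \<open>Frechet smoothness\<close>

lemma bsmooth_dd_linear: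
 assumes f: "bsmooth f"
 shows "dd (v + w) (dds ws f) = (\<lambda>x. dd v (dds ws f) x + dd w (dds ws f) x)"
  "dd (c *\<^sub>R v) (dds ws f) = (\<lambda>x. c * dd v (dds ws f) x)"
proof -
 have "continuous (at x) (dd w (dds ws f))" for x
  using lipb_continuous[OF bsmooth_lipb[OF f], of UNIV "w # ws"] by (simp add: continuous_on_eq_continuous_at)
 then show "dd (v + w) (dds ws f) = (\<lambda>x. dd v (dds ws f) x + dd w (dds ws f) x)"
  by (intro ext dd_add_dir(2) bsmooth_has_dd[OF f])
 show "dd (c *\<^sub>R v) (dds ws f) = (\<lambda>x. c * dd v (dds ws f) x)"
  by (intro ext dd_scale_dir(2) bsmooth_has_dd[OF f])
qed

lemma bsmooth_bounded_multilinear: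
 assumes f: "bsmooth f"
 shows "bounded_multilinear k (\<lambda>vs. dds vs f x)"
 unfolding bounded_multilinear_def
proof (intro conjI allI impI)
 fix vs :: "ell2 list" and j assume vs: "length vs = k" "j < k"
 let ?us = "take j vs" and ?ws = "drop (Suc j) vs"
 have upd: "vs[j := v] = ?us @ v # ?ws" for v
  using vs by (simp add: upd_conv_take_nth_drop)
 have reg: "regular (\<lambda>_. True) UNIV (dd v (dds ?ws f))" for v
  by (intro regular_dd regular_dds bsmooth_regular f) auto
 show "linear (\<lambda>v. dds (vs[j := v]) f x)"
 proof (rule linearI)
  show "dds (vs[j := v + w]) f x = dds (vs[j := v]) f x + dds (vs[j := w]) f x" for v w
   by (simp add: upd dds_append bsmooth_dd_linear[OF f] dds_add[OF reg reg])
  show "dds (vs[j := c *\<^sub>R v]) f x = c *\<^sub>R dds (vs[j := v]) f x" for c v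
   by (simp add: upd dds_append bsmooth_dd_linear[OF f] dds_cmult[OF reg])
 qed
next
 obtain C where "C \<ge> 0" "\<And>y vs. norm y < norm x + 1 ==> length vs \<le> k ==> \<bar>dds vs f y\<bar> \<le> C * pn vs"
  using bsmoothE[OF f] by blast
 then show "\<exists>C. \<forall>vs. length vs = k \<longrightarrow> \<bar>dds vs f x\<bar> \<le> C * pn vs"
  by (intro exI[of _ C]) auto
qed

lemma bsmooth_mean_value:
 assumes "bsmooth f"
 shows "\<exists>s. 0 < s \<and> s < 1 \<and> dds vs f (x + h) - dds vs f x = dds (h # vs) f (x + s *\<^sub>R h)"
 using dd_mean_value[of h "dds vs f" x] bsmooth_has_dd[OF assms] by simp

text \<open>Two applications of the mean value theorem turn the remainder into a derivative of order
  \<open>k + 2\<close> in the directions \<open>s h\<close> and \<open>h\<close>, so it is quadratic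
  in \<open>norm h\<close>.\<close>

lemma bsmooth_frechet:
 assumes f: "bsmooth f" and "\<epsilon> > 0"
 shows "\<forall>\<^sub>F h in at 0. \<forall>vs. length vs = k \<longrightarrow>
  \<bar>dds vs f (x + h) - dds vs f x - dds (h # vs) f x\<bar> \<le> \<epsilon> * norm h * pn vs"
proof -
 obtain C where C: "C \<ge> 0" "\<And>y vs. norm y < norm x + 1 ==> length vs \<le> Suc (Suc k) ==> \<bar>dds vs f y\<bar> \<le> C * pn vs"
  using bsmoothE[OF f] by blast
 have main: "\<bar>dds vs f (x + h) - dds vs f x - dds (h # vs) f x\<bar> \<le> C * norm h * norm h * pn vs"
  if "norm h < 1" "length vs = k" for h vs
 proof -
  obtain s where s: "0 < s" "s < 1" "dds vs f (x + h) - dds vs f x = dds (h # vs) f (x + s *\<^sub>R h)"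
   using bsmooth_mean_value[OF f] by blast
  obtain u where u: "0 < u" "u < 1"
   "dds (h # vs) f (x + s *\<^sub>R h) - dds (h # vs) f x = dds ((s *\<^sub>R h) # h # vs) f (x + u *\<^sub>R (s *\<^sub>R h))"
   using bsmooth_mean_value[OF f] by blast
  have sh: "s * norm h \<le> 1 * norm h" using s by (intro mult_right_mono) auto
  have "u * (s * norm h) \<le> 1 * (1 * norm h)" using s u by (intro mult_mono) auto
  moreover have "norm (u *\<^sub>R (s *\<^sub>R h)) = u * (s * norm h)" using s u by simp
  ultimately have "norm (u *\<^sub>R (s *\<^sub>R h)) < 1" using that by linarith
  then have "norm (x + u *\<^sub>R (s *\<^sub>R h)) < norm x + 1"
   using norm_triangle_ineq[of x "u *\<^sub>R (s *\<^sub>R h)"] by linarith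
  from C(2)[OF this, of "(s *\<^sub>R h) # h # vs"] that
  have "\<bar>dds ((s *\<^sub>R h) # h # vs) f (x + u *\<^sub>R (s *\<^sub>R h))\<bar> \<le> C * ((s * norm h) * (norm h * pn vs))"
   using s by simp
  also have "\<dots> \<le> C * (norm h * (norm h * pn vs))"
   using C(1) sh by (intro mult_left_mono mult_right_mono) auto
  finally show ?thesis using s u by (simp add: ac_simps)
 qed
 show ?thesis
  unfolding eventually_at
 proof (intro exI[of _ "min 1 (\<epsilon> / (C + 1))"] conjI ballI impI allI)
  show "0 < min 1 (\<epsilon> / (C + 1))" using C(1) assms(2) by auto
  fix h :: 'a and vs :: "'a list" assume h: "h \<noteq> 0 \<and> dist h 0 < min 1 (\<epsilon> / (C + 1))" and vs: "length vs = k"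
  then have "norm h * (C + 1) < \<epsilon>" using C(1) by (simp add: pos_less_divide_eq)
  moreover have "C * norm h \<le> norm h * (C + 1)" by (simp add: algebra_simps)
  ultimately have "C * norm h \<le> \<epsilon>" by linarith
  have "\<bar>dds vs f (x + h) - dds vs f x - dds (h # vs) f x\<bar> \<le> C * norm h * norm h * pn vs"
   using h vs by (intro main) auto
  also have "\<dots> \<le> \<epsilon> * norm h * pn vs"
   using \<open>C * norm h \<le> \<epsilon>\<close> by (intro mult_right_mono) auto
  finally show "\<bar>dds vs f (x + h) - dds vs f x - dds (h # vs) f x\<bar> \<le> \<epsilon> * norm h * pn vs" .
 qed
qed

lemma dds_sum:
 assumes "\<And>i. i \<in> A ==> regular (\<lambda>_. True) D (F i)" "vs \<in> lists D"
 shows "dds vs (\<lambda>x. \<Sum>i\<in>A. F i x) = (\<lambda>x. \<Sum>i\<in>A. dds vs (F i) x)"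
  "regular (\<lambda>_. True) D (\<lambda>x. \<Sum>i\<in>A. F i x)"
proof -
 have "dds vs (\<lambda>x. \<Sum>i\<in>A. F i x) = (\<lambda>x. \<Sum>i\<in>A. dds vs (F i) x) \<and> regular (\<lambda>_. True) D (\<lambda>x. \<Sum>i\<in>A. F i x)"
  using assms(1)
 proof (induction A rule: infinite_finite_induct)
  case (insert a A)
  then have r: "regular (\<lambda>_. True) D (F a)" "regular (\<lambda>_. True) D (\<lambda>x. \<Sum>i\<in>A. F i x)" by auto
  from insert show ?case
   by (simp add: dds_add[OF r assms(2)] regular_add[OF _ r])
 qed (auto intro: regular_const)
 then show "dds vs (\<lambda>x. \<Sum>i\<in>A. F i x) = (\<lambda>x. \<Sum>i\<in>A. dds vs (F i) x)"
  "regular (\<lambda>_. True) D (\<lambda>x. \<Sum>i\<in>A. F i x)" by auto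
qed

text \<open>Composition with the projection to finitely many coordinates turns partial regularity into
 Frechet smoothness.\<close>

lemma trunc_add_scale: "trunc N (x + t *\<^sub>R v) = trunc N x + t *\<^sub>R trunc N v"
 by (rule ell2_eqI) (simp add: coord_simps)

lemma dd_trunc:
 assumes f: "tame f"
 shows "has_dd v (\<lambda>x. f (trunc N x)) x"
  "dd v (\<lambda>x. f (trunc N x)) = (\<lambda>x. (\<Sum>i<N. coord v i * pd i f (trunc N x)))"
proof -
 have "DERIV (\<lambda>t. f (trunc N (x + t *\<^sub>R v))) 0 :> (\<Sum>i<N. coord v i * pd i f (trunc N x))" for x
 proof -
  have "has_dd (trunc N v) f (trunc N x)" "dd (trunc N v) f (trunc N x) = (\<Sum>i<N. coord v i * pd i f (trunc N x))"
   using tame_dd_finite[OF f, where n = N and c = "coord v"] unfolding trunc_def[of N v] by auto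
  then show ?thesis unfolding trunc_add_scale by (simp only: has_dd_DERIV)
 qed
 from dd_eqI[OF this] show "has_dd v (\<lambda>x. f (trunc N x)) x"
  "dd v (\<lambda>x. f (trunc N x)) = (\<lambda>x. (\<Sum>i<N. coord v i * pd i f (trunc N x)))" by auto
qed

text \<open>A directional derivative of the composition involves only the partial derivatives below
  \<open>N\<close>, with coefficients at most \<open>norm v\<close>. The constants grow with
  \<open>N\<close>; bounds uniform in \<open>N\<close> come from \<open>Sq_trunc\<close>
  instead.\<close>

lemma bsmooth_trunc:
 assumes "tame f"
 shows "bsmooth (\<lambda>x. f (trunc N x))"
proof -
 let ?T = "\<lambda>f x. f (trunc N x)"
 have reg: "regular (\<lambda>_. True) UNIV (?T f)" if "tame f" for f
 proof (rule regular_coinduct[where C = "{?T f | f. tame f}"])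
  fix g v x assume "g \<in> {?T f | f. tame f}"
  then obtain f where f: "g = ?T f" "tame f" by blast
  show "has_dd v g x" unfolding f(1) by (rule dd_trunc[OF f(2)])
  have "tame (\<lambda>y. \<Sum>i<N. coord v i * pd i f y)" by (intro tame_sum tame_cmult tame_pd f)
  then show "dd v g \<in> {?T f | f. tame f}"
   unfolding f(1) dd_trunc[OF f(2)] by (intro CollectI exI[of _ "\<lambda>y. \<Sum>i<N. coord v i * pd i f y"]) auto
 qed (use that in auto)
 have "\<exists>C\<ge>0. \<forall>x vs. norm x < R \<longrightarrow> length vs \<le> k \<longrightarrow> \<bar>dds vs (?T f) x\<bar> \<le> C * pn vs"
  if "tame f" for f k R
  using that
 proof (induction k arbitrary: f)
  case 0
  obtain C where C: "C \<ge> 0" "\<And>x. norm x < R ==> \<bar>f x\<bar> \<le> C"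
   using lipb_boundedE[OF tame_lipb[OF 0]] by blast
  then show ?case
   by (intro exI[of _ C]) (auto intro!: C(2) le_less_trans[OF norm_trunc_le])
 next
  case (Suc k)
  obtain B where B: "B \<ge> 0" "\<And>x vs. norm x < R ==> length vs \<le> k ==> \<bar>dds vs (?T f) x\<bar> \<le> B * pn vs"
   using Suc.IH[OF Suc.prems] by blast
  obtain C where C: "\<And>i. C i \<ge> 0" "\<And>i x vs. norm x < R ==> length vs \<le> k ==> \<bar>dds vs (?T (pd i f)) x\<bar> \<le> C i * pn vs"
   using Suc.IH[OF tame_pd[OF Suc.prems]] by metis
  have S: "(\<Sum>i<N. C i) \<ge> 0" using C(1) by (intro sum_nonneg) auto
  have "\<bar>dds vs (?T f) x\<bar> \<le> (B + (\<Sum>i<N. C i)) * pn vs" if x: "norm x < R" and vs: "length vs \<le> Suc k" for x vs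
  proof (cases vs rule: rev_exhaust)
   case Nil
   then show ?thesis using B(2)[OF x, of "[]"] S by simp
  next
   case (snoc us v)
   have r: "regular (\<lambda>_. True) UNIV (\<lambda>x. coord v i * pd i f (trunc N x))" for i
    by (rule reg) (intro tame_cmult tame_pd Suc.prems)
   have r': "regular (\<lambda>_. True) UNIV (\<lambda>x. pd i f (trunc N x))" for i
    by (rule reg) (intro tame_pd Suc.prems)
   have "dds vs (?T f) x = (\<Sum>i<N. coord v i * dds us (?T (pd i f)) x)"
    by (simp add: snoc dds_append dd_trunc[OF Suc.prems] dds_sum(1)[OF r] dds_cmult[OF r'])
   also have "\<bar>\<dots>\<bar> \<le> (\<Sum>i<N. norm v * (C i * prod_list (map norm us)))"
    using vs snoc abs_coord_le_norm C x
    by (intro order_trans[OF sum_abs] sum_mono) (auto simp: abs_mult intro!: mult_mono)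
   also have "\<dots> = (\<Sum>i<N. C i) * pn vs"
    by (simp add: snoc sum_distrib_right sum_distrib_left ac_simps)
   also have "\<dots> \<le> (B + (\<Sum>i<N. C i)) * pn vs" using B by (intro mult_right_mono) auto
   finally show ?thesis .
  qed
  then show ?case using B S by (intro exI[of _ "B + (\<Sum>i<N. C i)"]) auto
 qed
 then show ?thesis unfolding bsmooth_def using reg assms by blast
qed

lemma pds_trunc:
 assumes "tame f"
 shows "pds is (\<lambda>x. f (trunc N x)) = (\<lambda>x. if set is \<subseteq> {..<N} then pds is f (trunc N x) else 0)"
proof (induction "is")
 case (Cons i "is")
 show ?case
 proof (cases "set is \<subseteq> {..<N}")
  case True
  then have "pds (i # is) (\<lambda>x. f (trunc N x)) = dd (unit_vec i) (\<lambda>x. pds is f (trunc N x))"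
   using Cons by (simp add: pd_eq_dd)
  also have "\<dots> = (\<lambda>x. if i < N then pd i (pds is f) (trunc N x) else 0)"
   unfolding dd_trunc[OF tame_pds[OF assms]]
   by (auto simp: fun_eq_iff if_distrib[of "\<lambda>c. c * _"] sum.delta cong: if_cong)
  finally show ?thesis using True by auto
 qed (use Cons in \<open>auto simp: pd_eq_dd\<close>)
qed simp

section \<open>Weighted sums of squares of derivatives\<close>

text \<open>\<open>Sq w k f x\<close> is the sum of \<open>w i\<^sub>1 * \<dots> * w i\<^sub>k * \<bar>D f(x)\<bar>^2\<close> over the derivatives \<open>D\<close> in
 the directions \<open>i\<^sub>1, \<dots>, i\<^sub>k\<close>.\<close>

primrec Sq :: "(nat \<Rightarrow> real) \<Rightarrow> nat \<Rightarrow> (ell2 \<Rightarrow> real) \<Rightarrow> ell2 \<Rightarrow> ennreal" where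
 "Sq w 0 f x = ennreal ((f x)^2)"
| "Sq w (Suc k) f x = (suminf (\<lambda>i. ennreal (w i) * Sq w k (pd i f) x))"

lemma tame_pd_add: "tame f ==> tame g ==> pd i (\<lambda>x. f x + g x) = (\<lambda>x. pd i f x + pd i g x)"
 using tame_has_pd[of f i] tame_has_pd[of g i] by (auto simp: pd_eq_dd has_pd_eq dd_add fun_eq_iff)

lemma tame_pd_mult:
 "tame f ==> tame g ==> pd i (\<lambda>x. f x * g x) = (\<lambda>x. pd i f x * g x + f x * pd i g x)"
 using tame_has_pd[of f i] tame_has_pd[of g i] by (auto simp: pd_eq_dd has_pd_eq dd_mult fun_eq_iff)

lemma tame_pd_cmult: "tame f ==> pd i (\<lambda>x. c * f x) = (\<lambda>x. c * pd i f x)"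
 using tame_has_pd[of f i] by (auto simp: pd_eq_dd has_pd_eq dd_cmult fun_eq_iff)

lemma Sq_cong_local:
 assumes "open U" "x \<in> U" "\<And>y. y \<in> U ==> f y = g y"
 shows "Sq w k f x = Sq w k g x"
 using assms(3)
proof (induction k arbitrary: f g)
 case (Suc k)
 have "Sq w k (pd i f) x = Sq w k (pd i g) x" for i
  by (rule Suc.IH) (use dd_cong_local(1)[OF assms(1) _ Suc.prems] in \<open>auto simp: pd_eq_dd\<close>)
 then show ?case by simp
qed (use assms in auto)

lemma Sq_zero [simp]: "Sq w k (\<lambda>x. 0) x = 0"
 by (induction k) (simp_all add: pd_eq_dd)

lemma Sq_cmult: "tame f ==> Sq w k (\<lambda>x. c * f x) x = ennreal (c^2) * Sq w k f x"
proof (induction k arbitrary: f)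
 case 0
 show ?case by (simp add: power_mult_distrib ennreal_mult)
next
 case (Suc k)
 have "Sq w (Suc k) (\<lambda>x. c * f x) x = (suminf (\<lambda>i. ennreal (c^2) * (ennreal (w i) * Sq w k (pd i f) x)))"
  using Suc by (simp add: tame_pd_cmult tame_pd ac_simps)
 then show ?case by simp
qed

lemma Sq_scale: "c \<ge> 0 ==> Sq (\<lambda>i. c * w i) k f x = ennreal (c ^ k) * Sq w k f x" if "\<And>i. w i \<ge> 0"
proof (induction k arbitrary: f)
 case (Suc k)
 have "Sq (\<lambda>i. c * w i) (Suc k) f x = (suminf (\<lambda>i. ennreal (c ^ Suc k) * (ennreal (w i) * Sq w k (pd i f) x)))"
  using Suc that by (simp add: ennreal_mult ac_simps)
 then show ?case by (simp only: ennreal_suminf_cmult Sq.simps)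
qed simp

lemma Sq_add:
 "tame f ==> tame g ==> Sq w k (\<lambda>x. f x + g x) x \<le> 2 * (Sq w k f x + Sq w k g x)"
proof (induction k arbitrary: f g)
 case 0
 have "(f x + g x)^2 \<le> 2 * ((f x)^2 + (g x)^2)"
  using sum_squares_bound[of "f x" "g x"] by (simp add: power2_sum)
 then have "ennreal ((f x + g x)^2) \<le> ennreal (2 * ((f x)^2 + (g x)^2))" by (rule ennreal_leI)
 then show ?case by (simp add: ennreal_mult)
next
 case (Suc k)
 have "Sq w (Suc k) (\<lambda>x. f x + g x) x \<le>
   (suminf (\<lambda>i. ennreal (w i) * (2 * (Sq w k (pd i f) x + Sq w k (pd i g) x))))"
  using Suc by (auto simp: tame_pd_add intro!: suminf_le mult_left_mono tame_pd)
 also have "\<dots> = (suminf (\<lambda>i. 2 * (ennreal (w i) * Sq w k (pd i f) x + ennreal (w i) * Sq w k (pd i g) x)))"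
  by (simp add: algebra_simps)
 also have "\<dots> = 2 * (Sq w (Suc k) f x + Sq w (Suc k) g x)"
  by (simp add: suminf_add[symmetric])
 finally show ?case .
qed

lemma Sq_diff:
 assumes "tame f" "tame g"
 shows "Sq w k (\<lambda>x. f x - g x) x \<le> 2 * (Sq w k f x + Sq w k g x)"
 using Sq_add[OF assms(1) tame_cmult[OF assms(2), of "- 1"], of w k x]
 by (simp add: Sq_cmult[OF assms(2), of w k "- 1", simplified])

text \<open>The factor 4 per order: one 2 from \<open>Sq_add\<close>, another from enlarging each of
  the two shifted sums to the full sum of order \<open>k + 1\<close>.\<close>

lemma Sq_mult:
 "tame f ==> tame g ==>
  Sq w k (\<lambda>x. f x * g x) x \<le> 4 ^ k * (\<Sum>j\<le>k. Sq w j f x * Sq w (k - j) g x)"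
proof (induction k arbitrary: f g)
 case 0
 show ?case by (simp add: power_mult_distrib ennreal_mult)
next
 case (Suc k)
 let ?S = "\<lambda>j f. Sq w j f x"
 have t: "tame (pd i f)" "tame (pd i g)" for i using Suc.prems by (auto intro: tame_pd)
 have "?S (Suc k) (\<lambda>x. f x * g x) \<le>
  (suminf (\<lambda>i. ennreal (w i) * (2 * (?S k (\<lambda>x. pd i f x * g x) + ?S k (\<lambda>x. f x * pd i g x)))))"
 proof -
  have "?S k (pd i (\<lambda>x. f x * g x)) \<le> 2 * (?S k (\<lambda>x. pd i f x * g x) + ?S k (\<lambda>x. f x * pd i g x))" for i
   unfolding tame_pd_mult[OF Suc.prems] by (intro Sq_add tame_mult t Suc.prems)
  then show ?thesis unfolding Sq.simps by (intro suminf_le mult_left_mono) auto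
 qed
 also have "\<dots> \<le> (suminf (\<lambda>i. ennreal (w i) * (2 *
  (4 ^ k * (\<Sum>j\<le>k. ?S j (pd i f) * ?S (k - j) g) + 4 ^ k * (\<Sum>j\<le>k. ?S j f * ?S (k - j) (pd i g))))))"
  using Suc.prems t by (intro suminf_le mult_left_mono add_mono Suc.IH) auto
 also have "\<dots> = (suminf (\<lambda>i. 2 * 4 ^ k * ((\<Sum>j\<le>k. ennreal (w i) * ?S j (pd i f) * ?S (k - j) g) +
  (\<Sum>j\<le>k. ?S j f * (ennreal (w i) * ?S (k - j) (pd i g))))))"
  by (intro suminf_cong) (simp add: algebra_simps sum_distrib_left sum_distrib_right)
 also have "\<dots> = 2 * 4 ^ k * ((\<Sum>j\<le>k. ?S (Suc j) f * ?S (k - j) g) + (\<Sum>j\<le>k. ?S j f * ?S (Suc (k - j)) g))"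
  by (simp add: suminf_add[symmetric] suminf_sum)
 also have "(\<Sum>j\<le>k. ?S (Suc j) f * ?S (k - j) g) \<le> (\<Sum>j\<le>Suc k. ?S j f * ?S (Suc k - j) g)"
  by (subst sum.atMost_Suc_shift) (simp del: Sq.simps)
 also have "(\<Sum>j\<le>k. ?S j f * ?S (Suc (k - j)) g) \<le> (\<Sum>j\<le>Suc k. ?S j f * ?S (Suc k - j) g)"
  by (simp add: Suc_diff_le del: Sq.simps)
 also have "2 * 4 ^ k * ((\<Sum>j\<le>Suc k. ?S j f * ?S (Suc k - j) g) + (\<Sum>j\<le>Suc k. ?S j f * ?S (Suc k - j) g))
   = 4 ^ Suc k * (\<Sum>j\<le>Suc k. ?S j f * ?S (Suc k - j) g)"
 proof -
  have "2 * 4 ^ k * (X + X) = 4 ^ Suc k * X" for X :: ennreal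
  proof -
   have "2 * 4 ^ k * (X + X) = (2 * 2) * 4 ^ k * X" unfolding mult_2[symmetric] by (simp only: ac_simps)
   then show ?thesis by simp
  qed
  then show ?thesis .
 qed
 finally show ?case by (auto simp: mult_left_mono add_mono)
qed

lemma Sq_mult_bound:
 assumes "A \<ge> 0" "B \<ge> 0"
 shows "\<exists>C\<ge>0. \<forall>f g x k. tame f \<longrightarrow> tame g \<longrightarrow> k \<le> m \<longrightarrow> (\<forall>j\<le>k. Sq w j f x \<le> ennreal A) \<longrightarrow>
  (\<forall>j\<le>k. Sq w j g x \<le> ennreal B) \<longrightarrow> Sq w k (\<lambda>x. f x * g x) x \<le> ennreal C"
proof (intro exI conjI allI impI)
 define C where "C = 4 ^ m * (real (Suc m) * (A * B))"
 show "4 ^ m * (real (Suc m) * (A * B)) \<ge> 0" using assms by simp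
 fix f g x k
 assume t: "tame f" "tame g" and k: "k \<le> m" and A: "\<forall>j\<le>k. Sq w j f x \<le> ennreal A"
  and B: "\<forall>j\<le>k. Sq w j g x \<le> ennreal B"
 have "Sq w k (\<lambda>x. f x * g x) x \<le> 4 ^ k * (\<Sum>j\<le>k. Sq w j f x * Sq w (k - j) g x)"
  by (rule Sq_mult[OF t])
 also have "\<dots> \<le> 4 ^ k * (\<Sum>j\<le>k. ennreal A * ennreal B)"
  using A B by (intro mult_left_mono sum_mono mult_mono) auto
 also have "\<dots> = ennreal (4 ^ k * (real (Suc k) * (A * B)))"
 proof -
  have "(4::ennreal) ^ k = ennreal (4 ^ k)" by (simp add: ennreal_power[symmetric])
  moreover have "(\<Sum>j\<le>k. ennreal A * ennreal B) = ennreal (real (Suc k) * (A * B))"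
   using assms by (simp add: ennreal_mult[symmetric] ennreal_of_nat_eq_real_of_nat del: of_nat_Suc)
  ultimately show ?thesis using assms by (simp add: ennreal_mult)
 qed
 also have "\<dots> \<le> ennreal C"
  unfolding C_def using k assms by (intro ennreal_leI mult_mono power_increasing mult_right_mono) auto
 finally show "Sq w k (\<lambda>x. f x * g x) x \<le> ennreal (4 ^ m * (real (Suc m) * (A * B)))"
  unfolding C_def .
qed

text \<open>Everything is pointwise at \<open>x\<close>, so a bound on \<open>f\<close> is wanted
  only where it is available. Order 0 is excluded from the hypothesis since the \<open>th n\<close>
  are bounded; the constant depends on \<open>B\<close>, \<open>m\<close>, \<open>n\<close> and
  \<open>th\<close>, but not on \<open>f\<close> or \<open>x\<close>.\<close>

lemma Sq_compose_bound:
 assumes th: "\<And>n t. DERIV (th n) t :> th (Suc n) t" and b: "\<And>n. bounded (range (th n))"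
  and B: "B \<ge> 0"
 shows "\<exists>C\<ge>0. \<forall>f x k. tame f \<longrightarrow> k \<le> m \<longrightarrow> (\<forall>j\<in>{1..k}. Sq w j f x \<le> ennreal B) \<longrightarrow>
  Sq w k (\<lambda>x. th n (f x)) x \<le> ennreal C"
proof (induction m arbitrary: n)
 case 0
 obtain T where T: "T > 0" "\<And>t. \<bar>th n t\<bar> \<le> T" using b[of n] unfolding bounded_pos by auto
 have "(th n t)^2 \<le> T^2" for t using power_mono[OF T(2)[of t], of 2] by simp
 then show ?case by (intro exI[of _ "T^2"]) (auto intro: ennreal_leI)
next
 case (Suc m)
 obtain C0 where C0: "C0 \<ge> 0" "\<And>f x k. tame f ==> k \<le> m ==> (\<forall>j\<in>{1..k}. Sq w j f x \<le> ennreal B) ==>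
  Sq w k (\<lambda>x. th n (f x)) x \<le> ennreal C0" using Suc.IH[of n] by blast
 obtain C1 where C1: "C1 \<ge> 0" "\<And>f x k. tame f ==> k \<le> m ==> (\<forall>j\<in>{1..k}. Sq w j f x \<le> ennreal B) ==>
  Sq w k (\<lambda>x. th (Suc n) (f x)) x \<le> ennreal C1" using Suc.IH[of "Suc n"] by blast
 define C where "C = 4 ^ m * (real (Suc m) * (C1 * B))"
 have "Sq w (Suc m) (\<lambda>x. th n (f x)) x \<le> ennreal C"
  if f: "tame f" and Bf: "\<forall>j\<in>{1..Suc m}. Sq w j f x \<le> ennreal B" for f x
 proof -
  have tt: "tame (\<lambda>x. th (Suc n) (f x))" by (rule tame_compose[where th = th and f = f, OF th f])
  have pdth: "pd i (\<lambda>x. th n (f x)) = (\<lambda>x. th (Suc n) (f x) * pd i f x)" for i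
  proof
   fix y
   have "has_dd (unit_vec i) f y" using tame_has_pd[OF f] by (simp add: has_pd_eq)
   from dd_chain(2)[OF this th[of n "f y"]]
   show "pd i (\<lambda>x. th n (f x)) y = th (Suc n) (f y) * pd i f y" by (simp add: pd_eq_dd)
  qed
  have "Sq w (Suc m) (\<lambda>x. th n (f x)) x =
    (suminf (\<lambda>i. ennreal (w i) * Sq w m (\<lambda>x. th (Suc n) (f x) * pd i f x) x))"
   by (simp add: pdth)
  also have "\<dots> \<le> (suminf (\<lambda>i. ennreal (w i) * (4 ^ m * (\<Sum>j\<le>m. Sq w j (\<lambda>x. th (Suc n) (f x)) x * Sq w (m - j) (pd i f) x))))"
   by (intro suminf_le mult_left_mono Sq_mult tt tame_pd f) auto
  also have "\<dots> = (suminf (\<lambda>i. 4 ^ m * (\<Sum>j\<le>m. Sq w j (\<lambda>x. th (Suc n) (f x)) x * (ennreal (w i) * Sq w (m - j) (pd i f) x))))"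
   by (intro suminf_cong) (simp add: sum_distrib_left ac_simps)
  also have "\<dots> = 4 ^ m * (\<Sum>j\<le>m. Sq w j (\<lambda>x. th (Suc n) (f x)) x * Sq w (Suc (m - j)) f x)"
   by (simp add: suminf_sum)
  also have "\<dots> \<le> 4 ^ m * (\<Sum>j\<le>m. ennreal C1 * ennreal B)"
   using Bf f by (intro mult_left_mono sum_mono mult_mono C1(2)) (auto simp del: Sq.simps)
  also have "\<dots> = ennreal C"
  proof -
   have "(4::ennreal) ^ m = ennreal (4 ^ m)" by (simp add: ennreal_power[symmetric])
   moreover have "(\<Sum>j\<le>m. ennreal C1 * ennreal B) = ennreal (real (Suc m) * (C1 * B))"
    using C1 B by (simp add: ennreal_mult[symmetric] ennreal_of_nat_eq_real_of_nat del: of_nat_Suc)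
   ultimately show ?thesis using C1 B unfolding C_def by (simp add: ennreal_mult)
  qed
  finally show ?thesis .
 qed
 note last = this
 have "C \<ge> 0" using C1 B by (simp add: C_def)
 have "Sq w k (\<lambda>x. th n (f x)) x \<le> ennreal (C + C0)"
  if f: "tame f" and k: "k \<le> Suc m" and Bf: "\<forall>j\<in>{1..k}. Sq w j f x \<le> ennreal B" for f x k
 proof (cases "k = Suc m")
  case True
  then have "Sq w k (\<lambda>x. th n (f x)) x \<le> ennreal C" using last[OF f] Bf by (simp del: Sq.simps)
  also have "\<dots> \<le> ennreal (C + C0)" using C0 by (intro ennreal_leI) auto
  finally show ?thesis .
 next
  case False
  then have "Sq w k (\<lambda>x. th n (f x)) x \<le> ennreal C0" using C0(2)[OF f _ Bf] k by (simp del: Sq.simps)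
  also have "\<dots> \<le> ennreal (C + C0)" using \<open>C \<ge> 0\<close> by (intro ennreal_leI) auto
  finally show ?thesis .
 qed
 then show ?case using C0 \<open>C \<ge> 0\<close> by (intro exI[of _ "C + C0"]) auto
qed

text \<open>Composition with the projection deletes the derivatives in directions from
  \<open>N\<close> on and evaluates the others at \<open>trunc N x\<close>, so terms are only
  lost.\<close>

lemma Sq_trunc:
 assumes "tame f"
 shows "Sq w k (\<lambda>x. f (trunc N x)) x \<le> Sq w k f (trunc N x)"
 using assms
proof (induction k arbitrary: f)
 case (Suc k)
 have "Sq w k (pd i (\<lambda>x. f (trunc N x))) x \<le> Sq w k (pd i f) (trunc N x)" for i
 proof -
  have "pd i (\<lambda>x. f (trunc N x)) = (if i < N then (\<lambda>x. pd i f (trunc N x)) else (\<lambda>x. 0))"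
   using pds_trunc[OF Suc.prems, of "[i]" N] by (auto simp: fun_eq_iff)
  then show ?thesis using Suc.IH[OF tame_pd[OF Suc.prems], of i] by simp
 qed
 then show ?case by (auto intro!: suminf_le mult_left_mono)
qed simp

section \<open>Gaussian smoothing\<close>

lemma suminf_swap_ennreal:
 fixes f :: "nat \<Rightarrow> nat \<Rightarrow> ennreal"
 shows "(suminf (\<lambda>i. suminf (\<lambda>j. f i j))) = (suminf (\<lambda>j. suminf (\<lambda>i. f i j)))"
proof -
 have "(suminf (\<lambda>i. suminf (\<lambda>j. f i j))) = (\<integral>\<^sup>+i. suminf (\<lambda>j. f i j) \<partial>count_space UNIV)"
  by (rule nn_integral_count_space_nat[symmetric])
 also have "\<dots> = suminf (\<lambda>j. \<integral>\<^sup>+i. f i j \<partial>count_space UNIV)"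
  by (rule nn_integral_suminf) simp
 finally show ?thesis by (simp only: nn_integral_count_space_nat)
qed

text \<open>Dominated convergence for difference quotients, which the mean value theorem bounds by
  \<open>B\<close>; being their limit, \<open>F' 0\<close> is measurable.\<close>

lemma DERIV_integral:
 fixes F F' :: "real \<Rightarrow> 'a \<Rightarrow> real"
 assumes r: "r > 0" and int: "\<And>s. \<bar>s\<bar> < r ==> integrable M (F s)"
  and der: "\<And>s x. \<bar>s\<bar> < r ==> DERIV (\<lambda>s. F s x) s :> F' s x"
  and bd: "\<And>s x. \<bar>s\<bar> < r ==> \<bar>F' s x\<bar> \<le> B x" and B: "integrable M B"
 shows "DERIV (\<lambda>s. \<integral>x. F s x \<partial>M) 0 :> (\<integral>x. F' 0 x \<partial>M)"
  "F' 0 \<in> borel_measurable M"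
proof -
 have main: "(\<lambda>i. (\<integral>x. (F (X i) x - F 0 x) / X i \<partial>M)) \<longlonglongrightarrow> (\<integral>x. F' 0 x \<partial>M) \<and> F' 0 \<in> borel_measurable M"
  if X: "\<And>i. X i \<noteq> 0" "\<And>i. \<bar>X i\<bar> < r" "X \<longlonglongrightarrow> 0" for X :: "nat \<Rightarrow> real"
 proof -
  have meas: "(\<lambda>x. (F (X i) x - F 0 x) / X i) \<in> borel_measurable M" for i
   using int[OF X(2)[of i]] int[of 0] r by (intro borel_measurable_divide borel_measurable_diff) auto
  have lim: "(\<lambda>i. (F (X i) x - F 0 x) / X i) \<longlonglongrightarrow> F' 0 x" for x
  proof -
   have "((\<lambda>s. (F s x - F 0 x) / (s - 0)) \<longlongrightarrow> F' 0 x) (at 0)"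
    using der[of 0 x] r by (simp add: has_field_derivative_iff)
   then show ?thesis
    using X by (auto simp: tendsto_at_iff_sequentially o_def)
  qed
  have m': "F' 0 \<in> borel_measurable M" by (rule borel_measurable_LIMSEQ_real[OF lim meas])
  have bnd: "\<bar>(F (X i) x - F 0 x) / X i\<bar> \<le> B x" for i x
  proof -
   have "norm (F (X i) x - F 0 x) \<le> B x * norm (X i - 0)"
    by (rule field_differentiable_bound[of "{-r<..<r}" "\<lambda>s. F s x" "\<lambda>s. F' s x"])
     (use der bd X(2)[of i] r in \<open>auto intro: has_field_derivative_at_within simp: abs_less_iff\<close>)
   then show ?thesis using X(1)[of i] by (simp add: abs_divide pos_divide_le_eq)
  qed
  have "(\<lambda>i. (\<integral>x. (F (X i) x - F 0 x) / X i \<partial>M)) \<longlonglongrightarrow> (\<integral>x. F' 0 x \<partial>M)"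
   by (rule integral_dominated_convergence[where w = B]) (use m' meas B lim bnd in auto)
  then show ?thesis using m' by blast
 qed
 let ?X = "\<lambda>i. r / 2 * inverse (real (Suc i))"
 have "?X \<longlonglongrightarrow> r / 2 * 0" by (intro tendsto_mult tendsto_const LIMSEQ_inverse_real_of_nat)
 moreover have "\<bar>?X i\<bar> < r" for i
 proof -
  have "inverse (real (Suc i)) \<le> 1" by (simp add: field_simps)
  then have "r / 2 * inverse (real (Suc i)) \<le> r / 2 * 1" using r by (intro mult_left_mono) auto
  then show ?thesis using r by simp
 qed
 ultimately show "F' 0 \<in> borel_measurable M"
  using main[of ?X] r by simp
 show "DERIV (\<lambda>s. \<integral>x. F s x \<partial>M) 0 :> (\<integral>x. F' 0 x \<partial>M)"
 proof -
  have "((\<lambda>s. ((\<integral>x. F s x \<partial>M) - (\<integral>x. F 0 x \<partial>M)) / (s - 0)) \<longlongrightarrow> (\<integral>x. F' 0 x \<partial>M)) (at 0 within {-r<..<r})"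
   unfolding tendsto_at_iff_sequentially o_def
  proof (intro allI impI)
   fix X :: "nat \<Rightarrow> real" assume X: "\<forall>i. X i \<in> {-r<..<r} - {0}" "X \<longlonglongrightarrow> 0"
   then have X': "X i \<noteq> 0" "\<bar>X i\<bar> < r" for i by (auto simp: abs_less_iff) (metis minus_less_iff)
   have "((\<integral>x. F (X i) x \<partial>M) - (\<integral>x. F 0 x \<partial>M)) / (X i - 0) = (\<integral>x. (F (X i) x - F 0 x) / X i \<partial>M)" for i
    using int[OF X'(2)[of i]] int[of 0] r by (simp add: bint_diff)
   then show "(\<lambda>i. ((\<integral>x. F (X i) x \<partial>M) - (\<integral>x. F 0 x \<partial>M)) / (X i - 0)) \<longlonglongrightarrow> (\<integral>x. F' 0 x \<partial>M)"
    using main[OF X' X(2)] by (simp only:)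
  qed
  then show ?thesis using r by (simp add: has_field_derivative_iff at_within_open[of 0 "{-r<..<r}"])
 qed
qed

text \<open>Polynomials in finitely many coordinates: the kernels that arise when derivatives of a
  Gaussian convolution are moved onto the Gaussian.\<close>

inductive gpoly :: "(ell2 \<Rightarrow> real) \<Rightarrow> bool" where
 gpoly_const: "gpoly (\<lambda>x. c)"
| gpoly_add: "gpoly f ==> gpoly g ==> gpoly (\<lambda>x. f x + g x)"
| gpoly_coord_mult: "gpoly f ==> gpoly (\<lambda>x. coord x i * f x)"

lemma gpoly_cmult: "gpoly f ==> gpoly (\<lambda>x. c * f x)"
proof (induction rule: gpoly.induct)
 case (gpoly_add f g)
 then show ?case using gpoly.gpoly_add[of "\<lambda>x. c * f x" "\<lambda>x. c * g x"] by (simp add: algebra_simps)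
next
 case (gpoly_coord_mult f i)
 then show ?case using gpoly.gpoly_coord_mult[of "\<lambda>x. c * f x" i] by (simp add: ac_simps)
qed (rule gpoly.gpoly_const)

lemma gpoly_coord: "gpoly (\<lambda>x. coord x i)"
 using gpoly_coord_mult[OF gpoly_const[of 1], of i] by simp

lemma gpoly_sum: "(\<And>i. i \<in> A ==> gpoly (f i)) ==> gpoly (\<lambda>x. \<Sum>i\<in>A. f i x)"
 by (induction A rule: infinite_finite_induct) (auto intro: gpoly_add gpoly_const)

lemma tame_coord: "tame (\<lambda>x. coord x i)"
 by (rule bsmooth_tame[OF bsmooth_coord])

lemma gpoly_tame: "gpoly f ==> tame f"
 by (induction rule: gpoly.induct) (auto intro: tame_const tame_add tame_mult tame_coord)

lemma pd_coord: "pd j (\<lambda>x. coord x i) = (\<lambda>x. if i = j then 1 else 0)"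
 using dd_inner_left(1)[of "unit_vec j" "unit_vec i" 0]
 by (simp add: pd_eq_dd inner_commute[of "unit_vec i"] fun_eq_iff)

lemma gpoly_pd: "gpoly f ==> gpoly (pd j f)"
proof (induction rule: gpoly.induct)
 case (gpoly_const c)
 show ?case by (simp add: pd_eq_dd gpoly.gpoly_const)
next
 case (gpoly_add f g)
 then show ?case by (simp add: tame_pd_add gpoly_tame gpoly.gpoly_add)
next
 case (gpoly_coord_mult f i)
 have "gpoly (\<lambda>x. (if i = j then 1 else 0) * f x + coord x i * pd j f x)"
  by (intro gpoly.gpoly_add gpoly_cmult gpoly.gpoly_coord_mult gpoly_coord_mult)
 then show ?case by (simp add: tame_pd_mult tame_coord gpoly_tame gpoly_coord_mult pd_coord)
qed

text \<open>An exponential majorant is chosen because it is integrable by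
  \<open>integrable_exp_sum_coord\<close> and changes only by constant factors under bounded
  shifts.\<close>

lemma gpoly_bound:
 "gpoly f ==> \<exists>C\<ge>0. \<exists>c\<ge>0. \<exists>n. \<forall>x. \<bar>f x\<bar> \<le> C * exp (c * (\<Sum>i<n. \<bar>coord x i\<bar>))"
proof (induction rule: gpoly.induct)
 case (gpoly_const c)
 show ?case by (intro exI[of _ "\<bar>c\<bar>"] exI[of _ 0] conjI) auto
next
 case (gpoly_add f g)
 obtain C c n where 1: "C \<ge> 0" "c \<ge> 0" "\<And>x. \<bar>f x\<bar> \<le> C * exp (c * (\<Sum>i<n. \<bar>coord x i\<bar>))"
  using gpoly_add.IH(1) by blast
 obtain D d k where 2: "D \<ge> 0" "d \<ge> 0" "\<And>x. \<bar>g x\<bar> \<le> D * exp (d * (\<Sum>i<k. \<bar>coord x i\<bar>))"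
  using gpoly_add.IH(2) by blast
 have "\<bar>f x + g x\<bar> \<le> (C + D) * exp ((c + d) * (\<Sum>i<n + k. \<bar>coord x i\<bar>))" for x
 proof -
  have m: "(\<Sum>i<n. \<bar>coord x i\<bar>) \<le> (\<Sum>i<n+k. \<bar>coord x i\<bar>)" "(\<Sum>i<k. \<bar>coord x i\<bar>) \<le> (\<Sum>i<n+k. \<bar>coord x i\<bar>)"
   by (intro sum_mono2; auto)+
  have e: "c * (\<Sum>i<n. \<bar>coord x i\<bar>) \<le> (c + d) * (\<Sum>i<n+k. \<bar>coord x i\<bar>)"
   "d * (\<Sum>i<k. \<bar>coord x i\<bar>) \<le> (c + d) * (\<Sum>i<n+k. \<bar>coord x i\<bar>)"
   using 1 2 m by (intro mult_mono; auto simp: sum_nonneg)+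
  have "\<bar>f x\<bar> + \<bar>g x\<bar> \<le> C * exp ((c + d) * (\<Sum>i<n + k. \<bar>coord x i\<bar>)) + D * exp ((c + d) * (\<Sum>i<n + k. \<bar>coord x i\<bar>))"
   using e 1 2 by (intro add_mono order_trans[OF 1(3)] order_trans[OF 2(3)] mult_left_mono) auto
  then show ?thesis by (simp add: algebra_simps)
 qed
 then show ?case using 1 2 by (intro exI[of _ "C + D"] exI[of _ "c + d"] exI[of _ "n + k"] conjI) auto
next
 case (gpoly_coord_mult f j)
 obtain C c n where 1: "C \<ge> 0" "c \<ge> 0" "\<And>x. \<bar>f x\<bar> \<le> C * exp (c * (\<Sum>i<n. \<bar>coord x i\<bar>))"
  using gpoly_coord_mult.IH by blast
 have "\<bar>coord x j * f x\<bar> \<le> C * exp ((c + 1) * (\<Sum>i<n + Suc j. \<bar>coord x i\<bar>))" for x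
 proof -
  let ?S = "\<Sum>i<n + Suc j. \<bar>coord x i\<bar>"
  have m: "(\<Sum>i<n. \<bar>coord x i\<bar>) \<le> ?S" by (intro sum_mono2) auto
  have "\<bar>coord x j\<bar> \<le> ?S" by (rule member_le_sum) auto
  also have "\<dots> \<le> exp ?S" using exp_ge_add_one_self[of ?S] by linarith
  finally have "\<bar>coord x j * f x\<bar> \<le> exp ?S * (C * exp (c * ?S))"
   unfolding abs_mult using 1 m
   by (intro mult_mono order_trans[OF 1(3)] mult_left_mono) (auto intro: mult_left_mono)
  then show ?thesis by (simp add: algebra_simps exp_add)
 qed
 then show ?case using 1 by (intro exI[of _ C] exI[of _ "c + 1"] exI[of _ "n + Suc j"] conjI) auto
qed

text \<open>Global bounds, in contrast to \<open>lipb\<close>: the translates in a convolution leave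
  every ball.\<close>

definition bl :: "(ell2 \<Rightarrow> real) \<Rightarrow> bool" where
 "bl u \<longleftrightarrow> (\<exists>K. \<forall>x. \<bar>u x\<bar> \<le> K) \<and> (\<exists>L. \<forall>x y. \<bar>u x - u y\<bar> \<le> L * norm (x - y))"

lemma bl_lipb: "bl u ==> lipb u"
 unfolding bl_def lipb_def
proof (intro allI, elim conjE exE)
 fix L assume "\<forall>x y. \<bar>u x - u y\<bar> \<le> L * norm (x - y)"
 then have L: "\<bar>u x - u y\<bar> \<le> L * norm (x - y)" for x y by blast
 have "\<bar>u x - u y\<bar> \<le> \<bar>L\<bar> * norm (x - y)" for x y
  by (rule order_trans[OF L]) (intro mult_right_mono, auto)
 then show "\<exists>L\<ge>0. \<forall>x y. norm x < R \<longrightarrow> norm y < R \<longrightarrow> \<bar>u x - u y\<bar> \<le> L * norm (x - y)" for R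
  by (intro exI[of _ "\<bar>L\<bar>"]) auto
qed

lemma bl_measurable: "bl u ==> u \<in> borel_measurable borel"
 by (intro borel_measurable_continuous_onI lipb_continuous bl_lipb)

section \<open>Convolution with polynomial kernels and the gain of one order\<close>

context gaussian_seq
begin

definition gconv :: "(ell2 \<Rightarrow> real) \<Rightarrow> (ell2 \<Rightarrow> real) \<Rightarrow> ell2 \<Rightarrow> real" where
 "gconv u h x = (\<integral>y. u (x + y) * h y \<partial>G)"

lemma gpoly_measurable: "gpoly h ==> h \<in> borel_measurable borel"
 by (rule tame_measurable[OF gpoly_tame])

lemma integrable_gpoly_shift:
 assumes u: "bmeas u" "\<And>x. \<bar>u x\<bar> \<le> K" and h: "gpoly h"
 obtains B where "integrable G B"
  "\<And>s y. \<bar>s\<bar> < 1 ==> \<bar>u y * (cm i s y * h (y - s *\<^sub>R unit_vec i))\<bar> \<le> B y"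
  "\<And>s. \<bar>s\<bar> < 1 ==> integrable G (\<lambda>y. u y * (cm i s y * h (y - s *\<^sub>R unit_vec i)))"
proof -
 note [measurable] = u(1) gpoly_measurable[OF h]
 obtain C c n where 1: "C \<ge> 0" "c \<ge> 0" "\<And>x. \<bar>h x\<bar> \<le> C * exp (c * (\<Sum>i<n. \<bar>coord x i\<bar>))"
  using gpoly_bound[OF h] by blast
 have K: "K \<ge> 0" using u(2)[of 0] by linarith
 let ?S = "\<lambda>y. \<Sum>j<n + Suc i. \<bar>coord y j\<bar>"
 \<comment> \<open>\<open>exp (c * real n)\<close> pays for shifting coordinates inside
   \<open>h\<close> by less than 1, and the summand \<open>1 / (b i)^2\<close> in the exponent for
   the Cameron-Martin density with \<open>|s| < 1\<close>.\<close>
 define B where "B y = K * C * exp (c * real n) * exp ((c + 1 / (b i)^2) * ?S y)" for y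
 have int: "integrable G B"
  unfolding B_def by (intro integrable_mult_right integrable_exp_sum_coord)
 have bd: "\<bar>u y * (cm i s y * h (y - s *\<^sub>R unit_vec i))\<bar> \<le> B y" if s: "\<bar>s\<bar> < 1" for s y
 proof -
  have Si: "\<bar>coord y i\<bar> \<le> ?S y" by (rule member_le_sum) auto
  have "s * coord y i \<le> \<bar>s\<bar> * \<bar>coord y i\<bar>" using abs_ge_self[of "s * coord y i"] by (simp add: abs_mult)
  also have "\<dots> \<le> 1 * ?S y" using s Si by (intro mult_mono) auto
  finally have "s * coord y i / (b i)^2 \<le> ?S y / (b i)^2" by (intro divide_right_mono) auto
  moreover have "0 \<le> s^2 / (2 * (b i)^2)" by simp
  ultimately have "s * coord y i / (b i)^2 - s^2 / (2 * (b i)^2) \<le> ?S y / (b i)^2" by linarith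
  then have cm: "cm i s y \<le> exp (?S y / (b i)^2)" unfolding cm_def by simp
  have "\<bar>coord (y - s *\<^sub>R unit_vec i) j\<bar> \<le> \<bar>coord y j\<bar> + 1" for j
   using s by (auto simp: coord_simps)
  then have "(\<Sum>j<n. \<bar>coord (y - s *\<^sub>R unit_vec i) j\<bar>) \<le> (\<Sum>j<n. \<bar>coord y j\<bar> + 1)" by (intro sum_mono)
  also have "\<dots> = (\<Sum>j<n. \<bar>coord y j\<bar>) + real n" by (simp add: sum.distrib)
  also have "(\<Sum>j<n. \<bar>coord y j\<bar>) \<le> ?S y" by (intro sum_mono2) auto
  finally have "c * (\<Sum>j<n. \<bar>coord (y - s *\<^sub>R unit_vec i) j\<bar>) \<le> c * (?S y + real n)"
   using 1(2) by (intro mult_left_mono) auto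
  then have "\<bar>h (y - s *\<^sub>R unit_vec i)\<bar> \<le> C * exp (c * (?S y + real n))"
   using 1(1) by (intro order_trans[OF 1(3)] mult_left_mono) auto
  then have "\<bar>u y * (cm i s y * h (y - s *\<^sub>R unit_vec i))\<bar> \<le> K * (exp (?S y / (b i)^2) * (C * exp (c * (?S y + real n))))"
   unfolding abs_mult using u(2)[of y] K 1 cm by (intro mult_mono) auto
  also have "\<dots> = B y" by (simp add: B_def algebra_simps exp_add add_divide_distrib)
  finally show ?thesis .
 qed
 have "integrable G (\<lambda>y. u y * (cm i s y * h (y - s *\<^sub>R unit_vec i)))" if "\<bar>s\<bar> < 1" for s
  by (rule bint_bound[OF int])
   (use bd[OF that] in \<open>auto intro!: AE_I2 intro: order_trans[OF _ abs_ge_self]\<close>)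
 then show ?thesis using that int bd by blast
qed

lemma integrable_gpoly:
 assumes u: "bmeas u" "\<And>x. \<bar>u x\<bar> \<le> K" and h: "gpoly h"
 shows "integrable G (\<lambda>y. u y * h y)"
proof -
 obtain B where "\<And>s. \<bar>s\<bar> < 1 ==> integrable G (\<lambda>y. u y * (cm 0 s y * h (y - s *\<^sub>R unit_vec 0)))"
  using integrable_gpoly_shift[OF u h, of 0] by metis
 from this[of 0] show ?thesis by simp
qed

text \<open>This is \<open>- delta b i\<close>, the adjoint of \<open>pd i\<close> with respect to
  \<open>G\<close>.\<close>

definition hop :: "nat \<Rightarrow> (ell2 \<Rightarrow> real) \<Rightarrow> ell2 \<Rightarrow> real" where
 "hop i h y = coord y i / (b i)^2 * h y - pd i h y"

lemma gpoly_hop: "gpoly h ==> gpoly (hop i h)"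
proof -
 assume h: "gpoly h"
 have "gpoly (\<lambda>y. (1 / (b i)^2) * (coord y i * h y) + (- 1) * pd i h y)"
  by (intro gpoly_add gpoly_cmult gpoly_coord_mult gpoly_pd h)
 then show ?thesis unfolding hop_def by simp
qed

text \<open>By the Cameron--Martin formula, derivatives of \<open>gconv u h\<close> fall on the kernel.\<close>

lemma pd_gconv:
 assumes u: "bmeas u" "\<And>x. \<bar>u x\<bar> \<le> K" and h: "gpoly h"
 shows "has_pd i (gconv u h) x" "pd i (gconv u h) x = gconv u (hop i h) x"
proof -
 note [measurable] = u(1) gpoly_measurable[OF h]
 \<comment> \<open>The increment of \<open>x\<close> is absorbed by the variable of integration, so
   \<open>s\<close> appears in the kernel alone and \<open>u\<close> is not differentiated.\<close>
 have eq: "gconv u h (x + s *\<^sub>R unit_vec i) = (\<integral>y. u (x + y) * (cm i s y * h (y - s *\<^sub>R unit_vec i)) \<partial>G)" for s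
 proof -
  have "gconv u h (x + s *\<^sub>R unit_vec i) =
    (\<integral>y. (\<lambda>y. u (x + y) * h (y - s *\<^sub>R unit_vec i)) (y + s *\<^sub>R unit_vec i) \<partial>G)"
   by (simp add: gconv_def algebra_simps)
  also have "\<dots> = (\<integral>y. cm i s y * (u (x + y) * h (y - s *\<^sub>R unit_vec i)) \<partial>G)"
   by (rule integral_shift(1)) measurable
  finally show ?thesis by (simp add: ac_simps)
 qed
 have um: "bmeas (\<lambda>y. u (x + y))" "\<And>y. \<bar>u (x + y)\<bar> \<le> K" using u(2) by auto
 obtain B where B: "integrable G B"
  "\<And>s y. \<bar>s\<bar> < 1 ==> \<bar>u (x + y) * (cm i s y * hop i h (y - s *\<^sub>R unit_vec i))\<bar> \<le> B y"
  using integrable_gpoly_shift[OF um gpoly_hop[OF h]] by metis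
 obtain B' where B': "\<And>s. \<bar>s\<bar> < 1 ==> integrable G (\<lambda>y. u (x + y) * (cm i s y * h (y - s *\<^sub>R unit_vec i)))"
  using integrable_gpoly_shift[OF um h, of i] by metis
 have der: "((\<lambda>s. u (x + y) * (cm i s y * h (y - s *\<^sub>R unit_vec i))) has_real_derivative
   u (x + y) * (cm i s y * hop i h (y - s *\<^sub>R unit_vec i))) (at s)" for s y
 proof -
  have "DERIV (\<lambda>s. h (y + s *\<^sub>R (- 1 *\<^sub>R unit_vec i))) s :> dd (- 1 *\<^sub>R unit_vec i) h (y + s *\<^sub>R (- 1 *\<^sub>R unit_vec i))"
   by (rule has_dd_at, rule dd_scale_dir) (use tame_has_pd[OF gpoly_tame[OF h]] in \<open>simp add: has_pd_eq\<close>)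
  also have "dd (- 1 *\<^sub>R unit_vec i) h (y + s *\<^sub>R (- 1 *\<^sub>R unit_vec i)) = - pd i h (y - s *\<^sub>R unit_vec i)"
   by (subst dd_scale_dir(2)) (use tame_has_pd[OF gpoly_tame[OF h]] in \<open>simp_all add: has_pd_eq pd_eq_dd\<close>)
  finally have "DERIV (\<lambda>s. h (y - s *\<^sub>R unit_vec i)) s :> - pd i h (y - s *\<^sub>R unit_vec i)"
   by simp
  moreover have "DERIV (\<lambda>s. cm i s y) s :> cm i s y * ((coord y i - s) / (b i)^2)"
   unfolding cm_def using pos[of i]
   by (auto intro!: derivative_eq_intros simp: field_simps)
  ultimately have "((\<lambda>s. cm i s y * h (y - s *\<^sub>R unit_vec i)) has_real_derivative
   cm i s y * ((coord y i - s) / (b i)^2) * h (y - s *\<^sub>R unit_vec i) + (- pd i h (y - s *\<^sub>R unit_vec i)) * cm i s y) (at s)"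
   by (intro DERIV_mult)
  moreover have "cm i s y * ((coord y i - s) / (b i)^2) * h (y - s *\<^sub>R unit_vec i) + (- pd i h (y - s *\<^sub>R unit_vec i)) * cm i s y
   = cm i s y * hop i h (y - s *\<^sub>R unit_vec i)"
   by (simp add: hop_def coord_simps algebra_simps)
  ultimately show ?thesis by (simp add: DERIV_cmult)
 qed
 have "((\<lambda>s. \<integral>y. u (x + y) * (cm i s y * h (y - s *\<^sub>R unit_vec i)) \<partial>G) has_real_derivative
   (\<integral>y. u (x + y) * (cm i 0 y * hop i h (y - 0 *\<^sub>R unit_vec i)) \<partial>G)) (at 0)"
  by (rule DERIV_integral(1)[where r = 1, OF _ B' der B(2) B(1)]) auto
 then have "DERIV (\<lambda>s. gconv u h (x + s *\<^sub>R unit_vec i)) 0 :> gconv u (hop i h) x"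
  unfolding eq by (simp add: gconv_def)
 from dd_eqI[OF this] show "has_pd i (gconv u h) x" "pd i (gconv u h) x = gconv u (hop i h) x"
  by (simp_all add: has_pd_eq pd_eq_dd)
qed

lemma bl_gconv:
 assumes "bl u" and h: "gpoly h"
 shows "bl (gconv u h)"
proof -
 obtain K L where K: "\<And>x. \<bar>u x\<bar> \<le> K" and L: "\<And>x y. \<bar>u x - u y\<bar> \<le> L * norm (x - y)"
  using assms(1) unfolding bl_def by blast
 note [measurable] = bl_measurable[OF assms(1)] gpoly_measurable[OF h]
 have int1: "integrable G (\<lambda>y. \<bar>h y\<bar>)"
  using integrable_gpoly[of "\<lambda>_. 1" 1 h] h by (intro integrable_abs) auto
 have int: "integrable G (\<lambda>y. u (x + y) * h y)" for x
  using K by (intro integrable_gpoly[OF _ _ h]) auto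
 have "\<bar>gconv u h x\<bar> \<le> (\<integral>y. K * \<bar>h y\<bar> \<partial>G)" for x
  unfolding gconv_def
  by (rule order_trans[OF integral_abs_bound integral_mono])
   (use integrable_abs[OF int] int1 K in \<open>auto simp: abs_mult intro: mult_right_mono\<close>)
 moreover have "\<bar>gconv u h x - gconv u h y\<bar> \<le> (\<integral>z. L * \<bar>h z\<bar> \<partial>G) * norm (x - y)" for x y
 proof -
  have "gconv u h x - gconv u h y = (\<integral>z. u (x + z) * h z - u (y + z) * h z \<partial>G)"
   unfolding gconv_def by (rule bint_diff[symmetric, OF int int])
  also have "\<bar>\<dots>\<bar> \<le> (\<integral>z. norm (x - y) * (L * \<bar>h z\<bar>) \<partial>G)"
  proof (rule order_trans[OF integral_abs_bound integral_mono])
   fix z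
   have "\<bar>u (x + z) - u (y + z)\<bar> * \<bar>h z\<bar> \<le> (L * norm (x - y)) * \<bar>h z\<bar>"
    using L[of "x + z" "y + z"] by (intro mult_right_mono) auto
   moreover have "u (x + z) * h z - u (y + z) * h z = (u (x + z) - u (y + z)) * h z"
    by (simp add: left_diff_distrib)
   ultimately show "\<bar>u (x + z) * h z - u (y + z) * h z\<bar> \<le> norm (x - y) * (L * \<bar>h z\<bar>)"
    by (simp only: abs_mult) (simp add: ac_simps)
  qed (use int int1 in auto)
  finally show ?thesis by (simp add: ac_simps)
 qed
 ultimately show ?thesis unfolding bl_def by blast
qed

lemma regular_bl_gconv:
 assumes u: "bl u" and "gpoly h"
 shows "regular bl (range unit_vec) (gconv u h)"
proof -
 obtain K where K: "\<And>x. \<bar>u x\<bar> \<le> K" using u unfolding bl_def by blast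
 note pg = pd_gconv[OF bl_measurable[OF u] K]
 show ?thesis
 proof (rule regular_coinduct[where C = "{gconv u h | h. gpoly h}"])
  fix f v x assume "f \<in> {gconv u h | h. gpoly h}" "v \<in> range unit_vec"
  then obtain h i where h: "f = gconv u h" "gpoly h" "v = unit_vec i" by blast
  show "has_dd v f x" using pg(1)[OF h(2)] by (simp add: h has_pd_eq)
  have "dd v f = gconv u (hop i h)" using pg(2)[OF h(2)] by (auto simp: h pd_eq_dd)
  then show "dd v f \<in> {gconv u h | h. gpoly h}" using gpoly_hop[OF h(2)] by blast
 qed (use assms bl_gconv in auto)
qed

lemma tame_of_regular_bl: "regular bl (range unit_vec) u ==> tame u"
 using regular_mono[of bl "range unit_vec" u lipb "range unit_vec"] bl_lipb by blast

text \<open>The alternative to \<open>pd_gconv\<close>: the derivative may fall on \<open>u\<close>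
  when \<open>u\<close> has one. Comparing both is how integration by parts is obtained
  later.\<close>

lemma pd_gconv_commute:
 assumes u: "bmeas u" "\<And>x. \<bar>u x\<bar> \<le> K" "\<And>x. has_pd i u x" and K': "\<And>x. \<bar>pd i u x\<bar> \<le> K'"
  and h: "gpoly h"
 shows "pd i (gconv u h) = gconv (pd i u) h"
proof
 fix x
 note K = u(2)
 note [measurable] = u(1) gpoly_measurable[OF h]
 have "((\<lambda>s. \<integral>y. u (x + y + s *\<^sub>R unit_vec i) * h y \<partial>G) has_real_derivative
   (\<integral>y. pd i u (x + y + 0 *\<^sub>R unit_vec i) * h y \<partial>G)) (at 0)"
 proof (rule DERIV_integral(1)[where r = 1 and B = "\<lambda>y. K' * \<bar>h y\<bar>"])
  show "integrable G (\<lambda>y. u (x + y + s *\<^sub>R unit_vec i) * h y)" for s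
   using K by (intro integrable_gpoly[OF _ _ h]) auto
  show "DERIV (\<lambda>s. u (x + y + s *\<^sub>R unit_vec i) * h y) s :> pd i u (x + y + s *\<^sub>R unit_vec i) * h y" for s y
   unfolding pd_eq_dd by (intro DERIV_cmult_right has_dd_at) (use u(3) in \<open>simp add: has_pd_eq\<close>)
  show "integrable G (\<lambda>y. K' * \<bar>h y\<bar>)"
   using integrable_gpoly[of "\<lambda>_. 1" 1 h] h by (intro integrable_mult_right integrable_abs) auto
 qed (use K' in \<open>auto simp: abs_mult intro: mult_right_mono\<close>)
 then have "DERIV (\<lambda>s. gconv u h (x + s *\<^sub>R unit_vec i)) 0 :> gconv (pd i u) h x"
  by (simp add: gconv_def algebra_simps)
 from dd_eqI(2)[OF this] show "pd i (gconv u h) x = gconv (pd i u) h x"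
  by (simp add: pd_eq_dd)
qed

text \<open>The convolution of the constant 1 with \<open>coord j\<close> is constant, so its
  derivative, the integral of \<open>hop i\<close> of that kernel, vanishes; this is the
  orthogonality relation.\<close>

lemma integral_coord_mult: "(\<integral>y. coord y i * coord y j \<partial>G) = (if i = j then (b i)^2 else 0)"
proof -
 have "gconv (\<lambda>_. 1) (\<lambda>y. coord y j) = (\<lambda>_. gconv (\<lambda>_. 1) (\<lambda>y. coord y j) 0)"
  by (simp add: gconv_def fun_eq_iff)
 then have "pd i (gconv (\<lambda>_. 1) (\<lambda>y. coord y j)) 0 = 0" by (metis dd_const pd_eq_dd)
 then have "gconv (\<lambda>_. 1) (hop i (\<lambda>y. coord y j)) 0 = 0"
  by (subst (asm) pd_gconv(2)[where K = 1]) (auto intro: gpoly_coord)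
 then have "(\<integral>y. (1 / (b i)^2) * (coord y i * coord y j) - (if i = j then 1 else 0) \<partial>G) = 0"
  by (simp add: gconv_def hop_def pd_coord eq_commute[of j i])
 moreover have "integrable G (\<lambda>y. (1 / (b i)^2) * (coord y i * coord y j))"
  using integrable_gpoly[of "\<lambda>_. 1" 1 "\<lambda>y. coord y i * coord y j"] gpoly_coord_mult[OF gpoly_coord] by auto
 ultimately have "(1 / (b i)^2) * (\<integral>y. coord y i * coord y j \<partial>G) = (if i = j then 1 else 0)"
  by (subst (asm) bint_diff) (auto simp: G.prob_space[simplified])
 then show ?thesis using pos[of i] by (simp add: field_simps split: if_splits)
qed

text \<open>Bessel's inequality for the orthonormal functions \<open>coord y i / b i\<close>. By
  \<open>pd_gconv\<close> their coefficients are \<open>b i\<close> times the first derivatives of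
  the average of \<open>u\<close>.\<close>

lemma bessel:
 assumes u: "bmeas u" "\<And>x. \<bar>u x\<bar> \<le> K"
 shows "(\<Sum>i<n. (\<integral>y. u y * (coord y i / b i) \<partial>G)^2) \<le> (\<integral>y. (u y)^2 \<partial>G)"
proof -
 note [measurable] = u(1)
 define c where "c i = (\<integral>y. u y * (coord y i / b i) \<partial>G)" for i
 define S where "S y = (\<Sum>i<n. c i / b i * coord y i)" for y
 have gS: "gpoly S" unfolding S_def by (intro gpoly_sum gpoly_cmult gpoly_coord)
 have gc: "gpoly (\<lambda>y. coord y i * coord y j)" for i j by (intro gpoly_coord_mult gpoly_coord)
 have one: "integrable G h" if "gpoly h" for h using integrable_gpoly[of "\<lambda>_. 1" 1 h] that by simp
 have i1: "integrable G (\<lambda>y. (u y)^2)"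
 proof (rule G.integrable_const_bound[where B = "K^2"])
  have "(u y)^2 \<le> K^2" for y using power_mono[OF u(2)[of y], of 2] by simp
  then show "AE x in G. norm ((u x)^2) \<le> K^2" by simp
 qed simp
 have i2: "integrable G (\<lambda>y. u y * S y)" by (rule integrable_gpoly[OF u gS])
 have SS: "S y * S y = (\<Sum>i<n. \<Sum>j<n. (c i / b i * (c j / b j)) * (coord y i * coord y j))" for y
  unfolding S_def sum_product by (simp add: ac_simps)
 have i3: "integrable G (\<lambda>y. S y * S y)"
  unfolding SS by (intro one gpoly_sum gpoly_cmult gc)
 have uS: "(\<integral>y. u y * S y \<partial>G) = (\<Sum>i<n. (c i)^2)"
 proof -
  have "(\<integral>y. u y * S y \<partial>G) = (\<integral>y. (\<Sum>i<n. c i * (u y * (coord y i / b i))) \<partial>G)"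
   unfolding S_def by (simp add: sum_distrib_left ac_simps)
  also have "\<dots> = (\<Sum>i<n. c i * (\<integral>y. u y * (coord y i / b i) \<partial>G))"
  proof (subst Bochner_Integration.integral_sum)
   have "gpoly (\<lambda>y. (1 / b i) * coord y i)" for i by (intro gpoly_cmult gpoly_coord)
   from integrable_gpoly[OF u this]
   show "integrable G (\<lambda>y. c i * (u y * (coord y i / b i)))" for i
    by (intro integrable_mult_right) simp
  qed simp
  finally show ?thesis by (simp add: c_def power2_eq_square)
 qed
 have "(\<integral>y. S y * S y \<partial>G) = (\<Sum>i<n. \<Sum>j<n. (c i / b i * (c j / b j)) * (\<integral>y. coord y i * coord y j \<partial>G))"
  unfolding SS using one[OF gc] by (simp add: Bochner_Integration.integral_sum)
 also have "\<dots> = (\<Sum>i<n. (c i)^2)"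
  unfolding integral_coord_mult
  using pos by (intro sum.cong refl) (simp add: if_distrib sum.delta' power2_eq_square less_imp_neq[symmetric] cong: if_cong)
 finally have s2: "(\<integral>y. S y * S y \<partial>G) = (\<Sum>i<n. (c i)^2)" .
 have "0 \<le> (\<integral>y. (u y)^2 - 2 * (u y * S y) + S y * S y \<partial>G)"
 proof (rule integral_nonneg_AE, intro AE_I2)
  fix y
  have "(u y)^2 - 2 * (u y * S y) + S y * S y = (u y - S y)^2"
   by (simp add: power2_eq_square algebra_simps)
  then show "0 \<le> (u y)^2 - 2 * (u y * S y) + S y * S y" by simp
 qed
 also have "\<dots> = (\<integral>y. (u y)^2 \<partial>G) - 2 * (\<Sum>i<n. (c i)^2) + (\<Sum>i<n. (c i)^2)"
  using i1 i2 i3 by (simp add: uS s2)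
 finally show ?thesis by (simp add: c_def)
qed

abbreviation smooth1 :: "(ell2 \<Rightarrow> real) \<Rightarrow> ell2 \<Rightarrow> real" where
 "smooth1 u \<equiv> gconv u (\<lambda>_. 1)"

text \<open>Derivatives of \<open>u\<close> pass under the convolution and the sums over the two
  kinds of index are swapped, until Bessel's inequality remains at order 0. Finite regularity
  \<open>reg bl k\<close> is assumed because in the iteration below each average supplies the
  hypothesis of the next.\<close>

lemma Sq_gconv_sum:
 assumes "reg bl k (range unit_vec) u"
 shows "(suminf (\<lambda>i. Sq w k (gconv u (\<lambda>y. coord y i / b i)) x)) \<le> (\<integral>\<^sup>+y. Sq w k u (x + y) \<partial>G)"
 using assms
proof (induction k arbitrary: u)
 case 0
 then obtain K where K: "\<And>x. \<bar>u x\<bar> \<le> K" unfolding bl_def by auto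
 have [measurable]: "bmeas u" using 0 bl_measurable by simp
 have "(\<Sum>i<n. ennreal ((gconv u (\<lambda>y. coord y i / b i) x)^2)) \<le> ennreal (\<integral>y. (u (x + y))^2 \<partial>G)" for n
  using bessel[of "\<lambda>y. u (x + y)" K n] K unfolding gconv_def by (subst sum_ennreal) (auto intro: ennreal_leI)
 then have "(suminf (\<lambda>i. ennreal ((gconv u (\<lambda>y. coord y i / b i) x)^2))) \<le> ennreal (\<integral>y. (u (x + y))^2 \<partial>G)"
  by (intro suminf_le_const) auto
 also have "\<dots> = (\<integral>\<^sup>+y. ennreal ((u (x + y))^2) \<partial>G)"
 proof (rule nn_integral_eq_integral[symmetric])
  have "(u (x + y))^2 \<le> K^2" for y using power_mono[OF K[of "x + y"], of 2] by simp
  then show "integrable G (\<lambda>y. (u (x + y))^2)"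
   by (intro G.integrable_const_bound[where B = "K^2"]) auto
 qed auto
 finally show ?case by simp
next
 case (Suc k)
 have gp: "gpoly (\<lambda>y. coord y i / b i)" for i
  using gpoly_cmult[OF gpoly_coord, of "1 / b i" i] by simp
 have pdu: "pd j (gconv u (\<lambda>y. coord y i / b i)) = gconv (pd j u) (\<lambda>y. coord y i / b i)" for i j
 proof -
  have "bl u" "bl (pd j u)" "\<And>x. has_pd j u x" using Suc.prems by (auto simp: has_pd_eq pd_eq_dd dest: reg_base)
  then obtain K K' where "\<And>x. \<bar>u x\<bar> \<le> K" "\<And>x. \<bar>pd j u x\<bar> \<le> K'" unfolding bl_def by blast
  then show ?thesis using \<open>bl u\<close> \<open>\<And>x. has_pd j u x\<close> by (intro pd_gconv_commute[where K = K and K' = K'] gp bl_measurable)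
 qed
 have "(suminf (\<lambda>i. Sq w (Suc k) (gconv u (\<lambda>y. coord y i / b i)) x)) =
  (suminf (\<lambda>i. suminf (\<lambda>j. ennreal (w j) * Sq w k (gconv (pd j u) (\<lambda>y. coord y i / b i)) x)))"
  by (simp add: pdu)
 also have "\<dots> = (suminf (\<lambda>j. suminf (\<lambda>i. ennreal (w j) * Sq w k (gconv (pd j u) (\<lambda>y. coord y i / b i)) x)))"
  by (rule suminf_swap_ennreal)
 also have "\<dots> \<le> (suminf (\<lambda>j. ennreal (w j) * (\<integral>\<^sup>+y. Sq w k (pd j u) (x + y) \<partial>G)))"
  using Suc.prems by (auto intro!: suminf_le mult_left_mono Suc.IH simp: pd_eq_dd)
 also have "\<dots> = (\<integral>\<^sup>+y. Sq w (Suc k) u (x + y) \<partial>G)"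
 proof -
  have m: "bmeas (Sq w k (pd j u))" for j
  proof -
   have "reg bl k (range unit_vec) (pd j u)" using Suc.prems by (auto simp: pd_eq_dd)
   then show ?thesis
   proof (induction k arbitrary: u j)
    case 0
    then show ?case using bl_measurable by simp
   next
    case (Suc k)
    have "bmeas (Sq w k (pd i (pd j u)))" for i
     by (rule Suc.IH[of i "pd j u"]) (use Suc.prems in \<open>simp add: pd_eq_dd\<close>)
    note this[measurable]
    show ?case by simp
   qed
  qed
  have [measurable]: "bmeas (\<lambda>y. Sq w k (pd j u) (x + y))" for j
   by (rule measurable_compose[OF _ m]) simp
  show ?thesis by (simp add: nn_integral_suminf nn_integral_cmult)
 qed
 finally show ?case .
qed

text \<open>One average gains one order without loss: the weight \<open>(b i)^2\<close> cancels the
  factor \<open>1 / b i\<close> by which the derivative differs from a Bessel coefficient.\<close>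

lemma Sq_smooth1:
 assumes u: "bl u" "reg bl k (range unit_vec) u" and B: "\<And>x. Sq (\<lambda>i. (b i)^2) k u x \<le> B"
 shows "Sq (\<lambda>i. (b i)^2) (Suc k) (smooth1 u) x \<le> B"
proof -
 let ?w = "\<lambda>i. (b i)^2"
 obtain K where K: "\<And>x. \<bar>u x\<bar> \<le> K" using u(1) unfolding bl_def by auto
 have gp: "gpoly (\<lambda>y. coord y i / b i)" for i
  using gpoly_cmult[OF gpoly_coord, of "1 / b i" i] by simp
 have hop1: "hop i (\<lambda>_. 1) = (\<lambda>y. 1 / b i * (coord y i / b i))" for i
  by (simp add: hop_def pd_eq_dd power2_eq_square fun_eq_iff)
 have "pd i (smooth1 u) = (\<lambda>x. (1 / b i) * gconv u (\<lambda>y. coord y i / b i) x)" for i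
 proof
  fix x
  have "pd i (smooth1 u) x = gconv u (\<lambda>y. 1 / b i * (coord y i / b i)) x"
   by (subst pd_gconv(2)[OF bl_measurable[OF u(1)] K]) (auto simp: hop1 intro: gpoly_const)
  also have "\<dots> = (1 / b i) * gconv u (\<lambda>y. coord y i / b i) x"
   unfolding gconv_def by (simp flip: integral_mult_right_zero add: ac_simps)
  finally show "pd i (smooth1 u) x = (1 / b i) * gconv u (\<lambda>y. coord y i / b i) x" .
 qed
 then have "Sq ?w (Suc k) (smooth1 u) x =
   (suminf (\<lambda>i. ennreal ((b i)^2) * (ennreal ((1 / b i)^2) * Sq ?w k (gconv u (\<lambda>y. coord y i / b i)) x)))"
  using tame_of_regular_bl[OF regular_bl_gconv[OF u(1) gp]] by (simp add: Sq_cmult del: times_divide_eq_left)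
 also have "\<dots> = (suminf (\<lambda>i. Sq ?w k (gconv u (\<lambda>y. coord y i / b i)) x))"
  using pos by (simp add: mult.assoc[symmetric] ennreal_mult[symmetric] power_divide less_imp_neq[symmetric])
 also have "\<dots> \<le> (\<integral>\<^sup>+y. Sq ?w k u (x + y) \<partial>G)" by (rule Sq_gconv_sum[OF u(2)])
 also have "\<dots> \<le> (\<integral>\<^sup>+y. B \<partial>G)" by (intro nn_integral_mono B)
 also have "\<dots> = B" by (simp add: G.emeasure_space_1[simplified])
 finally show ?thesis .
qed

lemma smooth1_bounds:
 assumes u: "\<And>x. \<bar>u x\<bar> \<le> K" "\<And>x y. \<bar>u x - u y\<bar> \<le> L * norm (x - y)" and L: "L \<ge> 0"
 shows "\<bar>smooth1 u x\<bar> \<le> K" "\<bar>smooth1 u x - smooth1 u y\<bar> \<le> L * norm (x - y)"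
  "\<bar>smooth1 u x - u x\<bar> \<le> L * sqrt (suminf (\<lambda>i. (b i)^2))"
proof -
 have bl: "bl u" using u unfolding bl_def by blast
 note [measurable] = bl_measurable[OF bl]
 have int: "integrable G (\<lambda>y. u (x + y))" for x
  by (rule G.integrable_const_bound[where B = K]) (use u in auto)
 have s: "smooth1 u x = (\<integral>y. u (x + y) \<partial>G)" for x by (simp add: gconv_def)
 have "\<bar>smooth1 u x\<bar> \<le> (\<integral>y. K \<partial>G)" for x
  unfolding s by (rule order_trans[OF integral_abs_bound integral_mono]) (use int u in auto)
 then show "\<bar>smooth1 u x\<bar> \<le> K" by (simp add: G.prob_space[simplified])
 have "\<bar>smooth1 u x - smooth1 u y\<bar> \<le> (\<integral>z. L * norm (x - y) \<partial>G)"
  unfolding s bint_diff[symmetric, OF int int]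
 proof (rule order_trans[OF integral_abs_bound integral_mono])
  show "\<bar>u (x + z) - u (y + z)\<bar> \<le> L * norm (x - y)" for z using u(2)[of "x + z" "y + z"] by simp
 qed (use int in auto)
 then show "\<bar>smooth1 u x - smooth1 u y\<bar> \<le> L * norm (x - y)" by (simp add: G.prob_space[simplified])
 \<comment> \<open>The square root of the second moment. Integrating
   \<open>norm y \<le> (\<eta> + (norm y)^2 / \<eta>) / 2\<close> bounds the mean of
   \<open>norm y\<close> by \<open>\<eta>\<close>.\<close>
 define \<eta> where "\<eta> = sqrt (suminf (\<lambda>i. (b i)^2))"
 have "0 < suminf (\<lambda>i. (b i)^2)" by (rule suminf_pos[OF sq_summable]) (use pos in \<open>simp add: less_imp_neq[symmetric]\<close>)
 then have eta: "\<eta> > 0" "\<eta>^2 = suminf (\<lambda>i. (b i)^2)" by (auto simp: \<eta>_def)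
 have isq: "integrable G (\<lambda>y. (norm y)^2)" "(\<integral>y. (norm y)^2 \<partial>G) = \<eta>^2"
  using nn_integral_norm_sq eta suminf_nonneg[OF sq_summable]
  by (auto simp: integrable_iff_bounded integral_eq_nn_integral)
 have "\<bar>smooth1 u x - u x\<bar> = \<bar>\<integral>y. u (x + y) - u x \<partial>G\<bar>"
  using int[of x] by (simp add: s G.prob_space[simplified])
 also have "\<dots> \<le> (\<integral>y. L * ((\<eta> + (norm y)^2 / \<eta>) / 2) \<partial>G)"
 proof (rule order_trans[OF integral_abs_bound integral_mono])
  fix y :: ell2
  have "norm y \<le> (\<eta> + (norm y)^2 / \<eta>) / 2"
   using sum_squares_bound[of \<eta> "norm y"] eta(1) by (simp add: field_simps power2_eq_square)
  then have "L * norm y \<le> L * ((\<eta> + (norm y)^2 / \<eta>) / 2)" using L by (rule mult_left_mono)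
  then show "\<bar>u (x + y) - u x\<bar> \<le> L * ((\<eta> + (norm y)^2 / \<eta>) / 2)"
   using u(2)[of "x + y" x] by simp
 qed (use int isq in auto)
 also have "\<dots> = L * ((\<eta> + \<eta>^2 / \<eta>) / 2)" using isq by (simp add: G.prob_space[simplified])
 also have "\<dots> = L * \<eta>" using eta(1) by (simp add: power2_eq_square)
 finally show "\<bar>smooth1 u x - u x\<bar> \<le> L * sqrt (suminf (\<lambda>i. (b i)^2))" by (simp add: \<eta>_def)
qed

text \<open>Averages keep both the sup bound and the Lipschitz constant, so the hypotheses of one
  step survive it: errors add up linearly while the square bound \<open>K^2\<close> stays
  fixed.\<close>

lemma iterate_smooth1:
 assumes u: "\<And>x. \<bar>u x\<bar> \<le> K" "\<And>x y. \<bar>u x - u y\<bar> \<le> L * norm (x - y)" and L: "L \<ge> 0"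
 shows "(\<forall>x. \<bar>(smooth1 ^^ n) u x\<bar> \<le> K) \<and>
  (\<forall>x y. \<bar>(smooth1 ^^ n) u x - (smooth1 ^^ n) u y\<bar> \<le> L * norm (x - y)) \<and>
  (\<forall>x. \<bar>(smooth1 ^^ n) u x - u x\<bar> \<le> real n * (L * sqrt (suminf (\<lambda>i. (b i)^2)))) \<and>
  (\<forall>k\<le>n. \<forall>x. Sq (\<lambda>i. (b i)^2) k ((smooth1 ^^ n) u) x \<le> ennreal (K^2)) \<and>
  (n > 0 \<longrightarrow> regular bl (range unit_vec) ((smooth1 ^^ n) u))"
proof (induction n)
 case 0
 have "(u x)^2 \<le> K^2" for x using power_mono[OF u(1)[of x], of 2] by simp
 then show ?case using u by (auto intro: ennreal_leI)
next
 case (Suc n)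
 let ?v = "(smooth1 ^^ n) u"
 have v: "\<And>x. \<bar>?v x\<bar> \<le> K" "\<And>x y. \<bar>?v x - ?v y\<bar> \<le> L * norm (x - y)" using Suc by auto
 note sb = smooth1_bounds[OF v L]
 have blv: "bl ?v" using v unfolding bl_def by blast
 have "\<bar>smooth1 ?v x - u x\<bar> \<le> real (Suc n) * (L * sqrt (suminf (\<lambda>i. (b i)^2)))" for x
 proof -
  have "\<bar>?v x - u x\<bar> \<le> real n * (L * sqrt (suminf (\<lambda>i. (b i)^2)))" using Suc by auto
  then show ?thesis using sb(3)[of x] by (simp add: algebra_simps)
 qed
 moreover have "Sq (\<lambda>i. (b i)^2) k (smooth1 ?v) x \<le> ennreal (K^2)" if "k \<le> Suc n" for k x
 proof (cases k)
  case 0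
  have "(smooth1 ?v x)^2 \<le> K^2" using power_mono[OF sb(1)[of x], of 2] by simp
  then show ?thesis using 0 by (auto intro: ennreal_leI)
 next
  case k: (Suc k')
  \<comment> \<open>For \<open>n = 0\<close> the function is merely bounded Lipschitz, but then
    \<open>k' = 0\<close> and \<open>reg bl 0\<close> is all that is asked.\<close>
  have "reg bl k' (range unit_vec) ?v"
   using Suc that k blv by (cases "n = 0") (auto simp: regular_def)
  from Sq_smooth1[OF blv this, of "ennreal (K^2)"] show ?thesis
   using Suc that k by (auto simp del: Sq.simps)
 qed
 moreover have "regular bl (range unit_vec) (smooth1 ?v)"
  by (rule regular_bl_gconv[OF blv gpoly_const])
 ultimately show ?case using sb by simp
qed

end

text \<open>With \<open>b i = \<delta> * sqrt (a i)\<close> the natural weights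
  \<open>(b i)^2\<close> of the averages are multiples of \<open>a i\<close>, and square-summability
  of \<open>b\<close> is summability of \<open>a\<close>.\<close>

lemma lipschitz_smoothing:
 fixes a :: "nat \<Rightarrow> real" and u :: "ell2 \<Rightarrow> real"
 assumes a: "\<And>i. a i > 0" "summable a" and "\<epsilon> > 0"
  and u: "\<And>x. \<bar>u x\<bar> \<le> 1" "\<And>x y. \<bar>u x - u y\<bar> \<le> norm (x - y)"
 obtains D C where "tame D" "\<And>x. \<bar>D x - u x\<bar> \<le> \<epsilon>" "C \<ge> 0" "\<And>k x. k \<le> m ==> Sq a k D x \<le> ennreal C"
proof -
 define A where "A = suminf a"
 have A: "A > 0" unfolding A_def by (rule suminf_pos[OF a(2)]) (use a in auto)
 \<comment> \<open>\<open>Suc m\<close> averages, each moving a function of Lipschitz constant 1 by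
   at most \<open>\<delta> * sqrt A\<close>, have total error \<open>\<epsilon>\<close>. The extra
   average ensures that one is made even for \<open>m = 0\<close>, so that the result is
   tame.\<close>
 define \<delta> where "\<delta> = \<epsilon> / (real (Suc m) * sqrt A)"
 have d: "\<delta> > 0" using A assms(3) by (auto simp: \<delta>_def)
 define b where "b i = \<delta> * sqrt (a i)" for i
 have b2: "(b i)^2 = \<delta>^2 * a i" for i using a(1)[of i] by (simp add: b_def power_mult_distrib)
 interpret gaussian_seq b
 proof
  show "b i > 0" for i using d a(1)[of i] by (simp add: b_def)
  show "summable (\<lambda>i. (b i)^2)" unfolding b2 using a(2) by (rule summable_mult)
 qed
 have sb: "suminf (\<lambda>i. (b i)^2) = \<delta>^2 * A" unfolding b2 A_def using a(2) by (simp add: suminf_mult)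
 let ?D = "(smooth1 ^^ Suc m) u"
 note it = iterate_smooth1[of u 1 1 "Suc m", OF u(1) _ zero_le_one, simplified mult_1_left, OF u(2)]
 have eps: "real (Suc m) * sqrt (suminf (\<lambda>i. (b i)^2)) = \<epsilon>"
  unfolding sb using d A assms(3) by (simp add: real_sqrt_mult \<delta>_def del: of_nat_Suc)
 \<comment> \<open>Passing from the weights \<open>(b i)^2\<close> to \<open>a i\<close> costs a
   factor \<open>1 / \<delta>^2\<close> per order; the sum dominates each of these powers.\<close>
 define C where "C = (\<Sum>k\<le>m. (1 / \<delta>^2) ^ k)"
 show ?thesis
 proof (rule that[of ?D C])
  show "tame ?D" using it by (intro tame_of_regular_bl) blast
  show "\<bar>?D x - u x\<bar> \<le> \<epsilon>" for x using it eps by metis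
  show "C \<ge> 0" unfolding C_def by (intro sum_nonneg) auto
  fix k x assume k: "k \<le> m"
  have "a i = 1 / \<delta>^2 * (b i)^2" for i using d by (simp add: b2)
  then have "Sq a k ?D x = Sq (\<lambda>i. 1 / \<delta>^2 * (b i)^2) k ?D x" by presburger
  also have "\<dots> = ennreal ((1 / \<delta>^2) ^ k) * Sq (\<lambda>i. (b i)^2) k ?D x" by (rule Sq_scale) auto
  also have "\<dots> \<le> ennreal ((1 / \<delta>^2) ^ k) * 1"
   using it k by (intro mult_left_mono) (metis ennreal_1 le_Suc_eq one_power2, simp)
  also have "\<dots> \<le> ennreal C"
   unfolding C_def mult_1_right by (intro ennreal_leI member_le_sum[of k "{..m}" "\<lambda>k. (1 / \<delta>^2) ^ k"]) (use k in auto)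
  finally show "Sq a k ?D x \<le> ennreal C" .
 qed
qed

section \<open>Exhaustion of the domain and partitions of unity\<close>

text \<open>Distance to the complement is expressed by balls, which also covers the case of an empty
  complement; the strict \<open>r > 1/c\<close> makes the set open.\<close>

definition Vset :: "ell2 set \<Rightarrow> real \<Rightarrow> ell2 set" where
 "Vset \<Omega> c = {x. norm x < c \<and> (\<exists>r>1/c. ball x r \<subseteq> \<Omega>)}"

lemma Vset_near:
 assumes x: "x \<in> Vset \<Omega> c" and c: "0 < c" "c < d" and y: "norm (y - x) \<le> d - c" "norm (y - x) \<le> 1 / c - 1 / d"
 shows "y \<in> Vset \<Omega> d"
proof -
 obtain r where r: "r > 1 / c" "ball x r \<subseteq> \<Omega>" and nx: "norm x < c" using x by (auto simp: Vset_def)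
 have "norm y < d" using norm_triangle_sub[of y x] nx y by linarith
 moreover have "ball y (r - norm (y - x)) \<subseteq> ball x r"
 proof
  fix z assume "z \<in> ball y (r - norm (y - x))"
  then have "dist y z < r - dist y x" by (simp add: dist_norm)
  then show "z \<in> ball x r" using dist_triangle[of x z y] by (simp add: dist_commute)
 qed
 moreover have "r - norm (y - x) > 1 / d" using r y by linarith
 ultimately show ?thesis using r(2) unfolding Vset_def by blast
qed

lemma Vset_mono:
 assumes "0 < c" "c \<le> d"
 shows "Vset \<Omega> c \<subseteq> Vset \<Omega> d"
proof (cases "c = d")
 case False
 then show ?thesis using Vset_near[of _ \<Omega> c d] assms by (auto simp: frac_le)
qed simp

lemma Vset_subset: "c > 0 ==> Vset \<Omega> c \<subseteq> \<Omega>"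
 unfolding Vset_def by clarify (metis centre_in_ball divide_pos_pos less_trans subsetD zero_less_one)

lemma open_Vset:
 assumes "c > 0"
 shows "open (Vset \<Omega> c)"
 unfolding open_contains_ball
proof
 fix x assume "x \<in> Vset \<Omega> c"
 then obtain r where r: "r > 1 / c" "ball x r \<subseteq> \<Omega>" and nx: "norm x < c" by (auto simp: Vset_def)
 define e where "e = min (c - norm x) (r - 1 / c)"
 have "ball x e \<subseteq> Vset \<Omega> c"
 proof
  fix y assume "y \<in> ball x e"
  then have y: "dist x y < c - norm x" "dist x y < r - 1 / c" by (auto simp: e_def)
  have "norm y < c" using y(1) norm_triangle_sub[of y x] by (simp add: dist_norm norm_minus_commute)
  moreover have "ball y (r - dist x y) \<subseteq> ball x r"
  proof
   fix z assume "z \<in> ball y (r - dist x y)"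
   then show "z \<in> ball x r" using dist_triangle[of x z y] by simp
  qed
  ultimately show "y \<in> Vset \<Omega> c" using y(2) r(2) unfolding Vset_def
   by (auto intro!: exI[of _ "r - dist x y"])
 qed
 moreover have "e > 0" using r nx by (simp add: e_def)
 ultimately show "\<exists>e>0. ball x e \<subseteq> Vset \<Omega> c" by blast
qed

lemma unif_incl_subset_Vset:
 assumes "unif_incl S \<Omega>"
 obtains c where "c > 0" "S \<subseteq> Vset \<Omega> c"
proof -
 obtain r R where r: "r > 0" "R > 0" "(\<Union>z\<in>S. ball z r) \<subseteq> \<Omega>" "S \<subseteq> ball 0 R"
  using assms unfolding unif_incl_def by blast
 \<comment> \<open>Large enough for both conditions: \<open>c \<ge> R\<close> bounds the norm, and
   \<open>c \<ge> 2 / r\<close> gives \<open>1 / c < r\<close>.\<close>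
 define c where "c = R + 2 / r"
 have c: "c > 0" using r by (simp add: c_def add_pos_pos)
 have "1 / c < r"
 proof -
  have "1 < r * c" using r by (simp add: c_def algebra_simps add_pos_pos)
  then show ?thesis using c by (simp add: pos_divide_less_eq)
 qed
 moreover have "R \<le> c" using r by (simp add: c_def)
 ultimately have "S \<subseteq> Vset \<Omega> c" using r unfolding Vset_def by force
 then show ?thesis using c that by blast
qed

lemma unif_incl_Vset: "c > 0 ==> S \<subseteq> Vset \<Omega> c ==> unif_incl S \<Omega>"
 unfolding unif_incl_def
proof (intro exI conjI)
 assume c: "c > 0" and S: "S \<subseteq> Vset \<Omega> c"
 show "(\<Union>z\<in>S. ball z (1 / c)) \<subseteq> \<Omega>"
 proof
  fix y assume "y \<in> (\<Union>z\<in>S. ball z (1 / c))"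
  then obtain z where z: "z \<in> S" "y \<in> ball z (1 / c)" by blast
  then obtain r where "r > 1 / c" "ball z r \<subseteq> \<Omega>" using S by (auto simp: Vset_def)
  then show "y \<in> \<Omega>" using z(2) by auto
 qed
 show "S \<subseteq> ball 0 c" using S by (auto simp: Vset_def)
qed auto

lemma Vset_exhausts:
 assumes "open \<Omega>" "x \<in> \<Omega>"
 obtains c where "c > 0" "x \<in> Vset \<Omega> c"
proof -
 obtain r where "r > 0" "ball x r \<subseteq> \<Omega>" using assms by (auto simp: open_contains_ball)
 then have "unif_incl {x} \<Omega>" unfolding unif_incl_def
  by (intro exI[of _ r] conjI exI[of _ "norm x + 1"]) (auto simp: add_nonneg_pos)
 then show ?thesis using unif_incl_subset_Vset[of "{x}" \<Omega>] that by blast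
qed

text \<open>The distance to \<open>S\<close> is smoothed up to an error \<open>\<eta> / 3\<close>.
  The smoothed distance is then at most \<open>\<eta> / 3\<close> on \<open>S\<close> and at least
  \<open>2 * \<eta> / 3\<close> at distance \<open>\<eta>\<close>, and the step function is rescaled
  to fall between these two values.\<close>

lemma uniform_cutoff:
 fixes a :: "nat \<Rightarrow> real"
 assumes a: "\<And>i. a i > 0" "summable a" and S: "S \<noteq> {}" and \<eta>: "0 < \<eta>" "\<eta> \<le> 1"
 obtains \<zeta> C where "tame \<zeta>" "\<And>x. x \<in> S ==> \<zeta> x = 1"
  "\<And>x. (\<And>y. y \<in> S ==> norm (x - y) \<ge> \<eta>) ==> \<zeta> x = 0"
  "C \<ge> 0" "\<And>k x. k \<le> m ==> Sq a k \<zeta> x \<le> ennreal C"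
proof -
 \<comment> \<open>Truncation at 1 provides the bound needed for smoothing; it does no harm below
   \<open>\<eta> \<le> 1\<close>.\<close>
 define e where "e x = min 1 (infdist x S)" for x
 have e1: "\<bar>e x\<bar> \<le> 1" for x using infdist_nonneg[of x S] by (auto simp: e_def)
 have e2: "\<bar>e x - e y\<bar> \<le> norm (x - y)" for x y
 proof -
  have "infdist x S \<le> infdist y S + norm (x - y)" "infdist y S \<le> infdist x S + norm (x - y)"
   using infdist_triangle[of x S y] infdist_triangle[of y S x] by (auto simp: dist_norm norm_minus_commute)
  then show ?thesis unfolding e_def by (auto simp: min_def abs_le_iff)
 qed
 have "\<eta> / 3 > 0" using \<eta> by simp
 then obtain D B where D: "tame D" "\<And>x. \<bar>D x - e x\<bar> \<le> \<eta> / 3" "B \<ge> 0" "\<And>k x. k \<le> m ==> Sq a k D x \<le> ennreal B"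
  using lipschitz_smoothing[OF a _ e1 e2, where m = m] by metis
 obtain th :: "nat \<Rightarrow> real \<Rightarrow> real" where th: "\<And>n t. DERIV (th n) t :> th (Suc n) t"
  "\<And>t. t \<le> 0 ==> th 0 t = 0" "\<And>t. t \<ge> 1 ==> th 0 t = 1" "\<And>n. bounded (range (th n))"
  using smooth_step_exists by blast
 define TH where "TH n t = (if n = 0 then 1 else 0) - (3 / \<eta>) ^ n * th n (3 / \<eta> * t - 1)" for n t
 have dTH: "DERIV (TH n) t :> TH (Suc n) t" for n t
 proof -
  have "DERIV (\<lambda>t. th n (3 / \<eta> * t - 1)) t :> th (Suc n) (3 / \<eta> * t - 1) * (3 / \<eta>)"
   by (rule DERIV_chain2[where f = "th n", OF th(1)]) (use \<eta> in \<open>auto intro!: derivative_eq_intros\<close>)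
  then show ?thesis unfolding TH_def using \<eta> by (auto intro!: derivative_eq_intros)
 qed
 have bTH: "bounded (range (TH n))" for n
 proof -
  obtain T where T: "\<And>t. \<bar>th n t\<bar> \<le> T" using th(4)[of n] unfolding bounded_iff by auto
  have "\<bar>TH n t\<bar> \<le> 1 + (3 / \<eta>) ^ n * T" for t
  proof -
   have "\<bar>TH n t\<bar> \<le> 1 + \<bar>(3 / \<eta>) ^ n * th n (3 / \<eta> * t - 1)\<bar>" unfolding TH_def by auto
   also have "\<dots> \<le> 1 + (3 / \<eta>) ^ n * T" using T \<eta> by (simp add: abs_mult mult_left_mono)
   finally show ?thesis .
  qed
  then show ?thesis unfolding bounded_iff by auto
 qed
 define \<zeta> where "\<zeta> x = TH 0 (D x)" for x
 obtain C where C: "C \<ge> 0" "\<And>f x k. tame f ==> k \<le> m ==> (\<forall>j\<in>{1..k}. Sq a j f x \<le> ennreal B) ==>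
  Sq a k (\<lambda>x. TH 0 (f x)) x \<le> ennreal C"
  using Sq_compose_bound[of TH B m a 0] dTH bTH D(3) by blast
 show ?thesis
 proof (rule that)
  show "tame \<zeta>" unfolding \<zeta>_def by (rule tame_compose[where th = TH, OF dTH D(1)])
  show "C \<ge> 0" by fact
  show "Sq a k \<zeta> x \<le> ennreal C" if "k \<le> m" for k x
   unfolding \<zeta>_def using C(2)[OF D(1) that] D(4) that by auto
  show "\<zeta> x = 1" if "x \<in> S" for x
  proof -
   have "e x = 0" using that by (simp add: e_def)
   then have "3 / \<eta> * D x - 1 \<le> 0" using D(2)[of x] \<eta> by (simp add: field_simps)
   then show ?thesis by (simp add: \<zeta>_def TH_def th(2))
  qed
  show "\<zeta> x = 0" if far: "\<And>y. y \<in> S ==> norm (x - y) \<ge> \<eta>" for x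
  proof -
   have "\<eta> \<le> infdist x S"
    unfolding infdist_notempty[OF S] using far by (intro cINF_greatest S) (simp add: dist_norm)
   then have "e x \<ge> \<eta>" using \<eta> by (simp add: e_def)
   moreover have "- (D x - e x) \<le> \<eta> / 3" using D(2)[of x] by (simp only: abs_le_iff)
   ultimately have "2 * \<eta> \<le> 3 * D x" by linarith
   then have "3 / \<eta> * D x - 1 \<ge> 1" using \<eta> by (simp add: field_simps)
   then show ?thesis by (simp add: \<zeta>_def TH_def th(3))
  qed
 qed
qed

text \<open>\<open>K\<close> shifts the index so that the exhaustion starts with a non-empty set and
  \<open>infdist\<close> to each of its members is a true distance.\<close>

locale exhaustion =
 fixes a :: "nat \<Rightarrow> real" and \<Omega> :: "ell2 set" and K :: nat
 assumes a_pos: "\<And>i. a i > 0" and a_summable: "summable a" and open_\<Omega>: "open \<Omega>"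
  and K: "K \<ge> 1" and V0: "Vset \<Omega> (real K) \<noteq> {}"
begin

definition V :: "nat \<Rightarrow> ell2 set" where "V n = Vset \<Omega> (real (n + K))"

text \<open>The slack between consecutive distance conditions; being at most 1, it also respects the
  slack in the norm conditions.\<close>

definition \<eta> :: "nat \<Rightarrow> real" where "\<eta> n = 1 / real (n + K) - 1 / real (n + K + 1)"

lemma \<eta>: "0 < \<eta> n" "\<eta> n \<le> 1"
proof -
 have "1 / real (n + K + 1) < 1 / real (n + K)" using K by (intro divide_strict_left_mono) auto
 then show "0 < \<eta> n" by (simp add: \<eta>_def)
 have "1 / real (n + K) \<le> 1" using K by simp
 moreover have "0 \<le> 1 / real (n + K + 1)" by simp
 ultimately show "\<eta> n \<le> 1" unfolding \<eta>_def by linarith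
qed

lemma \<eta>_antimono: "n \<le> k ==> \<eta> k \<le> \<eta> n"
proof (induction rule: dec_induct)
 case (step i)
 have "\<eta> j = 1 / (real (j + K) * real (j + K + 1))" for j
  unfolding \<eta>_def using K by (simp add: field_simps)
 then have "\<eta> (Suc i) \<le> \<eta> i" using K by (simp only:) (intro divide_left_mono mult_mono mult_pos_pos, auto)
 with step show ?case by linarith
qed simp

lemma V_near: "x \<in> V n ==> norm (y - x) < \<eta> n ==> y \<in> V (Suc n)"
 unfolding V_def by (rule Vset_near) (use K \<eta>(2)[of n] in \<open>auto simp: \<eta>_def add_ac\<close>)

lemma V_mono: "n \<le> k ==> V n \<subseteq> V k"
 unfolding V_def using K by (intro Vset_mono) auto

lemma V_subset: "V n \<subseteq> \<Omega>" and open_V: "open (V n)"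
 unfolding V_def using K by (auto intro!: Vset_subset open_Vset)

lemma V_nonempty: "V n \<noteq> {}"
 using V_mono[of 0 n] V0 by (auto simp: V_def)

lemma V_exhausts: "x \<in> \<Omega> ==> \<exists>n. x \<in> V n"
proof -
 assume "x \<in> \<Omega>"
 then obtain c where c: "c > 0" "x \<in> Vset \<Omega> c" using Vset_exhausts[OF open_\<Omega>] by blast
 obtain n where "c \<le> real n" using real_arch_simple by blast
 then have "x \<in> V n" using Vset_mono[of c "real (n + K)" \<Omega>] c by (auto simp: V_def)
 then show ?thesis ..
qed

lemma unif_incl_V: "unif_incl S \<Omega> ==> \<exists>n. S \<subseteq> V n"
proof -
 assume "unif_incl S \<Omega>"
 then obtain c where c: "c > 0" "S \<subseteq> Vset \<Omega> c" using unif_incl_subset_Vset by blast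
 obtain n where "c \<le> real n" using real_arch_simple by blast
 then have "S \<subseteq> V n" using Vset_mono[of c "real (n + K)" \<Omega>] c by (auto simp: V_def)
 then show ?thesis ..
qed

lemma V_unif_incl: "S \<subseteq> V n ==> unif_incl S \<Omega>"
 unfolding V_def using K by (intro unif_incl_Vset) auto

lemma closure_V: "closure (V n) \<subseteq> V (Suc n)"
proof
 fix x assume "x \<in> closure (V n)"
 then obtain y where "y \<in> V n" "dist y x < \<eta> n" using \<eta>(1) closure_approachable by blast
 then show "x \<in> V (Suc n)" using V_near[of y n x] by (simp add: dist_norm norm_minus_commute)
qed

lemma V_bounded: "x \<in> V n ==> norm x < real (n + K)"
 by (simp add: V_def Vset_def)

text \<open>The functions \<open>\<psi>\<close> are needed because products with the \<open>\<tau>\<close> have to be localised once more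
 after smoothing.\<close>

lemma partition:
 obtains \<tau> \<psi> :: "nat \<Rightarrow> ell2 \<Rightarrow> real" and C :: "nat \<Rightarrow> real" where
  "\<And>j. tame (\<tau> j)" "\<And>j. tame (\<psi> j)" "\<And>j. C j \<ge> 0"
  "\<And>j k x. k \<le> m ==> Sq a k (\<tau> j) x \<le> ennreal (C j)"
  "\<And>j k x. k \<le> m ==> Sq a k (\<psi> j) x \<le> ennreal (C j)"
  "\<And>j x. \<tau> j x \<noteq> 0 ==> x \<in> V (Suc j) \<and> \<psi> j x = 1"
  "\<And>j k x. x \<in> V k ==> k < j ==> \<tau> j x = 0"
  "\<And>J x. x \<in> V J ==> (\<Sum>j\<le>J. \<tau> j x) = 1"
  "\<And>j x. \<psi> j x \<noteq> 0 ==> x \<in> V (j + 2)"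
  "\<And>j k x. x \<in> V k ==> k + 2 \<le> j ==> \<psi> j x = 0"
proof -
 have "\<exists>z c. tame z \<and> (\<forall>x. x \<in> V n \<longrightarrow> z x = 1) \<and> (\<forall>x. x \<notin> V (Suc n) \<longrightarrow> z x = 0) \<and> c \<ge> 0 \<and>
   (\<forall>k x. k \<le> m \<longrightarrow> Sq a k z x \<le> ennreal c)" for n
 proof -
  obtain z c where z: "tame z" "\<And>x. x \<in> V n ==> z x = 1"
   "\<And>x. (\<And>y. y \<in> V n ==> norm (x - y) \<ge> \<eta> n) ==> z x = 0"
   "c \<ge> 0" "\<And>k x. k \<le> m ==> Sq a k z x \<le> ennreal c"
   using uniform_cutoff[OF a_pos a_summable V_nonempty \<eta>, where m = m] by metis
  have "z x = 0" if "x \<notin> V (Suc n)" for x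
   by (rule z(3)) (use V_near that in \<open>metis linorder_not_less\<close>)
  then show ?thesis using z by blast
 qed
 then obtain z :: "nat \<Rightarrow> ell2 \<Rightarrow> real" and c where z: "\<And>n. tame (z n)" "\<And>n x. x \<in> V n ==> z n x = 1"
  "\<And>n x. x \<notin> V (Suc n) ==> z n x = 0" "\<And>n. c n \<ge> 0" "\<And>n k x. k \<le> m ==> Sq a k (z n) x \<le> ennreal (c n)"
  by metis
 \<comment> \<open>Differences of consecutive cutoffs, so that the partial sums telescope to
   \<open>z J\<close>, which is 1 on \<open>V J\<close>.\<close>
 define \<tau> where "\<tau> j x = z j x - (if j = 0 then 0 else z (j - 1) x)" for j x
 \<comment> \<open>One index further out and one further in than \<open>\<tau> j\<close>: where
   \<open>\<tau> j\<close> is nonzero, the point lies in \<open>V (j + 1)\<close> but, if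
   \<open>j \<ge> 2\<close>, not in \<open>V (j - 1)\<close>, so \<open>z (j + 1)\<close> is 1 and
   \<open>z (j - 2)\<close> is 0.\<close>
 define \<psi> where "\<psi> j x = z (j + 1) x - (if j < 2 then 0 else z (j - 2) x)" for j x
 define C where "C j = 2 * (c j + c (j - 1)) + 2 * (c (j + 1) + c (j - 2))" for j
 have zt: "tame (\<lambda>x. if P then 0 else z n x)" for P n by (cases P) (auto intro: tame_const z)
 have zS: "k \<le> m ==> Sq a k (\<lambda>x. if P then 0 else z n x) x \<le> ennreal (c n)" for P n k x
  using z(5) by (cases P) auto
 have two: "k \<le> m ==> Sq a k (\<lambda>x. z i x - (if P then 0 else z j x)) x \<le> ennreal (2 * (c i + c j))" for i j k x P
 proof -
  assume k: "k \<le> m"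
  have "Sq a k (\<lambda>x. z i x - (if P then 0 else z j x)) x \<le> 2 * (Sq a k (z i) x + Sq a k (\<lambda>x. if P then 0 else z j x) x)"
   by (rule Sq_diff[OF z(1) zt])
  also have "\<dots> \<le> 2 * (ennreal (c i) + ennreal (c j))"
   by (intro mult_left_mono add_mono z(5) zS k) auto
  finally show ?thesis using z(4) by (simp add: ennreal_mult ennreal_plus)
 qed
 show ?thesis
 proof (rule that[of \<tau> \<psi> C])
  show "tame (\<tau> j)" "tame (\<psi> j)" for j unfolding \<tau>_def \<psi>_def by (intro tame_diff z(1) zt)+
  show "C j \<ge> 0" for j using z(4) by (simp add: C_def)
  show "Sq a k (\<tau> j) x \<le> ennreal (C j)" if "k \<le> m" for j k x
   using two[OF that, of j "j = 0" "j - 1" x] unfolding \<tau>_def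
   by (rule order_trans) (use z(4) in \<open>auto simp: C_def intro!: ennreal_leI\<close>)
  show "Sq a k (\<psi> j) x \<le> ennreal (C j)" if "k \<le> m" for j k x
   using two[OF that, of "j + 1" "j < 2" "j - 2" x] unfolding \<psi>_def
   by (rule order_trans) (use z(4) in \<open>auto simp: C_def intro!: ennreal_leI\<close>)
  show t0: "\<tau> j x = 0" if "x \<in> V k" "k < j" for j k x
  proof -
   have "k \<le> j - 1" "k \<le> j" using that by auto
   then have "x \<in> V j" "x \<in> V (j - 1)" using that(1) V_mono by blast+
   then show ?thesis using z(2)[of x j] z(2)[of x "j - 1"] that by (simp add: \<tau>_def)
  qed
  show "x \<in> V (Suc j) \<and> \<psi> j x = 1" if t: "\<tau> j x \<noteq> 0" for j x
  proof -
   have 1: "x \<in> V (Suc j)"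
   proof (rule ccontr)
    assume "x \<notin> V (Suc j)"
    moreover have "j > 0 ==> x \<notin> V j" using calculation V_mono[of j "Suc j"] by auto
    ultimately show False using t z(3)[of x j] z(3)[of x "j - 1"] by (auto simp: \<tau>_def split: if_splits)
   qed
   have "z (j - 2) x = 0" if "\<not> j < 2"
   proof (rule z(3))
    have "x \<notin> V (j - 1)" using t0[of x "j - 1" j] t that by auto
    then show "x \<notin> V (Suc (j - 2))" using that by (simp add: Suc_diff_le numeral_2_eq_2 Suc_diff_Suc)
   qed
   then show ?thesis using 1 z(2)[of x "j + 1"] by (simp add: \<psi>_def)
  qed
  show "(\<Sum>j\<le>J. \<tau> j x) = 1" if "x \<in> V J" for J x
  proof -
   have "(\<Sum>j\<le>J. \<tau> j x) = z J x" by (induction J) (auto simp: \<tau>_def)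
   then show ?thesis using z(2) that by simp
  qed
  show "x \<in> V (j + 2)" if p: "\<psi> j x \<noteq> 0" for j x
  proof (rule ccontr)
   assume "x \<notin> V (j + 2)"
   moreover have "Suc (j - 2) \<le> j + 2" by arith
   then have "x \<notin> V (Suc (j - 2))" using calculation V_mono by blast
   ultimately show False using p z(3)[of x "j + 1"] z(3)[of x "j - 2"] by (auto simp: \<psi>_def split: if_splits)
  qed
  show "\<psi> j x = 0" if "x \<in> V k" "k + 2 \<le> j" for j k x
  proof -
   have "k \<le> j - 2" "k \<le> j + 1" using that by arith+
   then have "x \<in> V (j - 2)" "x \<in> V (j + 1)" using that(1) V_mono by blast+
   then show ?thesis using z(2)[of x "j + 1"] z(2)[of x "j - 2"] that by (simp add: \<psi>_def)
  qed
 qed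
qed

end

section \<open>Cutting off the tail\<close>

lemma tail_tendsto_0:
 fixes f :: "nat \<Rightarrow> real"
 assumes "summable f"
 shows "(\<lambda>N. suminf (\<lambda>i. f (i + N))) \<longlonglongrightarrow> 0"
proof -
 have "(\<lambda>N. suminf f - (\<Sum>i<N. f i)) \<longlonglongrightarrow> suminf f - suminf f"
  by (intro tendsto_intros summable_LIMSEQ assms)
 then show ?thesis using suminf_minus_initial_segment[OF assms] by simp
qed

lemma suminf_tail_if:
 fixes f :: "nat \<Rightarrow> real"
 assumes "summable f"
 shows "suminf (\<lambda>i. if i < N then 0 else f i) = suminf (\<lambda>i. f (i + N))"
  "summable (\<lambda>i. if i < N then 0 else f i)"
proof -
 show s: "summable (\<lambda>i. if i < N then 0 else f i)"
  by (rule summable_cong[THEN iffD2, OF _ assms]) (auto intro: eventually_sequentiallyI[of N])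
 show "suminf (\<lambda>i. if i < N then 0 else f i) = suminf (\<lambda>i. f (i + N))"
  using suminf_split_initial_segment[OF s, of N] by simp
qed

lemma norm_trunc_diff_tail:
 "(norm (x - trunc N x))^2 = suminf (\<lambda>i. if i < N then 0 else (coord x i)^2)"
 unfolding norm_ell2_sq by (intro suminf_cong) (auto simp: coord_simps)

text \<open>A step function of \<open>q N x = (norm (x - trunc N x))^2 / t N\<close>. The scaling is
  balanced: \<open>a i \<le> t N\<close> for \<open>i \<ge> N\<close> and
  \<open>\<Sum> a i = t N\<close> over the tail keep the weighted derivatives of \<open>q N\<close>
  bounded independently of \<open>N\<close>, while \<open>x_i^2 = a_i * (x_i^2 / a_i)\<close> still
  forces \<open>q N x\<close> to 0 whenever \<open>\<Sum> x_i^2 / a_i\<close> converges.\<close>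

lemma tail_cutoff:
 fixes a :: "nat \<Rightarrow> real"
 assumes a: "\<And>i. a i > 0" "summable a"
 defines "t N \<equiv> suminf (\<lambda>i. a (i + N))"
 obtains \<kappa> :: "nat \<Rightarrow> ell2 \<Rightarrow> real" and C where
  "\<And>N. bsmooth (\<kappa> N)" "C \<ge> 0" "\<And>N k x. k \<le> m ==> Sq a k (\<kappa> N) x \<le> ennreal C"
  "\<And>N x. \<kappa> N x \<noteq> 0 ==> (norm (x - trunc N x))^2 \<le> 2 * t N"
  "\<And>x. summable (\<lambda>i. (coord x i)^2 / a i) ==>
   \<forall>\<^sub>F N in sequentially. \<exists>U. open U \<and> x \<in> U \<and> (\<forall>y\<in>U. \<kappa> N y = 1)"
proof -
 obtain th :: "nat \<Rightarrow> real \<Rightarrow> real" where th: "\<And>n t. DERIV (th n) t :> th (Suc n) t"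
  "\<And>t. t \<le> 0 ==> th 0 t = 0" "\<And>t. t \<ge> 1 ==> th 0 t = 1" "\<And>n. bounded (range (th n))"
  using smooth_step_exists by blast
 define TH where "TH n t = (if n = 0 then 1 else 0) - th n (t - 1)" for n t
 have dTH: "DERIV (TH n) t :> TH (Suc n) t" for n t
 proof -
  have "DERIV (\<lambda>t. th n (t - 1)) t :> th (Suc n) (t - 1) * 1"
   by (rule DERIV_chain2[where f = "th n", OF th(1)]) (auto intro!: derivative_eq_intros)
  then show ?thesis unfolding TH_def by (auto intro!: derivative_eq_intros)
 qed
 have bTH: "bounded (range (TH n))" for n
 proof -
  obtain T where T: "\<And>t. \<bar>th n t\<bar> \<le> T" using th(4)[of n] unfolding bounded_iff by auto
  have "\<bar>TH n t\<bar> \<le> 1 + T" for t using T[of "t - 1"] unfolding TH_def by auto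
  then show ?thesis unfolding bounded_iff by auto
 qed
 have sa: "summable (\<lambda>i. a (i + N))" for N using a(2) by (simp add: summable_iff_shift)
 have t: "t N > 0" for N unfolding t_def by (rule suminf_pos[OF sa]) (use a in auto)
 have at: "a i \<le> t N" if "N \<le> i" for i N
 proof -
  have "a (i - N + N) \<le> t N"
   unfolding t_def using sum_le_suminf[OF sa[of N], of "{i - N}"] a(1) by (auto intro: less_imp_le)
  then show ?thesis using that by simp
 qed
 define q where "q N x = (norm (x - trunc N x))^2 / t N" for N x
 have q_alt: "q N = (\<lambda>x. (1 / t N) * ((norm x)^2 - (\<Sum>i<N. coord x i * coord x i)))" for N
  unfolding q_def norm_trunc_diff by (simp add: power2_eq_square)
 have bq: "bsmooth (q N)" for N
  unfolding q_alt by (intro bsmooth_cmult bsmooth_diff bsmooth_norm_sq bsmooth_sum bsmooth_mult bsmooth_coord)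
 have tq: "tame (q N)" for N by (rule bsmooth_tame[OF bq])
 have pdq: "pd i (q N) = (\<lambda>x. (if i < N then 0 else 2 / t N) * coord x i)" for i N
 proof
  fix x
  let ?w = "unit_vec i - trunc N (unit_vec i)" and ?y = "x - trunc N x"
  have w: "?w = (if i < N then 0 else unit_vec i)" by (rule ell2_eqI) (auto simp: coord_simps)
  have "DERIV (\<lambda>s. (norm (?y + s *\<^sub>R ?w))^2 / t N) 0 :> 2 * inner ?y ?w / t N"
   using t[of N] by (auto simp: power2_norm_eq_inner inner_add_right inner_add_left inner_commute
    intro!: derivative_eq_intros)
  moreover have "(\<lambda>s. q N (x + s *\<^sub>R unit_vec i)) = (\<lambda>s. (norm (?y + s *\<^sub>R ?w))^2 / t N)"
   unfolding q_def trunc_add_scale by (simp add: algebra_simps)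
  moreover have "2 * inner ?y ?w / t N = (if i < N then 0 else 2 / t N) * coord x i"
   unfolding w by (simp add: coord_simps)
  ultimately have "DERIV (\<lambda>s. q N (x + s *\<^sub>R unit_vec i)) 0 :> (if i < N then 0 else 2 / t N) * coord x i"
   by (simp only:)
  from dd_eqI(2)[OF this] show "pd i (q N) x = (if i < N then 0 else 2 / t N) * coord x i" by (simp add: pd_eq_dd)
 qed
 have pdpdq: "pd j (pd i (q N)) = (\<lambda>x. if i < N \<or> i \<noteq> j then 0 else 2 / t N)" for i j N
  unfolding pdq by (subst tame_pd_cmult[OF tame_coord]) (auto simp: pd_coord)
 have S1: "Sq a 1 (q N) x \<le> ennreal (4 * q N x)" for N x
 proof -
  have "Sq a 1 (q N) x = suminf (\<lambda>i. ennreal (a i * ((if i < N then 0 else 2 / t N) * coord x i)^2))"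
   using a(1) by (simp add: pdq ennreal_mult less_imp_le)
  also have "\<dots> \<le> suminf (\<lambda>i. ennreal (4 / t N * (if i < N then 0 else (coord x i)^2)))"
  proof (intro suminf_le ennreal_leI)
   fix i
   show "a i * ((if i < N then 0 else 2 / t N) * coord x i)^2 \<le> 4 / t N * (if i < N then 0 else (coord x i)^2)"
   proof (cases "i < N")
    case False
    have "a i * (2 / t N * coord x i)^2 \<le> t N * (2 / t N * coord x i)^2"
     using at[of N i] False by (intro mult_right_mono) auto
    also have "\<dots> = 4 / t N * (coord x i)^2" using t[of N] by (simp add: power2_eq_square)
    finally show ?thesis using False by simp
   qed simp
  qed auto
  also have "\<dots> = ennreal (4 / t N * suminf (\<lambda>i. if i < N then 0 else (coord x i)^2))"
   by (subst suminf_mult[OF suminf_tail_if(2)[OF summable_coord_sq], symmetric],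
     intro suminf_ennreal2 summable_mult suminf_tail_if(2) summable_coord_sq)
    (use t[of N] in auto)
  finally show ?thesis by (simp add: q_def norm_trunc_diff_tail)
 qed
 have S2: "Sq a 2 (q N) x \<le> ennreal 4" for N x
 proof -
  have "Sq a 2 (q N) x = suminf (\<lambda>i. suminf (\<lambda>j. ennreal (a i) * (ennreal (a j) * ennreal ((if i < N \<or> i \<noteq> j then 0 else 2 / t N)^2))))"
   by (simp add: numeral_2_eq_2 pdpdq)
  also have "\<dots> = suminf (\<lambda>i. ennreal (if i < N then 0 else a i * (a i * (2 / t N)^2)))"
  proof (intro suminf_cong)
   fix i
   have "suminf (\<lambda>j. ennreal (a i) * (ennreal (a j) * ennreal ((if i < N \<or> i \<noteq> j then 0 else 2 / t N)^2)))
    = (\<Sum>j\<in>{i}. ennreal (a i) * (ennreal (a j) * ennreal ((if i < N \<or> i \<noteq> j then 0 else 2 / t N)^2)))"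
    by (rule suminf_finite) auto
   then show "suminf (\<lambda>j. ennreal (a i) * (ennreal (a j) * ennreal ((if i < N \<or> i \<noteq> j then 0 else 2 / t N)^2)))
    = ennreal (if i < N then 0 else a i * (a i * (2 / t N)^2))"
    using a(1)[of i] by (auto simp: ennreal_mult less_imp_le)
  qed
  also have "\<dots> \<le> suminf (\<lambda>i. ennreal (4 / t N * (if i < N then 0 else a i)))"
  proof (intro suminf_le ennreal_leI)
   fix i
   show "(if i < N then 0 else a i * (a i * (2 / t N)^2)) \<le> 4 / t N * (if i < N then 0 else a i)"
   proof (cases "i < N")
    case False
    have "a i * (a i * (2 / t N)^2) \<le> t N * (a i * (2 / t N)^2)"
     using at[of N i] False a(1)[of i] by (intro mult_right_mono) auto
    also have "\<dots> = 4 / t N * a i" using t[of N] by (simp add: power2_eq_square)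
    finally show ?thesis using False by simp
   qed simp
  qed auto
  also have "\<dots> = ennreal (4 / t N * suminf (\<lambda>i. if i < N then 0 else a i))"
   by (subst suminf_mult[OF suminf_tail_if(2)[OF a(2)], symmetric],
     intro suminf_ennreal2 summable_mult suminf_tail_if(2) a(2))
    (use t[of N] a(1) in \<open>auto simp: less_imp_le\<close>)
  also have "\<dots> = ennreal 4" using suminf_tail_if(1)[OF a(2), of N] t[of N] by (simp add: t_def)
  finally show ?thesis .
 qed
 have S3: "Sq a (Suc (Suc (Suc k))) (q N) x = 0" for N k x
  by (simp add: pdpdq) (simp add: pd_eq_dd)
 \<comment> \<open>8 is the first-order bound \<open>4 * q N x\<close> at \<open>q N x = 2\<close>;
   it also dominates the second-order bound 4, and higher derivatives vanish.\<close>
 obtain C where C: "C \<ge> 0" "\<And>f x k. tame f ==> k \<le> m ==> (\<forall>j\<in>{1..k}. Sq a j f x \<le> ennreal 8) ==>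
  Sq a k (\<lambda>x. TH 0 (f x)) x \<le> ennreal C"
  using Sq_compose_bound[of TH 8 m a 0] dTH bTH by auto
 define \<kappa> where "\<kappa> N x = TH 0 (q N x)" for N x
 have cq: "continuous_on UNIV (q N)" for N by (rule tame_continuous[OF tq])
 show ?thesis
 proof (rule that[of \<kappa> C])
  show "bsmooth (\<kappa> N)" for N unfolding \<kappa>_def by (rule bsmooth_compose[where th = TH, OF dTH bq])
  show "C \<ge> 0" by fact
  show "Sq a k (\<kappa> N) x \<le> ennreal C" if k: "k \<le> m" for N k x
  \<comment> \<open>Beyond 2 the cutoff vanishes on a neighbourhood, so derivatives of
    \<open>q N\<close> have to be controlled only where it is at most 2.\<close>
  proof (cases "q N x > 2")
   case True
   have "open {x. q N x > 2}" by (rule open_Collect_less) (auto intro: cq)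
   then have "Sq a k (\<kappa> N) x = Sq a k (\<lambda>x. 0) x"
    using True by (intro Sq_cong_local[of "{x. q N x > 2}"]) (auto simp: \<kappa>_def TH_def th(3))
   then show ?thesis by simp
  next
   case False
   have "Sq a j (q N) x \<le> ennreal 8" if "j \<in> {1..k}" for j
   proof -
    have "j \<noteq> 1 ==> j \<noteq> 2 ==> j = Suc (Suc (Suc (j - 3)))" using that by auto
    then consider "j = 1" | "j = 2" | k' where "j = Suc (Suc (Suc k'))" by blast
    then show ?thesis
    proof cases
     case 1
     have "ennreal (4 * q N x) \<le> ennreal 8" using False by (intro ennreal_leI) auto
     then show ?thesis using S1[of N x] 1 by (metis order_trans)
    next
     case 2
     have "ennreal 4 \<le> ennreal 8" by (intro ennreal_leI) auto
     then show ?thesis using S2[of N x] 2 by (metis order_trans)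
    next
     case 3
     then show ?thesis using S3[of k' N x] by (simp del: Sq.simps)
    qed
   qed
   then show ?thesis unfolding \<kappa>_def using C(2)[OF tq k] by blast
  qed
  show "(norm (x - trunc N x))^2 \<le> 2 * t N" if "\<kappa> N x \<noteq> 0" for N x
  proof (rule ccontr)
   assume "\<not> ?thesis"
   then have "q N x > 2" using t[of N] by (simp add: q_def pos_less_divide_eq)
   then show False using that by (simp add: \<kappa>_def TH_def th(3))
  qed
  fix x assume x: "summable (\<lambda>i. (coord x i)^2 / a i)"
  have "q N x \<le> suminf (\<lambda>i. (coord x (i + N))^2 / a (i + N))" for N
  proof -
   have s: "summable (\<lambda>i. (coord x (i + N))^2 / a (i + N))"
    using x summable_iff_shift[of "\<lambda>i. (coord x i)^2 / a i" N] by simp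
   have "(norm (x - trunc N x))^2 = suminf (\<lambda>i. (coord x (i + N))^2)"
    unfolding norm_trunc_diff_tail by (rule suminf_tail_if(1)[OF summable_coord_sq])
   also have "\<dots> \<le> suminf (\<lambda>i. t N * ((coord x (i + N))^2 / a (i + N)))"
   proof (rule suminf_le)
    fix i
    have "a (i + N) * ((coord x (i + N))^2 / a (i + N)) \<le> t N * ((coord x (i + N))^2 / a (i + N))"
     using at[of N "i + N"] a(1)[of "i + N"] by (intro mult_right_mono) auto
    then show "(coord x (i + N))^2 \<le> t N * ((coord x (i + N))^2 / a (i + N))"
     using a(1)[of "i + N"] by simp
   qed (use summable_coord_sq[of x] summable_mult[OF s, of "t N"] in \<open>auto simp: summable_iff_shift[of "\<lambda>i. (coord x i)^2"] intro: summable_mult\<close>)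
   also have "\<dots> = t N * suminf (\<lambda>i. (coord x (i + N))^2 / a (i + N))" by (rule suminf_mult[OF s])
   finally show ?thesis using t[of N] by (simp add: q_def pos_divide_le_eq mult.commute)
  qed
  moreover have "\<forall>\<^sub>F N in sequentially. suminf (\<lambda>i. (coord x (i + N))^2 / a (i + N)) < 1"
   using tail_tendsto_0[OF x] by (rule order_tendstoD) simp
  ultimately have "\<forall>\<^sub>F N in sequentially. q N x < 1"
   by (auto elim!: eventually_mono intro: le_less_trans)
  then show "\<forall>\<^sub>F N in sequentially. \<exists>U. open U \<and> x \<in> U \<and> (\<forall>y\<in>U. \<kappa> N y = 1)"
  proof eventually_elim
   case (elim N)
   have "open {x. q N x < 1}" by (rule open_Collect_less) (auto intro: cq)
   then show ?case using elim by (intro exI[of _ "{x. q N x < 1}"]) (auto simp: \<kappa>_def TH_def th(2))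
  qed
 qed
qed

text \<open>\<open>\<psi>\<close> composed with \<open>trunc N\<close> is Frechet smooth but
  supported in a cylinder; the tail cutoff confines \<open>x\<close> to the vicinity of
  \<open>trunc N x\<close>, where \<open>\<psi>\<close> is nonzero. Where the tail cutoff is locally
  1, the derivatives are those of \<open>\<psi>\<close> at \<open>trunc N x\<close>, which tends to
  \<open>x\<close>.\<close>

lemma smooth_localization:
 fixes a :: "nat \<Rightarrow> real"
 assumes a: "\<And>i. a i > 0" "summable a" and \<psi>: "tame \<psi>" and B: "B \<ge> 0" "\<And>k x. k \<le> m ==> Sq a k \<psi> x \<le> ennreal B"
  and \<epsilon>: "\<epsilon> > 0"
 obtains \<Psi> :: "nat \<Rightarrow> ell2 \<Rightarrow> real" and C where
  "\<And>N. bsmooth (\<Psi> N)" "C \<ge> 0" "\<And>N k x. k \<le> m ==> Sq a k (\<Psi> N) x \<le> ennreal C"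
  "\<And>N x. \<Psi> N x \<noteq> 0 ==> \<exists>y. norm (x - y) < \<epsilon> \<and> \<psi> y \<noteq> 0"
  "\<And>x is. summable (\<lambda>i. (coord x i)^2 / a i) ==> (\<lambda>N. pds is (\<Psi> N) x) \<longlonglongrightarrow> pds is \<psi> x"
proof -
 define t where "t N = suminf (\<lambda>i. a (i + N))" for N
 obtain \<kappa> D where \<kappa>: "\<And>N. bsmooth (\<kappa> N)" "D \<ge> 0" "\<And>N k x. k \<le> m ==> Sq a k (\<kappa> N) x \<le> ennreal D"
  "\<And>N x. \<kappa> N x \<noteq> 0 ==> (norm (x - trunc N x))^2 \<le> 2 * t N"
  "\<And>x. summable (\<lambda>i. (coord x i)^2 / a i) ==>
   \<forall>\<^sub>F N in sequentially. \<exists>U. open U \<and> x \<in> U \<and> (\<forall>y\<in>U. \<kappa> N y = 1)"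
  by (rule tail_cutoff[OF a, where m = m, folded t_def]) (rule that, assumption+)
 have "t \<longlonglongrightarrow> 0" unfolding t_def by (rule tail_tendsto_0[OF a(2)])
 then have "\<forall>\<^sub>F N in sequentially. t N < \<epsilon>^2 / 2" by (rule order_tendstoD) (use \<epsilon> in simp)
 \<comment> \<open>The tail cutoff forces \<open>(norm (x - trunc N x))^2 \<le> 2 * t N\<close>,
   which is below \<open>\<epsilon>^2\<close> from \<open>N0\<close> on.\<close>
 then obtain N0 where N0: "\<And>N. N \<ge> N0 ==> t N < \<epsilon>^2 / 2" unfolding eventually_sequentially by blast
 define \<Psi> where "\<Psi> N x = \<psi> (trunc (N + N0) x) * \<kappa> (N + N0) x" for N x
 obtain C where C: "C \<ge> 0"
  "\<And>f g x k. tame f ==> tame g ==> k \<le> m ==> \<forall>j\<le>k. Sq a j f x \<le> ennreal B ==>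
   \<forall>j\<le>k. Sq a j g x \<le> ennreal D ==> Sq a k (\<lambda>x. f x * g x) x \<le> ennreal C"
  using Sq_mult_bound[OF B(1) \<kappa>(2), of m a] by blast
 show ?thesis
 proof (rule that[of \<Psi> C])
  show "bsmooth (\<Psi> N)" for N unfolding \<Psi>_def by (intro bsmooth_mult bsmooth_trunc \<psi> \<kappa>)
  show "C \<ge> 0" by fact
  show "Sq a k (\<Psi> N) x \<le> ennreal C" if "k \<le> m" for N k x
   unfolding \<Psi>_def
  proof (rule C(2))
   show "\<forall>j\<le>k. Sq a j (\<lambda>x. \<psi> (trunc (N + N0) x)) x \<le> ennreal B"
   proof (intro allI impI)
    fix j assume "j \<le> k"
    then have "Sq a j \<psi> (trunc (N + N0) x) \<le> ennreal B" using B(2) that by simp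
    then show "Sq a j (\<lambda>x. \<psi> (trunc (N + N0) x)) x \<le> ennreal B" by (rule order_trans[OF Sq_trunc[OF \<psi>]])
   qed
  qed (use that \<kappa> bsmooth_tame bsmooth_trunc \<psi> in auto)
  show "\<exists>y. norm (x - y) < \<epsilon> \<and> \<psi> y \<noteq> 0" if "\<Psi> N x \<noteq> 0" for N x
  proof (intro exI conjI)
   have "(norm (x - trunc (N + N0) x))^2 < \<epsilon>^2" using \<kappa>(4)[of "N + N0" x] that N0[of "N + N0"] by (auto simp: \<Psi>_def)
   then show "norm (x - trunc (N + N0) x) < \<epsilon>" using \<epsilon> by (intro power2_less_imp_less[of _ \<epsilon>]) auto
   show "\<psi> (trunc (N + N0) x) \<noteq> 0" using that by (auto simp: \<Psi>_def)
  qed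
  fix x "is" assume "summable (\<lambda>i. (coord x i)^2 / a i)"
  from \<kappa>(5)[OF this] obtain N1 where N1: "\<And>N. N \<ge> N1 ==> \<exists>U. open U \<and> x \<in> U \<and> (\<forall>y\<in>U. \<kappa> N y = 1)"
   unfolding eventually_sequentially by blast
  \<comment> \<open>From here on every direction in the list survives the projection;
    \<open>insert 0\<close> keeps the maximum meaningful for the empty list.\<close>
  define N2 where "N2 = max N1 (Suc (Max (insert 0 (set is))))"
  have "pds is \<psi> (trunc (N + N0) x) = pds is (\<Psi> N) x" if N: "N \<ge> N2" for N
  proof -
   obtain U where U: "open U" "x \<in> U" "\<forall>y\<in>U. \<kappa> (N + N0) y = 1" using N1[of "N + N0"] N by (auto simp: N2_def)
   have "i < N + N0" if "i \<in> set is" for i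
   proof -
    have "i \<le> Max (insert 0 (set is))" using that by (intro Max_ge) auto
    then show ?thesis using N by (simp add: N2_def)
   qed
   then have "set is \<subseteq> {..<N + N0}" by auto
   then have "pds is \<psi> (trunc (N + N0) x) = pds is (\<lambda>x. \<psi> (trunc (N + N0) x)) x"
    by (simp add: pds_trunc[OF \<psi>])
   also have "\<dots> = pds is (\<Psi> N) x"
    by (rule pds_cong_local[OF U(1,2)]) (use U(3) in \<open>simp add: \<Psi>_def\<close>)
   finally show ?thesis .
  qed
  then have ev: "\<forall>\<^sub>F N in sequentially. pds is \<psi> (trunc (N + N0) x) = pds is (\<Psi> N) x"
   by (rule eventually_sequentiallyI)
  have "(\<lambda>N. trunc (N + N0) x) \<longlonglongrightarrow> x" by (rule LIMSEQ_ignore_initial_segment[OF trunc_tendsto])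
  then have "(\<lambda>N. pds is \<psi> (trunc (N + N0) x)) \<longlonglongrightarrow> pds is \<psi> x"
   using tame_continuous[OF tame_pds[OF \<psi>], of UNIV]
   by (intro isCont_tendsto_compose[of x "pds is \<psi>"]) (auto simp: continuous_on_eq_continuous_at)
  then show "(\<lambda>N. pds is (\<Psi> N) x) \<longlonglongrightarrow> pds is \<psi> x" by (rule Lim_transform_eventually[OF _ ev])
 qed
qed

section \<open>The Mehler kernel\<close>

text \<open>\<open>mk c \<sigma> x\<close> is the density of the normal distribution with mean \<open>c * x\<close> and variance
 \<open>(1 - c^2) * \<sigma>^2\<close> with respect to the one with mean \<open>0\<close> and variance \<open>\<sigma>^2\<close>.\<close>

definition mk :: "real \<Rightarrow> real \<Rightarrow> real \<Rightarrow> real \<Rightarrow> real" where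
 "mk c \<sigma> x z = exp (- (c\<^sup>2 * x\<^sup>2 - 2 * c * x * z + c\<^sup>2 * z\<^sup>2) / (2 * (1 - c\<^sup>2) * \<sigma>\<^sup>2)) / sqrt (1 - c\<^sup>2)"

lemma mk_commute: "mk c \<sigma> x z = mk c \<sigma> z x"
 by (simp add: mk_def algebra_simps)

lemma mk_nonneg [simp]: "\<bar>c\<bar> < 1 ==> 0 \<le> mk c \<sigma> x z"
 by (simp add: mk_def abs_square_le_1 less_imp_le)

lemma one_minus_sq_pos: "\<bar>c\<bar> < 1 ==> 0 < 1 - (c::real)^2"
 by (simp add: abs_square_less_1)

lemma normal_density_mk:
 assumes "\<bar>c\<bar> < 1" "\<sigma> > 0"
 shows "normal_density 0 \<sigma> z * mk c \<sigma> x z = normal_density (c * x) (sqrt (1 - c^2) * \<sigma>) z"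
proof -
 define q where "q = 1 - c^2"
 have q: "q > 0" using one_minus_sq_pos[OF assms(1)] by (simp add: q_def)
 have e: "- (z - c * x)\<^sup>2 / (2 * (q * \<sigma>\<^sup>2)) =
   - (z - 0)\<^sup>2 / (2 * \<sigma>\<^sup>2) + - (c\<^sup>2 * x\<^sup>2 - 2 * c * x * z + c\<^sup>2 * z\<^sup>2) / (2 * q * \<sigma>\<^sup>2)"
 proof -
  have "- (z - 0)\<^sup>2 / (2 * \<sigma>\<^sup>2) = - (q * z\<^sup>2) / (2 * q * \<sigma>\<^sup>2)" using q by simp
  then have "- (z - 0)\<^sup>2 / (2 * \<sigma>\<^sup>2) + - (c\<^sup>2 * x\<^sup>2 - 2 * c * x * z + c\<^sup>2 * z\<^sup>2) / (2 * q * \<sigma>\<^sup>2)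
    = (- (q * z\<^sup>2) + - (c\<^sup>2 * x\<^sup>2 - 2 * c * x * z + c\<^sup>2 * z\<^sup>2)) / (2 * q * \<sigma>\<^sup>2)"
   by (simp only: add_divide_distrib)
  also have "- (q * z\<^sup>2) + - (c\<^sup>2 * x\<^sup>2 - 2 * c * x * z + c\<^sup>2 * z\<^sup>2) = - (z - c * x)\<^sup>2"
   by (simp add: q_def power2_eq_square algebra_simps)
  finally show ?thesis by (simp add: mult.assoc)
 qed
 have "normal_density (c * x) (sqrt q * \<sigma>) z = exp (- (z - c * x)\<^sup>2 / (2 * (q * \<sigma>\<^sup>2))) / sqrt (2 * pi * (q * \<sigma>\<^sup>2))"
  using q by (simp add: normal_density_def power_mult_distrib)
 also have "\<dots> = normal_density 0 \<sigma> z * mk c \<sigma> x z"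
  unfolding e exp_add normal_density_def mk_def q_def[symmetric] by (simp add: real_sqrt_mult)
 finally show ?thesis by (simp add: q_def)
qed

text \<open>For fixed \<open>x\<close> the kernel is bounded in \<open>z\<close>: the numerator of
  the exponent is \<open>(1 - c^2) * x^2 - (x - c * z)^2\<close>.\<close>

lemma mk_bound: "\<bar>c\<bar> < 1 ==> mk c \<sigma> x z \<le> exp (x^2 / (2 * \<sigma>^2)) / sqrt (1 - c^2)"
proof -
 assume c: "\<bar>c\<bar> < 1"
 define q where "q = 1 - c^2"
 have q: "q > 0" using one_minus_sq_pos[OF c] by (simp add: q_def)
 have "- (c\<^sup>2 * x\<^sup>2 - 2 * c * x * z + c\<^sup>2 * z\<^sup>2) = q * x\<^sup>2 - (x - c * z)\<^sup>2"
  by (simp add: q_def power2_eq_square algebra_simps)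
 also have "\<dots> \<le> q * x^2" by simp
 finally have "- (c\<^sup>2 * x\<^sup>2 - 2 * c * x * z + c\<^sup>2 * z\<^sup>2) / (2 * q * \<sigma>\<^sup>2) \<le> q * x\<^sup>2 / (2 * q * \<sigma>\<^sup>2)"
  using q by (intro divide_right_mono) auto
 also have "\<dots> = x^2 / (2 * \<sigma>^2)" using q by simp
 finally show ?thesis unfolding mk_def q_def[symmetric] using q by (intro divide_right_mono) auto
qed

lemma measurable_mk [measurable]:
 assumes [measurable]: "f \<in> borel_measurable M" "g \<in> borel_measurable M"
 shows "(\<lambda>w. mk c \<sigma> (f w) (g w)) \<in> borel_measurable M"
 unfolding mk_def by measurable

section \<open>Jensen's inequality and elementary power estimates\<close>

lemma powr_tangent:
 assumes "p \<ge> 1" "A > 0" "t \<ge> (0::real)"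
 shows "A powr p + p * A powr (p - 1) * (t - A) \<le> t powr p"
proof (cases "t = 0")
 case True
 have "A powr p = A powr (p - 1) * A" using assms(2) by (simp add: powr_diff)
 then have "A powr p + p * A powr (p - 1) * (t - A) = (1 - p) * A powr p" using True by (simp add: algebra_simps)
 also have "\<dots> \<le> 0" using assms by (intro mult_nonpos_nonneg) auto
 finally show ?thesis using True assms by simp
next
 case False
 have "(\<lambda>x. x powr p) t - (\<lambda>x. x powr p) A \<ge> (p * A powr (p - 1)) * (t - A)"
 proof (rule convex_on_imp_above_tangent[OF powr_convex[OF assms(1)]])
  show "((\<lambda>x. x powr p) has_real_derivative p * A powr (p - 1)) (at A within {0<..})"
   using assms(2) by (intro has_field_derivative_at_within[OF has_real_derivative_powr]) auto
 qed (use assms False in \<open>auto simp: interior_open\<close>)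
 then show ?thesis by simp
qed

text \<open>The tangent line of \<open>t powr p\<close> at the mean of \<open>|v|\<close> lies below
  the graph; its integral is the value at the mean.\<close>

lemma (in prob_space) powr_jensen:
 fixes p :: real and v :: "'a \<Rightarrow> real"
 assumes p: "p \<ge> 1" and int: "integrable M (\<lambda>x. \<bar>v x\<bar> powr p)" "v \<in> borel_measurable M"
 shows "integrable M v" "\<bar>\<integral>x. v x \<partial>M\<bar> powr p \<le> (\<integral>x. \<bar>v x\<bar> powr p \<partial>M)"
proof -
 have le: "\<bar>t\<bar> \<le> 1 + \<bar>t\<bar> powr p" for t :: real
 proof (cases "\<bar>t\<bar> \<le> 1")
  case False
  then have "\<bar>t\<bar> powr 1 \<le> \<bar>t\<bar> powr p" using p by (intro powr_mono) auto
  then show ?thesis using False by simp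
 qed (simp add: add_increasing2)
 show v: "integrable M v"
  by (rule bint_bound[where f = "\<lambda>x. 1 + \<bar>v x\<bar> powr p"])
   (use int le in \<open>auto intro!: AE_I2 intro: order_trans[OF _ abs_ge_self]\<close>)
 define A where "A = (\<integral>x. \<bar>v x\<bar> \<partial>M)"
 have A0: "A \<ge> 0" unfolding A_def by (intro integral_nonneg_AE) auto
 have "A powr p \<le> (\<integral>x. \<bar>v x\<bar> powr p \<partial>M)"
 proof (cases "A = 0")
  case True
  then show ?thesis using p by (simp add: integral_nonneg_AE)
 next
  case False
  have "(\<integral>x. A powr p + p * A powr (p - 1) * (\<bar>v x\<bar> - A) \<partial>M) \<le> (\<integral>x. \<bar>v x\<bar> powr p \<partial>M)"
   using powr_tangent[OF p, of A] False A0 v int by (intro integral_mono) auto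
  also have "(\<integral>x. A powr p + p * A powr (p - 1) * (\<bar>v x\<bar> - A) \<partial>M) = A powr p"
   using v by (simp add: prob_space A_def[symmetric])
  finally show ?thesis .
 qed
 moreover have "\<bar>\<integral>x. v x \<partial>M\<bar> powr p \<le> A powr p"
  unfolding A_def using p by (intro powr_mono2 integral_abs_bound) auto
 ultimately show "\<bar>\<integral>x. v x \<partial>M\<bar> powr p \<le> (\<integral>x. \<bar>v x\<bar> powr p \<partial>M)" by linarith
qed

lemma tendsto_0_ennreal_eps:
 fixes f :: "'a \<Rightarrow> ennreal"
 assumes "\<And>\<epsilon>::real. \<epsilon> > 0 ==> \<forall>\<^sub>F n in F. f n \<le> ennreal \<epsilon>"
 shows "(f \<longlongrightarrow> 0) F"
proof (rule order_tendstoI)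
 fix y :: ennreal assume "0 < y"
 then obtain e where e: "0 < e" "e < y" using dense by blast
 then have "e < \<top>" by (meson order.strict_trans2 top_greatest)
 then have "e = ennreal (enn2real e)" "enn2real e > 0"
  using e(1) by (auto simp: enn2real_positive_iff)
 then show "\<forall>\<^sub>F n in F. f n < y" using assms[of "enn2real e"] e(2) by (auto elim!: eventually_mono)
qed auto

lemma powr_add_le:
 fixes x y p :: real
 assumes "p \<ge> 0"
 shows "\<bar>x + y\<bar> powr p \<le> 2 powr p * (\<bar>x\<bar> powr p + \<bar>y\<bar> powr p)"
proof -
 have "\<bar>x + y\<bar> powr p \<le> (2 * max \<bar>x\<bar> \<bar>y\<bar>) powr p" using assms by (intro powr_mono2) auto
 also have "\<dots> = 2 powr p * max \<bar>x\<bar> \<bar>y\<bar> powr p" by (simp add: powr_mult)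
 also have "\<dots> \<le> 2 powr p * (\<bar>x\<bar> powr p + \<bar>y\<bar> powr p)" by (intro mult_left_mono) (auto simp: max_def)
 finally show ?thesis .
qed

section \<open>The Mehler operator as a contraction and its pointwise limit\<close>

context gaussian_seq
begin

text \<open>Any finite set of coordinates is allowed because computations split off one coordinate
  at a time.\<close>

definition KJ :: "real \<Rightarrow> nat set \<Rightarrow> ell2 \<Rightarrow> ell2 \<Rightarrow> real" where
 "KJ c J x z = (\<Prod>i\<in>J. mk c (b i) (coord x i) (coord z i))"

text \<open>For \<open>0 < c < 1\<close> this is Mehler's formula at time \<open>- ln c\<close> in
  the first \<open>n\<close> coordinates; the coordinates from \<open>n\<close> on have kernel 1, so
  they are averaged out and the result depends on the first \<open>n\<close> only.\<close>

definition mehler :: "real \<Rightarrow> nat \<Rightarrow> (ell2 \<Rightarrow> real) \<Rightarrow> ell2 \<Rightarrow> real" where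
 "mehler c n v x = (\<integral>z. v z * KJ c {..<n} x z \<partial>G)"

lemma KJ_commute: "KJ c J x z = KJ c J z x"
 unfolding KJ_def by (intro prod.cong refl mk_commute)

lemma KJ_nonneg [simp]: "\<bar>c\<bar> < 1 ==> 0 \<le> KJ c J x z"
 unfolding KJ_def by (intro prod_nonneg) auto

lemma measurable_KJ [measurable]:
 assumes [measurable]: "f \<in> borel_measurable M" "g \<in> borel_measurable M"
 shows "(\<lambda>w. KJ c J (f w) (g w)) \<in> borel_measurable M"
 unfolding KJ_def by measurable

lemma nn_integral_mk: "\<bar>c\<bar> < 1 ==> (\<integral>\<^sup>+t. ennreal (mk c (b i) x t) \<partial>nd i) = 1"
proof -
 assume c: "\<bar>c\<bar> < 1"
 have s: "sqrt (1 - c^2) * b i > 0" using one_minus_sq_pos[OF c] pos[of i] by simp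
 have "(\<integral>\<^sup>+t. ennreal (mk c (b i) x t) \<partial>nd i) = (\<integral>\<^sup>+t. ennreal (normal_density (c * x) (sqrt (1 - c^2) * b i) t) \<partial>lborel)"
  by (subst nn_integral_density) (auto simp: ennreal_mult[symmetric] c normal_density_mk[OF c pos])
 also have "\<dots> = 1"
  using s by (subst nn_integral_eq_integral) auto
 finally show ?thesis .
qed

text \<open>With \<open>t - x = (t - c * x) - (1 - c) * x\<close> the second moment splits into the
  variance \<open>(1 - c^2) * (b i)^2\<close> and the squared drift.\<close>

lemma nn_integral_mk_sq:
 assumes c: "\<bar>c\<bar> < 1"
 shows "(\<integral>\<^sup>+t. ennreal (mk c (b i) x t * (t - x)^2) \<partial>nd i) \<le> ennreal (2 * ((1 - c^2) * (b i)^2) + 2 * ((1 - c)^2 * x^2))"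
proof -
 let ?s = "sqrt (1 - c^2) * b i"
 have s: "?s > 0" using one_minus_sq_pos[OF c] pos[of i] by simp
 have s2: "?s^2 = (1 - c^2) * (b i)^2" using one_minus_sq_pos[OF c] by (simp add: power_mult_distrib)
 have le: "(t - x)^2 \<le> 2 * (t - c * x)^2 + 2 * ((1 - c)^2 * x^2)" for t
 proof -
  have "(A - B)^2 \<le> 2 * A^2 + 2 * B^2" for A B :: real
   using zero_le_power2[of "A + B"] by (simp add: power2_sum power2_diff)
  moreover have "t - x = (t - c * x) - (1 - c) * x" by (simp add: algebra_simps)
  ultimately show ?thesis by (metis power_mult_distrib)
 qed
 interpret N: prob_space "density lborel (normal_density (c * x) ?s)" by (rule prob_space_normal_density[OF s])
 have "(\<integral>\<^sup>+t. ennreal (mk c (b i) x t * (t - x)^2) \<partial>nd i)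
   = (\<integral>\<^sup>+t. ennreal ((t - x)^2) \<partial>density lborel (normal_density (c * x) ?s))"
  by (subst (1 2) nn_integral_density)
   (auto simp: ennreal_mult[symmetric] c mult.assoc[symmetric] normal_density_mk[OF c pos])
 also have "\<dots> \<le> (\<integral>\<^sup>+t. 2 * ennreal ((t - c * x)^2) + ennreal (2 * ((1 - c)^2 * x^2)) \<partial>density lborel (normal_density (c * x) ?s))"
  by (intro nn_integral_mono order_trans[OF ennreal_leI[OF le]]) (simp add: ennreal_plus ennreal_mult)
 also have "\<dots> = 2 * ennreal (?s^2) + ennreal (2 * ((1 - c)^2 * x^2))"
  by (subst nn_integral_add) (auto simp: nn_integral_cmult nn_integral_normal_sq[OF s] N.emeasure_space_1[simplified])
 also have "\<dots> = ennreal (2 * ((1 - c^2) * (b i)^2) + 2 * ((1 - c)^2 * x^2))"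
  using one_minus_sq_pos[OF c] by (simp add: s2 ennreal_plus ennreal_mult)
 finally show ?thesis .
qed

lemma KJ_resample:
 assumes "finite J" "i \<in> J"
 shows "KJ c J x (z + (t - coord z i) *\<^sub>R unit_vec i) = KJ c (J - {i}) x z * mk c (b i) (coord x i) t"
proof -
 have "KJ c J x (z + (t - coord z i) *\<^sub>R unit_vec i) =
   mk c (b i) (coord x i) t * KJ c (J - {i}) x (z + (t - coord z i) *\<^sub>R unit_vec i)"
  unfolding KJ_def by (subst prod.remove[OF assms]) (simp add: coord_simps)
 also have "KJ c (J - {i}) x (z + (t - coord z i) *\<^sub>R unit_vec i) = KJ c (J - {i}) x z"
  unfolding KJ_def by (intro prod.cong) (auto simp: coord_simps)
 finally show ?thesis by (simp add: mult.commute)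
qed

lemma KJ_resample': "i \<notin> J ==> KJ c J x (z + (t - coord z i) *\<^sub>R unit_vec i) = KJ c J x z"
 unfolding KJ_def by (intro prod.cong) (auto simp: coord_simps)

lemma nn_integral_KJ:
 assumes c: "\<bar>c\<bar> < 1" and "finite J"
 shows "(\<integral>\<^sup>+z. ennreal (KJ c J x z) \<partial>G) = 1"
 using assms(2)
proof (induction J)
 case empty
 then show ?case by (simp add: KJ_def G.emeasure_space_1[simplified])
next
 case (insert i J)
 have "(\<integral>\<^sup>+z. ennreal (KJ c (insert i J) x z) \<partial>G) =
   (\<integral>\<^sup>+z. \<integral>\<^sup>+t. ennreal (KJ c J x z * mk c (b i) (coord x i) t) \<partial>nd i \<partial>G)"
  using insert KJ_resample[of "insert i J" i] by (subst resample[where i = i]) auto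
 also have "\<dots> = (\<integral>\<^sup>+z. ennreal (KJ c J x z) \<partial>G)"
  using c by (simp add: ennreal_mult nn_integral_cmult nn_integral_mk)
 finally show ?case using insert by simp
qed

text \<open>Below \<open>n\<close> the contribution is small because \<open>c\<close> is near 1.
  From \<open>n\<close> on the coordinate is replaced by an independent copy; the cost does not
  become small, but it is the tail of a summable sequence. One formula covers both so that it can be
  summed over \<open>i\<close>.\<close>

lemma nn_integral_KJ_sq:
 assumes c: "\<bar>c\<bar> < 1" "0 < c"
 shows "(\<integral>\<^sup>+z. ennreal (KJ c {..<n} x z * (coord z i - coord x i)^2) \<partial>G) \<le>
  ennreal (2 * ((1 - c^2) * (b i)^2) + 2 * ((1 - c)^2 * (coord x i)^2) + (if i < n then 0 else 2 * (b i)^2 + 2 * (coord x i)^2))"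
proof (cases "i < n")
 case True
 let ?m = "\<integral>\<^sup>+t. ennreal (mk c (b i) (coord x i) t * (t - coord x i)^2) \<partial>nd i"
 have "(\<integral>\<^sup>+z. ennreal (KJ c {..<n} x z * (coord z i - coord x i)^2) \<partial>G) =
   (\<integral>\<^sup>+z. \<integral>\<^sup>+t. ennreal (KJ c ({..<n} - {i}) x z) * ennreal (mk c (b i) (coord x i) t * (t - coord x i)^2) \<partial>nd i \<partial>G)"
  using True c KJ_resample[of "{..<n}" i]
  by (subst resample[where i = i]) (auto simp: coord_simps ennreal_mult[symmetric] mult.assoc)
 also have "\<dots> = ?m" using c by (simp add: nn_integral_cmult nn_integral_multc nn_integral_KJ)
 also have "\<dots> \<le> ennreal (2 * ((1 - c^2) * (b i)^2) + 2 * ((1 - c)^2 * (coord x i)^2))"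
  by (rule nn_integral_mk_sq[OF c(1)])
 finally show ?thesis using True by simp
next
 case False
 have le: "(t - coord x i)^2 \<le> 2 * (t - 0)^2 + 2 * (coord x i)^2" for t
 proof -
  have "0 \<le> (t + coord x i)^2" by simp
  then show ?thesis by (simp add: power2_sum power2_diff)
 qed
 have "(\<integral>\<^sup>+z. ennreal (KJ c {..<n} x z * (coord z i - coord x i)^2) \<partial>G) =
   (\<integral>\<^sup>+z. \<integral>\<^sup>+t. ennreal (KJ c {..<n} x z) * ennreal ((t - coord x i)^2) \<partial>nd i \<partial>G)"
  using False c KJ_resample'[of i "{..<n}"]
  by (subst resample[where i = i]) (auto simp: coord_simps ennreal_mult)
 also have "\<dots> = (\<integral>\<^sup>+t. ennreal ((t - coord x i)^2) \<partial>nd i)"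
  using c by (simp add: nn_integral_cmult nn_integral_multc nn_integral_KJ)
 also have "\<dots> \<le> (\<integral>\<^sup>+t. 2 * ennreal ((t - 0)^2) + ennreal (2 * (coord x i)^2) \<partial>nd i)"
  by (intro nn_integral_mono order_trans[OF ennreal_leI[OF le]]) (simp add: ennreal_plus ennreal_mult)
 also have "\<dots> = 2 * ennreal ((b i)^2) + ennreal (2 * (coord x i)^2)"
  using nn_integral_normal_sq[OF pos[of i], of 0]
  by (subst nn_integral_add) (auto simp: nn_integral_cmult nd.emeasure_space_1[simplified])
 also have "\<dots> = ennreal (2 * (b i)^2 + 2 * (coord x i)^2)" by (simp add: ennreal_plus ennreal_mult)
 also have "\<dots> \<le> ennreal (2 * ((1 - c^2) * (b i)^2) + 2 * ((1 - c)^2 * (coord x i)^2) + (2 * (b i)^2 + 2 * (coord x i)^2))"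
  using one_minus_sq_pos[OF c(1)] by (intro ennreal_leI) (simp add: add_nonneg_nonneg)
 finally show ?thesis using False by simp
qed

lemma KJ_bounded:
 assumes c: "\<bar>c\<bar> < 1"
 shows "\<exists>B. \<forall>z. KJ c J x z \<le> B"
proof -
 have "KJ c J x z \<le> (\<Prod>i\<in>J. exp ((coord x i)^2 / (2 * (b i)^2)) / sqrt (1 - c^2))" for z
  unfolding KJ_def by (intro prod_mono conjI mk_nonneg mk_bound c)
 then show ?thesis by blast
qed

lemma integrable_mult_KJ:
 assumes c: "\<bar>c\<bar> < 1" and v: "integrable G v"
 shows "integrable G (\<lambda>z. v z * KJ c J x z)"
proof -
 obtain B where B: "\<And>z. KJ c J x z \<le> B" using KJ_bounded[OF c] by blast
 have [measurable]: "v \<in> borel_measurable G" using v by simp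
 show ?thesis
 proof (rule bint_bound[where f = "\<lambda>z. B * v z"])
  show "AE z in G. norm (v z * KJ c J x z) \<le> norm (B * v z)"
  proof (intro AE_I2)
   fix z
   have "\<bar>v z\<bar> * KJ c J x z \<le> \<bar>v z\<bar> * \<bar>B\<bar>" by (intro mult_left_mono order_trans[OF B abs_ge_self]) auto
   then show "norm (v z * KJ c J x z) \<le> norm (B * v z)" using c by (simp add: abs_mult mult.commute)
  qed
 qed (use v in auto)
qed

lemma mehler_measurable [measurable]:
 assumes [measurable]: "bmeas v"
 shows "bmeas (mehler c n v)"
 unfolding mehler_def by measurable

abbreviation Lm :: "real \<Rightarrow> (ell2 \<Rightarrow> real) \<Rightarrow> ennreal" where
 "Lm p f \<equiv> \<integral>\<^sup>+x. ennreal (\<bar>f x\<bar> powr p) \<partial>G"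

text \<open>For fixed \<open>x\<close> the kernel is a probability density, so Jensen applies; by
  the symmetry of the kernel its integral over \<open>x\<close> is 1 as well, and Fubini finishes
  the estimate.\<close>

lemma mehler_contraction:
 assumes c: "\<bar>c\<bar> < 1" and p: "p \<ge> 1" and v [measurable]: "bmeas v"
 shows "Lm p (\<lambda>x. mehler c n v x) \<le> Lm p v"
proof -
 let ?K = "KJ c {..<n}"
 have pt: "ennreal (\<bar>mehler c n v x\<bar> powr p) \<le> (\<integral>\<^sup>+z. ennreal (\<bar>v z\<bar> powr p) * ennreal (?K x z) \<partial>G)" for x
 proof (cases "(\<integral>\<^sup>+z. ennreal (\<bar>v z\<bar> powr p) * ennreal (?K x z) \<partial>G) = \<infinity>")
  case False
  let ?M = "density G (\<lambda>z. ennreal (?K x z))"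
  interpret M: prob_space ?M
   by standard (simp add: emeasure_density nn_integral_KJ[OF c])
  have nn: "(\<integral>\<^sup>+z. ennreal (\<bar>v z\<bar> powr p) \<partial>?M) = (\<integral>\<^sup>+z. ennreal (\<bar>v z\<bar> powr p) * ennreal (?K x z) \<partial>G)"
   by (subst nn_integral_density) (auto simp: mult.commute)
  have int: "integrable ?M (\<lambda>z. \<bar>v z\<bar> powr p)"
   using nn False by (intro integrableI_bounded) (auto simp: less_top)
  have "mehler c n v x = (\<integral>z. v z \<partial>?M)"
   unfolding mehler_def by (subst integral_density) (auto simp: c mult.commute)
  then have "\<bar>mehler c n v x\<bar> powr p \<le> (\<integral>z. \<bar>v z\<bar> powr p \<partial>?M)"
   using M.powr_jensen(2)[OF p int] by simp
  then have "ennreal (\<bar>mehler c n v x\<bar> powr p) \<le> ennreal (\<integral>z. \<bar>v z\<bar> powr p \<partial>?M)" by (rule ennreal_leI)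
  also have "\<dots> = (\<integral>\<^sup>+z. ennreal (\<bar>v z\<bar> powr p) \<partial>?M)"
   by (rule nn_integral_eq_integral[symmetric, OF int]) auto
  finally show ?thesis by (simp only: nn)
 qed simp
 interpret GG: pair_sigma_finite G G by unfold_locales
 have "Lm p (\<lambda>x. mehler c n v x) \<le>
  (\<integral>\<^sup>+x. \<integral>\<^sup>+z. ennreal (\<bar>v z\<bar> powr p) * ennreal (?K x z) \<partial>G \<partial>G)"
  by (intro nn_integral_mono pt)
 also have "\<dots> = (\<integral>\<^sup>+z. \<integral>\<^sup>+x. ennreal (\<bar>v z\<bar> powr p) * ennreal (?K x z) \<partial>G \<partial>G)"
  by (rule GG.Fubini') measurable
 also have "\<dots> = Lm p v"
  by (simp add: nn_integral_cmult KJ_commute[of c "{..<n}" _] nn_integral_KJ[OF c])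
 finally show ?thesis .
qed

text \<open>The time tends to 0 while the number of coordinates grows; \<open>+ 2\<close> keeps
  \<open>mc 0 = 1/2\<close> positive.\<close>

definition mc :: "nat \<Rightarrow> real" where "mc n = 1 - 1 / (real n + 2)"

lemma mc: "0 < mc n" "mc n < 1" "\<bar>mc n\<bar> < 1"
 by (simp_all add: mc_def field_simps)

lemma mc_tendsto: "mc \<longlonglongrightarrow> 1"
 unfolding mc_def by real_asymp

abbreviation T :: "nat \<Rightarrow> (ell2 \<Rightarrow> real) \<Rightarrow> ell2 \<Rightarrow> real" where
 "T n \<equiv> mehler (mc n) n"

lemma T_diff:
 assumes "integrable G v" "integrable G w"
 shows "T n (\<lambda>x. v x - w x) x = T n v x - T n w x"
 unfolding mehler_def left_diff_distrib
 by (intro bint_diff integrable_mult_KJ mc assms)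

lemma prob_KJ: "\<bar>c\<bar> < 1 ==> integrable G (KJ c {..<n} x)" "\<bar>c\<bar> < 1 ==> (\<integral>z. KJ c {..<n} x z \<partial>G) = 1"
proof -
 assume c: "\<bar>c\<bar> < 1"
 show "integrable G (KJ c {..<n} x)"
  using nn_integral_KJ[OF c, of "{..<n}" x] c by (intro integrableI_bounded) auto
 then show "(\<integral>z. KJ c {..<n} x z \<partial>G) = 1"
  using nn_integral_KJ[OF c, of "{..<n}" x] c by (subst integral_eq_nn_integral) auto
qed

text \<open>The second moment of the kernel about \<open>x\<close> is at most \<open>E n\<close>,
  which tends to 0. The Lipschitz increment is compared with it through
  \<open>norm y \<le> (\<epsilon> + (norm y)^2 / \<epsilon>) / 2\<close>.\<close>

lemma T_bl_pointwise:
 assumes u: "bl u"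
 shows "(\<lambda>n. T n u x) \<longlonglongrightarrow> u x"
proof -
 obtain K L where K: "\<And>x. \<bar>u x\<bar> \<le> K" and L: "\<And>x y. \<bar>u x - u y\<bar> \<le> L * norm (x - y)"
  using u unfolding bl_def by blast
 note [measurable] = bl_measurable[OF u]
 define m where "m n i = 2 * ((1 - (mc n)^2) * (b i)^2) + 2 * ((1 - mc n)^2 * (coord x i)^2)
   + (if i < n then 0 else 2 * (b i)^2 + 2 * (coord x i)^2)" for n i
 define E where "E n = 2 * ((1 - (mc n)^2) * suminf (\<lambda>i. (b i)^2)) + 2 * ((1 - mc n)^2 * (norm x)^2)
   + suminf (\<lambda>i. 2 * (b (i + n))^2 + 2 * (coord x (i + n))^2)" for n
 have sb: "summable (\<lambda>i. 2 * (b i)^2 + 2 * (coord x i)^2)"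
  by (intro summable_add summable_mult sq_summable summable_coord_sq)
 have mE: "m n sums E n" for n
 proof -
  have "(\<lambda>i. if i < n then 0 else 2 * (b i)^2 + 2 * (coord x i)^2) sums suminf (\<lambda>i. 2 * (b (i + n))^2 + 2 * (coord x (i + n))^2)"
   using suminf_tail_if[OF sb, of n] by (simp add: sums_iff)
  then show ?thesis
   unfolding m_def E_def norm_ell2_sq
   by (intro sums_add sums_mult summable_sums sq_summable summable_coord_sq)
 qed
 have m0: "m n i \<ge> 0" for n i
  unfolding m_def using one_minus_sq_pos[OF mc(3)[of n]] by (simp add: add_nonneg_nonneg)
 have E: "E \<longlonglongrightarrow> 2 * ((1 - 1^2) * suminf (\<lambda>i. (b i)^2)) + 2 * ((1 - 1)^2 * (norm x)^2) + 0"
  unfolding E_def by (intro tendsto_intros mc_tendsto tail_tendsto_0[OF sb])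
 have sq: "(\<integral>\<^sup>+z. ennreal (KJ (mc n) {..<n} x z * (norm (z - x))^2) \<partial>G) \<le> ennreal (E n)" for n
 proof -
  have "ennreal (KJ (mc n) {..<n} x z * (norm (z - x))^2) =
    suminf (\<lambda>i. ennreal (KJ (mc n) {..<n} x z * (coord z i - coord x i)^2))" for z
  proof -
   have "ennreal (KJ (mc n) {..<n} x z * (norm (z - x))^2) =
     ennreal (suminf (\<lambda>i. KJ (mc n) {..<n} x z * (coord (z - x) i)^2))"
    unfolding norm_ell2_sq by (subst suminf_mult[OF summable_coord_sq]) simp
   also have "\<dots> = suminf (\<lambda>i. ennreal (KJ (mc n) {..<n} x z * (coord (z - x) i)^2))"
    by (intro suminf_ennreal2[symmetric] summable_mult summable_coord_sq) (simp add: mc)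
   finally show ?thesis by (simp add: coord_simps)
  qed
  then have "(\<integral>\<^sup>+z. ennreal (KJ (mc n) {..<n} x z * (norm (z - x))^2) \<partial>G) =
    suminf (\<lambda>i. \<integral>\<^sup>+z. ennreal (KJ (mc n) {..<n} x z * (coord z i - coord x i)^2) \<partial>G)"
   by (simp add: nn_integral_suminf)
  also have "\<dots> \<le> suminf (\<lambda>i. ennreal (m n i))"
   unfolding m_def by (intro suminf_le nn_integral_KJ_sq mc) auto
  also have "\<dots> = ennreal (E n)" using mE[of n] m0 by (simp add: suminf_ennreal2 sums_iff)
  finally show ?thesis .
 qed
 have isq: "integrable G (\<lambda>z. KJ (mc n) {..<n} x z * (norm (z - x))^2)"
  and isq': "(\<integral>z. KJ (mc n) {..<n} x z * (norm (z - x))^2 \<partial>G) \<le> E n" for n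
 proof -
  have E0: "E n \<ge> 0" using sums_le[OF m0 sums_zero mE] by simp
  show i: "integrable G (\<lambda>z. KJ (mc n) {..<n} x z * (norm (z - x))^2)"
   using sq[of n] by (intro integrableI_bounded) (auto simp: mc intro: le_less_trans)
  have "ennreal (\<integral>z. KJ (mc n) {..<n} x z * (norm (z - x))^2 \<partial>G) \<le> ennreal (E n)"
   using sq[of n] by (subst nn_integral_eq_integral[symmetric, OF i]) (auto simp: mc)
  then show "(\<integral>z. KJ (mc n) {..<n} x z * (norm (z - x))^2 \<partial>G) \<le> E n" using E0 by (simp add: ennreal_le_iff)
 qed
 have est: "\<bar>T n u x - u x\<bar> \<le> \<bar>L\<bar> * ((\<epsilon> + E n / \<epsilon>) / 2)" if "\<epsilon> > 0" for n \<epsilon>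
 proof -
  have iu: "integrable G (\<lambda>z. u z * KJ (mc n) {..<n} x z)"
   by (intro integrable_mult_KJ mc G.integrable_const_bound[where B = K]) (use K in auto)
  have "T n u x - u x = (\<integral>z. (u z - u x) * KJ (mc n) {..<n} x z \<partial>G)"
   using prob_KJ[OF mc(3), of n n x] iu by (simp add: mehler_def left_diff_distrib)
  also have "\<bar>\<dots>\<bar> \<le> (\<integral>z. \<bar>L\<bar> * ((\<epsilon> * KJ (mc n) {..<n} x z + (KJ (mc n) {..<n} x z * (norm (z - x))^2) / \<epsilon>) / 2) \<partial>G)"
  proof (rule order_trans[OF integral_abs_bound integral_mono])
   show "integrable G (\<lambda>z. \<bar>(u z - u x) * KJ (mc n) {..<n} x z\<bar>)"
    unfolding left_diff_distrib
    by (intro integrable_abs Bochner_Integration.integrable_diff iu integrable_mult_right prob_KJ mc)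
   show "integrable G (\<lambda>z. \<bar>L\<bar> * ((\<epsilon> * KJ (mc n) {..<n} x z + (KJ (mc n) {..<n} x z * (norm (z - x))^2) / \<epsilon>) / 2))"
    using isq[of n] prob_KJ(1)[OF mc(3), of n n x] by simp
   fix z
   have "norm (z - x) \<le> (\<epsilon> + (norm (z - x))^2 / \<epsilon>) / 2"
    using sum_squares_bound[of \<epsilon> "norm (z - x)"] that by (simp add: field_simps power2_eq_square)
   moreover have "\<bar>u z - u x\<bar> \<le> \<bar>L\<bar> * norm (z - x)"
    by (rule order_trans[OF L]) (intro mult_right_mono, auto)
   ultimately have "\<bar>u z - u x\<bar> \<le> \<bar>L\<bar> * ((\<epsilon> + (norm (z - x))^2 / \<epsilon>) / 2)"
    by (meson abs_ge_zero mult_left_mono order_trans)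
   then have "\<bar>u z - u x\<bar> * KJ (mc n) {..<n} x z \<le> \<bar>L\<bar> * ((\<epsilon> + (norm (z - x))^2 / \<epsilon>) / 2) * KJ (mc n) {..<n} x z"
    by (intro mult_right_mono) (auto simp: mc)
   then show "\<bar>(u z - u x) * KJ (mc n) {..<n} x z\<bar> \<le> \<bar>L\<bar> * ((\<epsilon> * KJ (mc n) {..<n} x z + (KJ (mc n) {..<n} x z * (norm (z - x))^2) / \<epsilon>) / 2)"
   proof -
    have "\<bar>(u z - u x) * KJ (mc n) {..<n} x z\<bar> = \<bar>u z - u x\<bar> * KJ (mc n) {..<n} x z"
     by (simp add: abs_mult mc)
    moreover have "\<bar>L\<bar> * ((\<epsilon> + (norm (z - x))^2 / \<epsilon>) / 2) * KJ (mc n) {..<n} x z =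
      \<bar>L\<bar> * ((\<epsilon> * KJ (mc n) {..<n} x z + (KJ (mc n) {..<n} x z * (norm (z - x))^2) / \<epsilon>) / 2)"
     by (simp add: algebra_simps add_divide_distrib)
    ultimately show ?thesis using \<open>\<bar>u z - u x\<bar> * KJ (mc n) {..<n} x z \<le> _\<close> by (simp only:)
   qed
  qed
  also have "\<dots> = \<bar>L\<bar> * ((\<epsilon> + (\<integral>z. KJ (mc n) {..<n} x z * (norm (z - x))^2 \<partial>G) / \<epsilon>) / 2)"
   using isq[of n] prob_KJ[OF mc(3), of n n x] by simp
  also have "\<dots> \<le> \<bar>L\<bar> * ((\<epsilon> + E n / \<epsilon>) / 2)"
   using isq'[of n] that by (intro mult_left_mono divide_right_mono add_left_mono) auto
  finally show ?thesis .
 qed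
 show ?thesis
 proof (rule LIMSEQ_I)
  fix r :: real assume r: "r > 0"
  define \<epsilon> where "\<epsilon> = r / (\<bar>L\<bar> + 1)"
  have e: "\<epsilon> > 0" using r by (simp add: \<epsilon>_def add_nonneg_pos)
  have "\<forall>\<^sub>F n in sequentially. E n < \<epsilon>^2" using E by (intro order_tendstoD(2)[where a = "\<epsilon>^2"]) (use e in auto)
  then obtain N where N: "\<And>n. n \<ge> N ==> E n < \<epsilon>^2" unfolding eventually_sequentially by blast
  have "norm (T n u x - u x) < r" if "n \<ge> N" for n
  proof -
   have "E n / \<epsilon> \<le> \<epsilon>" using N[OF that] e by (simp add: pos_divide_le_eq power2_eq_square)
   then have "\<bar>L\<bar> * ((\<epsilon> + E n / \<epsilon>) / 2) \<le> \<bar>L\<bar> * \<epsilon>" by (intro mult_left_mono) auto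
   also have "\<dots> < (\<bar>L\<bar> + 1) * \<epsilon>" using e by (simp add: algebra_simps)
   also have "\<dots> = r" by (simp add: \<epsilon>_def add_nonneg_pos less_imp_neq[symmetric])
   finally show ?thesis using est[OF e, of n] by simp
  qed
  then show "\<exists>N. \<forall>n\<ge>N. norm (T n u x - u x) < r" by blast
 qed
qed

lemma T_bounded:
 assumes [measurable]: "bmeas u" and K: "\<And>x. \<bar>u x\<bar> \<le> K"
 shows "\<bar>T n u x\<bar> \<le> K"
proof -
 have iu: "integrable G (\<lambda>z. u z * KJ (mc n) {..<n} x z)"
  by (intro integrable_mult_KJ mc G.integrable_const_bound[where B = K]) (use K in auto)
 have "\<bar>T n u x\<bar> \<le> (\<integral>z. K * KJ (mc n) {..<n} x z \<partial>G)"
  unfolding mehler_def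
  by (rule order_trans[OF integral_abs_bound integral_mono])
   (use integrable_abs[OF iu] K prob_KJ(1)[OF mc(3)] in \<open>auto simp: abs_mult mc intro: mult_right_mono\<close>)
 then show ?thesis by (simp add: prob_KJ mc)
qed

end

section \<open>Strong convergence of the Mehler operators in L^p\<close>

lemma abs_le_one_plus_powr:
 fixes p t :: real
 assumes "p \<ge> 1"
 shows "\<bar>t\<bar> \<le> 1 + \<bar>t\<bar> powr p"
proof (cases "\<bar>t\<bar> \<le> 1")
 case False
 then have "\<bar>t\<bar> powr 1 \<le> \<bar>t\<bar> powr p" using assms by (intro powr_mono) auto
 then show ?thesis using False by simp
qed (simp add: add_increasing2)

lemma powr_le_mult:
 assumes "p \<ge> 1" "0 \<le> t" "t \<le> (A::real)"
 shows "t powr p \<le> A powr (p - 1) * t"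
proof (cases "t = 0")
 case False
 have "t powr p = t powr (p - 1) * t" using False assms by (simp add: powr_diff)
 also have "\<dots> \<le> A powr (p - 1) * t" using assms by (intro mult_right_mono powr_mono2) auto
 finally show ?thesis .
qed (use assms in simp)

context gaussian_seq
begin

lemma Lp_integrable:
 assumes [measurable]: "bmeas v" and p: "p \<ge> 1"
  and v: "Lm p v < \<infinity>"
 shows "integrable G v" "integrable G (\<lambda>x. \<bar>v x\<bar> powr p)"
proof -
 show ip: "integrable G (\<lambda>x. \<bar>v x\<bar> powr p)" using v by (intro integrableI_bounded) auto
 show "integrable G v"
  by (rule bint_bound[where f = "\<lambda>x. 1 + \<bar>v x\<bar> powr p"])
   (use ip abs_le_one_plus_powr[OF p] in \<open>auto intro!: AE_I2 intro: order_trans[OF _ abs_ge_self]\<close>)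
qed

text \<open>The class on which convergence is already known. It is closed under affine combinations
  and dominated limits, and so grows from bounded Lipschitz functions through indicators and simple
  functions to all of L^p.\<close>

definition TC :: "real \<Rightarrow> (ell2 \<Rightarrow> real) \<Rightarrow> bool" where
 "TC p v \<longleftrightarrow> v \<in> borel_measurable borel \<and> (Lm p v) < \<infinity> \<and>
  (\<lambda>n. Lm p (\<lambda>x. T n v x - v x)) \<longlonglongrightarrow> 0"

lemma Lm_cmult:
 assumes [measurable]: "bmeas f"
 shows "Lm p (\<lambda>x. c * f x) = ennreal (\<bar>c\<bar> powr p) * Lm p f"
 by (simp add: abs_mult powr_mult ennreal_mult nn_integral_cmult)

lemma Lm_affine:
 assumes "p \<ge> 1" and [measurable]: "bmeas f" "bmeas g"
 shows "Lm p (\<lambda>x. c * f x + g x) \<le> ennreal (2 powr p) * (ennreal (\<bar>c\<bar> powr p) * Lm p f + Lm p g)"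
proof -
 have "ennreal (\<bar>c * f x + g x\<bar> powr p) \<le> ennreal (2 powr p) * (ennreal (\<bar>c\<bar> powr p) * ennreal (\<bar>f x\<bar> powr p) + ennreal (\<bar>g x\<bar> powr p))" for x
  using powr_add_le[of p "c * f x" "g x"] assms(1)
  by (auto simp: ennreal_mult[symmetric] ennreal_plus[symmetric] abs_mult powr_mult simp del: ennreal_plus intro!: ennreal_leI)
 from nn_integral_mono[OF this, of G "\<lambda>x. x"] show ?thesis by (simp add: nn_integral_cmult nn_integral_add)
qed

lemma TC_affine:
 assumes p: "p \<ge> 1" and v: "TC p v" and w: "TC p w"
 shows "TC p (\<lambda>x. c * v x + w x)"
proof -
 have [measurable]: "bmeas v" "bmeas w" using v w by (auto simp: TC_def)
 have [measurable]: "bmeas (T n u)" if "bmeas u" for n u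
  using that by (intro mehler_measurable mc) simp_all
 have i: "integrable G v" "integrable G w" using v w p by (auto simp: TC_def intro!: Lp_integrable(1)[of _ p])
 let ?c = "ennreal (2 powr p)" and ?d = "ennreal (\<bar>c\<bar> powr p)"
 have fin: "Lm p (\<lambda>x. c * v x + w x) < \<infinity>"
  by (rule le_less_trans[OF Lm_affine[OF p]]) (use v w in \<open>auto simp: TC_def ennreal_mult_less_top\<close>)
 have "T n (\<lambda>x. c * v x + w x) x - (c * v x + w x) = c * (T n v x - v x) + (T n w x - w x)" for n x
  using integrable_mult_KJ[OF mc(3) i(1), of n "{..<n}" x] integrable_mult_KJ[OF mc(3) i(2), of n "{..<n}" x]
  by (simp add: mehler_def distrib_right mult.assoc right_diff_distrib)
 then have le': "Lm p (\<lambda>x. T n (\<lambda>x. c * v x + w x) x - (c * v x + w x)) \<le>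
   ?c * (?d * Lm p (\<lambda>x. T n v x - v x) + Lm p (\<lambda>x. T n w x - w x))" for n
  by (simp only:) (rule Lm_affine[OF p], measurable)
 have "(\<lambda>n. ?c * (?d * Lm p (\<lambda>x. T n v x - v x) + Lm p (\<lambda>x. T n w x - w x))) \<longlonglongrightarrow> ?c * (?d * 0 + 0)"
  using v w by (intro ennreal_tendsto_cmult tendsto_add) (auto simp: TC_def)
 then have lim: "(\<lambda>n. ?c * (?d * Lm p (\<lambda>x. T n v x - v x) + Lm p (\<lambda>x. T n w x - w x))) \<longlonglongrightarrow> 0" by simp
 have "(\<lambda>n. Lm p (\<lambda>x. T n (\<lambda>x. c * v x + w x) x - (c * v x + w x))) \<longlonglongrightarrow> 0"
  by (rule tendsto_sandwich[OF always_eventually always_eventually tendsto_const lim]) (use le' in auto)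
 then show ?thesis using fin by (simp add: TC_def)
qed

text \<open>Write \<open>T n u - u\<close> as
  \<open>T n (u - v k) + (T n (v k) - v k) + (v k - u)\<close>. The contraction property bounds the
  first term by the third, uniformly in \<open>n\<close>, so \<open>k\<close> is chosen before
  \<open>n\<close>.\<close>

lemma TC_limit:
 assumes p: "p \<ge> 1" and v: "\<And>k::nat. TC p (v k)" and lim: "\<And>x. (\<lambda>k. v k x) \<longlonglongrightarrow> u x"
  and g [measurable]: "bmeas g" and gfin: "(\<integral>\<^sup>+x. ennreal (g x powr p) \<partial>G) < \<infinity>"
  and le: "\<And>k x. \<bar>v k x\<bar> \<le> g x"
 shows "TC p u"
proof -
 have vm [measurable]: "bmeas (v k)" for k using v by (simp add: TC_def)
 have um [measurable]: "bmeas u" by (rule borel_measurable_LIMSEQ_metric[OF vm lim])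
 have ule: "\<bar>u x\<bar> \<le> g x" for x
  by (rule tendsto_upperbound[OF tendsto_rabs[OF lim]]) (auto simp: le)
 have pt: "\<bar>v k x - u x\<bar> powr p \<le> 2 powr p * g x powr p" for k x
  using le[of k x] ule[of x] p by (subst powr_mult[symmetric]) (auto intro!: powr_mono2)
 have fin: "(\<integral>\<^sup>+x. ennreal (2 powr p * g x powr p) \<partial>G) < \<infinity>"
  using gfin by (simp add: ennreal_mult nn_integral_cmult ennreal_mult_less_top)
 have "(\<lambda>k. Lm p (\<lambda>x. v k x - u x)) \<longlonglongrightarrow> (\<integral>\<^sup>+x. 0 \<partial>G)"
 proof (rule nn_integral_dominated_convergence[where w = "\<lambda>x. ennreal (2 powr p * g x powr p)"])
  show "AE x in G. (\<lambda>k. ennreal (\<bar>v k x - u x\<bar> powr p)) \<longlonglongrightarrow> 0"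
  proof (rule AE_I2)
   fix x
   have "(\<lambda>k. \<bar>v k x - u x\<bar>) \<longlonglongrightarrow> \<bar>u x - u x\<bar>" by (intro tendsto_intros lim)
   then have "(\<lambda>k. \<bar>v k x - u x\<bar> powr p) \<longlonglongrightarrow> 0" using p by (intro tendsto_zero_powrI) auto
   then show "(\<lambda>k. ennreal (\<bar>v k x - u x\<bar> powr p)) \<longlonglongrightarrow> 0" using tendsto_ennrealI by fastforce
  qed
 qed (use fin pt in \<open>auto intro!: ennreal_leI\<close>)
 then have X: "(\<lambda>k. Lm p (\<lambda>x. v k x - u x)) \<longlonglongrightarrow> 0" by simp
 have ufin: "Lm p u < \<infinity>"
  by (rule le_less_trans[OF nn_integral_mono gfin]) (use ule p in \<open>auto intro!: ennreal_leI powr_mono2\<close>)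
 have iu: "integrable G u" "integrable G (v k)" for k
  using v[of k] ufin p by (auto simp: TC_def intro!: Lp_integrable(1)[of _ p])
 have [measurable]: "bmeas (T n w)" if "bmeas w" for n w
  using that by (intro mehler_measurable mc) simp_all
 have "(\<lambda>n. Lm p (\<lambda>x. T n u x - u x)) \<longlonglongrightarrow> 0"
 proof (rule tendsto_0_ennreal_eps)
  fix \<epsilon> :: real assume e: "\<epsilon> > 0"
  define q where "q = 2 powr p"
  \<comment> \<open>Two uses of \<open>Lm_affine\<close> turn three errors of size \<open>d\<close>
    into \<open>q * (d + q * (d + d))\<close>, which is \<open>\<epsilon>\<close> for this
    choice.\<close>
  define d where "d = \<epsilon> / (q * (1 + 2 * q))"
  have q: "q > 0" by (simp add: q_def)
  have "q * (d + q * (d + d)) = d * (q * (1 + 2 * q))" by (simp add: algebra_simps)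
  also have "\<dots> = \<epsilon>" using q by (simp add: d_def)
  finally have d: "2 powr p * (d + 2 powr p * (d + d)) = \<epsilon>" by (simp add: q_def)
  have d0: "d > 0" unfolding d_def using e q by (intro divide_pos_pos mult_pos_pos) auto
  have "\<forall>\<^sub>F k in sequentially. Lm p (\<lambda>x. v k x - u x) < ennreal d"
   by (rule order_tendstoD[OF X]) (use d0 in simp)
  then obtain k where k: "Lm p (\<lambda>x. v k x - u x) < ennreal d"
   unfolding eventually_sequentially by blast
  have "\<forall>\<^sub>F n in sequentially. Lm p (\<lambda>x. T n (v k) x - v k x) < ennreal d"
   by (rule order_tendstoD[of _ 0]) (use d0 v[of k] in \<open>auto simp: TC_def\<close>)
  then show "\<forall>\<^sub>F n in sequentially. Lm p (\<lambda>x. T n u x - u x) \<le> ennreal \<epsilon>"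
  proof eventually_elim
   case (elim n)
   let ?A = "\<lambda>x. T n (\<lambda>x. u x - v k x) x" and ?B = "\<lambda>x. T n (v k) x - v k x" and ?D = "\<lambda>x. v k x - u x"
   have "T n u x - u x = 1 * ?A x + (1 * ?B x + ?D x)" for x unfolding T_diff[OF iu] by simp
   then have "Lm p (\<lambda>x. T n u x - u x) \<le> ennreal (2 powr p) * (ennreal (\<bar>1\<bar> powr p) * Lm p ?A + Lm p (\<lambda>x. 1 * ?B x + ?D x))"
    by (simp only:) (rule Lm_affine[OF p], measurable)
   also have "\<dots> \<le> ennreal (2 powr p) * (ennreal d + ennreal (2 powr p) * (ennreal (\<bar>1\<bar> powr p) * ennreal d + ennreal d))"
    using mehler_contraction[OF mc(3) p, of "\<lambda>x. u x - v k x" n n] k elim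
    by (intro mult_left_mono add_mono order_trans[OF Lm_affine[OF p]]) (auto simp: abs_minus_commute)
   also have "\<dots> = ennreal \<epsilon>"
    using d d0 by (simp add: ennreal_plus[symmetric] ennreal_mult[symmetric] del: ennreal_plus)
   finally show ?case .
  qed
 qed
 then show ?thesis using ufin um by (simp add: TC_def)
qed

lemma TC_bl:
 assumes u: "bl u" and p: "p \<ge> 1"
 shows "TC p u"
proof -
 obtain B where B: "\<And>x. \<bar>u x\<bar> \<le> B" using u unfolding bl_def by blast
 note [measurable] = bl_measurable[OF u]
 have [measurable]: "bmeas (T n u)" for n by (intro mehler_measurable mc) simp_all
 have c: "(\<integral>\<^sup>+x. ennreal C \<partial>G) < \<infinity>" for C by (simp add: G.emeasure_space_1[unfolded space_G] ennreal_mult_less_top)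
 have "(\<lambda>n. Lm p (\<lambda>x. T n u x - u x)) \<longlonglongrightarrow> (\<integral>\<^sup>+x. 0 \<partial>G)"
 proof (rule nn_integral_dominated_convergence[where w = "\<lambda>x. ennreal ((2 * B) powr p)"])
  show "AE x in G. ennreal (\<bar>T n u x - u x\<bar> powr p) \<le> ennreal ((2 * B) powr p)" for n
  proof (intro AE_I2 ennreal_leI powr_mono2)
   fix x show "\<bar>T n u x - u x\<bar> \<le> 2 * B"
    using T_bounded[OF bl_measurable[OF u] B, of n x] B[of x] by linarith
  qed (use p in auto)
  show "AE x in G. (\<lambda>n. ennreal (\<bar>T n u x - u x\<bar> powr p)) \<longlonglongrightarrow> 0"
  proof (rule AE_I2)
   fix x
   have "(\<lambda>n. \<bar>T n u x - u x\<bar>) \<longlonglongrightarrow> \<bar>u x - u x\<bar>" by (intro tendsto_intros T_bl_pointwise u)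
   then have "(\<lambda>n. \<bar>T n u x - u x\<bar> powr p) \<longlonglongrightarrow> 0" using p by (intro tendsto_zero_powrI) auto
   then show "(\<lambda>n. ennreal (\<bar>T n u x - u x\<bar> powr p)) \<longlonglongrightarrow> 0" using tendsto_ennrealI by fastforce
  qed
 qed (use c in auto)
 moreover have "Lm p u < \<infinity>"
  by (rule le_less_trans[OF nn_integral_mono c[of "B powr p"]]) (use B p in \<open>auto intro!: ennreal_leI powr_mono2\<close>)
 ultimately show ?thesis using bl_measurable[OF u] by (simp add: TC_def)
qed

lemma TC_const: "p \<ge> 1 ==> TC p (\<lambda>_. c)"
 by (rule TC_bl) (auto simp: bl_def intro!: exI[of _ "\<bar>c\<bar>"])

lemma TC_indicator:
 assumes A: "A \<in> sets borel" and p: "p \<ge> 1"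
 shows "TC p (indicator A)"
proof -
 have one: "(\<integral>\<^sup>+x. ennreal (1 powr p) \<partial>G) < \<infinity>" by (simp add: G.emeasure_space_1[unfolded space_G])
 have "Int_stable (Collect closed :: ell2 set set)" by (auto simp: Int_stable_def)
 moreover have "(Collect closed :: ell2 set set) \<subseteq> Pow UNIV" by simp
 moreover have "A \<in> sigma_sets UNIV (Collect closed)" using A by (simp add: borel_eq_closed)
 ultimately show ?thesis
 proof (induction rule: sigma_sets_induct_disjoint)
  case (basic K)
  show ?case
  \<comment> \<open>\<open>infdist\<close> to the empty set is 0 by convention, so the functions
    \<open>u k\<close> below would not tend to the indicator in that case.\<close>
  proof (cases "K = {}")
   case True
   then show ?thesis using TC_const[OF p, of 0] by simp
  next
   case ne: False
   define u where "u k x = max 0 (1 - real k * infdist x K)" for k x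
   have b: "\<bar>u k x\<bar> \<le> 1" for k x unfolding u_def using infdist_nonneg[of x K] by (auto simp: max_def)
   have "\<bar>u k x - u k y\<bar> \<le> real k * norm (x - y)" for k x y
   proof -
    have "\<bar>infdist x K - infdist y K\<bar> \<le> norm (x - y)"
     using infdist_triangle[of x K y] infdist_triangle[of y K x] by (auto simp: dist_norm norm_minus_commute)
    then have "\<bar>real k * infdist x K - real k * infdist y K\<bar> \<le> real k * norm (x - y)"
     unfolding right_diff_distrib[symmetric] abs_mult by (intro mult_mono) auto
    then show ?thesis unfolding u_def by (auto simp: max_def abs_le_iff)
   qed
   then have "bl (u k)" for k unfolding bl_def using b by blast
   then have "TC p (u k)" for k by (intro TC_bl p)
   moreover have "(\<lambda>k. u k x) \<longlonglongrightarrow> indicator K x" for x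
   proof (cases "x \<in> K")
    case False
    then have d: "infdist x K > 0" using infdist_pos_not_in_closed[OF _ ne] basic by simp
    obtain k0 where k0: "1 / infdist x K \<le> real k0" using real_arch_simple by blast
    have "0 = u k x" if "k \<ge> k0" for k
    proof -
     have "1 / infdist x K \<le> real k" using k0 that by linarith
     then show ?thesis using d by (simp add: u_def pos_divide_le_eq)
    qed
    then have "\<forall>\<^sub>F k in sequentially. 0 = u k x" by (intro eventually_sequentiallyI[of k0]) auto
    then show ?thesis using False by (auto intro: Lim_transform_eventually[OF tendsto_const])
   qed (simp add: u_def)
   ultimately show ?thesis by (rule TC_limit[OF p _ _ _ one]) (use b in auto)
  qed
 next
  case (compl A)
  have "indicator (UNIV - A) = (\<lambda>x. - 1 * indicator A x + 1 :: real)" by (auto simp: fun_eq_iff indicator_def)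
  then show ?case by (simp only:) (rule TC_affine[OF p compl.IH TC_const[OF p]])
 next
  case (union A)
  have "TC p (indicator (\<Union>i<k. A i))" for k
  proof (induction k)
   case (Suc k)
   have "A k \<inter> A i = {}" if "i < k" for i
    using union(1) that by (intro disjoint_family_onD[of A UNIV]) auto
   then have "indicator (\<Union>i<Suc k. A i) = (\<lambda>x. 1 * indicator (A k) x + indicator (\<Union>i<k. A i) x :: real)"
    by (auto simp: fun_eq_iff indicator_def lessThan_Suc)
   then show ?case by (simp only:) (rule TC_affine[OF p union.IH Suc])
  qed (use TC_const[OF p, of 0] in simp)
  then show ?case
   by (rule TC_limit[OF p _ LIMSEQ_indicator_UN _ one]) (auto simp: indicator_def)
 qed (use TC_const[OF p, of 0] in simp)
qed

text \<open>Simple functions bounded by \<open>2 * |v|\<close> converge to \<open>v\<close>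
  pointwise, which is a dominated limit inside \<open>TC\<close>.\<close>

lemma T_Lp:
 assumes v: "bmeas v" and p: "p \<ge> 1"
  and fin: "Lm p v < \<infinity>"
 shows "(\<lambda>n. Lm p (\<lambda>x. T n v x - v x)) \<longlonglongrightarrow> 0"
proof -
 obtain s where s: "\<And>i. simple_function borel (s i)" "\<And>x. (\<lambda>i. s i x) \<longlonglongrightarrow> v x" "\<And>i x. \<bar>s i x\<bar> \<le> 2 * \<bar>v x\<bar>"
  using borel_measurable_implies_sequence_metric[OF v, of 0] by auto
 have "TC p (s i)" for i
 proof -
  have S: "finite (range (s i))" "\<And>y. s i -` {y} \<in> sets borel" for y using simple_functionD[OF s(1)[of i]] by auto
  have "TC p (\<lambda>x. \<Sum>y\<in>Y. y * indicator (s i -` {y}) x)" if "finite Y" for Y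
   using that
  proof (induction Y)
   case empty
   show ?case using TC_const[OF p, of 0] by simp
  next
   case (insert y Y)
   then show ?case using TC_affine[OF p TC_indicator[OF S(2) p] insert.IH] by (simp only: sum.insert[OF insert.hyps(1,2)])
  qed
  moreover have "s i = (\<lambda>x. \<Sum>y\<in>range (s i). y * indicator (s i -` {y}) x)"
  proof
   fix x
   have "(\<Sum>y\<in>range (s i). y * indicator (s i -` {y}) x) = (\<Sum>y\<in>{s i x}. y * indicator (s i -` {y}) x)"
    using S(1) by (intro sum.mono_neutral_right) auto
   then show "s i x = (\<Sum>y\<in>range (s i). y * indicator (s i -` {y}) x)" by simp
  qed
  ultimately show ?thesis using S(1) by metis
 qed
 then have "TC p v"
 proof (rule TC_limit[OF p _ s(2) _ _ s(3)])
  show "(\<integral>\<^sup>+x. ennreal ((2 * \<bar>v x\<bar>) powr p) \<partial>G) < \<infinity>"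
   using fin v by (simp add: powr_mult ennreal_mult nn_integral_cmult ennreal_mult_less_top)
 qed (use v in simp)
 then show ?thesis by (simp add: TC_def)
qed

end

subsection \<open>Smoothness and derivatives\<close>

lemma DERIV_prod_single:
 fixes f :: "nat \<Rightarrow> real \<Rightarrow> real"
 assumes "finite J" "j \<in> J" "DERIV (f j) s :> D"
  and "\<And>i. i \<in> J - {j} ==> f i = (\<lambda>_. c i)"
 shows "DERIV (\<lambda>t. \<Prod>i\<in>J. f i t) s :> D * (\<Prod>i\<in>J - {j}. c i)"
proof -
 have "(\<lambda>t. \<Prod>i\<in>J. f i t) = (\<lambda>t. f j t * (\<Prod>i\<in>J - {j}. c i))"
  using assms(4) by (simp add: prod.remove[OF assms(1,2)] fun_eq_iff)
 then show ?thesis using DERIV_cmult_right[OF assms(3)] by simp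
qed

text \<open>For a product of one-variable functions only the number of occurrences of each direction
  matters, so the order of differentiation drops out.\<close>

lemma pds_product:
 fixes \<phi> :: "nat \<Rightarrow> nat \<Rightarrow> real \<Rightarrow> real"
 assumes d: "\<And>i k t. DERIV (\<phi> i k) t :> \<phi> i (Suc k) t" and "set is \<subseteq> {..<n}"
 shows "pds is (\<lambda>y. \<Prod>i<n. \<phi> i 0 (coord y i)) = (\<lambda>y. \<Prod>i<n. \<phi> i (count_list is i) (coord y i))"
 using assms(2)
proof (induction "is")
 case (Cons j "is")
 then have j: "j \<in> {..<n}" by auto
 show ?case
 proof
  fix y
  have "((\<lambda>t. \<Prod>i<n. \<phi> i (count_list is i) (coord (y + t *\<^sub>R unit_vec j) i)) has_real_derivative
    \<phi> j (Suc (count_list is j)) (coord y j) * (\<Prod>i\<in>{..<n} - {j}. \<phi> i (count_list is i) (coord y i))) (at 0)"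
  proof (rule DERIV_prod_single[OF _ j])
   have "((\<lambda>t. \<phi> j (count_list is j) (coord y j + t)) has_real_derivative
     \<phi> j (Suc (count_list is j)) (coord y j + 0) * 1) (at 0)"
    by (rule DERIV_chain2[where f = "\<phi> j (count_list is j)", OF d]) (auto intro!: derivative_eq_intros)
   then show "((\<lambda>t. \<phi> j (count_list is j) (coord (y + t *\<^sub>R unit_vec j) j)) has_real_derivative
     \<phi> j (Suc (count_list is j)) (coord y j)) (at 0)" by (simp add: coord_simps)
  qed (auto simp: coord_simps)
  from dd_eqI(2)[OF this]
  have "pd j (\<lambda>y. \<Prod>i<n. \<phi> i (count_list is i) (coord y i)) y =
   \<phi> j (Suc (count_list is j)) (coord y j) * (\<Prod>i\<in>{..<n} - {j}. \<phi> i (count_list is i) (coord y i))"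
   by (simp add: pd_eq_dd)
  also have "\<dots> = (\<Prod>i<n. \<phi> i (count_list (j # is) i) (coord y i))"
   by (subst prod.remove[OF _ j]) (auto intro!: prod.cong)
  finally show "pds (j # is) (\<lambda>y. \<Prod>i<n. \<phi> i 0 (coord y i)) y = (\<Prod>i<n. \<phi> i (count_list (j # is) i) (coord y i))"
   using Cons by simp
 qed
qed simp

lemma bsmooth_exp: "bsmooth f ==> bsmooth (\<lambda>x. exp (f x))"
 using bsmooth_compose[where th = "\<lambda>_. exp" and f = f] DERIV_exp by blast

text \<open>Moving derivatives by integration by parts reverses their order, whereas the kernel
  formula below keeps it; for the product Gaussian both orders agree.\<close>

lemma pds_rev_gaussian:
 assumes "set is \<subseteq> {..<n}"
 shows "pds (rev is) (\<lambda>y. \<Prod>i<n. exp (- (coord y i)\<^sup>2 * r i)) = pds is (\<lambda>y. \<Prod>i<n. exp (- (coord y i)\<^sup>2 * r i))"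
proof -
 define \<phi> where "\<phi> i k = dds (replicate k 1) (\<lambda>t::real. exp (- r i * (norm t)\<^sup>2))" for i k
 have "regular (\<lambda>_. True) {1} (\<lambda>t::real. exp (- r i * (norm t)\<^sup>2))" for i
  by (rule regular_mono[OF bsmooth_regular[OF bsmooth_exp[OF bsmooth_cmult[OF bsmooth_norm_sq]]]]) auto
 then have d: "DERIV (\<phi> i k) t :> \<phi> i (Suc k) t" for i k t
  unfolding \<phi>_def by (rule regular_real_DERIV)
 have eq: "(\<lambda>y. \<Prod>i<n. exp (- (coord y i)\<^sup>2 * r i)) = (\<lambda>y. \<Prod>i<n. \<phi> i 0 (coord y i))"
  by (simp add: \<phi>_def mult.commute)
 show ?thesis
  unfolding eq using pds_product[where \<phi> = \<phi>, OF d assms] pds_product[where \<phi> = \<phi>, OF d, of "rev is" n] assms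
  by simp
qed

lemma bsmooth_affine: "bsmooth f ==> bsmooth (\<lambda>x. f (w + c *\<^sub>R x))"
proof -
 assume f: "bsmooth f"
 note r = regular_affine[OF bsmooth_regular[OF f], of "\<lambda>_. True" w c]
 show ?thesis
  unfolding bsmooth_def
 proof (intro conjI allI)
  show "regular (\<lambda>_. True) UNIV (\<lambda>x. f (w + c *\<^sub>R x))" by (rule r(1)) auto
  fix R :: real and k
  obtain C where C: "C \<ge> 0" "\<And>x vs. norm x < norm w + \<bar>c\<bar> * \<bar>R\<bar> + 1 ==> length vs \<le> k ==> \<bar>dds vs f x\<bar> \<le> C * pn vs"
   using bsmoothE[OF f] by blast
  have "\<bar>dds vs (\<lambda>x. f (w + c *\<^sub>R x)) x\<bar> \<le> ((1 + \<bar>c\<bar>) ^ k * C) * pn vs" if x: "norm x < R" and vs: "length vs \<le> k" for x vs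
  proof -
   have "norm (w + c *\<^sub>R x) \<le> norm w + \<bar>c\<bar> * norm x" by (rule order_trans[OF norm_triangle_ineq]) simp
   also have "\<bar>c\<bar> * norm x \<le> \<bar>c\<bar> * \<bar>R\<bar>" using x by (intro mult_left_mono) auto
   finally have n: "norm (w + c *\<^sub>R x) < norm w + \<bar>c\<bar> * \<bar>R\<bar> + 1" by simp
   have "\<bar>c\<bar> ^ length vs \<le> (1 + \<bar>c\<bar>) ^ length vs" by (intro power_mono) auto
   also have "\<dots> \<le> (1 + \<bar>c\<bar>) ^ k" using vs by (intro power_increasing) auto
   finally have "\<bar>c\<bar> ^ length vs * \<bar>dds vs f (w + c *\<^sub>R x)\<bar> \<le> (1 + \<bar>c\<bar>) ^ k * (C * pn vs)"
    using C(2)[OF n vs] by (intro mult_mono) auto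
   then show ?thesis by (simp add: r(2) abs_mult power_abs mult.assoc)
  qed
  then show "\<exists>C\<ge>0. \<forall>x vs. norm x < R \<longrightarrow> length vs \<le> k \<longrightarrow> \<bar>dds vs (\<lambda>x. f (w + c *\<^sub>R x)) x\<bar> \<le> C * pn vs"
   using C(1) by (intro exI[of _ "(1 + \<bar>c\<bar>) ^ k * C"]) auto
 qed
qed

lemma bsmooth_dds_measurable:
 fixes W :: "ell2 \<Rightarrow> real"
 shows "bsmooth W ==> dds vs W \<in> borel_measurable borel"
 by (intro borel_measurable_continuous_onI lipb_continuous bsmooth_lipb)

text \<open>Differentiation under the integral for a kernel depending on \<open>z - c x\<close>. The
  bounded support of \<open>h\<close> keeps the argument of \<open>W\<close> in a ball as long as
  \<open>x\<close> does, so the bounds from \<open>bsmooth\<close> supply the majorants.\<close>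

lemma kernel_integral:
 fixes M :: "ell2 measure" and W :: "ell2 \<Rightarrow> real" and c :: real
 assumes sM: "sets M = sets borel" and h: "integrable M h" and R0: "\<And>z. norm z \<ge> R0 ==> h z = 0" and W: "bsmooth W"
 defines "U \<equiv> \<lambda>vs x. \<integral>z. h z * dds vs W (z + (- c) *\<^sub>R x) \<partial>M"
 shows "bsmooth (U [])" "dds vs (U []) x = (- c) ^ length vs * U vs x"
proof -
 have meas: "(\<lambda>z. dds vs W (z + w)) \<in> borel_measurable M" for vs w
 proof -
  have "bmeas (\<lambda>z. dds vs W (z + w))"
   by (rule measurable_compose[OF _ bsmooth_dds_measurable[OF W]]) simp
  then show ?thesis using measurable_cong_sets[OF sM refl] by blast
 qed
 have bnd: "\<exists>C\<ge>0. \<forall>vs z x. length vs \<le> k \<longrightarrow> norm x < R \<longrightarrow>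
   \<bar>h z * dds vs W (z + (- c) *\<^sub>R x)\<bar> \<le> \<bar>h z\<bar> * (C * pn vs)" for k R
 proof -
  obtain C where C: "C \<ge> 0" "\<And>x vs. norm x < \<bar>R0\<bar> + \<bar>c\<bar> * \<bar>R\<bar> + 1 ==> length vs \<le> k ==> \<bar>dds vs W x\<bar> \<le> C * pn vs"
   using bsmoothE[OF W] by blast
  have "\<bar>h z * dds vs W (z + (- c) *\<^sub>R x)\<bar> \<le> \<bar>h z\<bar> * (C * pn vs)"
   if vs: "length vs \<le> k" and x: "norm x < R" for vs z x
  proof (cases "norm z \<ge> R0")
   case False
   have "norm (z + (- c) *\<^sub>R x) \<le> norm z + \<bar>c\<bar> * norm x" by (rule order_trans[OF norm_triangle_ineq]) simp
   also have "\<bar>c\<bar> * norm x \<le> \<bar>c\<bar> * \<bar>R\<bar>" using x by (intro mult_left_mono) auto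
   finally have "norm (z + (- c) *\<^sub>R x) < \<bar>R0\<bar> + \<bar>c\<bar> * \<bar>R\<bar> + 1" using False by linarith
   from C(2)[OF this vs] show ?thesis by (simp add: abs_mult mult_left_mono)
  qed (use R0 in simp)
  then show ?thesis using C(1) by blast
 qed
 have int: "integrable M (\<lambda>z. h z * dds vs W (z + (- c) *\<^sub>R x))" for vs x
 proof -
  obtain C where C: "C \<ge> 0" "\<And>z. \<bar>h z * dds vs W (z + (- c) *\<^sub>R x)\<bar> \<le> \<bar>h z\<bar> * (C * pn vs)"
   using bnd[of "length vs" "norm x + 1"] by auto
  show ?thesis
  proof (rule bint_bound[where f = "\<lambda>z. \<bar>h z\<bar> * (C * pn vs)"])
   show "AE z in M. norm (h z * dds vs W (z + (- c) *\<^sub>R x)) \<le> norm (\<bar>h z\<bar> * (C * pn vs))"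
    using C by (intro AE_I2) (simp add: abs_mult)
   show "(\<lambda>z. h z * dds vs W (z + (- c) *\<^sub>R x)) \<in> borel_measurable M"
    using h by (intro borel_measurable_times meas) auto
  qed (use h in auto)
 qed
 have der: "has_dd v (U vs) x" "dd v (U vs) x = - c * U (v # vs) x" for v vs x
 proof -
  obtain C where C: "C \<ge> 0" "\<And>z y ws. length ws \<le> Suc (length vs) ==> norm y < norm x + norm v + 1 ==>
    \<bar>h z * dds ws W (z + (- c) *\<^sub>R y)\<bar> \<le> \<bar>h z\<bar> * (C * prod_list (map norm ws))"
   using bnd[of "Suc (length vs)" "norm x + norm v + 1"] by blast
  have nrm: "norm (x + s *\<^sub>R v) < norm x + norm v + 1" if "\<bar>s\<bar> < 1" for s
  proof -
   have "norm (x + s *\<^sub>R v) \<le> norm x + \<bar>s\<bar> * norm v" by (rule order_trans[OF norm_triangle_ineq]) simp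
   also have "\<bar>s\<bar> * norm v \<le> 1 * norm v" using that by (intro mult_right_mono) auto
   finally show ?thesis by simp
  qed
  have "((\<lambda>s. \<integral>z. h z * dds vs W (z + (- c) *\<^sub>R (x + s *\<^sub>R v)) \<partial>M) has_real_derivative
    (\<integral>z. - c * (h z * dds (v # vs) W (z + (- c) *\<^sub>R (x + 0 *\<^sub>R v))) \<partial>M)) (at 0)"
  proof (rule DERIV_integral(1)[where r = 1 and B = "\<lambda>z. \<bar>c\<bar> * (\<bar>h z\<bar> * (C * pn (v # vs)))"])
   fix s z
   have "has_dd v (\<lambda>y. dds vs W (z + (- c) *\<^sub>R y)) (x + s *\<^sub>R v)"
    by (rule dd_affine(1)[OF bsmooth_has_dd[OF W]])
   from has_dd_at[OF this]
   have "DERIV (\<lambda>s. dds vs W (z + (- c) *\<^sub>R (x + s *\<^sub>R v))) s :> - c * dds (v # vs) W (z + (- c) *\<^sub>R (x + s *\<^sub>R v))"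
    by (simp only: dd_affine(2)[OF bsmooth_has_dd[OF W]] dds_Cons)
   from DERIV_cmult[OF this, of "h z"]
   show "((\<lambda>s. h z * dds vs W (z + (- c) *\<^sub>R (x + s *\<^sub>R v))) has_real_derivative
     - c * (h z * dds (v # vs) W (z + (- c) *\<^sub>R (x + s *\<^sub>R v)))) (at s)" by (simp only: ac_simps)
   assume "\<bar>s\<bar> < 1"
   from C(2)[OF _ nrm[OF this], of "v # vs" z]
   have "\<bar>c\<bar> * \<bar>h z * dds (v # vs) W (z + (- c) *\<^sub>R (x + s *\<^sub>R v))\<bar> \<le> \<bar>c\<bar> * (\<bar>h z\<bar> * (C * pn (v # vs)))"
    by (intro mult_left_mono) auto
   then show "\<bar>- c * (h z * dds (v # vs) W (z + (- c) *\<^sub>R (x + s *\<^sub>R v)))\<bar> \<le> \<bar>c\<bar> * (\<bar>h z\<bar> * (C * pn (v # vs)))"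
    by (simp only: abs_mult abs_minus)
  qed (use int h in auto)
  then have "DERIV (\<lambda>s. U vs (x + s *\<^sub>R v)) 0 :> - c * U (v # vs) x"
   unfolding U_def by simp
  from dd_eqI[OF this] show "has_dd v (U vs) x" "dd v (U vs) x = - c * U (v # vs) x" by auto
 qed
 have dds_U: "dds vs (U []) = (\<lambda>x. (- c) ^ length vs * U vs x)" for vs
 proof (induction vs)
  case (Cons v vs)
  have "dd v (\<lambda>x. (- c) ^ length vs * U vs x) x = (- c) ^ length vs * (- c * U (v # vs) x)" for x
   using dd_cmult(2)[OF der(1)] der(2) by metis
  then have "dd v (\<lambda>x. (- c) ^ length vs * U vs x) = (\<lambda>x. (- c) ^ length (v # vs) * U (v # vs) x)"
   by (simp add: fun_eq_iff)
  then show ?case by (simp only: dds_Cons Cons.IH)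
 qed simp
 then show "dds vs (U []) x = (- c) ^ length vs * U vs x" by simp
 show "bsmooth (U [])"
  unfolding bsmooth_def
 proof (intro conjI allI)
  show "regular (\<lambda>_. True) UNIV (U [])"
   by (rule regularI) (auto simp: dds_U intro: dd_cmult(1) der(1))
  fix R k
  obtain C where C: "C \<ge> 0" "\<And>z x vs. length vs \<le> k ==> norm x < R ==>
    \<bar>h z * dds vs W (z + (- c) *\<^sub>R x)\<bar> \<le> \<bar>h z\<bar> * (C * pn vs)"
   using bnd[of k R] by blast
  let ?H = "\<integral>z. \<bar>h z\<bar> \<partial>M"
  have H: "?H \<ge> 0" by (intro integral_nonneg_AE) auto
  have "\<bar>dds vs (U []) x\<bar> \<le> ((1 + \<bar>c\<bar>) ^ k * (?H * C)) * pn vs" if x: "norm x < R" and vs: "length vs \<le> k" for x vs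
  proof -
   have "\<bar>U vs x\<bar> \<le> (\<integral>z. \<bar>h z\<bar> * (C * pn vs) \<partial>M)"
    unfolding U_def by (rule order_trans[OF integral_abs_bound integral_mono]) (use int h C(2)[OF vs x] in auto)
   also have "\<dots> = ?H * C * pn vs" by simp
   finally have u: "\<bar>U vs x\<bar> \<le> ?H * C * pn vs" .
   have "\<bar>c\<bar> ^ length vs \<le> (1 + \<bar>c\<bar>) ^ length vs" by (intro power_mono) auto
   also have "\<dots> \<le> (1 + \<bar>c\<bar>) ^ k" using vs by (intro power_increasing) auto
   finally have "\<bar>c\<bar> ^ length vs * \<bar>U vs x\<bar> \<le> (1 + \<bar>c\<bar>) ^ k * (?H * C * pn vs)"
    using u by (intro mult_mono) auto
   then show ?thesis by (simp add: dds_U abs_mult power_abs mult.assoc)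
  qed
  then show "\<exists>C\<ge>0. \<forall>x vs. norm x < R \<longrightarrow> length vs \<le> k \<longrightarrow> \<bar>dds vs (U []) x\<bar> \<le> C * pn vs"
   using C(1) H by (intro exI[of _ "(1 + \<bar>c\<bar>) ^ k * (?H * C)"]) auto
 qed
qed

section \<open>Derivatives of the Mehler kernel in both variables\<close>

context gaussian_seq
begin

definition rr :: "real \<Rightarrow> nat \<Rightarrow> real" where "rr c i = 1 / (2 * (1 - c^2) * (b i)^2)"
definition Wk :: "real \<Rightarrow> nat \<Rightarrow> ell2 \<Rightarrow> real" where
 "Wk c n y = (\<Prod>i<n. exp (- (coord y i)\<^sup>2 * rr c i))"
definition Ek :: "real \<Rightarrow> nat \<Rightarrow> ell2 \<Rightarrow> real" where
 "Ek c n z = (1 / sqrt (1 - c^2)) ^ n * exp (\<Sum>i<n. coord z i * coord z i / (2 * (b i)^2))"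

text \<open>As a function of \<open>z\<close>, the kernel is a Gaussian centred at \<open>c x\<close> divided by the density of \<open>G\<close>;
 this is why \<open>\<partial>\<close> in \<open>x\<close> corresponds to \<open>- c \<delta>\<close> in \<open>z\<close>.\<close>

lemma KJ_factor:
 assumes c: "\<bar>c\<bar> < 1"
 shows "KJ c {..<n} x z = Wk c n (z + (- c) *\<^sub>R x) * Ek c n z"
proof -
 have q: "1 - c^2 > 0" by (rule one_minus_sq_pos[OF c])
 have mk_eq: "mk c (b i) s t = exp (- (t - c * s)\<^sup>2 * rr c i) * (1 / sqrt (1 - c\<^sup>2) * exp (t * t / (2 * (b i)\<^sup>2)))" for i s t
 proof -
  have "t * t / (2 * (b i)^2) = ((1 - c^2) * (t * t)) * rr c i"
  proof -
   define q where "q = 1 - c^2"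
   have "q > 0" using \<open>1 - c^2 > 0\<close> by (simp add: q_def)
   then show ?thesis unfolding rr_def q_def[symmetric] using pos[of i] by simp
  qed
  then have "- (t - c * s)\<^sup>2 * rr c i + t * t / (2 * (b i)\<^sup>2) = (- (t - c * s)\<^sup>2 + (1 - c\<^sup>2) * (t * t)) * rr c i"
   by (simp only: distrib_right)
  also have "- (t - c * s)\<^sup>2 + (1 - c\<^sup>2) * (t * t) = - (c\<^sup>2 * s\<^sup>2 - 2 * c * s * t + c\<^sup>2 * t\<^sup>2)"
   by (simp add: power2_eq_square algebra_simps)
  finally have "- (c\<^sup>2 * s\<^sup>2 - 2 * c * s * t + c\<^sup>2 * t\<^sup>2) / (2 * (1 - c\<^sup>2) * (b i)\<^sup>2) = - (t - c * s)\<^sup>2 * rr c i + t * t / (2 * (b i)\<^sup>2)"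
   by (simp add: rr_def)
  then show ?thesis unfolding mk_def by (simp only: exp_add) simp
 qed
 have "KJ c {..<n} x z = (\<Prod>i<n. exp (- (coord z i - c * coord x i)\<^sup>2 * rr c i)) *
   ((\<Prod>i<n. 1 / sqrt (1 - c^2)) * (\<Prod>i<n. exp (coord z i * coord z i / (2 * (b i)^2))))"
  by (simp only: KJ_def mk_eq prod.distrib)
 then show ?thesis by (simp add: Wk_def Ek_def exp_sum coord_simps)
qed

lemma bsmooth_Wk: "bsmooth (Wk c n)"
proof -
 have "Wk c n = (\<lambda>y. exp (\<Sum>i<n. (- rr c i) * (coord y i * coord y i)))"
  by (simp add: Wk_def exp_sum power2_eq_square mult.commute fun_eq_iff)
 then show ?thesis
  by (simp only:) (intro bsmooth_exp bsmooth_sum bsmooth_cmult bsmooth_mult bsmooth_coord)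
qed

lemma bsmooth_Ek: "bsmooth (Ek c n)"
proof -
 have "Ek c n = (\<lambda>y. (1 / sqrt (1 - c^2)) ^ n * exp (\<Sum>i<n. (1 / (2 * (b i)^2)) * (coord y i * coord y i)))"
  by (simp add: Ek_def fun_eq_iff)
 then show ?thesis
  by (simp only:) (intro bsmooth_cmult bsmooth_exp bsmooth_sum bsmooth_mult bsmooth_coord)
qed

lemma pd_Ek:
 assumes "i < n"
 shows "pd i (Ek c n) z = coord z i / (b i)^2 * Ek c n z"
proof -
 let ?q = "\<lambda>y. \<Sum>j<n. coord y j * coord y j / (2 * (b j)^2)"
 have "((\<lambda>t. coord (z + t *\<^sub>R unit_vec i) j * coord (z + t *\<^sub>R unit_vec i) j / (2 * (b j)^2)) has_real_derivative
  (if j = i then coord z i / (b i)^2 else 0)) (at 0)" for j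
 proof -
  have "((\<lambda>t. coord (z + t *\<^sub>R unit_vec i) j * coord (z + t *\<^sub>R unit_vec i) j) has_real_derivative
    (if j = i then 2 * coord z i else 0)) (at 0)"
   by (auto simp: coord_simps intro!: derivative_eq_intros)
  from DERIV_cdivide[OF this, of "2 * (b j)^2"] show ?thesis
   by (rule DERIV_cong) simp
 qed
 then have "DERIV (\<lambda>t. ?q (z + t *\<^sub>R unit_vec i)) 0 :> (\<Sum>j<n. if j = i then coord z i / (b i)^2 else 0)"
  by (intro DERIV_sum)
 then have "DERIV (\<lambda>t. ?q (z + t *\<^sub>R unit_vec i)) 0 :> coord z i / (b i)^2"
  using assms by simp
 then have "((\<lambda>t. exp (?q (z + t *\<^sub>R unit_vec i))) has_real_derivative
   exp (?q (z + 0 *\<^sub>R unit_vec i)) * (coord z i / (b i)^2)) (at 0)"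
  by (rule DERIV_chain2[OF DERIV_exp])
 from DERIV_cmult[OF this, of "(1 / sqrt (1 - c^2)) ^ n"]
 have "DERIV (\<lambda>t. Ek c n (z + t *\<^sub>R unit_vec i)) 0 :> coord z i / (b i)^2 * Ek c n z"
  unfolding Ek_def by (rule DERIV_cong) simp
 from dd_eqI(2)[OF this] show ?thesis by (simp add: pd_eq_dd)
qed

text \<open>\<open>Ek\<close> is, up to a constant, the reciprocal of the Gaussian density, so its
  logarithmic derivative \<open>coord z i / (b i)^2\<close> cancels the zeroth-order term of
  \<open>delta\<close> and only \<open>w\<close> is differentiated.\<close>

lemma delta_kernel:
 assumes "bsmooth w" "i < n"
 shows "delta b i (\<lambda>z. w (z + y) * Ek c n z) = (\<lambda>z. pd i w (z + y) * Ek c n z)"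
proof
 fix z
 have w: "has_dd v w (y + 1 *\<^sub>R x)" for v x using bsmooth_has_dd[OF assms(1), of v "[]"] by simp
 have 1: "has_dd (unit_vec i) (\<lambda>z. w (z + y)) z" "dd (unit_vec i) (\<lambda>z. w (z + y)) z = pd i w (z + y)"
  using dd_affine[OF w, of "unit_vec i" z] by (auto simp: pd_eq_dd add.commute)
 have 2: "has_dd (unit_vec i) (Ek c n) z" using bsmooth_has_dd[OF bsmooth_Ek, of "unit_vec i" "[]"] by simp
 show "delta b i (\<lambda>z. w (z + y) * Ek c n z) z = pd i w (z + y) * Ek c n z"
  unfolding delta_def pd_eq_dd[of i "\<lambda>z. w (z + y) * Ek c n z"] dd_mult(2)[OF 1(1) 2] 1(2)
  using pd_Ek[OF assms(2)] by (simp add: pd_eq_dd)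
qed

lemma bsmooth_dd: "bsmooth f ==> bsmooth (dd v f)"
 unfolding bsmooth_def
proof (elim conjE, intro conjI allI)
 assume r: "regular (\<lambda>_. True) UNIV f" and b: "\<forall>R k. \<exists>C\<ge>0. \<forall>x vs. norm x < R \<longrightarrow> length vs \<le> k \<longrightarrow> \<bar>dds vs f x\<bar> \<le> C * pn vs"
 show "regular (\<lambda>_. True) UNIV (dd v f)" by (rule regular_dd[OF r]) simp
 fix R k
 obtain C where C: "C \<ge> 0" "\<And>x vs. norm x < R ==> length vs \<le> Suc k ==> \<bar>dds vs f x\<bar> \<le> C * pn vs"
  using b by blast
 have "\<bar>dds vs (dd v f) x\<bar> \<le> (C * norm v) * pn vs" if "norm x < R" "length vs \<le> k" for x vs
  using C(2)[of x "vs @ [v]"] that by (simp add: dds_append ac_simps)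
 then show "\<exists>C\<ge>0. \<forall>x vs. norm x < R \<longrightarrow> length vs \<le> k \<longrightarrow> \<bar>dds vs (dd v f) x\<bar> \<le> C * pn vs"
  using C(1) by (intro exI[of _ "C * norm v"]) auto
qed

lemma bsmooth_pds: "bsmooth f ==> bsmooth (pds is f)"
 by (induction "is") (auto intro: bsmooth_dd simp: pd_eq_dd)

lemma deltas_kernel:
 assumes "bsmooth w" "set is \<subseteq> {..<n}"
 shows "foldr (delta b) is (\<lambda>z. w (z + y) * Ek c n z) = (\<lambda>z. pds is w (z + y) * Ek c n z)"
 using assms(2) by (induction "is") (auto simp: delta_kernel bsmooth_pds assms(1))

lemma bsmooth_KJ: "\<bar>c\<bar> < 1 ==> bsmooth (KJ c {..<n} x)"
proof -
 assume c: "\<bar>c\<bar> < 1"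
 have "KJ c {..<n} x = (\<lambda>z. Wk c n ((- c) *\<^sub>R x + 1 *\<^sub>R z) * Ek c n z)"
  by (simp add: KJ_factor[OF c] add.commute fun_eq_iff)
 then show ?thesis by (simp only:) (intro bsmooth_mult bsmooth_affine bsmooth_Wk bsmooth_Ek)
qed

lemma mehler_smooth:
 assumes c: "\<bar>c\<bar> < 1" and v: "integrable G v" and R0: "\<And>z. norm z \<ge> R0 ==> v z = 0"
 shows "bsmooth (mehler c n v)"
  "set is \<subseteq> {..<n} ==> pds (rev is) (mehler c n v) x =
   (- c) ^ length is * (\<integral>z. v z * foldr (delta b) is (KJ c {..<n} x) z \<partial>G)"
  "\<not> set is \<subseteq> {..<n} ==> pds is (mehler c n v) x = 0"
proof -
 \<comment> \<open>\<open>Ek\<close> grows like the exponential of a square; the bounded support of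
   \<open>v\<close> is what keeps this product integrable.\<close>
 define h where "h z = v z * Ek c n z" for z
 have R0': "h z = 0" if "norm z \<ge> R0" for z using R0[OF that] by (simp add: h_def)
 have h: "integrable G h"
 proof -
  obtain C where C: "C \<ge> 0" "\<And>z. norm z < R0 ==> \<bar>Ek c n z\<bar> \<le> C"
   using lipb_boundedE[OF tame_lipb[OF bsmooth_tame[OF bsmooth_Ek]]] by blast
  have m: "bmeas (Ek c n)" by (rule tame_measurable[OF bsmooth_tame[OF bsmooth_Ek]])
  show ?thesis
  proof (rule bint_bound[where f = "\<lambda>z. C * v z"])
   show "AE z in G. norm (h z) \<le> norm (C * v z)"
   proof (intro AE_I2)
    fix z show "norm (h z) \<le> norm (C * v z)"
    proof (cases "norm z \<ge> R0")
     case False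
     then have "\<bar>v z\<bar> * \<bar>Ek c n z\<bar> \<le> \<bar>v z\<bar> * C" by (intro mult_left_mono C(2)) auto
     then show ?thesis using C(1) by (simp add: h_def abs_mult mult.commute)
    qed (simp add: R0')
   qed
   show "h \<in> borel_measurable G"
    unfolding h_def using v m by (intro borel_measurable_times) auto
  qed (use v in auto)
 qed
 have eq: "mehler c n v = (\<lambda>x. \<integral>z. h z * dds [] (Wk c n) (z + (- c) *\<^sub>R x) \<partial>G)"
  unfolding mehler_def h_def KJ_factor[OF c] by (simp add: ac_simps fun_eq_iff)
 note ki = kernel_integral[OF sets_G h R0' bsmooth_Wk[of c n]]
 show bs: "bsmooth (mehler c n v)" unfolding eq by (rule ki(1))
 show "pds (rev is) (mehler c n v) x = (- c) ^ length is * (\<integral>z. v z * foldr (delta b) is (KJ c {..<n} x) z \<partial>G)"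
  if s: "set is \<subseteq> {..<n}" for "is"
 proof -
  have "foldr (delta b) is (KJ c {..<n} x) = (\<lambda>z. pds is (Wk c n) (z + (- c) *\<^sub>R x) * Ek c n z)"
  proof -
   have "KJ c {..<n} x = (\<lambda>z. Wk c n (z + (- c) *\<^sub>R x) * Ek c n z)" by (simp add: KJ_factor[OF c] fun_eq_iff)
   then show ?thesis by (simp only: deltas_kernel[OF bsmooth_Wk s])
  qed
  moreover have "pds is (Wk c n) = pds (rev is) (Wk c n)"
   using pds_rev_gaussian[OF s, of "rr c"] by (simp add: Wk_def[abs_def])
  moreover have "pds (rev is) (mehler c n v) x = (- c) ^ length is * (\<integral>z. h z * pds (rev is) (Wk c n) (z + (- c) *\<^sub>R x) \<partial>G)"
   using ki(2)[where vs = "map unit_vec (rev is)" and c = c and x = x]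
   unfolding eq pds_eq_dds length_map length_rev .
  ultimately show ?thesis by (simp add: h_def ac_simps)
 qed
 show "pds is (mehler c n v) x = 0" if "\<not> set is \<subseteq> {..<n}"
 proof -
  \<comment> \<open>The kernel does not see the coordinates of \<open>x\<close> from
    \<open>n\<close> on.\<close>
  have "mehler c n v = (\<lambda>x. mehler c n v (trunc n x))"
   unfolding mehler_def KJ_def by (simp add: fun_eq_iff)
  then have "pds is (mehler c n v) x = pds is (\<lambda>x. mehler c n v (trunc n x)) x" by simp
  also have "\<dots> = 0" using that by (simp add: pds_trunc[OF bsmooth_tame[OF bs]])
  finally show ?thesis .
 qed
qed

end

section \<open>Multi-indices as sorted lists\<close>

text \<open>Inverse to \<open>mi_list\<close> on sorted lists. Derivatives are handled by induction
  over lists, and multi-indices return only when the definitions are unfolded.\<close>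

definition mi_of :: "nat list \<Rightarrow> multi_index" where
 "mi_of s = Abs_poly_mapping (count_list s)"

lemma lookup_mi_of [simp]: "Poly_Mapping.lookup (mi_of s) = count_list s"
proof -
 have "{i. count_list s i \<noteq> 0} \<subseteq> set s" by (auto simp: count_list_0_iff)
 then have "finite {i. count_list s i \<noteq> 0}" by (rule finite_subset) simp
 then show ?thesis unfolding mi_of_def by (intro Abs_poly_mapping_inverse) simp
qed

lemma keys_mi_of [simp]: "Poly_Mapping.keys (mi_of s) = set s"
 by (auto simp: Poly_Mapping.keys.rep_eq count_list_0_iff)

lemma sorted_concat_replicate:
 "sorted xs ==> sorted (concat (map (\<lambda>i. replicate (f i) (i::nat)) xs))"
 by (induction xs) (auto simp: sorted_append sorted_replicate)

lemma sorted_mi_list: "sorted (mi_list \<alpha>)"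
 unfolding mi_list_def by (rule sorted_concat_replicate) simp

lemma count_list_replicate: "count_list (replicate n y) x = (if x = y then n else 0)"
 by (induction n) auto

lemma count_list_concat_replicate:
 "distinct xs ==> count_list (concat (map (\<lambda>i. replicate (f i) i) xs)) x = (if x \<in> set xs then f x else 0)"
 by (induction xs) (auto simp: count_list_append count_list_replicate)

lemma count_mi_list: "count_list (mi_list \<alpha>) = Poly_Mapping.lookup \<alpha>"
 unfolding mi_list_def
 by (rule ext, subst count_list_concat_replicate) (auto simp: Poly_Mapping.in_keys_iff)

lemma mi_of_mi_list [simp]: "mi_of (mi_list \<alpha>) = \<alpha>"
 by (rule poly_mapping_eqI) (simp add: count_mi_list)

lemma mi_list_mi_of: "sorted s ==> mi_list (mi_of s) = s"
proof -
 assume s: "sorted s"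
 have "mset (mi_list (mi_of s)) = mset s"
  by (rule multiset_eqI) (simp add: count_mset count_mi_list)
 then show ?thesis using s sorted_mi_list properties_for_sort by metis
qed

lemma mi_order_eq: "mi_order \<alpha> = length (mi_list \<alpha>)"
proof -
 have "length (mi_list \<alpha>) = (\<Sum>i\<in>set (mi_list \<alpha>). count_list (mi_list \<alpha>) i)"
  by (simp add: sum_count_set)
 also have "set (mi_list \<alpha>) = Poly_Mapping.keys \<alpha>"
  using keys_mi_of[of "mi_list \<alpha>"] by simp
 finally show ?thesis by (simp add: mi_order_def count_mi_list)
qed

lemma prod_list_concat_replicate:
 "distinct xs ==> prod_list (map w (concat (map (\<lambda>i. replicate (f i) i) xs))) = (\<Prod>i\<in>set xs. w i ^ f i)"
 for w :: "nat \<Rightarrow> real"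
 by (induction xs) (auto simp: prod_list_replicate)

lemma mi_power_eq: "mi_power a \<alpha> = prod_list (map a (mi_list \<alpha>))"
 unfolding mi_power_def mi_list_def by (subst prod_list_concat_replicate) auto

lemma Dmi_eq_pds: "Dmi \<alpha> = pds (mi_list \<alpha>)"
 by (simp add: Dmi_def pds_def fun_eq_iff)

section \<open>Test functions\<close>

text \<open>Test functions extended by zero to the whole space.\<close>

definition QT :: "(ell2 \<Rightarrow> real) \<Rightarrow> bool" where
 "QT u \<longleftrightarrow> continuous_on UNIV u \<and> (\<exists>C. \<forall>x. \<bar>u x\<bar> \<le> C) \<and> (\<exists>R. \<forall>x. norm x \<ge> R \<longrightarrow> u x = 0)"

abbreviation btest :: "(ell2 \<Rightarrow> real) \<Rightarrow> bool" where
 "btest \<equiv> regular QT (range unit_vec)"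

lemma QT_add: "QT f ==> QT g ==> QT (\<lambda>x. f x + g x)"
 unfolding QT_def
proof (elim conjE exE, intro conjI)
 fix C R C' R' assume f: "\<forall>x. \<bar>f x\<bar> \<le> C" "\<forall>x. R \<le> norm x \<longrightarrow> f x = 0" and g: "\<forall>x. \<bar>g x\<bar> \<le> C'" "\<forall>x. R' \<le> norm x \<longrightarrow> g x = 0"
 show "\<exists>C. \<forall>x. \<bar>f x + g x\<bar> \<le> C"
 proof (intro exI[of _ "C + C'"] allI)
  fix x show "\<bar>f x + g x\<bar> \<le> C + C'" using f(1)[rule_format, of x] g(1)[rule_format, of x] by linarith
 qed
 show "\<exists>R. \<forall>x. R \<le> norm x \<longrightarrow> f x + g x = 0"
  using f(2) g(2) by (intro exI[of _ "max R R'"]) auto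
qed (intro continuous_intros)

lemma QT_mult: "lipb f ==> QT g ==> QT (\<lambda>x. f x * g x)"
proof -
 assume f: "lipb f" and g: "QT g"
 obtain C R where g: "continuous_on UNIV g" "\<And>x. \<bar>g x\<bar> \<le> C" "\<And>x. norm x \<ge> R ==> g x = 0"
  using g unfolding QT_def by blast
 obtain D where D: "D \<ge> 0" "\<And>x. norm x < R ==> \<bar>f x\<bar> \<le> D" using lipb_boundedE[OF f] by blast
 have C: "C \<ge> 0" using g(2)[of 0] by linarith
 have "\<bar>f x * g x\<bar> \<le> D * C" for x
 proof (cases "norm x \<ge> R")
  case False
  then show ?thesis unfolding abs_mult using D g(2) C by (intro mult_mono) auto
 qed (use g(3) D C in simp)
 moreover have "continuous_on UNIV (\<lambda>x. f x * g x)"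
  by (intro continuous_intros lipb_continuous f g)
 ultimately show ?thesis unfolding QT_def using g(3) by (metis mult_zero_right)
qed

lemma btest_mult: "tame f ==> btest u ==> btest (\<lambda>x. f x * u x)"
 by (rule regular_mult[where P = lipb and Q = QT and R = QT, OF QT_mult QT_add])

lemma btest_add: "btest u ==> btest w ==> btest (\<lambda>x. u x + w x)"
 by (rule regular_add[where Q = QT, OF QT_add])

lemma btest_pd: "btest u ==> btest (pd i u)"
 unfolding pd_eq_dd by (rule regular_dd) auto

lemma btest_pds: "btest u ==> btest (pds is u)"
 by (induction "is") (auto intro: btest_pd)

lemma btest_has_pd: "btest u ==> has_pd i u x"
 unfolding has_pd_eq by (rule regular_has_dd) auto

lemma btest_QT: "btest u ==> QT u"
 by (rule regular_base)

lemma btest_measurable: "btest u ==> u \<in> borel_measurable borel"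
 using btest_QT[of u] by (auto simp: QT_def intro: borel_measurable_continuous_onI)

lemma btest_bounded: "btest u ==> \<exists>C. \<forall>x. \<bar>u x\<bar> \<le> C"
 using btest_QT[of u] by (auto simp: QT_def)

lemma btest_delta: "btest u ==> btest (delta a i u)"
proof -
 assume u: "btest u"
 have "delta a i u = (\<lambda>x. pd i u x + (- 1 / (a i)\<^sup>2 * coord x i) * u x)"
  by (simp add: delta_def fun_eq_iff)
 then show ?thesis
  by (simp only:) (intro btest_add btest_pd btest_mult tame_cmult tame_coord u)
qed

lemma btest_deltas: "btest u ==> btest (foldr (delta a) is u)"
 by (induction "is") (auto intro: btest_delta)

lemma delta_mult:
 assumes "tame f" "btest u"
 shows "delta a i (\<lambda>x. f x * u x) x = pd i f x * u x + f x * delta a i u x"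
 using dd_mult(2)[of "unit_vec i" f x u] tame_has_pd[OF assms(1), of i x] btest_has_pd[OF assms(2), of i x]
 by (simp add: delta_def pd_eq_dd has_pd_eq algebra_simps)

lemma delta_cong_local:
 assumes "open U" "x \<in> U" "\<And>y. y \<in> U ==> f y = g y"
 shows "delta a i f x = delta a i g x"
 using dd_cong_local(1)[OF assms] assms by (simp add: delta_def pd_eq_dd)

lemma deltas_cong_local:
 assumes "open U" "x \<in> U" "\<And>y. y \<in> U ==> f y = g y"
 shows "foldr (delta a) is f x = foldr (delta a) is g x"
 using assms(2)
proof (induction "is" arbitrary: x)
 case (Cons i "is")
 then show ?case using delta_cong_local[OF assms(1) Cons.prems Cons.IH] by simp
qed (use assms in auto)

lemma delta_sum_list:
 assumes "\<And>p. p \<in> set ps ==> btest (F p)"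
 shows "delta a i (\<lambda>x. \<Sum>p\<leftarrow>ps. F p x) x = (\<Sum>p\<leftarrow>ps. delta a i (F p) x)"
proof -
 have "pd i (\<lambda>x. \<Sum>p\<leftarrow>ps. F p x) x = (\<Sum>p\<leftarrow>ps. pd i (F p) x)"
  unfolding pd_eq_dd by (rule dd_sum_list(2)) (use btest_has_pd assms in \<open>auto simp: has_pd_eq\<close>)
 then show ?thesis
  unfolding delta_def by (simp only: sum_list_subtractf sum_list_const_mult)
qed

lemma delta_cmult:
 assumes "btest u"
 shows "delta a i (\<lambda>x. c * u x) x = c * delta a i u x"
 using dd_cmult(2)[of "unit_vec i" u x c] btest_has_pd[OF assms, of i x]
 by (simp add: delta_def pd_eq_dd has_pd_eq algebra_simps)

text \<open>The Leibniz rule solved for the undifferentiated factor, by iterating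
  \<open>f * delta w = delta (f * w) - (pd f) * w\<close>. In this form a cutoff \<open>f\<close>
  can be shifted into the function on which \<open>delta\<close> acts; the innermost derivative
  comes first, hence \<open>rev\<close>.\<close>

lemma leibniz_deltas:
 assumes u: "btest u" and "tame f"
 shows "f x * foldr (delta a) is u x =
  (\<Sum>(r, s)\<leftarrow>splits is. (- 1) ^ length r * foldr (delta a) s (\<lambda>x. pds (rev r) f x * u x) x)"
 using assms(2)
proof (induction "is" arbitrary: f x)
 case (Cons i "is")
 let ?w = "foldr (delta a) is u"
 have w: "btest ?w" by (rule btest_deltas[OF u])
 let ?F = "\<lambda>p x. (- 1) ^ length (fst p) * foldr (delta a) (snd p) (\<lambda>x. pds (rev (fst p)) f x * u x) x"
 have b: "btest (foldr (delta a) s (\<lambda>x. pds (rev r) f x * u x))" for r s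
  by (intro btest_deltas btest_mult tame_pds Cons.prems u)
 have bF: "btest (?F p)" for p
  by (intro btest_mult tame_const b)
 have "f x * delta a i ?w x = delta a i (\<lambda>x. f x * ?w x) x - pd i f x * ?w x"
  by (simp add: delta_mult[OF Cons.prems w])
 also have "(\<lambda>x. f x * ?w x) = (\<lambda>x. \<Sum>p\<leftarrow>splits is. ?F p x)"
  using Cons.IH[OF Cons.prems] by (simp add: case_prod_unfold fun_eq_iff)
 also have "delta a i (\<lambda>x. \<Sum>p\<leftarrow>splits is. ?F p x) x = (\<Sum>p\<leftarrow>splits is. delta a i (?F p) x)"
  by (rule delta_sum_list[OF bF])
 also have "\<dots> = (\<Sum>p\<leftarrow>splits is. (- 1) ^ length (fst p) * foldr (delta a) (i # snd p) (\<lambda>x. pds (rev (fst p)) f x * u x) x)"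
  by (simp add: delta_cmult[OF b])
 also have "pd i f x * ?w x = (\<Sum>p\<leftarrow>splits is. (- 1) ^ length (fst p) * foldr (delta a) (snd p) (\<lambda>x. pds (rev (i # fst p)) f x * u x) x)"
  using Cons.IH[OF tame_pd[OF Cons.prems], of i x] by (simp add: case_prod_unfold pds_append)
 finally show ?case
  by (simp add: case_prod_unfold o_def uminus_sum_list_map)
qed simp

section \<open>Integration by parts for the Gaussian measure\<close>

context gaussian_seq
begin

text \<open>The derivative at 0 of the average of \<open>u\<close> is computed in two ways, once
  with the derivative on \<open>u\<close> and once on the kernel.\<close>

lemma integral_delta:
 assumes u: "btest u"
 shows "(\<integral>x. delta b i u x \<partial>G) = 0"
proof -
 obtain K where K: "\<And>x. \<bar>u x\<bar> \<le> K" using btest_bounded[OF u] by blast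
 obtain K' where K': "\<And>x. \<bar>pd i u x\<bar> \<le> K'" using btest_bounded[OF btest_pd[OF u]] by blast
 note m [measurable] = btest_measurable[OF u] btest_measurable[OF btest_pd[OF u], of i]
 have "(\<integral>x. pd i u x \<partial>G) = gconv (pd i u) (\<lambda>_. 1) 0" by (simp add: gconv_def)
 also have "\<dots> = pd i (gconv u (\<lambda>_. 1)) 0"
  by (subst pd_gconv_commute[OF m(1) K btest_has_pd[OF u] K' gpoly_const]) simp
 also have "\<dots> = gconv u (hop i (\<lambda>_. 1)) 0" by (rule pd_gconv(2)[OF m(1) K gpoly_const])
 also have "\<dots> = (\<integral>x. coord x i / (b i)^2 * u x \<partial>G)"
  by (simp add: gconv_def hop_def pd_eq_dd mult.commute)
 finally have eq: "(\<integral>x. pd i u x \<partial>G) = (\<integral>x. coord x i / (b i)^2 * u x \<partial>G)" .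
 have "integrable G (pd i u)" by (rule G.integrable_const_bound[where B = K']) (use K' in auto)
 moreover have "integrable G (\<lambda>x. coord x i / (b i)^2 * u x)"
  using integrable_gpoly[OF m(1) K gpoly_cmult[OF gpoly_coord], of "1 / (b i)^2" i] by (simp add: mult.commute)
 ultimately show ?thesis unfolding delta_def using eq by simp
qed

lemma btest_integrable: "btest u ==> integrable G u"
proof -
 assume u: "btest u"
 obtain K where "\<And>x. \<bar>u x\<bar> \<le> K" using btest_bounded[OF u] by blast
 then show ?thesis using btest_measurable[OF u] by (intro G.integrable_const_bound[where B = K]) auto
qed

lemma integrable_mult_btest: "integrable G f ==> btest u ==> integrable G (\<lambda>x. f x * u x)"
proof -
 assume f: "integrable G f" and u: "btest u"
 obtain K where K: "\<And>x. \<bar>u x\<bar> \<le> K" using btest_bounded[OF u] by blast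
 have "\<bar>f x * u x\<bar> \<le> \<bar>K * f x\<bar>" for x
 proof -
  have "\<bar>f x\<bar> * \<bar>u x\<bar> \<le> \<bar>f x\<bar> * \<bar>K\<bar>" using K[of x] by (intro mult_left_mono) auto
  then show ?thesis by (simp add: abs_mult mult.commute)
 qed
 then have le: "AE x in G. norm (f x * u x) \<le> norm (K * f x)" by simp
 note [measurable] = borel_measurable_integrable[OF f] btest_measurable[OF u]
 show ?thesis
  by (rule bint_bound[OF _ _ le]) (use f in simp, measurable)
qed

lemma integration_by_parts:
 assumes "btest u" and "tame f"
 shows "(\<integral>x. f x * foldr (delta b) is u x \<partial>G) = (- 1) ^ length is * (\<integral>x. pds (rev is) f x * u x \<partial>G)"
 using assms(2)
proof (induction "is" arbitrary: f)
 case (Cons i "is")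
 let ?w = "foldr (delta b) is u"
 have w: "btest ?w" by (rule btest_deltas[OF assms(1)])
 have "(\<integral>x. f x * delta b i ?w x \<partial>G) = (\<integral>x. delta b i (\<lambda>x. f x * ?w x) x - pd i f x * ?w x \<partial>G)"
  by (simp add: delta_mult[OF Cons.prems w])
 also have "\<dots> = - (\<integral>x. pd i f x * ?w x \<partial>G)"
  using integral_delta[OF btest_mult[OF Cons.prems w], of i]
   btest_integrable[OF btest_delta[OF btest_mult[OF Cons.prems w]], of b i]
   btest_integrable[OF btest_mult[OF tame_pd[OF Cons.prems] w], of i]
  by (subst bint_diff) simp_all
 finally show ?case using Cons.IH[OF tame_pd[OF Cons.prems], of i] by (simp add: pds_append)
qed simp

end

sublocale exhaustion \<subseteq> gaussian_seq a
proof
 show "a i > 0" for i by (rule a_pos)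
 have "(\<lambda>i. a i) \<longlonglongrightarrow> 0" by (rule summable_LIMSEQ_zero[OF a_summable])
 then have "\<forall>\<^sub>F i in sequentially. a i < 1" by (rule order_tendstoD) simp
 then have "\<forall>\<^sub>F i in sequentially. norm ((a i)^2) \<le> a i"
 proof eventually_elim
  case (elim i)
  then show ?case using a_pos[of i] by (simp add: power2_eq_square mult_left_le_one_le less_imp_le)
 qed
 then show "summable (\<lambda>i. (a i)^2)" by (rule summable_comparison_test_ev[OF _ a_summable])
qed

section \<open>Extension by zero and the supply of test functions\<close>

context exhaustion
begin

definition ext :: "(ell2 \<Rightarrow> real) \<Rightarrow> ell2 \<Rightarrow> real" where
 "ext \<phi> x = (if x \<in> \<Omega> then \<phi> x else 0)"

text \<open>Uniform bounds of the gradient, as in the definition of \<^const>\<open>C1_F\<close>.\<close>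

definition gb :: "(ell2 \<Rightarrow> real) \<Rightarrow> bool" where
 "gb v \<longleftrightarrow> (\<exists>C. \<forall>x n. (\<Sum>i<n. (pd i v x)^2) \<le> C)"

text \<open>The support is closed only relative to \<open>\<Omega>\<close>, but uniform inclusion
  keeps its closure inside \<open>\<Omega>\<close>, so it is closed in the whole space. Extension by
  zero is then smooth across the boundary.\<close>

lemma test_fun_support:
 assumes "\<phi> \<in> C_0_infty \<Omega>"
 obtains S n where "closed S" "S \<subseteq> V n" "\<And>x. x \<notin> S ==> ext \<phi> x = 0"
proof -
 have u: "unif_incl (supp_in \<Omega> \<phi>) \<Omega>" using assms by (auto simp: C_0_infty_def C_0_def)
 obtain n where n: "supp_in \<Omega> \<phi> \<subseteq> V n" using unif_incl_V[OF u] by blast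
 have "closed (supp_in \<Omega> \<phi>)"
  unfolding closure_subset_eq[symmetric]
 proof
  fix x assume x: "x \<in> closure (supp_in \<Omega> \<phi>)"
  have "x \<in> closure (V n)" using x n closure_mono by blast
  then have "x \<in> \<Omega>" using closure_V V_subset by blast
  moreover have "x \<in> closure (closure {x \<in> \<Omega>. \<phi> x \<noteq> 0})"
   using x closure_mono[of "supp_in \<Omega> \<phi>" "closure {x \<in> \<Omega>. \<phi> x \<noteq> 0}"] by (auto simp: supp_in_def)
  ultimately show "x \<in> supp_in \<Omega> \<phi>" by (simp add: supp_in_def)
 qed
 moreover have "ext \<phi> x = 0" if "x \<notin> supp_in \<Omega> \<phi>" for x
  using that closure_subset[of "{x \<in> \<Omega>. \<phi> x \<noteq> 0}"] by (auto simp: ext_def supp_in_def)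
 ultimately show ?thesis using n that by blast
qed

lemma pds_ext:
 assumes "\<phi> \<in> C_0_infty \<Omega>"
 shows "pds is (ext \<phi>) = ext (pds is \<phi>)"
proof
 fix x
 obtain S n where S: "closed S" "S \<subseteq> V n" "\<And>x. x \<notin> S ==> ext \<phi> x = 0" by (rule test_fun_support[OF assms]) (rule that, assumption+)
 show "pds is (ext \<phi>) x = ext (pds is \<phi>) x"
 proof (cases "x \<in> \<Omega>")
  case True
  then show ?thesis
   using pds_cong_local[OF open_\<Omega> True, of "ext \<phi>" \<phi> "is"] by (simp add: ext_def)
 next
  case False
  then have "x \<in> - S" using S(2) V_subset by blast
  then show ?thesis
   using pds_cong_local[of "- S" x "ext \<phi>" "\<lambda>_. 0" "is"] S False by (simp add: ext_def open_Compl)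
 qed
qed

lemma deltas_ext:
 assumes "\<phi> \<in> C_0_infty \<Omega>"
 shows "foldr (delta a) is (ext \<phi>) x = indicator \<Omega> x * foldr (delta a) is \<phi> x"
proof -
 obtain S n where S: "closed S" "S \<subseteq> V n" "\<And>x. x \<notin> S ==> ext \<phi> x = 0" by (rule test_fun_support[OF assms]) (rule that, assumption+)
 have z: "foldr (delta a) is (\<lambda>_. 0) = (\<lambda>_. 0)"
  by (induction "is") (auto simp: delta_def[abs_def] pd_eq_dd)
 show ?thesis
 proof (cases "x \<in> \<Omega>")
  case True
  then show ?thesis
   using deltas_cong_local[OF open_\<Omega> True, of "ext \<phi>" \<phi> a "is"] by (simp add: ext_def)
 next
  case False
  then have "x \<in> - S" using S(2) V_subset by blast
  then show ?thesis
   using deltas_cong_local[of "- S" x "ext \<phi>" "\<lambda>_. 0" a "is"] S False z by (simp add: open_Compl)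
 qed
qed

lemma btest_ext:
 assumes p: "\<phi> \<in> C_0_infty \<Omega>"
 shows "btest (ext \<phi>)"
proof (rule regularI)
 obtain S n where S: "closed S" "S \<subseteq> V n" "\<And>x. x \<notin> S ==> ext \<phi> x = 0" by (rule test_fun_support[OF p]) (rule that, assumption+)
 have U: "\<Omega> \<union> - S = UNIV" using S(2) V_subset by blast
 have zero: "pds is (ext \<phi>) y = 0" if "y \<in> - S" for "is" y
  using pds_cong_local[of "- S" y "ext \<phi>" "\<lambda>_. 0" "is"] S that by (simp add: open_Compl)
 fix vs :: "ell2 list" assume "vs \<in> lists (range unit_vec)"
 then have "set vs \<subseteq> range unit_vec" by auto
 then obtain "is" where vs: "vs = map unit_vec is" by (metis ex_map_conv subset_code(1) rangeE)
 have k: "\<phi> \<in> C_b (length is) \<Omega>" "\<phi> \<in> C_k (Suc (length is)) \<Omega>"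
  using p by (auto simp: C_0_infty_def C_0_def C_b_def)
 show "QT (dds vs (ext \<phi>))"
  unfolding vs pds_eq_dds[symmetric] QT_def
 proof (intro conjI)
  have "continuous_on (\<Omega> \<union> - S) (pds is (ext \<phi>))"
  proof (rule continuous_on_open_Un)
   show "continuous_on \<Omega> (pds is (ext \<phi>))"
    using k by (subst continuous_on_cong[OF refl, of \<Omega> _ "pds is \<phi>"]) (auto simp: pds_ext[OF p] ext_def C_k_def C_b_def)
   show "continuous_on (- S) (pds is (ext \<phi>))"
    by (subst continuous_on_cong[OF refl, of "- S" _ "\<lambda>_. 0"]) (auto simp: zero)
  qed (use S open_\<Omega> in \<open>auto simp: open_Compl\<close>)
  then show "continuous_on UNIV (pds is (ext \<phi>))" by (simp only: U)
  have "bounded (pds is \<phi> ` \<Omega>)" using k(1) by (auto simp: C_b_def)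
  then obtain C where C: "C > 0" "\<forall>x\<in>\<Omega>. \<bar>pds is \<phi> x\<bar> \<le> C" unfolding bounded_pos by auto
  then show "\<exists>C. \<forall>x. \<bar>pds is (ext \<phi>) x\<bar> \<le> C" by (intro exI[of _ C]) (auto simp: pds_ext[OF p] ext_def)
  show "\<exists>R. \<forall>x. R \<le> norm x \<longrightarrow> pds is (ext \<phi>) x = 0"
  proof (intro exI[of _ "real (n + K)"] allI impI)
   fix x :: ell2 assume "real (n + K) \<le> norm x"
   then have "x \<in> - S" using V_bounded[of x n] S(2) by force
   then show "pds is (ext \<phi>) x = 0" by (rule zero)
  qed
 qed
 fix v x assume "v \<in> range unit_vec"
 then obtain i where v: "v = unit_vec i" by auto
 show "has_dd v (dds vs (ext \<phi>)) x"
  unfolding vs pds_eq_dds[symmetric] v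
 proof (cases "x \<in> \<Omega>")
  case True
  have "has_pd i (pds is \<phi>) x" using k(2) True by (auto simp: C_k_def pds_exist_def)
  then show "has_dd (unit_vec i) (pds is (ext \<phi>)) x"
   using dd_cong_local(2)[OF open_\<Omega> True, of "pds is (ext \<phi>)" "pds is \<phi>"] by (simp add: pds_ext[OF p] ext_def has_pd_eq)
 next
  case False
  then have "x \<in> - S" using S(2) V_subset by blast
  then have "has_dd (unit_vec i) (pds is (ext \<phi>)) x = has_dd (unit_vec i) (\<lambda>_. 0) x"
   using S(1) zero by (intro dd_cong_local(2)[of "- S"]) (auto simp: open_Compl)
  then show "has_dd (unit_vec i) (pds is (ext \<phi>)) x" by (simp add: has_dd_def)
 qed
qed

text \<open>Sorted lists only, because the gradient bound in \<open>C_infty_F\<close> is imposed on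
  \<open>Dmi\<close>, that is, on derivatives in one fixed order.\<close>

lemma gb_ext:
 assumes p: "\<phi> \<in> test_fun \<Omega>" and s: "sorted s"
 shows "gb (pds s (ext \<phi>))"
proof -
 have p0: "\<phi> \<in> C_0_infty \<Omega>" using p by (simp add: test_fun_def)
 obtain S n where S: "closed S" "S \<subseteq> V n" "\<And>x. x \<notin> S ==> ext \<phi> x = 0" by (rule test_fun_support[OF p0]) (rule that, assumption+)
 have "Dmi (mi_of s) \<phi> \<in> C1_F \<Omega>" using p by (auto simp: test_fun_def C_infty_F_def)
 then have "(SUP x\<in>V n. ennreal \<bar>pds s \<phi> x\<bar> + suminf (\<lambda>i. ennreal (\<bar>pd i (pds s \<phi>) x\<bar>^2))) < \<infinity>"
  using V_unif_incl[of "V n" n] by (simp add: C1_F_def Dmi_eq_pds mi_list_mi_of[OF s])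
 then obtain C where C: "(SUP x\<in>V n. ennreal \<bar>pds s \<phi> x\<bar> + suminf (\<lambda>i. ennreal (\<bar>pd i (pds s \<phi>) x\<bar>^2))) = ennreal C" "C \<ge> 0"
  unfolding infinity_ennreal_def less_top_ennreal by blast
 have "(\<Sum>i<k. (pd i (pds s (ext \<phi>)) x)^2) \<le> C" for x k
 proof (cases "x \<in> S")
  case True
  then have x: "x \<in> V n" using S by auto
  have "ennreal (\<Sum>i<k. (pd i (pds s \<phi>) x)^2) = (\<Sum>i<k. ennreal (\<bar>pd i (pds s \<phi>) x\<bar>^2))"
   by (simp add: sum_ennreal)
  also have "\<dots> \<le> suminf (\<lambda>i. ennreal (\<bar>pd i (pds s \<phi>) x\<bar>^2))"
   by (rule sum_le_suminf) auto
  also have "\<dots> \<le> ennreal \<bar>pds s \<phi> x\<bar> + suminf (\<lambda>i. ennreal (\<bar>pd i (pds s \<phi>) x\<bar>^2))" by simp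
  also have "\<dots> \<le> ennreal C" unfolding C(1)[symmetric] by (rule SUP_upper[OF x])
  finally have "(\<Sum>i<k. (pd i (pds s \<phi>) x)^2) \<le> C" using C(2) by (simp add: ennreal_le_iff)
  moreover have "pd i (pds s (ext \<phi>)) x = pd i (pds s \<phi>) x" for i
   using pds_ext[OF p0, of "i # s"] x V_subset by (auto simp: ext_def)
  ultimately show ?thesis by simp
 next
  case False
  then have "pd i (pds s (ext \<phi>)) x = 0" for i
   using pds_cong_local[of "- S" x "ext \<phi>" "\<lambda>_. 0" "i # s"] S by (simp add: open_Compl)
  then show ?thesis using C(2) by simp
 qed
 then show ?thesis unfolding gb_def by blast
qed

lemma gb_add:
 assumes "btest u" "btest w" "gb u" "gb w"
 shows "gb (\<lambda>x. u x + w x)"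
proof -
 obtain C D where C: "\<And>x n. (\<Sum>i<n. (pd i u x)^2) \<le> C" and D: "\<And>x n. (\<Sum>i<n. (pd i w x)^2) \<le> D"
  using assms unfolding gb_def by blast
 have "(\<Sum>i<n. (pd i (\<lambda>x. u x + w x) x)^2) \<le> 2 * C + 2 * D" for x n
 proof -
  have "(pd i (\<lambda>x. u x + w x) x)^2 \<le> 2 * (pd i u x)^2 + 2 * (pd i w x)^2" for i
  proof -
   have "pd i (\<lambda>x. u x + w x) x = pd i u x + pd i w x"
    using btest_has_pd[OF assms(1)] btest_has_pd[OF assms(2)] by (simp add: pd_eq_dd has_pd_eq dd_add)
   then show ?thesis using sum_squares_bound[of "pd i u x" "pd i w x"] by (simp add: power2_sum)
  qed
  then have "(\<Sum>i<n. (pd i (\<lambda>x. u x + w x) x)^2) \<le> (\<Sum>i<n. 2 * (pd i u x)^2 + 2 * (pd i w x)^2)" by (intro sum_mono)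
  also have "\<dots> = 2 * (\<Sum>i<n. (pd i u x)^2) + 2 * (\<Sum>i<n. (pd i w x)^2)" by (simp add: sum.distrib sum_distrib_left)
  also have "\<dots> \<le> 2 * C + 2 * D" using C D by (intro add_mono mult_left_mono) auto
  finally show ?thesis .
 qed
 then show ?thesis unfolding gb_def by blast
qed

lemma gb_mult:
 assumes f: "tame f" and u: "btest u" "gb u"
 shows "gb (\<lambda>x. f x * u x)"
proof -
 obtain C where C: "\<And>x n. (\<Sum>i<n. (pd i u x)^2) \<le> C" using u unfolding gb_def by blast
 obtain B R where B: "\<And>x. \<bar>u x\<bar> \<le> B" and R: "\<And>x. norm x \<ge> R ==> u x = 0"
  using btest_QT[OF u(1)] unfolding QT_def by blast
 \<comment> \<open>The margin 1: a point of norm at least \<open>R + 1\<close> has a neighbourhood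
   on which \<open>u\<close> vanishes, so the derivatives of the product vanish there too.\<close>
 obtain F where F: "F \<ge> 0" "\<And>x. norm x < R + 1 ==> \<bar>f x\<bar> \<le> F" using lipb_boundedE[OF tame_lipb[OF f]] by blast
 obtain D where D: "D \<ge> 0" "\<And>x n. norm x < R + 1 ==> (\<Sum>i<n. (pd i f x)^2) \<le> D" using tame_gradE[OF f] by blast
 have C0: "C \<ge> 0" using C[of 0 0] by simp
 have "(\<Sum>i<n. (pd i (\<lambda>x. f x * u x) x)^2) \<le> 2 * B^2 * D + 2 * F^2 * C" for x n
 proof (cases "norm x < R + 1")
  case True
  have "(pd i (\<lambda>x. f x * u x) x)^2 \<le> 2 * B^2 * (pd i f x)^2 + 2 * F^2 * (pd i u x)^2" for i
  proof -
   have "pd i (\<lambda>x. f x * u x) x = pd i f x * u x + f x * pd i u x"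
    using tame_has_pd[OF f] btest_has_pd[OF u(1)] by (simp add: pd_eq_dd has_pd_eq dd_mult)
   then have "(pd i (\<lambda>x. f x * u x) x)^2 \<le> 2 * (pd i f x * u x)^2 + 2 * (f x * pd i u x)^2"
    using sum_squares_bound[of "pd i f x * u x" "f x * pd i u x"] by (simp add: power2_sum)
   also have "\<dots> \<le> 2 * ((pd i f x)^2 * B^2) + 2 * (F^2 * (pd i u x)^2)"
    unfolding power_mult_distrib
    using power_mono[OF B[of x], of 2] power_mono[OF F(2)[OF True], of 2]
    by (intro add_mono mult_left_mono mult_right_mono) auto
   finally show ?thesis by (simp add: ac_simps)
  qed
  then have "(\<Sum>i<n. (pd i (\<lambda>x. f x * u x) x)^2) \<le> (\<Sum>i<n. 2 * B^2 * (pd i f x)^2 + 2 * F^2 * (pd i u x)^2)" by (intro sum_mono)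
  also have "\<dots> = 2 * B^2 * (\<Sum>i<n. (pd i f x)^2) + 2 * F^2 * (\<Sum>i<n. (pd i u x)^2)" by (simp add: sum.distrib sum_distrib_left)
  also have "\<dots> \<le> 2 * B^2 * D + 2 * F^2 * C" using C D(2)[OF True] by (intro add_mono mult_left_mono) auto
  finally show ?thesis .
 next
  case False
  have "open {x. norm x > R}" by (intro open_Collect_less continuous_intros)
  then have "pd i (\<lambda>x. f x * u x) x = pd i (\<lambda>_. 0) x" for i
   unfolding pd_eq_dd using False R by (intro dd_cong_local(1)[of "{x. norm x > R}"]) auto
  then show ?thesis using C0 D(1) by (simp add: pd_eq_dd)
 qed
 then show ?thesis unfolding gb_def by blast
qed

lemma btest_test_funI:
 assumes u: "btest u" and S: "\<And>x. u x \<noteq> 0 ==> x \<in> V n" and g: "\<And>s. sorted s ==> gb (pds s u)"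
 shows "u \<in> test_fun \<Omega>"
proof -
 have cont: "continuous_on \<Omega> (pds is u)" for "is"
  using btest_QT[OF btest_pds[OF u, of "is"]] continuous_on_subset by (auto simp: QT_def)
 have ck: "pds js u \<in> C_k k \<Omega>" for js k
  using btest_has_pd[OF btest_pds[OF u]] cont
  by (auto simp: C_k_def pds_exist_def pds_append[symmetric])
 have bdd: "bounded (pds is u ` \<Omega>)" for "is"
  using btest_bounded[OF btest_pds[OF u, of "is"]] by (auto simp: bounded_iff)
 have supp: "unif_incl (supp_in \<Omega> u) \<Omega>"
 proof (rule V_unif_incl)
  have "closure {x \<in> \<Omega>. u x \<noteq> 0} \<subseteq> closure (V n)" using S by (intro closure_mono) auto
  then show "supp_in \<Omega> u \<subseteq> V (Suc n)" using closure_V by (auto simp: supp_in_def)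
 qed
 have "u \<in> C_0_infty \<Omega>"
  using ck[of "[]"] bdd supp by (auto simp: C_0_infty_def C_0_def C_b_def)
 moreover have "Dmi \<alpha> u \<in> C1_F \<Omega>" for \<alpha>
 proof -
  let ?s = "mi_list \<alpha>"
  obtain C where C: "\<And>x n. (\<Sum>i<n. (pd i (pds ?s u) x)^2) \<le> C"
   using g[OF sorted_mi_list] unfolding gb_def by blast
  obtain B where B: "\<And>x. \<bar>pds ?s u x\<bar> \<le> B" using btest_bounded[OF btest_pds[OF u]] by blast
  have "ennreal \<bar>pds ?s u x\<bar> + suminf (\<lambda>i. ennreal (\<bar>pd i (pds ?s u) x\<bar>^2)) \<le> ennreal B + ennreal C" for x
  proof (intro add_mono ennreal_leI B)
   have "(\<Sum>i<n. ennreal (\<bar>pd i (pds ?s u) x\<bar>^2)) \<le> ennreal C" for n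
    using C[of x n] by (subst sum_ennreal) (auto intro: ennreal_leI)
   then show "suminf (\<lambda>i. ennreal (\<bar>pd i (pds ?s u) x\<bar>^2)) \<le> ennreal C"
    by (intro suminf_le_const) auto
  qed
  then have "(SUP x\<in>E. ennreal \<bar>pds ?s u x\<bar> + suminf (\<lambda>i. ennreal (\<bar>pd i (pds ?s u) x\<bar>^2))) \<le> ennreal B + ennreal C" for E
   by (intro SUP_least)
  then have "(SUP x\<in>E. ennreal \<bar>pds ?s u x\<bar> + suminf (\<lambda>i. ennreal (\<bar>pd i (pds ?s u) x\<bar>^2))) < \<infinity>" for E
   by (rule le_less_trans) simp
  then show ?thesis using ck[of ?s 1] unfolding C1_F_def Dmi_eq_pds by auto
 qed
 ultimately show ?thesis
  using ck[of "[]"] by (auto simp: test_fun_def C_infty_F_def C_infty_def)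
qed

lemma gb_pds_mult:
 assumes f: "tame f" and u: "btest u" "\<And>s. sorted s ==> gb (pds s u)" and s: "sorted s"
 shows "gb (pds s (\<lambda>x. f x * u x))"
proof -
 have eq: "pds s (\<lambda>x. f x * u x) = (\<lambda>x. \<Sum>(r, t)\<leftarrow>splits s. pds r f x * pds t u x)"
  unfolding pds_eq_dds
  by (subst dds_mult[OF f u(1)]) (auto simp: splits_map case_prod_unfold o_def)
 have "btest (\<lambda>x. \<Sum>(r, t)\<leftarrow>ps. pds r f x * pds t u x) \<and> gb (\<lambda>x. \<Sum>(r, t)\<leftarrow>ps. pds r f x * pds t u x)"
  if "\<And>r t. (r, t) \<in> set ps ==> sorted t" for ps
  using that
 proof (induction ps)
  case Nil
  have "btest (\<lambda>x. 0)" by (rule regular_coinduct[where C = "{\<lambda>x. 0}"]) (auto simp: QT_def has_dd_def)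
  then show ?case by (auto simp: gb_def pd_eq_dd)
 next
  case (Cons p ps)
  obtain r t where p: "p = (r, t)" by fastforce
  have "sorted t" using Cons.prems p by auto
  then have "btest (\<lambda>x. pds r f x * pds t u x)" "gb (\<lambda>x. pds r f x * pds t u x)"
   by (auto intro!: btest_mult gb_mult tame_pds f btest_pds u)
  with Cons p show ?case by (auto intro!: btest_add gb_add)
 qed
 then show ?thesis unfolding eq using splits_sorted[OF _ s] by blast
qed

text \<open>Allows a cutoff to be moved from a Sobolev function onto the test function in the
  definition of the weak derivative.\<close>

lemma test_fun_mult:
 assumes f: "tame f" and p: "\<phi> \<in> test_fun \<Omega>"
 shows "(\<lambda>x. f x * ext \<phi> x) \<in> test_fun \<Omega>"
proof -
 have p0: "\<phi> \<in> C_0_infty \<Omega>" using p by (simp add: test_fun_def)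
 obtain S n where S: "closed S" "S \<subseteq> V n" "\<And>x. x \<notin> S ==> ext \<phi> x = 0" by (rule test_fun_support[OF p0]) (rule that, assumption+)
 show ?thesis
 proof (rule btest_test_funI)
  show "btest (\<lambda>x. f x * ext \<phi> x)" by (intro btest_mult f btest_ext p0)
  show "x \<in> V n" if "f x * ext \<phi> x \<noteq> 0" for x using that S by auto
  show "gb (pds s (\<lambda>x. f x * ext \<phi> x))" if "sorted s" for s
   by (intro gb_pds_mult f btest_ext p0 gb_ext[OF p] that)
 qed
qed

lemma tame_supp_btest:
 assumes f: "tame f" and S: "\<And>x. f x \<noteq> 0 ==> x \<in> V n"
 shows "btest f"
proof (rule regularI)
 fix vs :: "ell2 list" assume vs: "vs \<in> lists (range unit_vec)"
 have z: "dds vs f x = 0" if "norm x > real (n + K)" for x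
 proof -
  have "open {x. norm x > real (n + K)}" by (intro open_Collect_less continuous_intros)
  moreover have "f y = 0" if "norm y > real (n + K)" for y using S[of y] V_bounded[of y n] that by force
  ultimately have "dds vs f x = dds vs (\<lambda>_. 0) x" using that by (intro dds_cong_local[of "{x. norm x > real (n + K)}"]) auto
  then show ?thesis by simp
 qed
 have l: "lipb (dds vs f)" by (rule regular_base[OF regular_dds[OF f vs]])
 obtain C where C: "C \<ge> 0" "\<And>x. norm x < real (n + K) + 1 ==> \<bar>dds vs f x\<bar> \<le> C" using lipb_boundedE[OF l] by blast
 have "\<bar>dds vs f x\<bar> \<le> C" for x
  using C z[of x] by (cases "norm x < real (n + K) + 1") auto
 then show "QT (dds vs f)" unfolding QT_def using lipb_continuous[OF l] z
  by (intro conjI exI[of _ C] exI[of _ "real (n + K) + 1"]) auto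
 fix v x assume "v \<in> range unit_vec"
 then show "has_dd v (dds vs f) x" by (rule regular_has_dd[OF regular_dds[OF f vs]])
qed

text \<open>Localised kernels become test functions through this lemma: the gradient bound required
  of them follows from \<open>tame_gradE\<close> on a ball containing the support.\<close>

lemma tame_test_fun:
 assumes f: "tame f" and S: "\<And>x. f x \<noteq> 0 ==> x \<in> V n"
 shows "f \<in> test_fun \<Omega>"
proof (rule btest_test_funI[OF tame_supp_btest[OF f S] S])
 fix s :: "nat list"
 obtain C where C: "C \<ge> 0" "\<And>x k. norm x < real (n + K) + 1 ==> (\<Sum>i<k. (pd i (pds s f) x)^2) \<le> C"
  using tame_gradE[OF tame_pds[OF f]] by blast
 have "(\<Sum>i<k. (pd i (pds s f) x)^2) \<le> C" for x k
 proof (cases "norm x < real (n + K) + 1")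
  case False
  have "open {x. norm x > real (n + K)}" by (intro open_Collect_less continuous_intros)
  moreover have "f y = 0" if "norm y > real (n + K)" for y using S[of y] V_bounded[of y n] that by force
  ultimately have "pds (i # s) f x = pds (i # s) (\<lambda>_. 0) x" for i
   using False by (intro pds_cong_local[of "{x. norm x > real (n + K)}"]) auto
  then have "pd i (pds s f) x = 0" for i by (simp only: pds_Cons[symmetric] pds_zero)
  then show ?thesis using C(1) by simp
 qed (use C in auto)
 then show "gb (pds s f)" unfolding gb_def by blast
qed

section \<open>Weak derivatives\<close>

text \<open>The integral identity of \<open>has_weak_D\<close> by itself, for lists; the L^p
  conditions are tracked separately, so that the identity can be manipulated for products and sums
  first.\<close>

definition WD :: "(ell2 \<Rightarrow> real) \<Rightarrow> nat list \<Rightarrow> (ell2 \<Rightarrow> real) \<Rightarrow> bool" where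
 "WD f s g \<longleftrightarrow> (\<forall>\<phi>\<in>test_fun \<Omega>. (\<integral>x. f x * foldr (delta a) s (ext \<phi>) x \<partial>G) = (- 1) ^ length s * (\<integral>x. g x * ext \<phi> x \<partial>G))"

lemma test_fun_C0: "\<phi> \<in> test_fun \<Omega> ==> \<phi> \<in> C_0_infty \<Omega>"
 by (simp add: test_fun_def)

lemma has_weak_D_iff:
 assumes "sorted s"
 shows "has_weak_D p a \<Omega> (mi_of s) f g \<longleftrightarrow> f \<in> Lp_on p a \<Omega> \<and> g \<in> Lp_on p a \<Omega> \<and> WD f s g"
proof -
 have 1: "(LINT x:\<Omega>|G. f x * delta_mi a (mi_of s) \<phi> x) = (\<integral>x. f x * foldr (delta a) s (ext \<phi>) x \<partial>G)"
  if "\<phi> \<in> test_fun \<Omega>" for \<phi>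
  unfolding set_lebesgue_integral_def delta_mi_def mi_list_mi_of[OF assms]
  by (intro Bochner_Integration.integral_cong refl) (simp add: deltas_ext[OF test_fun_C0[OF that]])
 have 2: "(LINT x:\<Omega>|G. g x * \<phi> x) = (\<integral>x. g x * ext \<phi> x \<partial>G)" for \<phi>
  unfolding set_lebesgue_integral_def
  by (intro Bochner_Integration.integral_cong refl) (auto simp: ext_def indicator_def)
 show ?thesis
  unfolding has_weak_D_def WD_def mi_order_eq mi_list_mi_of[OF assms] by (auto simp: 1 2)
qed

lemma WD_cong:
 assumes "\<And>x. x \<in> \<Omega> ==> f x = f' x" "\<And>x. x \<in> \<Omega> ==> g x = g' x"
 shows "WD f s g \<longleftrightarrow> WD f' s g'"
proof -
 have "f x * foldr (delta a) s (ext \<phi>) x = f' x * foldr (delta a) s (ext \<phi>) x" if "\<phi> \<in> test_fun \<Omega>" for \<phi> x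
  using assms(1) by (cases "x \<in> \<Omega>") (auto simp: deltas_ext[OF test_fun_C0[OF that]])
 moreover have "g x * ext \<phi> x = g' x * ext \<phi> x" for \<phi> x
  using assms(2) by (cases "x \<in> \<Omega>") (auto simp: ext_def)
 ultimately show ?thesis unfolding WD_def by (simp only: cong: ball_cong)
qed

lemma ext_id: "(\<And>x. x \<notin> \<Omega> ==> u x = 0) ==> ext u = u"
 by (auto simp: ext_def)

text \<open>By \<open>leibniz_deltas\<close> the factor \<open>\<tau>\<close> moves to the test
  function; each product \<open>c r\<close> of a derivative of \<open>\<tau>\<close> with the test
  function is again one, and the identity for \<open>f\<close> applies to it. The signs
  \<open>(-1)^|r|\<close> and \<open>(-1)^|t|\<close> combine to \<open>(-1)^|s|\<close>.\<close>

lemma WD_leibniz: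
 assumes f: "integrable G f" and v: "\<And>t. integrable G (v t)" and \<tau>: "tame \<tau>" and s: "sorted s"
  and wd: "\<And>t. sorted t ==> length t \<le> length s ==> WD f t (v t)"
 shows "WD (\<lambda>x. \<tau> x * f x) s (\<lambda>x. \<Sum>(r, t)\<leftarrow>splits s. pds (rev r) \<tau> x * v t x)"
 unfolding WD_def
proof
 fix \<phi> assume p: "\<phi> \<in> test_fun \<Omega>"
 define u where "u = ext \<phi>"
 have u: "btest u" unfolding u_def by (rule btest_ext[OF test_fun_C0[OF p]])
 define c where "c r = (\<lambda>x. pds (rev r) \<tau> x * u x)" for r
 have bc: "btest (c r)" for r unfolding c_def by (intro btest_mult tame_pds \<tau> u)
 have cT: "c r \<in> test_fun \<Omega>" for r unfolding c_def u_def by (rule test_fun_mult[OF tame_pds[OF \<tau>] p])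
 have ec: "ext (c r) = c r" for r by (rule ext_id) (simp add: c_def u_def ext_def)
 have int_sum: "(\<integral>x. (\<Sum>p\<leftarrow>ps. F p x) \<partial>G) = (\<Sum>p\<leftarrow>ps. (\<integral>x. F p x \<partial>G)) \<and> integrable G (\<lambda>x. \<Sum>p\<leftarrow>ps. F p x)"
  if "\<And>p. p \<in> set ps ==> integrable G (F p)" for ps and F :: "nat list \<times> nat list \<Rightarrow> ell2 \<Rightarrow> real"
  using that by (induction ps) auto
 have i1: "integrable G (\<lambda>x. f x * foldr (delta a) t (c r) x)" for r t
  by (intro integrable_mult_btest f btest_deltas bc)
 have i2: "integrable G (\<lambda>x. v t x * c r x)" for r t by (intro integrable_mult_btest v bc)
 have "(\<integral>x. (\<tau> x * f x) * foldr (delta a) s u x \<partial>G) =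
   (\<integral>x. (\<Sum>p\<leftarrow>splits s. (- 1) ^ length (fst p) * (f x * foldr (delta a) (snd p) (c (fst p)) x)) \<partial>G)"
 proof (intro Bochner_Integration.integral_cong refl)
  fix x
  have "(\<tau> x * f x) * foldr (delta a) s u x = f x * (\<tau> x * foldr (delta a) s u x)" by simp
  also have "\<dots> = f x * (\<Sum>p\<leftarrow>splits s. (- 1) ^ length (fst p) * foldr (delta a) (snd p) (c (fst p)) x)"
   unfolding leibniz_deltas[OF u \<tau>] c_def by (simp add: case_prod_unfold)
  finally show "(\<tau> x * f x) * foldr (delta a) s u x = (\<Sum>p\<leftarrow>splits s. (- 1) ^ length (fst p) * (f x * foldr (delta a) (snd p) (c (fst p)) x))"
   by (simp add: sum_list_const_mult[symmetric] ac_simps)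
 qed
 also have "\<dots> = (\<Sum>p\<leftarrow>splits s. (- 1) ^ length (fst p) * (\<integral>x. f x * foldr (delta a) (snd p) (c (fst p)) x \<partial>G))"
  by (subst int_sum[THEN conjunct1]) (auto intro: i1)
 also have "\<dots> = (\<Sum>p\<leftarrow>splits s. (- 1) ^ length s * (\<integral>x. v (snd p) x * c (fst p) x \<partial>G))"
 proof (intro arg_cong[where f = sum_list] map_cong refl)
  fix p assume "p \<in> set (splits s)"
  then have p: "(fst p, snd p) \<in> set (splits s)" by simp
  have wp: "WD f (snd p) (v (snd p))"
   using splits_sorted[OF p s] splits_length[OF p] by (intro wd) auto
  have "(\<integral>x. f x * foldr (delta a) (snd p) (c (fst p)) x \<partial>G) = (- 1) ^ length (snd p) * (\<integral>x. v (snd p) x * c (fst p) x \<partial>G)"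
   using bspec[OF wp[unfolded WD_def] cT[of "fst p"]] by (simp only: ec)
  then show "(- 1) ^ length (fst p) * (\<integral>x. f x * foldr (delta a) (snd p) (c (fst p)) x \<partial>G) = (- 1) ^ length s * (\<integral>x. v (snd p) x * c (fst p) x \<partial>G)"
   unfolding splits_length[OF p] power_add by (simp only: mult.assoc)
 qed
 also have "\<dots> = (- 1) ^ length s * (\<integral>x. (\<Sum>p\<leftarrow>splits s. v (snd p) x * c (fst p) x) \<partial>G)"
  by (subst int_sum[THEN conjunct1]) (auto intro: i2 simp: sum_list_const_mult)
 also have "(\<lambda>x. (\<Sum>p\<leftarrow>splits s. v (snd p) x * c (fst p) x)) = (\<lambda>x. (\<Sum>(r, t)\<leftarrow>splits s. pds (rev r) \<tau> x * v t x) * u x)"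
  by (simp add: c_def case_prod_unfold sum_list_const_mult ac_simps)
 finally show "(\<integral>x. \<tau> x * f x * foldr (delta a) s (ext \<phi>) x \<partial>G) =
   (- 1) ^ length s * (\<integral>x. (\<Sum>(r, t)\<leftarrow>splits s. pds (rev r) \<tau> x * v t x) * ext \<phi> x \<partial>G)"
  by (simp only: u_def)
qed

lemma WD_tame: "tame f ==> WD f s (pds (rev s) f)"
 unfolding WD_def using integration_by_parts btest_ext test_fun_C0 by blast

text \<open>Mollifying with the Mehler kernel, which consists of test functions after localisation, shows
 that weak derivatives are unique.\<close>

lemma WD_unique:
 assumes w: "bmeas w" "integrable G w" and z: "\<And>x. x \<notin> \<Omega> ==> w x = 0"
  and t: "\<And>\<phi>. \<phi> \<in> test_fun \<Omega> ==> (\<integral>x. w x * ext \<phi> x \<partial>G) = 0"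
 shows "AE x in G. w x = 0"
proof -
 obtain \<tau> \<psi> :: "nat \<Rightarrow> ell2 \<Rightarrow> real" and C where \<tau>: "\<And>j. tame (\<tau> j)" "\<And>j x. \<tau> j x \<noteq> 0 ==> x \<in> V (Suc j)"
  "\<And>J x. x \<in> V J ==> (\<Sum>j\<le>J. \<tau> j x) = 1"
  using partition[of 0] by metis
 have "AE x in G. \<tau> j x * w x = 0" for j
 proof -
  have b: "btest (\<tau> j)" by (rule tame_supp_btest[OF \<tau>(1,2)])
  have i: "integrable G (\<lambda>x. \<tau> j x * w x)" using integrable_mult_btest[OF w(2) b] by (simp add: mult.commute)
  have m [measurable]: "bmeas (\<lambda>x. \<tau> j x * w x)"
   using w(1) tame_measurable[OF \<tau>(1)] by measurable
  \<comment> \<open>The smoothed function at \<open>x\<close> is \<open>w\<close> integrated against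
    the kernel at \<open>x\<close> times \<open>\<tau> j\<close>, which is a test function.\<close>
  have T0: "T n (\<lambda>x. \<tau> j x * w x) x = 0" for n x
  proof -
   have tt: "tame (\<lambda>z. \<tau> j z * KJ (mc n) {..<n} x z)"
    by (intro tame_mult \<tau> bsmooth_tame[OF bsmooth_KJ] mc)
   have "(\<lambda>z. \<tau> j z * KJ (mc n) {..<n} x z) \<in> test_fun \<Omega>"
    by (rule tame_test_fun[OF tt, of "Suc j"]) (use \<tau>(2) in auto)
   moreover have "ext (\<lambda>z. \<tau> j z * KJ (mc n) {..<n} x z) = (\<lambda>z. \<tau> j z * KJ (mc n) {..<n} x z)"
    by (rule ext_id) (use \<tau>(2)[of j] V_subset in force)
   ultimately have "(\<integral>z. w z * (\<tau> j z * KJ (mc n) {..<n} x z) \<partial>G) = 0" using t by metis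
   then show ?thesis by (simp add: mehler_def ac_simps)
  qed
  have "(\<integral>\<^sup>+x. ennreal (\<bar>\<tau> j x * w x\<bar> powr 1) \<partial>G) < \<infinity>"
   using i by (simp add: integrable_iff_bounded)
  then have "(\<lambda>n. \<integral>\<^sup>+x. ennreal (\<bar>T n (\<lambda>x. \<tau> j x * w x) x - \<tau> j x * w x\<bar> powr 1) \<partial>G) \<longlonglongrightarrow> 0"
   by (rule T_Lp[OF m order_refl])
  then have "(\<integral>\<^sup>+x. ennreal \<bar>\<tau> j x * w x\<bar> \<partial>G) = 0" by (simp add: T0 LIMSEQ_const_iff)
  then show ?thesis by (subst (asm) nn_integral_0_iff_AE) auto
 qed
 then have "AE x in G. \<forall>j. \<tau> j x * w x = 0" by (simp only: AE_all_countable) simp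
 then show ?thesis
 proof eventually_elim
  case (elim x)
  show ?case
  proof (cases "x \<in> \<Omega>")
   case True
   then obtain J where "x \<in> V J" using V_exhausts by blast
   then have "w x = (\<Sum>j\<le>J. \<tau> j x) * w x" using \<tau>(3) by simp
   also have "\<dots> = (\<Sum>j\<le>J. \<tau> j x * w x)" by (rule sum_distrib_right)
   also have "\<dots> = 0" by (rule sum.neutral) (use elim in blast)
   finally show ?thesis .
  qed (use z in auto)
 qed
qed

end

section \<open>Sums over multi-indices\<close>

definition SL :: "nat \<Rightarrow> nat list set" where
 "SL m = {s. sorted s \<and> length s \<le> m}"

text \<open>An integral over counting measure, so that Tonelli's theorem and dominated convergence
  apply to the sum over multi-indices.\<close>

abbreviation ssum :: "nat \<Rightarrow> (nat list \<Rightarrow> ennreal) \<Rightarrow> ennreal" where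
 "ssum m F \<equiv> \<integral>\<^sup>+s. F s \<partial>count_space (SL m)"

definition av :: "(nat \<Rightarrow> real) \<Rightarrow> nat list \<Rightarrow> real" where
 "av a s = prod_list (map a s)"

lemma av_simps [simp]: "av a [] = 1" "av a (i # s) = a i * av a s"
 by (simp_all add: av_def)

lemma av_pos: "(\<And>i. a i > 0) ==> av a s > 0"
 by (induction s) auto

lemma countable_SL: "countable (SL m)"
 by (rule countableI_type)

lemma infsum_eq_count_space:
 fixes f :: "'a \<Rightarrow> ennreal"
 assumes "countable A"
 shows "infsum f A = (\<integral>\<^sup>+x. f x \<partial>count_space A)"
proof -
 have eq: "infsum f A = (SUP F\<in>{F. finite F \<and> F \<subseteq> A}. sum f F)"
  by (rule nonneg_infsum_complete) simp
 show ?thesis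
 proof (rule antisym)
  show "infsum f A \<le> (\<integral>\<^sup>+x. f x \<partial>count_space A)"
   unfolding eq
  proof (rule SUP_least, clarify)
   fix F assume F: "finite F" "F \<subseteq> A"
   have "sum f F = (\<integral>\<^sup>+x. f x * indicator F x \<partial>count_space A)"
    using F by (subst nn_integral_count_space'[of F]) auto
   also have "\<dots> \<le> (\<integral>\<^sup>+x. f x \<partial>count_space A)"
    by (intro nn_integral_mono) (auto split: split_indicator)
   finally show "sum f F \<le> (\<integral>\<^sup>+x. f x \<partial>count_space A)" .
  qed
  show "(\<integral>\<^sup>+x. f x \<partial>count_space A) \<le> infsum f A"
  proof (cases "finite A")
   case True
   then show ?thesis by (simp add: nn_integral_count_space_finite)
  next
   case False
   have bij: "bij_betw (from_nat_into A) UNIV A" by (rule bij_betw_from_nat_into[OF assms False])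
   have "(\<integral>\<^sup>+x. f x \<partial>count_space A) = (suminf (\<lambda>n. f (from_nat_into A n)))"
    unfolding nn_integral_bij_count_space[OF bij, symmetric] by (rule nn_integral_count_space_nat)
   also have "\<dots> \<le> infsum f A"
   proof (rule suminf_le_const)
    fix n
    have inj: "inj_on (from_nat_into A) {..<n}" using bij by (auto simp: bij_betw_def inj_on_def)
    have "(\<Sum>i<n. f (from_nat_into A i)) = sum f (from_nat_into A ` {..<n})"
     using sum.reindex[OF inj, of f] by (simp add: o_def)
    also have "\<dots> \<le> (SUP F\<in>{F. finite F \<and> F \<subseteq> A}. sum f F)"
     using bij by (intro SUP_upper) (auto simp: bij_betw_def)
    finally show "(\<Sum>i<n. f (from_nat_into A i)) \<le> infsum f A" unfolding eq .
   qed auto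
   finally show ?thesis .
  qed
 qed
qed

lemma nn_integral_lists_Suc:
 "(\<integral>\<^sup>+l. F l \<partial>count_space {l::nat list. length l = Suc k}) =
  (suminf (\<lambda>i. \<integral>\<^sup>+l. F (i # l) \<partial>count_space {l. length l = k}))"
proof -
 let ?L = "{l::nat list. length l = k}"
 have c: "countable ?L" by (rule countableI_type)
 interpret L: sigma_finite_measure "count_space ?L" by (rule sigma_finite_measure_count_space_countable[OF c])
 have bij: "bij_betw (\<lambda>q. fst q # snd q) (UNIV \<times> ?L) {l. length l = Suc k}"
  unfolding bij_betw_def by (auto simp: inj_on_def length_Suc_conv image_iff)
 have "(\<integral>\<^sup>+l. F l \<partial>count_space {l. length l = Suc k}) = (\<integral>\<^sup>+q. F (fst q # snd q) \<partial>count_space (UNIV \<times> ?L))"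
  by (rule nn_integral_bij_count_space[OF bij, symmetric])
 also have "count_space ((UNIV :: nat set) \<times> ?L) = count_space UNIV \<Otimes>\<^sub>M count_space ?L"
  using pair_measure_countable[of "UNIV :: nat set" ?L] c by simp
 also have "(\<integral>\<^sup>+q. F (fst q # snd q) \<partial>(count_space UNIV \<Otimes>\<^sub>M count_space ?L)) =
   (\<integral>\<^sup>+i. \<integral>\<^sup>+l. F (i # l) \<partial>count_space ?L \<partial>count_space UNIV)"
  by (subst L.nn_integral_fst[symmetric]) (auto simp: pair_measure_countable c)
 finally show ?thesis by (simp only: nn_integral_count_space_nat)
qed

lemma nn_integral_lists_0:
 "(\<integral>\<^sup>+l. F l \<partial>count_space {l::nat list. length l = 0}) = F []"
 by (simp add: nn_integral_count_space_finite)

text \<open>\<open>Sq\<close> differentiates first in the direction at the head of the list, which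
  \<open>pds\<close> would do last; hence \<open>rev\<close>.\<close>

lemma Sq_eq_list_sum:
 assumes "\<And>i. a i > 0"
 shows "(\<integral>\<^sup>+l. ennreal (av a l * (pds (rev l) f x)^2) \<partial>count_space {l. length l = k}) = Sq a k f x"
proof (induction k arbitrary: f)
 case (Suc k)
 have "(\<integral>\<^sup>+l. ennreal (av a (i # l) * (pds (rev (i # l)) f x)^2) \<partial>count_space {l. length l = k}) = ennreal (a i) * Sq a k (pd i f) x" for i
 proof -
  have "ennreal (av a (i # l) * (pds (rev (i # l)) f x)^2) = ennreal (a i) * ennreal (av a l * (pds (rev l) (pd i f) x)^2)" for l
   using assms av_pos[of a l, OF assms] by (subst ennreal_mult[symmetric]) (auto simp: pds_append mult.assoc less_imp_le)
  then show ?thesis by (simp only: nn_integral_cmult borel_measurable_count_space Suc.IH)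
 qed
 then show ?case by (simp only: nn_integral_lists_Suc Sq.simps)
qed (simp only: nn_integral_lists_0, simp)

text \<open>The power of the sum, multiplied out. All lists are counted here; the sorted ones are
  among them, which suffices for upper bounds.\<close>

lemma av_list_sum:
 assumes "\<And>i. a i > 0" "summable a"
 shows "(\<integral>\<^sup>+l. ennreal (av a l) \<partial>count_space {l. length l = k}) = ennreal (suminf a ^ k)"
proof (induction k)
 case (Suc k)
 have s: "suminf a \<ge> 0" by (rule suminf_nonneg[OF assms(2)]) (use assms(1) less_imp_le in blast)
 have "(\<integral>\<^sup>+l. ennreal (av a (i # l)) \<partial>count_space {l. length l = k}) = ennreal (a i) * ennreal (suminf a ^ k)" for i
 proof -
  have "ennreal (av a (i # l)) = ennreal (a i) * ennreal (av a l)" for l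
   using assms(1) av_pos[of a l, OF assms(1)] by (subst ennreal_mult[symmetric]) (auto simp: less_imp_le)
  then show ?thesis by (simp only: nn_integral_cmult borel_measurable_count_space Suc.IH)
 qed
 then have "(\<integral>\<^sup>+l. ennreal (av a l) \<partial>count_space {l. length l = Suc k}) = suminf (\<lambda>i. ennreal (a i) * ennreal (suminf a ^ k))"
  by (simp only: nn_integral_lists_Suc)
 also have "\<dots> = suminf (\<lambda>i. ennreal (a i)) * ennreal (suminf a ^ k)" by simp
 also have "suminf (\<lambda>i. ennreal (a i)) = ennreal (suminf a)"
  by (rule suminf_ennreal_eq) (use assms in \<open>auto simp: less_imp_le summable_sums\<close>)
 also have "ennreal (suminf a) * ennreal (suminf a ^ k) = ennreal (suminf a ^ Suc k)"
  using s by (simp add: ennreal_mult)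
 finally show ?case .
qed (simp only: nn_integral_lists_0, simp)

lemma nn_integral_SL_le:
 "ssum m (\<lambda>s. F s) \<le> (\<Sum>k\<le>m. \<integral>\<^sup>+l. F l \<partial>count_space {l. length l = k})"
proof -
 have "ssum m (\<lambda>s. F s) = (\<integral>\<^sup>+s. F s * indicator (SL m) s \<partial>count_space UNIV)"
  by (rule nn_integral_count_space_indicator) auto
 also have "\<dots> \<le> (\<integral>\<^sup>+s. (\<Sum>k\<le>m. F s * indicator {l. length l = k} s) \<partial>count_space UNIV)"
 proof (rule nn_integral_mono)
  fix s
  have "F s * indicator (SL m) s \<le> (\<Sum>k\<in>{length s}. F s * indicator {l. length l = k} s)" if "s \<in> SL m" using that by simp
  also have "(\<Sum>k\<in>{length s}. F s * indicator {l. length l = k} s) \<le> (\<Sum>k\<le>m. F s * indicator {l. length l = k} s)" if "s \<in> SL m"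
   using that by (intro sum_mono2) (auto simp: SL_def)
  finally show "F s * indicator (SL m) s \<le> (\<Sum>k\<le>m. F s * indicator {l. length l = k} s)"
   by (cases "s \<in> SL m") auto
 qed
 also have "\<dots> = (\<Sum>k\<le>m. \<integral>\<^sup>+s. F s * indicator {l. length l = k} s \<partial>count_space UNIV)"
  by (rule nn_integral_sum) auto
 also have "\<dots> = (\<Sum>k\<le>m. \<integral>\<^sup>+l. F l \<partial>count_space {l. length l = k})"
  by (intro sum.cong refl nn_integral_count_space_indicator[symmetric]) auto
 finally show ?thesis .
qed

definition av_total :: "(nat \<Rightarrow> real) \<Rightarrow> nat \<Rightarrow> real" where
 "av_total a m = (\<Sum>k\<le>m. suminf a ^ k)"

lemma av_total:
 assumes "\<And>i. a i > 0" "summable a"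
 shows "av_total a m \<ge> 0" "ssum m (\<lambda>s. ennreal (av a s)) \<le> ennreal (av_total a m)"
proof -
 have s: "suminf a \<ge> 0" by (rule suminf_nonneg[OF assms(2)]) (use assms(1) less_imp_le in blast)
 then show "av_total a m \<ge> 0" by (auto simp: av_total_def intro: sum_nonneg)
 have "ssum m (\<lambda>s. ennreal (av a s)) \<le> (\<Sum>k\<le>m. ennreal (suminf a ^ k))"
  using nn_integral_SL_le[of m "\<lambda>s. ennreal (av a s)"] by (simp only: av_list_sum[OF assms])
 also have "\<dots> = ennreal (av_total a m)" unfolding av_total_def using s by (intro sum_ennreal) auto
 finally show "ssum m (\<lambda>s. ennreal (av a s)) \<le> ennreal (av_total a m)" .
qed

lemma Sq_sum_SL:
 assumes "\<And>i. a i > 0" and "\<And>k. k \<le> m ==> Sq a k f x \<le> ennreal C" "C \<ge> 0"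
 shows "ssum m (\<lambda>s. ennreal (av a s * (pds (rev s) f x)^2)) \<le> ennreal (real (Suc m) * C)"
proof -
 have "ssum m (\<lambda>s. ennreal (av a s * (pds (rev s) f x)^2)) \<le> (\<Sum>k\<le>m. Sq a k f x)"
  using nn_integral_SL_le[of m "\<lambda>s. ennreal (av a s * (pds (rev s) f x)^2)"] by (simp only: Sq_eq_list_sum[OF assms(1)])
 also have "\<dots> \<le> (\<Sum>k\<le>m. ennreal C)" using assms(2) by (intro sum_mono) auto
 also have "\<dots> = ennreal (real (Suc m) * C)" using assms(3) by (subst sum_ennreal) auto
 finally show ?thesis .
qed

section \<open>Weighted p-th power sums of jets\<close>

definition MD :: "nat \<Rightarrow> real \<Rightarrow> (nat \<Rightarrow> real) \<Rightarrow> (nat list \<Rightarrow> real) \<Rightarrow> ennreal" where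
 "MD m p a u = ssum m (\<lambda>s. ennreal (\<bar>av a s * u s\<bar> powr p))"

text \<open>The Leibniz rule as a product of jets: functions on lists stand for all derivatives of a
  function at a point.\<close>

definition lz :: "(nat list \<Rightarrow> real) \<Rightarrow> (nat list \<Rightarrow> real) \<Rightarrow> nat list \<Rightarrow> real" where
 "lz u v s = (\<Sum>(r, t)\<leftarrow>splits s. u r * v t)"

lemma MD_add:
 assumes "p \<ge> 0"
 shows "MD m p a (\<lambda>s. u s + v s) \<le> ennreal (2 powr p) * (MD m p a u + MD m p a v)"
proof -
 have "MD m p a (\<lambda>s. u s + v s) \<le> ssum m (\<lambda>s. ennreal (2 powr p) * (ennreal (\<bar>av a s * u s\<bar> powr p) + ennreal (\<bar>av a s * v s\<bar> powr p)))"
  unfolding MD_def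
 proof (rule nn_integral_mono)
  fix s
  have "ennreal (\<bar>av a s * (u s + v s)\<bar> powr p) \<le> ennreal (2 powr p * (\<bar>av a s * u s\<bar> powr p + \<bar>av a s * v s\<bar> powr p))"
   using powr_add_le[OF assms, of "av a s * u s" "av a s * v s"] by (intro ennreal_leI) (simp add: distrib_left)
  then show "ennreal (\<bar>av a s * (u s + v s)\<bar> powr p) \<le> ennreal (2 powr p) * (ennreal (\<bar>av a s * u s\<bar> powr p) + ennreal (\<bar>av a s * v s\<bar> powr p))"
   by (simp add: ennreal_mult)
 qed
 also have "\<dots> = ennreal (2 powr p) * (MD m p a u + MD m p a v)"
  by (simp add: nn_integral_cmult nn_integral_add MD_def)
 finally show ?thesis .
qed

lemma MD_uminus: "MD m p a (\<lambda>s. - u s) = MD m p a u"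
 by (simp add: MD_def)

lemma MD_diff:
 assumes "p \<ge> 0"
 shows "MD m p a (\<lambda>s. u s - v s) \<le> ennreal (2 powr p) * (MD m p a u + MD m p a v)"
 using MD_add[OF assms, of m a u "\<lambda>s. - v s"] by (simp add: MD_uminus)

text \<open>All terms are bounded by the largest. The sum on the right runs over the set of entries,
  counting repeated ones once, as the estimate of \<open>MD_lz\<close> wants.\<close>

lemma sum_list_powr_le:
 fixes z :: "'q \<Rightarrow> real"
 assumes p: "p \<ge> 0"
 shows "\<bar>\<Sum>q\<leftarrow>ps. z q\<bar> powr p \<le> real (length ps) powr p * (\<Sum>q\<in>set ps. \<bar>z q\<bar> powr p)"
proof (cases "ps = []")
 case False
 define M where "M = Max ((\<lambda>q. \<bar>z q\<bar>) ` set ps)"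
 have "M \<in> (\<lambda>q. \<bar>z q\<bar>) ` set ps" unfolding M_def by (rule Max_in) (use False in auto)
 then obtain q0 where q0: "q0 \<in> set ps" "M = \<bar>z q0\<bar>" by auto
 have M: "\<bar>z q\<bar> \<le> M" if "q \<in> set ps" for q unfolding M_def using that by (intro Max_ge) auto
 have "\<bar>\<Sum>q\<leftarrow>qs. z q\<bar> \<le> real (length qs) * M" if "set qs \<subseteq> set ps" for qs
  using that
 proof (induction qs)
  case (Cons q qs)
  then have "\<bar>\<Sum>q\<leftarrow>qs. z q\<bar> \<le> real (length qs) * M" "\<bar>z q\<bar> \<le> M" using M by auto
  then show ?case using abs_triangle_ineq[of "z q" "\<Sum>q\<leftarrow>qs. z q"] by (simp add: algebra_simps)
 qed simp
 from this[of ps] have "\<bar>\<Sum>q\<leftarrow>ps. z q\<bar> powr p \<le> (real (length ps) * M) powr p"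
  using p by (intro powr_mono2) auto
 also have "\<dots> = real (length ps) powr p * \<bar>z q0\<bar> powr p" using q0 by (simp add: powr_mult)
 also have "\<dots> \<le> real (length ps) powr p * (\<Sum>q\<in>set ps. \<bar>z q\<bar> powr p)"
  using q0(1) by (intro mult_left_mono member_le_sum) auto
 finally show ?thesis .
qed simp

text \<open>The weight \<open>av a\<close> is multiplicative under splitting, a list of length at
  most \<open>m\<close> has at most \<open>2 ^ m\<close> splits, and a pair of lists splits at most
  one sorted list, namely \<open>sort\<close> of their concatenation. Hence the double sum is at
  most the product of the sums.\<close>

lemma MD_lz:
 assumes p: "p \<ge> 1"
 shows "MD m p a (lz u v) \<le> ennreal ((2 ^ m) powr p) * (MD m p a u * MD m p a v)"
proof -
 define F where "F r = ennreal (\<bar>av a r * u r\<bar> powr p)" for r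
 define H where "H t = ennreal (\<bar>av a t * v t\<bar> powr p)" for t
 let ?S = "SL m" and ?K = "ennreal ((2 ^ m) powr p)"
 interpret S: sigma_finite_measure "count_space ?S" by (rule sigma_finite_measure_count_space_countable[OF countable_SL])
 have sub: "set (splits s) \<subseteq> ?S \<times> ?S" if "s \<in> ?S" for s
  using that splits_sorted[of _ _ s] splits_length[of _ _ s] by (fastforce simp: SL_def)
 have "MD m p a (lz u v) \<le> (\<integral>\<^sup>+s. ?K * (\<integral>\<^sup>+q. F (fst q) * H (snd q) * indicator (set (splits s)) q \<partial>count_space (?S \<times> ?S)) \<partial>count_space ?S)"
  unfolding MD_def
 proof (rule nn_integral_mono)
  fix s assume "s \<in> space (count_space ?S)"
  then have s: "s \<in> ?S" by simp
  define z where "z q = (av a (fst q) * u (fst q)) * (av a (snd q) * v (snd q))" for q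
  have eq: "av a s * lz u v s = (\<Sum>q\<leftarrow>splits s. z q)"
  proof -
   have "av a s * lz u v s = (\<Sum>q\<leftarrow>splits s. av a s * (u (fst q) * v (snd q)))"
    by (simp add: lz_def case_prod_unfold sum_list_const_mult)
   also have "\<dots> = (\<Sum>q\<leftarrow>splits s. z q)"
   proof (intro arg_cong[where f = sum_list] map_cong refl)
    fix q assume "q \<in> set (splits s)"
    then have "av a s = av a (fst q) * av a (snd q)"
     unfolding av_def by (intro splits_prod) simp
    then show "av a s * (u (fst q) * v (snd q)) = z q" by (simp add: z_def ac_simps)
   qed
   finally show ?thesis .
  qed
  have "real (length (splits s)) powr p \<le> (2 ^ m) powr p"
   using s p by (intro powr_mono2) (auto simp: SL_def intro!: power_increasing)
  then have "\<bar>av a s * lz u v s\<bar> powr p \<le> (2 ^ m) powr p * (\<Sum>q\<in>set (splits s). \<bar>z q\<bar> powr p)"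
   unfolding eq using sum_list_powr_le[of p z "splits s"] p
   by (meson mult_right_mono order_trans sum_nonneg powr_ge_zero zero_le_one)
  then have "ennreal (\<bar>av a s * lz u v s\<bar> powr p) \<le> ?K * (\<Sum>q\<in>set (splits s). ennreal (\<bar>z q\<bar> powr p))"
   by (simp add: ennreal_mult[symmetric] sum_nonneg ennreal_leI)
  also have "(\<Sum>q\<in>set (splits s). ennreal (\<bar>z q\<bar> powr p)) = (\<Sum>q\<in>set (splits s). F (fst q) * H (snd q) * indicator (set (splits s)) q)"
   by (intro sum.cong refl) (simp add: z_def F_def H_def abs_mult powr_mult ennreal_mult)
  also have "\<dots> = (\<integral>\<^sup>+q. F (fst q) * H (snd q) * indicator (set (splits s)) q \<partial>count_space (?S \<times> ?S))"
   using sub[OF s] by (intro nn_integral_count_space'[symmetric]) auto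
  finally show "ennreal (\<bar>av a s * lz u v s\<bar> powr p) \<le> ?K * \<dots>" .
 qed
 also have "\<dots> = ?K * (\<integral>\<^sup>+s. (\<integral>\<^sup>+q. F (fst q) * H (snd q) * indicator (set (splits s)) q \<partial>count_space (?S \<times> ?S)) \<partial>count_space ?S)"
  by (rule nn_integral_cmult) simp
 also have "(\<integral>\<^sup>+s. (\<integral>\<^sup>+q. F (fst q) * H (snd q) * indicator (set (splits s)) q \<partial>count_space (?S \<times> ?S)) \<partial>count_space ?S) =
   (\<integral>\<^sup>+q. (\<integral>\<^sup>+s. F (fst q) * H (snd q) * indicator (set (splits s)) q \<partial>count_space ?S) \<partial>count_space (?S \<times> ?S))"
  by (rule nn_integral_count_space_nn_integral[OF countable_SL, symmetric]) simp
 also have "\<dots> \<le> (\<integral>\<^sup>+q. F (fst q) * H (snd q) \<partial>count_space (?S \<times> ?S))"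
 proof (rule nn_integral_mono)
  fix q :: "nat list \<times> nat list"
  have "(\<integral>\<^sup>+s. F (fst q) * H (snd q) * indicator (set (splits s)) q \<partial>count_space ?S) \<le>
    (\<integral>\<^sup>+s. F (fst q) * H (snd q) * indicator {sort (fst q @ snd q)} s \<partial>count_space UNIV)"
  proof (subst nn_integral_count_space_indicator, simp, rule nn_integral_mono)
   fix s
   have "s = sort (fst q @ snd q)" if "q \<in> set (splits s)" "s \<in> ?S"
   proof -
    have "mset s = mset (fst q) + mset (snd q)" using that by (intro splits_mset) simp
    then show ?thesis using that(2) by (intro properties_for_sort[symmetric]) (auto simp: SL_def)
   qed
   then show "F (fst q) * H (snd q) * indicator (set (splits s)) q * indicator ?S s \<le> F (fst q) * H (snd q) * indicator {sort (fst q @ snd q)} s"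
    by (auto split: split_indicator)
  qed
  also have "\<dots> = F (fst q) * H (snd q)"
   by (subst nn_integral_cmult_indicator) auto
  finally show "(\<integral>\<^sup>+s. F (fst q) * H (snd q) * indicator (set (splits s)) q \<partial>count_space ?S) \<le> F (fst q) * H (snd q)" .
 qed
 also have "count_space (?S \<times> ?S) = count_space ?S \<Otimes>\<^sub>M count_space ?S"
  by (rule pair_measure_countable[symmetric, OF countable_SL countable_SL])
 also have "(\<integral>\<^sup>+q. F (fst q) * H (snd q) \<partial>(count_space ?S \<Otimes>\<^sub>M count_space ?S)) = (\<integral>\<^sup>+r. \<integral>\<^sup>+t. F r * H t \<partial>count_space ?S \<partial>count_space ?S)"
  by (subst S.nn_integral_fst[symmetric]) (auto simp: pair_measure_countable countable_SL)
 also have "\<dots> = MD m p a u * MD m p a v"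
  by (simp add: nn_integral_cmult nn_integral_multc MD_def F_def H_def)
 finally show ?thesis by (simp add: mult_left_mono)
qed

text \<open>Each term is at most the whole sum \<open>B\<close>, so its p-th power is at most
  \<open>B powr (p - 1)\<close> times the term.\<close>

lemma MD_le:
 assumes a: "\<And>i. a i > 0" and p: "p \<ge> 1" and B: "ssum m (\<lambda>s. ennreal (av a s * \<bar>u s\<bar>)) \<le> ennreal B" "B \<ge> 0"
 shows "MD m p a u \<le> ennreal (B powr (p - 1)) * ssum m (\<lambda>s. ennreal (av a s * \<bar>u s\<bar>))"
proof -
 have "MD m p a u \<le> ssum m (\<lambda>s. ennreal (B powr (p - 1)) * ennreal (av a s * \<bar>u s\<bar>))"
  unfolding MD_def
 proof (rule nn_integral_mono)
  fix s assume s: "s \<in> space (count_space (SL m))"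
  have av: "av a s > 0" by (rule av_pos[OF a])
  have "ennreal (av a s * \<bar>u s\<bar>) \<le> ssum m (\<lambda>s. ennreal (av a s * \<bar>u s\<bar>))"
   using s by (intro nn_integral_ge_point) auto
  then have "ennreal (av a s * \<bar>u s\<bar>) \<le> ennreal B" using B(1) by (rule order_trans)
  then have "av a s * \<bar>u s\<bar> \<le> B" using B(2) by (simp add: ennreal_le_iff)
  then have "(av a s * \<bar>u s\<bar>) powr p \<le> B powr (p - 1) * (av a s * \<bar>u s\<bar>)"
   using av p by (intro powr_le_mult) auto
  then show "ennreal (\<bar>av a s * u s\<bar> powr p) \<le> ennreal (B powr (p - 1)) * ennreal (av a s * \<bar>u s\<bar>)"
   using av by (simp add: ennreal_mult[symmetric] abs_mult ennreal_leI)
 qed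
 then show ?thesis by (simp add: nn_integral_cmult)
qed

text \<open>From \<open>|u| \<le> 1 + u^2\<close>: the first summand is paid for by the finite total
  weight \<open>av_total\<close>, the second by the square bound.\<close>

lemma av_abs_le:
 assumes a: "\<And>i. a i > 0" "summable a" and C: "ssum m (\<lambda>s. ennreal (av a s * (u s)^2)) \<le> ennreal C" "C \<ge> 0"
 shows "ssum m (\<lambda>s. ennreal (av a s * \<bar>u s\<bar>)) \<le> ennreal (av_total a m + C)"
proof -
 have "ssum m (\<lambda>s. ennreal (av a s * \<bar>u s\<bar>)) \<le> ssum m (\<lambda>s. ennreal (av a s) + ennreal (av a s * (u s)^2))"
 proof (rule nn_integral_mono)
  fix s
  have av: "av a s > 0" by (rule av_pos[OF a(1)])
  have "\<bar>u s\<bar> \<le> 1 + (u s)^2"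
  proof -
   have "0 \<le> (\<bar>u s\<bar> - 1)^2" by simp
   then have "2 * \<bar>u s\<bar> \<le> 1 + (u s)^2" unfolding power2_diff by (simp only: power2_abs) simp
   then show ?thesis using abs_ge_zero[of "u s"] by linarith
  qed
  then have "av a s * \<bar>u s\<bar> \<le> av a s * (1 + (u s)^2)" using av by (intro mult_left_mono) auto
  then have "ennreal (av a s * \<bar>u s\<bar>) \<le> ennreal (av a s + av a s * (u s)^2)" by (intro ennreal_leI) (simp add: distrib_left)
  also have "\<dots> = ennreal (av a s) + ennreal (av a s * (u s)^2)" using av by (intro ennreal_plus) auto
  finally show "ennreal (av a s * \<bar>u s\<bar>) \<le> ennreal (av a s) + ennreal (av a s * (u s)^2)" .
 qed
 also have "\<dots> = ssum m (\<lambda>s. ennreal (av a s)) + ssum m (\<lambda>s. ennreal (av a s * (u s)^2))"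
  by (simp add: nn_integral_add)
 also have "\<dots> \<le> ennreal (av_total a m) + ennreal C" by (intro add_mono av_total(2) a C)
 also have "\<dots> = ennreal (av_total a m + C)" using av_total(1)[OF a] C(2) by (simp add: ennreal_plus)
 finally show ?thesis .
qed

lemma MD_bounded:
 assumes a: "\<And>i. a i > 0" "summable a" and p: "p \<ge> 1"
  and C: "ssum m (\<lambda>s. ennreal (av a s * (u s)^2)) \<le> ennreal C" "C \<ge> 0"
 shows "MD m p a u \<le> ennreal ((av_total a m + C) powr p)"
proof -
 let ?B = "av_total a m + C"
 have B: "?B \<ge> 0" using av_total(1)[OF a, of m] C(2) by simp
 have "MD m p a u \<le> ennreal (?B powr (p - 1)) * ennreal ?B"
  by (rule order_trans[OF MD_le[OF a(1) p av_abs_le[OF a C] B]]) (intro mult_left_mono av_abs_le a C, simp)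
 also have "\<dots> = ennreal (?B powr p)"
  using B p by (cases "?B = 0") (auto simp: ennreal_mult[symmetric] powr_diff)
 finally show ?thesis .
qed

text \<open>No dominating sequence exists here, so the uniform square bound is used as uniform
 integrability.\<close>

lemma MD_tendsto_0:
 assumes a: "\<And>i. a i > 0" "summable a" and p: "p \<ge> 1"
  and C: "\<And>N::nat. ssum m (\<lambda>s. ennreal (av a s * (u N s)^2)) \<le> ennreal C" "C \<ge> 0"
  and u: "\<And>s. s \<in> SL m ==> (\<lambda>N. u N s) \<longlonglongrightarrow> 0"
 shows "(\<lambda>N. MD m p a (u N)) \<longlonglongrightarrow> 0"
proof -
 let ?B = "av_total a m + C"
 let ?I = "\<lambda>N. ssum m (\<lambda>s. ennreal (av a s * \<bar>u N s\<bar>))"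
 have B: "?B \<ge> 0" using av_total(1)[OF a, of m] C(2) by simp
 have I: "?I \<longlonglongrightarrow> 0"
 proof (rule tendsto_0_ennreal_eps)
  fix \<epsilon> :: real assume e: "\<epsilon> > 0"
  \<comment> \<open>Values above the level \<open>L\<close> satisfy \<open>|u| \<le> u^2 / L\<close>
    and contribute at most \<open>C / L \<le> \<epsilon> / 2\<close> in total; below it,
    \<open>L * av a s\<close> dominates.\<close>
  define L where "L = 2 * C / \<epsilon> + 1"
  have L: "L > 0" "C / L \<le> \<epsilon> / 2" using e C(2) by (auto simp: L_def field_simps intro: add_nonneg_pos)
  have "(\<lambda>N. ssum m (\<lambda>s. ennreal (av a s * min \<bar>u N s\<bar> L))) \<longlonglongrightarrow> (ssum m (\<lambda>s. 0))"
  proof (rule nn_integral_dominated_convergence[where w = "\<lambda>s. ennreal (L * av a s)"])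
   show "AE s in count_space (SL m). ennreal (av a s * min \<bar>u N s\<bar> L) \<le> ennreal (L * av a s)" for N
    using av_pos[of a, OF a(1)] by (auto simp: AE_count_space less_imp_le mult.commute intro!: ennreal_leI mult_right_mono)
   have "ssum m (\<lambda>s. ennreal (L * av a s)) = ennreal L * ssum m (\<lambda>s. ennreal (av a s))"
    using L av_pos[of a, OF a(1)] by (simp add: ennreal_mult less_imp_le nn_integral_cmult)
   also have "\<dots> < \<infinity>"
    using le_less_trans[OF av_total(2)[OF a, of m] ennreal_less_top] by (simp add: ennreal_mult_less_top)
   finally show "ssum m (\<lambda>s. ennreal (L * av a s)) < \<infinity>" .
   show "AE s in count_space (SL m). (\<lambda>N. ennreal (av a s * min \<bar>u N s\<bar> L)) \<longlonglongrightarrow> 0"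
   proof (rule AE_I2)
    fix s assume "s \<in> space (count_space (SL m))"
    then have "(\<lambda>N. u N s) \<longlonglongrightarrow> 0" using u by simp
    then have "(\<lambda>N. av a s * min \<bar>u N s\<bar> L) \<longlonglongrightarrow> av a s * min \<bar>0\<bar> L" by (intro tendsto_intros)
    then have "(\<lambda>N. ennreal (av a s * min \<bar>u N s\<bar> L)) \<longlonglongrightarrow> ennreal (av a s * min \<bar>0\<bar> L)" by (rule tendsto_ennrealI)
    then show "(\<lambda>N. ennreal (av a s * min \<bar>u N s\<bar> L)) \<longlonglongrightarrow> 0" using L by simp
   qed
  qed auto
  then have "\<forall>\<^sub>F N in sequentially. ssum m (\<lambda>s. ennreal (av a s * min \<bar>u N s\<bar> L)) < ennreal (\<epsilon> / 2)"
   using e by (intro order_tendstoD) auto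
  then show "\<forall>\<^sub>F N in sequentially. ?I N \<le> ennreal \<epsilon>"
  proof eventually_elim
   case (elim N)
   have "?I N \<le> ssum m (\<lambda>s. ennreal (av a s * min \<bar>u N s\<bar> L) + ennreal (1 / L) * ennreal (av a s * (u N s)^2))"
   proof (rule nn_integral_mono)
    fix s
    have av: "av a s > 0" by (rule av_pos[OF a(1)])
    have "\<bar>u N s\<bar> \<le> min \<bar>u N s\<bar> L + (u N s)^2 / L"
    proof (cases "\<bar>u N s\<bar> \<le> L")
     case False
     then have "L * \<bar>u N s\<bar> \<le> \<bar>u N s\<bar> * \<bar>u N s\<bar>" by (intro mult_right_mono) auto
     then have "\<bar>u N s\<bar> \<le> (u N s)^2 / L" using L by (simp add: field_simps power2_eq_square)
     then show ?thesis using L False by linarith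
    qed (use L in auto)
    then have "av a s * \<bar>u N s\<bar> \<le> av a s * (min \<bar>u N s\<bar> L + (u N s)^2 / L)" using av by (intro mult_left_mono) auto
    then have "ennreal (av a s * \<bar>u N s\<bar>) \<le> ennreal (av a s * min \<bar>u N s\<bar> L + 1 / L * (av a s * (u N s)^2))"
     by (intro ennreal_leI) (simp add: distrib_left)
    also have "\<dots> = ennreal (av a s * min \<bar>u N s\<bar> L) + ennreal (1 / L) * ennreal (av a s * (u N s)^2)"
     using av L by (subst ennreal_plus) (auto simp: ennreal_mult[symmetric])
    finally show "ennreal (av a s * \<bar>u N s\<bar>) \<le> ennreal (av a s * min \<bar>u N s\<bar> L) + ennreal (1 / L) * ennreal (av a s * (u N s)^2)" .
   qed
   also have "\<dots> = ssum m (\<lambda>s. ennreal (av a s * min \<bar>u N s\<bar> L)) + ennreal (1 / L) * ssum m (\<lambda>s. ennreal (av a s * (u N s)^2))"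
    by (simp add: nn_integral_add nn_integral_cmult)
   also have "\<dots> \<le> ennreal (\<epsilon> / 2) + ennreal (1 / L) * ennreal C"
    using less_imp_le[OF elim] by (intro add_mono mult_left_mono C) auto
   also have "\<dots> = ennreal (\<epsilon> / 2 + C / L)" using e L C(2) by (subst ennreal_mult[symmetric], simp, simp, subst ennreal_plus[symmetric], simp_all)
   also have "\<dots> \<le> ennreal \<epsilon>" using L by (intro ennreal_leI) linarith
   finally show ?case .
  qed
 qed
 have le: "MD m p a (u N) \<le> ennreal (?B powr (p - 1)) * ?I N" for N
  by (rule MD_le[OF a(1) p av_abs_le[OF a C] B])
 have "(\<lambda>N. ennreal (?B powr (p - 1)) * ?I N) \<longlonglongrightarrow> ennreal (?B powr (p - 1)) * 0"
  by (intro ennreal_tendsto_cmult I) simp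
 then have lim: "(\<lambda>N. ennreal (?B powr (p - 1)) * ?I N) \<longlonglongrightarrow> 0" by simp
 show ?thesis
  by (rule tendsto_sandwich[OF always_eventually always_eventually tendsto_const lim]) (use le in auto)
qed

lemma MD_measurable:
 assumes "\<And>s. s \<in> SL m ==> (\<lambda>x. w x s) \<in> borel_measurable M"
 shows "(\<lambda>x. MD m p a (w x)) \<in> borel_measurable M"
proof -
 interpret S: sigma_finite_measure "count_space (SL m)" by (rule sigma_finite_measure_count_space_countable[OF countable_SL])
 define F where "F q = ennreal (\<bar>av a (fst q) * w (snd q) (fst q)\<bar> powr p)" for q
 have F: "F \<in> borel_measurable (count_space (SL m) \<Otimes>\<^sub>M M)"
  unfolding F_def by (rule measurable_pair_measure_countable1[OF countable_SL]) (use assms in auto)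
 have eq: "(\<lambda>q. F (case q of (x, y) \<Rightarrow> (y, x))) = (\<lambda>(x, s). ennreal (\<bar>av a s * w x s\<bar> powr p))"
  by (auto simp: F_def fun_eq_iff)
 have "(\<lambda>(x, s). ennreal (\<bar>av a s * w x s\<bar> powr p)) \<in> borel_measurable (M \<Otimes>\<^sub>M count_space (SL m))"
  using measurable_compose[OF measurable_pair_swap' F] unfolding eq .
 then show ?thesis
  unfolding MD_def by (rule S.borel_measurable_nn_integral)
qed

lemma nn_integral_MD:
 assumes "\<And>s. s \<in> SL m ==> w s \<in> borel_measurable M"
 shows "(\<integral>\<^sup>+x. MD m p a (\<lambda>s. w s x) \<partial>M) = (\<integral>\<^sup>+s. \<integral>\<^sup>+x. ennreal (\<bar>av a s * w s x\<bar> powr p) \<partial>M \<partial>count_space (SL m))"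
 unfolding MD_def by (rule nn_integral_count_space_nn_integral[OF countable_SL]) (use assms in auto)

text \<open>Geometric weights in place of a power of the number of terms: the factor of each term is
  independent of \<open>n\<close>, so that countably many errors can be summed.\<close>

lemma powr_sum_le:
 fixes z :: "nat \<Rightarrow> real"
 assumes p: "p \<ge> 0"
 shows "\<bar>\<Sum>j<n. z j\<bar> powr p \<le> (\<Sum>j<n. (2 ^ Suc j) powr p * \<bar>z j\<bar> powr p)"
proof (induction n arbitrary: z)
 case (Suc n)
 have "\<bar>\<Sum>j<Suc n. z j\<bar> powr p = \<bar>z 0 + (\<Sum>j<n. z (Suc j))\<bar> powr p" by (simp only: sum.lessThan_Suc_shift)
 also have "\<dots> \<le> 2 powr p * (\<bar>z 0\<bar> powr p + \<bar>\<Sum>j<n. z (Suc j)\<bar> powr p)" by (rule powr_add_le[OF p])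
 also have "\<dots> \<le> 2 powr p * (\<bar>z 0\<bar> powr p + (\<Sum>j<n. (2 ^ Suc j) powr p * \<bar>z (Suc j)\<bar> powr p))"
  by (intro mult_left_mono add_left_mono Suc.IH) auto
 also have "\<dots> = 2 powr p * \<bar>z 0\<bar> powr p + (\<Sum>j<n. (2 ^ Suc (Suc j)) powr p * \<bar>z (Suc j)\<bar> powr p)"
  by (simp add: distrib_left sum_distrib_left powr_mult mult.assoc powr_mult[of 2 2 p, simplified])
 also have "\<dots> = (\<Sum>j<Suc n. (2 ^ Suc j) powr p * \<bar>z j\<bar> powr p)" by (simp only: sum.lessThan_Suc_shift) simp
 finally show ?case .
qed simp

lemma MD_sum_le:
 assumes "p \<ge> 0"
 shows "MD m p a (\<lambda>s. \<Sum>j<n. e j s) \<le> (\<Sum>j<n. ennreal ((2 ^ Suc j) powr p) * MD m p a (e j))"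
proof -
 have "MD m p a (\<lambda>s. \<Sum>j<n. e j s) \<le> ssum m (\<lambda>s. (\<Sum>j<n. ennreal ((2 ^ Suc j) powr p) * ennreal (\<bar>av a s * e j s\<bar> powr p)))"
  unfolding MD_def
 proof (rule nn_integral_mono)
  fix s
  have "\<bar>av a s * (\<Sum>j<n. e j s)\<bar> powr p \<le> (\<Sum>j<n. (2 ^ Suc j) powr p * \<bar>av a s * e j s\<bar> powr p)"
   using powr_sum_le[OF assms, of "\<lambda>j. av a s * e j s" n] by (simp add: sum_distrib_left)
  then have "ennreal (\<bar>av a s * (\<Sum>j<n. e j s)\<bar> powr p) \<le> ennreal (\<Sum>j<n. (2 ^ Suc j) powr p * \<bar>av a s * e j s\<bar> powr p)"
   by (rule ennreal_leI)
  also have "\<dots> = (\<Sum>j<n. ennreal ((2 ^ Suc j) powr p) * ennreal (\<bar>av a s * e j s\<bar> powr p))"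
   by (subst sum_ennreal[symmetric]) (auto simp: ennreal_mult)
  finally show "ennreal (\<bar>av a s * (\<Sum>j<n. e j s)\<bar> powr p) \<le> (\<Sum>j<n. ennreal ((2 ^ Suc j) powr p) * ennreal (\<bar>av a s * e j s\<bar> powr p))" .
 qed
 also have "\<dots> = (\<Sum>j<n. ennreal ((2 ^ Suc j) powr p) * MD m p a (e j))"
  by (subst nn_integral_sum) (auto simp: nn_integral_cmult MD_def)
 finally show ?thesis .
qed

section \<open>The Leibniz formula on lists\<close>

lemma lz_Cons: "lz u v (i # s) = lz (\<lambda>r. u (i # r)) v s + lz u (\<lambda>t. v (i # t)) s"
 by (simp add: lz_def case_prod_unfold o_def)

lemma lz_unit: "u [] = 1 ==> (\<And>r. r \<noteq> [] ==> u r = 0) ==> lz u v s = v s"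
proof (induction s arbitrary: v)
 case (Cons i s)
 have "lz (\<lambda>r. u (i # r)) v s = 0" using Cons.prems(2) by (simp add: lz_def case_prod_unfold)
 then show ?case using Cons by (simp add: lz_Cons)
qed (simp add: lz_def)

lemma lz_diff_left: "lz (\<lambda>r. u r - u' r) v s = lz u v s - lz u' v s"
 by (simp add: lz_def case_prod_unfold left_diff_distrib sum_list_subtractf)

lemma lz_diff_right: "lz u (\<lambda>r. v r - v' r) s = lz u v s - lz u v' s"
 by (simp add: lz_def case_prod_unfold right_diff_distrib sum_list_subtractf)

lemma lz_zero_left: "(\<And>r. u r = 0) ==> lz u v s = 0"
 by (simp add: lz_def case_prod_unfold)

lemma lz_measurable:
 assumes "\<And>r. (\<lambda>x. u x r) \<in> borel_measurable M" "\<And>t. (\<lambda>x. v x t) \<in> borel_measurable M"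
 shows "(\<lambda>x. lz (u x) (v x) s) \<in> borel_measurable M"
proof -
 have "(\<lambda>x. \<Sum>q\<leftarrow>ps. u x (fst q) * v x (snd q)) \<in> borel_measurable M" for ps
  by (induction ps) (auto intro!: borel_measurable_add borel_measurable_times assms)
 then show ?thesis by (simp add: lz_def case_prod_unfold)
qed

lemma lz_integrable:
 assumes "\<And>r t. integrable M (\<lambda>x. u x r * v x t)"
 shows "integrable M (\<lambda>x. lz (u x) (v x) s)"
proof -
 have "integrable M (\<lambda>x. \<Sum>q\<leftarrow>ps. u x (fst q) * v x (snd q))" for ps
  by (induction ps) (auto intro!: assms)
 then show ?thesis by (simp add: lz_def case_prod_unfold)
qed

lemma pds_add:
 assumes "tame f" "tame g"
 shows "pds is (\<lambda>x. f x + g x) = (\<lambda>x. pds is f x + pds is g x)"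
 unfolding pds_eq_dds by (rule dds_add[OF assms]) simp

lemma pds_cmult: "tame f ==> pds is (\<lambda>x. c * f x) = (\<lambda>x. c * pds is f x)"
 unfolding pds_eq_dds by (rule dds_cmult[OF _ map_unit_vec_lists])

lemma pds_diff:
 assumes "tame f" "tame g"
 shows "pds is (\<lambda>x. f x - g x) = (\<lambda>x. pds is f x - pds is g x)"
 using pds_add[OF assms(1) tame_cmult[OF assms(2), of "- 1"], of "is"] pds_cmult[OF assms(2), of "is" "- 1"] by simp

lemma pds_rev_mult:
 assumes "tame f" "tame g"
 shows "pds (rev s) (\<lambda>x. f x * g x) x = lz (\<lambda>r. pds (rev r) f x) (\<lambda>t. pds (rev t) g x) s"
 using assms
proof (induction s arbitrary: f g)
 case (Cons i s)
 have "pd i (\<lambda>x. f x * g x) = (\<lambda>x. pd i f x * g x + f x * pd i g x)"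
  using tame_has_pd[OF Cons.prems(1)] tame_has_pd[OF Cons.prems(2)] by (simp add: pd_eq_dd has_pd_eq dd_mult fun_eq_iff)
 then have "pds (rev (i # s)) (\<lambda>x. f x * g x) x = pds (rev s) (\<lambda>x. pd i f x * g x + f x * pd i g x) x"
  by (simp add: pds_append)
 also have "\<dots> = pds (rev s) (\<lambda>x. pd i f x * g x) x + pds (rev s) (\<lambda>x. f x * pd i g x) x"
  using Cons.prems by (subst pds_add) (auto intro!: tame_mult tame_pd)
 finally show ?case
  using Cons.IH[OF tame_pd[OF Cons.prems(1), of i] Cons.prems(2)] Cons.IH[OF Cons.prems(1) tame_pd[OF Cons.prems(2), of i]]
  by (simp add: lz_Cons pds_append)
qed (simp add: lz_def)

section \<open>Approximation of localised functions\<close>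

lemma pds_const: "pds is (\<lambda>_. c) = (\<lambda>_. if is = [] then c else 0)"
proof (induction "is")
 case (Cons i "is")
 have "pds (i # is) (\<lambda>_. c) = pd i (pds is (\<lambda>_. c))" by (simp add: fun_eq_iff)
 then show ?case unfolding Cons.IH by (simp add: pd_eq_dd)
qed (simp add: pds_def)

abbreviation Dl :: "(ell2 \<Rightarrow> real) \<Rightarrow> ell2 \<Rightarrow> nat list \<Rightarrow> real" where
 "Dl f x \<equiv> \<lambda>r. pds (rev r) f x"

abbreviation (in exhaustion) IM :: "nat \<Rightarrow> real \<Rightarrow> (ell2 \<Rightarrow> nat list \<Rightarrow> real) \<Rightarrow> ennreal" where
 "IM m p w \<equiv> \<integral>\<^sup>+x. MD m p a (w x) \<partial>G"

locale sobolev_fun = exhaustion +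
 fixes m :: nat and p :: real and v :: "nat list \<Rightarrow> ell2 \<Rightarrow> real"
 assumes p: "p \<ge> 1"
  and v_meas: "\<And>s. bmeas (v s)"
  and v_zero: "\<And>s. s \<notin> SL m ==> v s = (\<lambda>_. 0)"
  and v_out: "\<And>s x. x \<notin> \<Omega> ==> v s x = 0"
  and v_MD: "IM m p (\<lambda>x s. v s x) < \<infinity>"
  and v_WD: "\<And>s. s \<in> SL m ==> WD (v []) s (v s)"

context exhaustion
begin

lemma MD_component:
 assumes s: "s \<in> SL m" and w: "IM m p w < \<infinity>" and [measurable]: "bmeas (\<lambda>x. w x s)"
 shows "Lm p (\<lambda>x. w x s) < \<infinity>"
proof -
 have av: "av a s > 0" by (rule av_pos[OF a_pos])
 have "Lm p (\<lambda>x. w x s) = (\<integral>\<^sup>+x. ennreal (1 / av a s powr p) * ennreal (\<bar>av a s * w x s\<bar> powr p) \<partial>G)"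
  using av by (intro nn_integral_cong) (simp add: ennreal_mult[symmetric] abs_mult powr_mult)
 also have "\<dots> = ennreal (1 / av a s powr p) * Lm p (\<lambda>x. av a s * w x s)"
  by (rule nn_integral_cmult) simp
 also have "Lm p (\<lambda>x. av a s * w x s) \<le> IM m p w"
  unfolding MD_def using s by (intro nn_integral_mono nn_integral_ge_point) auto
 finally have "Lm p (\<lambda>x. w x s) \<le> ennreal (1 / av a s powr p) * IM m p w"
  by (simp add: mult_left_mono)
 also have "\<dots> < \<infinity>" using w by (simp add: ennreal_mult_less_top)
 finally show ?thesis .
qed

end

context sobolev_fun
begin

lemma v_integrable: "integrable G (v s)"
proof (cases "s \<in> SL m")
 case True
 then show ?thesis
  using MD_component[OF True v_MD] v_meas by (intro Lp_integrable(1)[OF v_meas p]) auto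
next
 case False
 then show ?thesis by (simp add: v_zero)
qed

end

text \<open>One piece of the partition. \<open>k\<close> fixes a set of the exhaustion containing
  the set where \<open>\<psi>\<close> is nonzero; \<open>C\<close> bounds both cutoffs in the
  weighted square sense.\<close>

locale localised = sobolev_fun +
 fixes \<tau> \<psi> :: "ell2 \<Rightarrow> real" and C :: real and k :: nat
 assumes tame_\<tau>: "tame \<tau>" and tame_\<psi>: "tame \<psi>" and C: "C \<ge> 0"
  and Sq_\<tau>: "\<And>i x. i \<le> m ==> Sq a i \<tau> x \<le> ennreal C"
  and Sq_\<psi>: "\<And>i x. i \<le> m ==> Sq a i \<psi> x \<le> ennreal C"
  and \<psi>_1: "\<And>x. \<tau> x \<noteq> 0 ==> \<psi> x = 1"
  and \<psi>_V: "\<And>x. \<psi> x \<noteq> 0 ==> x \<in> V k"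
begin

definition h :: "nat list \<Rightarrow> ell2 \<Rightarrow> real" where
 "h s x = lz (Dl \<tau> x) (\<lambda>t. v t x) s"

definition h0 :: "ell2 \<Rightarrow> real" where
 "h0 x = \<tau> x * v [] x"

definition U :: "ell2 set" where "U = {x. \<tau> x \<noteq> 0}"

lemma open_U: "open U"
 unfolding U_def by (intro open_Collect_neq tame_continuous tame_\<tau> continuous_on_const)

lemma btest_\<tau>: "btest \<tau>"
 by (rule tame_supp_btest[OF tame_\<tau>, of k]) (use \<psi>_1 \<psi>_V in force)

lemma h_measurable [measurable]: "bmeas (h s)"
 unfolding h_def[abs_def] by (intro lz_measurable tame_measurable tame_pds tame_\<tau> v_meas)

lemma h_integrable: "integrable G (h s)"
 unfolding h_def[abs_def]
 by (rule lz_integrable) (use integrable_mult_btest[OF v_integrable btest_pds[OF btest_\<tau>]] in \<open>simp add: mult.commute\<close>)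

lemma h0_measurable [measurable]: "bmeas h0"
 unfolding h0_def[abs_def] using tame_measurable[OF tame_\<tau>] v_meas by measurable

lemma h0_integrable: "integrable G h0"
 unfolding h0_def[abs_def] using integrable_mult_btest[OF v_integrable btest_\<tau>] by (simp add: mult.commute)

lemma h0_far: "norm x \<ge> real (k + K) ==> h0 x = 0"
 using \<psi>_V[of x] \<psi>_1[of x] V_bounded[of x k] by (force simp: h0_def)

lemma h_out: "x \<notin> closure U ==> h s x = 0"
proof -
 assume x: "x \<notin> closure U"
 have "pds (rev r) \<tau> x = pds (rev r) (\<lambda>_. 0) x" for r
  using x closure_subset[of U] by (intro pds_cong_local[of "- closure U"]) (auto simp: U_def)
 then show ?thesis unfolding h_def by (intro lz_zero_left) simp
qed

text \<open>On the open set \<open>U\<close> the function \<open>\<psi>\<close> is constantly 1; by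
  continuity its derivatives keep their values on the closure, which carries the derivatives of
  \<open>\<tau>\<close>.\<close>

lemma pds_\<psi>: "x \<in> closure U ==> pds is \<psi> x = (if is = [] then 1 else 0)"
proof -
 assume x: "x \<in> closure U"
 have "closed {x. pds is \<psi> x = (if is = [] then 1 else 0)}"
  by (intro closed_Collect_eq tame_continuous tame_pds tame_\<psi> continuous_on_const)
 moreover have "U \<subseteq> {x. pds is \<psi> x = (if is = [] then 1 else 0)}"
 proof
  fix x assume "x \<in> U"
  then have "pds is \<psi> x = pds is (\<lambda>_. 1) x"
   by (intro pds_cong_local[OF open_U]) (auto simp: U_def \<psi>_1)
  then show "x \<in> {x. pds is \<psi> x = (if is = [] then 1 else 0)}" by (simp add: pds_const)
 qed
 ultimately show ?thesis using x closure_minimal by blast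
qed

text \<open>\<open>\<psi>\<close> acts as the identity on the jet \<open>h\<close>, which lets the
  cutoff error be written with the difference \<open>\<psi> - \<Psi> N\<close> as
  multiplier.\<close>

lemma lz_\<psi>_h: "lz (Dl \<psi> x) (\<lambda>t. h t x) s = h s x"
proof (cases "x \<in> closure U")
 case True
 then show ?thesis by (intro lz_unit) (simp_all only: pds_\<psi>[OF True], simp_all)
next
 case False
 then show ?thesis by (simp add: h_out lz_def case_prod_unfold)
qed

lemma h_WD: "s \<in> SL m ==> WD h0 s (h s)"
 unfolding h0_def[abs_def] h_def[abs_def] lz_def
 by (rule WD_leibniz) (auto intro: v_integrable tame_\<tau> v_WD simp: SL_def)

lemma MD_Dl_le:
 assumes "\<And>i. i \<le> m ==> Sq a i f x \<le> ennreal B" "B \<ge> 0"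
 shows "MD m p a (Dl f x) \<le> ennreal ((av_total a m + real (Suc m) * B) powr p)"
 by (rule MD_bounded[OF a_pos a_summable p Sq_sum_SL[OF a_pos assms]]) (use assms(2) in auto)

lemma MD_lz_le:
 assumes "\<And>i. i \<le> m ==> Sq a i f x \<le> ennreal B" "B \<ge> 0"
 shows "MD m p a (lz (Dl f x) w) \<le> ennreal ((2 ^ m) powr p * (av_total a m + real (Suc m) * B) powr p) * MD m p a w"
proof -
 have "MD m p a (lz (Dl f x) w) \<le> ennreal ((2 ^ m) powr p) * (MD m p a (Dl f x) * MD m p a w)"
  by (rule MD_lz[OF p])
 also have "\<dots> \<le> ennreal ((2 ^ m) powr p) * (ennreal ((av_total a m + real (Suc m) * B) powr p) * MD m p a w)"
  by (intro mult_left_mono mult_right_mono MD_Dl_le assms) auto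
 finally show ?thesis by (simp add: ennreal_mult mult.assoc)
qed

lemma h_MD: "IM m p (\<lambda>x s. h s x) < \<infinity>"
proof -
 have "IM m p (\<lambda>x s. h s x) \<le> (\<integral>\<^sup>+x. ennreal ((2 ^ m) powr p * (av_total a m + real (Suc m) * C) powr p) * MD m p a (\<lambda>s. v s x) \<partial>G)"
  unfolding h_def by (intro nn_integral_mono MD_lz_le Sq_\<tau> C)
 also have "\<dots> = ennreal ((2 ^ m) powr p * (av_total a m + real (Suc m) * C) powr p) * IM m p (\<lambda>x s. v s x)"
  by (rule nn_integral_cmult) (use v_meas in \<open>intro MD_measurable, simp\<close>)
 also have "\<dots> < \<infinity>" using v_MD by (simp add: ennreal_mult_less_top)
 finally show ?thesis .
qed

lemma T_h0_bsmooth: "bsmooth (T n h0)"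
 by (rule mehler_smooth(1)[OF mc(3) h0_integrable h0_far])

text \<open>The Mehler operator commutes with weak derivatives up to a power of the contraction factor: the
 kernel, multiplied by \<open>\<psi>\<close>, is a test function.\<close>

lemma Dl_T:
 assumes s: "s \<in> SL m" "set s \<subseteq> {..<n}"
 shows "Dl (T n h0) x s = mc n ^ length s * T n (h s) x"
proof -
 let ?\<kappa> = "KJ (mc n) {..<n} x"
 define \<phi> where "\<phi> z = \<psi> z * ?\<kappa> z" for z
 have t: "tame \<phi>" unfolding \<phi>_def by (intro tame_mult tame_\<psi> bsmooth_tame[OF bsmooth_KJ] mc)
 have \<phi>: "\<phi> \<in> test_fun \<Omega>" by (rule tame_test_fun[OF t, of k]) (auto simp: \<phi>_def \<psi>_V)
 have e: "ext \<phi> = \<phi>" by (rule ext_id) (use \<psi>_V V_subset[of k] in \<open>force simp: \<phi>_def\<close>)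
 have 1: "h0 z * foldr (delta a) s \<phi> z = h0 z * foldr (delta a) s ?\<kappa> z" for z
 proof (cases "z \<in> U")
  case True
  then show ?thesis
   by (subst deltas_cong_local[OF open_U True, of \<phi> ?\<kappa>]) (auto simp: \<phi>_def U_def \<psi>_1)
 qed (simp add: h0_def U_def)
 have 2: "h s z * \<phi> z = h s z * ?\<kappa> z" for z
  using pds_\<psi>[of z "[]"] h_out[of z s] by (cases "z \<in> closure U") (auto simp: \<phi>_def pds_def)
 have "Dl (T n h0) x s = (- mc n) ^ length s * (\<integral>z. h0 z * foldr (delta a) s ?\<kappa> z \<partial>G)"
  by (rule mehler_smooth(2)[OF mc(3) h0_integrable h0_far s(2)])
 also have "(\<integral>z. h0 z * foldr (delta a) s ?\<kappa> z \<partial>G) = (\<integral>z. h0 z * foldr (delta a) s (ext \<phi>) z \<partial>G)"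
  by (simp only: 1 e)
 also have "\<dots> = (- 1) ^ length s * (\<integral>z. h s z * ext \<phi> z \<partial>G)"
  using h_WD[OF s(1)] \<phi> by (simp add: WD_def)
 also have "(\<integral>z. h s z * ext \<phi> z \<partial>G) = T n (h s) x"
  by (simp only: e 2 mehler_def)
 also have "(- mc n) ^ length s * ((- 1) ^ length s * T n (h s) x) = mc n ^ length s * T n (h s) x"
 proof -
  have "(- mc n) ^ length s * (- 1) ^ length s = mc n ^ length s" unfolding power_mult_distrib[symmetric] by simp
  then show ?thesis by (simp only: mult.assoc[symmetric])
 qed
 finally show ?thesis .
qed

lemma Dl_T_0: "\<not> set s \<subseteq> {..<n} ==> Dl (T n h0) x s = 0"
 by (rule mehler_smooth(3)[OF mc(3) h0_integrable h0_far]) auto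

text \<open>With \<open>c = mc n\<close> and \<open>l = length s\<close>, the error is
  \<open>-(T n (h s) - h s) + (1 - c^l) * T n (h s)\<close> up to the weight: the first part tends
  to 0 by \<open>T_Lp\<close>, the second because \<open>c\<close> tends to 1 and \<open>T n\<close>
  is a contraction. The formula holds once \<open>n\<close> exceeds all entries of
  \<open>s\<close>.\<close>

lemma T_term_tendsto:
 assumes s: "s \<in> SL m"
 shows "(\<lambda>n. Lm p (\<lambda>x. av a s * (h s x - Dl (T n h0) x s))) \<longlonglongrightarrow> 0"
proof -
 let ?l = "length s" and ?H = "Lm p (h s)"
 have fin: "?H < \<infinity>" by (rule MD_component[OF s h_MD]) simp
 then obtain H where H: "H \<ge> 0" "?H = ennreal H" unfolding infinity_ennreal_def less_top_ennreal by blast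
 let ?X = "\<lambda>n. Lm p (\<lambda>x. T n (h s) x - h s x)"
 let ?c = "ennreal (2 powr p)" and ?d = "ennreal (\<bar>- av a s\<bar> powr p)" and ?k = "\<lambda>n. av a s * (1 - mc n ^ ?l)"
 have le: "Lm p (\<lambda>x. av a s * (h s x - Dl (T n h0) x s)) \<le> ?c * (?d * ?X n + ennreal (\<bar>?k n\<bar> powr p * H))"
  if n: "set s \<subseteq> {..<n}" for n
 proof -
  have [measurable]: "bmeas (T n (h s))" by (intro mehler_measurable mc) simp_all
  have "av a s * (h s x - Dl (T n h0) x s) = - av a s * (T n (h s) x - h s x) + ?k n * T n (h s) x" for x
   unfolding Dl_T[OF s n] by (simp add: algebra_simps)
  then have "Lm p (\<lambda>x. av a s * (h s x - Dl (T n h0) x s)) \<le> ?c * (?d * ?X n + Lm p (\<lambda>x. ?k n * T n (h s) x))"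
   by (simp only:) (rule Lm_affine[OF p], measurable)
  also have "Lm p (\<lambda>x. ?k n * T n (h s) x) = ennreal (\<bar>?k n\<bar> powr p) * Lm p (T n (h s))" by (rule Lm_cmult) simp
  also have "?c * (?d * ?X n + \<dots>) \<le> ?c * (?d * ?X n + ennreal (\<bar>?k n\<bar> powr p) * ennreal H)"
   using mehler_contraction[OF mc(3) p, of "h s" n n] H by (intro mult_left_mono add_left_mono) auto
  finally show ?thesis using H by (simp only: ennreal_mult powr_ge_zero)
 qed
 have ev: "\<forall>\<^sub>F n in sequentially. set s \<subseteq> {..<n}"
 proof (rule eventually_sequentiallyI)
  fix n assume "Suc (Max (insert 0 (set s))) \<le> n"
  moreover have "i \<le> Max (insert 0 (set s))" if "i \<in> set s" for i using that by (intro Max_ge) auto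
  ultimately show "set s \<subseteq> {..<n}" using less_le_trans le_imp_less_Suc by (metis lessThan_iff subsetI)
 qed
 have "(\<lambda>n. \<bar>?k n\<bar>) \<longlonglongrightarrow> \<bar>av a s * (1 - 1 ^ ?l)\<bar>" by (intro tendsto_intros mc_tendsto)
 then have "(\<lambda>n. \<bar>?k n\<bar> powr p) \<longlonglongrightarrow> 0" using p by (intro tendsto_zero_powrI) auto
 then have "(\<lambda>n. \<bar>?k n\<bar> powr p * H) \<longlonglongrightarrow> 0" by (rule tendsto_mult_left_zero)
 then have "(\<lambda>n. ennreal (\<bar>?k n\<bar> powr p * H)) \<longlonglongrightarrow> ennreal 0" by (rule tendsto_ennrealI)
 then have "(\<lambda>n. ?c * (?d * ?X n + ennreal (\<bar>?k n\<bar> powr p * H))) \<longlonglongrightarrow> ?c * (?d * 0 + ennreal 0)"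
  using T_Lp[OF h_measurable p fin] by (intro ennreal_tendsto_cmult tendsto_add) auto
 then have lim: "(\<lambda>n. ?c * (?d * ?X n + ennreal (\<bar>?k n\<bar> powr p * H))) \<longlonglongrightarrow> 0" by simp
 show ?thesis
  by (rule tendsto_sandwich[OF always_eventually eventually_mono[OF ev le] tendsto_const lim]) auto
qed

text \<open>Dominated convergence in the sum over \<open>s\<close>. The contraction property gives a
  majorant, a multiple of the norm of \<open>h s\<close>, that is independent of \<open>n\<close>;
  before \<open>n\<close> exceeds the entries of \<open>s\<close> the derivative is 0 and the
  majorant still holds.\<close>

lemma T_MD_tendsto:
 "(\<lambda>n. IM m p (\<lambda>x s. h s x - Dl (T n h0) x s)) \<longlonglongrightarrow> 0"
proof -
 note [measurable] = mehler_measurable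
 have DTm [measurable]: "bmeas (\<lambda>x. Dl (T n h0) x s)" for n s
  by (intro tame_measurable tame_pds bsmooth_tame T_h0_bsmooth)
 let ?u = "\<lambda>n s. Lm p (\<lambda>x. av a s * (h s x - Dl (T n h0) x s))"
 let ?w = "\<lambda>s. Lm p (\<lambda>x. av a s * h s x)"
 have DT: "Lm p (\<lambda>x. av a s * Dl (T n h0) x s) \<le> ?w s" if s: "s \<in> SL m" for n s
 proof (cases "set s \<subseteq> {..<n}")
  case True
  have [measurable]: "bmeas (T n (h s))" by (intro mehler_measurable mc) simp_all
  have "\<bar>mc n ^ length s\<bar> \<le> 1" unfolding power_abs using mc[of n] by (intro power_le_one) auto
  then have "\<bar>av a s * mc n ^ length s\<bar> \<le> \<bar>av a s\<bar>" unfolding abs_mult by (intro mult_left_le) auto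
  then have "ennreal (\<bar>av a s * mc n ^ length s\<bar> powr p) * Lm p (T n (h s)) \<le> ennreal (\<bar>av a s\<bar> powr p) * Lm p (h s)"
   using p by (intro mult_mono mehler_contraction mc ennreal_leI powr_mono2) auto
  then show ?thesis
   unfolding Dl_T[OF s True] mult.assoc[symmetric] by (simp only: Lm_cmult h_measurable \<open>T n (h s) \<in> borel_measurable borel\<close>)
 next
  case False
  then show ?thesis by (simp add: Dl_T_0)
 qed
 have "(\<lambda>n. ssum m (\<lambda>s. ?u n s)) \<longlonglongrightarrow> (ssum m (\<lambda>s. 0))"
 proof (rule nn_integral_dominated_convergence[where w = "\<lambda>s. ennreal (2 powr p * 2) * ?w s"])
  show "AE s in count_space (SL m). ?u n s \<le> ennreal (2 powr p * 2) * ?w s" for n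
  proof (rule AE_I2)
   fix s assume "s \<in> space (count_space (SL m))"
   then have s: "s \<in> SL m" by simp
   have "av a s * (h s x - Dl (T n h0) x s) = - 1 * (av a s * Dl (T n h0) x s) + av a s * h s x" for x
    by (simp add: right_diff_distrib)
   then have "?u n s \<le> ennreal (2 powr p) * (ennreal (\<bar>- 1\<bar> powr p) * Lm p (\<lambda>x. av a s * Dl (T n h0) x s) + ?w s)"
    by (simp only:) (rule Lm_affine[OF p], measurable)
   also have "\<dots> = ennreal (2 powr p) * (?w s + Lm p (\<lambda>x. av a s * Dl (T n h0) x s))" by (simp add: add.commute)
   also have "\<dots> \<le> ennreal (2 powr p) * (?w s + ?w s)"
    by (intro mult_left_mono add_left_mono DT s) simp
   also have "\<dots> = ennreal (2 powr p * 2) * ?w s" by (simp add: ennreal_mult mult_2[symmetric] mult.assoc)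
   finally show "?u n s \<le> ennreal (2 powr p * 2) * ?w s" .
  qed
  have "ssum m (\<lambda>s. ?w s) < \<infinity>"
   using h_MD nn_integral_MD[of m h G p a] by simp
  then show "ssum m (\<lambda>s. ennreal (2 powr p * 2) * ?w s) < \<infinity>"
   by (simp add: nn_integral_cmult ennreal_mult_less_top)
  show "AE s in count_space (SL m). (\<lambda>n. ?u n s) \<longlonglongrightarrow> 0"
   by (rule AE_I2) (simp add: T_term_tendsto)
 qed auto
 moreover have "IM m p (\<lambda>x s. h s x - Dl (T n h0) x s) = ssum m (\<lambda>s. ?u n s)" for n
  by (rule nn_integral_MD) simp
 ultimately show ?thesis by simp
qed

text \<open>On the level of jets, \<open>h - Dl g\<close> is \<open>(\<psi> - \<Psi> N)\<close>
  times \<open>h\<close> plus \<open>\<Psi> N\<close> times \<open>h - Dl (T n h0)\<close>. The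
  first term fixes \<open>N\<close>, by dominated convergence in \<open>x\<close> on top of
  \<open>MD_tendsto_0\<close>; then \<open>n\<close> makes the second one small.\<close>

lemma local_approximation:
 assumes \<delta>: "\<delta> > 0" and e: "\<epsilon> > 0"
 obtains g where "bsmooth g" "\<And>x. g x \<noteq> 0 ==> \<exists>y. norm (x - y) < \<delta> \<and> \<psi> y \<noteq> 0"
  "IM m p (\<lambda>x s. h s x - Dl g x s) \<le> ennreal \<epsilon>"
proof -
 obtain \<Psi> D where \<Psi>: "\<And>N. bsmooth (\<Psi> N)" "D \<ge> 0" "\<And>N i x. i \<le> m ==> Sq a i (\<Psi> N) x \<le> ennreal D"
  "\<And>N x. \<Psi> N x \<noteq> 0 ==> \<exists>y. norm (x - y) < \<delta> \<and> \<psi> y \<noteq> 0"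
  "\<And>x is. summable (\<lambda>i. (coord x i)^2 / a i) ==> (\<lambda>N. pds is (\<Psi> N) x) \<longlonglongrightarrow> pds is \<psi> x"
  by (rule smooth_localization[OF a_pos a_summable tame_\<psi> C Sq_\<psi> \<delta>, where m = m], assumption) (rule that, assumption+)
 \<comment> \<open>Two errors of this size, with the factor \<open>2 powr p\<close> from
   \<open>MD_add\<close>, add up to \<open>\<epsilon>\<close>.\<close>
 define \<epsilon>1 where "\<epsilon>1 = \<epsilon> / (2 * 2 powr p)"
 have e1: "\<epsilon>1 > 0" using e by (simp add: \<epsilon>1_def)
 have tP: "tame (\<Psi> N)" for N by (rule bsmooth_tame[OF \<Psi>(1)])
 define B where "B = 2 * (C + D)"
 have B: "B \<ge> 0" using C \<Psi>(2) by (simp add: B_def)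
 have SqB: "Sq a i (\<lambda>x. \<psi> x - \<Psi> N x) x \<le> ennreal B" if "i \<le> m" for i N x
 proof -
  have "Sq a i (\<lambda>x. \<psi> x - \<Psi> N x) x \<le> 2 * (Sq a i \<psi> x + Sq a i (\<Psi> N) x)" by (rule Sq_diff[OF tame_\<psi> tP])
  also have "\<dots> \<le> 2 * (ennreal C + ennreal D)" by (intro mult_left_mono add_mono Sq_\<psi> \<Psi>(3) that) simp
  also have "\<dots> = ennreal B" using C \<Psi>(2) by (simp add: B_def ennreal_mult)
  finally show ?thesis .
 qed
 define w where "w N x = Dl (\<lambda>x. \<psi> x - \<Psi> N x) x" for N x
 have w_eq: "w N x r = Dl \<psi> x r - Dl (\<Psi> N) x r" for N x r
  unfolding w_def by (simp add: pds_diff[OF tame_\<psi> tP])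
 have w_meas: "bmeas (\<lambda>x. w N x r)" for N r
  unfolding w_def by (intro tame_measurable tame_pds tame_diff tame_\<psi> tP)
 let ?c = "(2 ^ m) powr p" and ?c2 = "(2 ^ m) powr p * (av_total a m + real (Suc m) * B) powr p"
 have hmeas: "bmeas (\<lambda>x. MD m p a (\<lambda>s. h s x))" by (intro MD_measurable) simp
 have lzmeas: "bmeas (\<lambda>x. MD m p a (lz (w N x) (\<lambda>t. h t x)))" for N
  by (intro MD_measurable lz_measurable w_meas) simp
 have G_borel: "f \<in> borel_measurable borel ==> f \<in> borel_measurable G" for f :: "ell2 \<Rightarrow> ennreal" by simp
 have "(\<lambda>N. IM m p (\<lambda>x. lz (w N x) (\<lambda>t. h t x))) \<longlonglongrightarrow> (\<integral>\<^sup>+x. 0 \<partial>G)"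
 proof (rule nn_integral_dominated_convergence[where w = "\<lambda>x. ennreal ?c2 * MD m p a (\<lambda>s. h s x)"])
  show "AE x in G. MD m p a (lz (w N x) (\<lambda>t. h t x)) \<le> ennreal ?c2 * MD m p a (\<lambda>s. h s x)" for N
   unfolding w_def by (intro AE_I2 MD_lz_le SqB B)
  show "(\<integral>\<^sup>+x. ennreal ?c2 * MD m p a (\<lambda>s. h s x) \<partial>G) < \<infinity>"
   using h_MD by (subst nn_integral_cmult[OF G_borel[OF hmeas]]) (simp add: ennreal_mult_less_top)
  have "AE x in G. summable (\<lambda>i. 1 / a i * (coord x i)^2)"
   using a_pos a_summable by (intro AE_summable_weighted) (auto simp: less_imp_le power2_eq_square less_imp_neq[symmetric])
  moreover have "AE x in G. MD m p a (\<lambda>s. h s x) \<noteq> \<infinity>"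
   using h_MD by (intro nn_integral_PInf_AE G_borel[OF hmeas]) auto
  ultimately show "AE x in G. (\<lambda>N. MD m p a (lz (w N x) (\<lambda>t. h t x))) \<longlonglongrightarrow> 0"
  proof eventually_elim
   case (elim x)
   have "(\<lambda>N. MD m p a (w N x)) \<longlonglongrightarrow> 0"
   proof (rule MD_tendsto_0[OF a_pos a_summable p])
    show "ssum m (\<lambda>s. ennreal (av a s * (w N x s)^2)) \<le> ennreal (real (Suc m) * B)" for N
     unfolding w_def by (rule Sq_sum_SL[OF a_pos SqB B])
    show "real (Suc m) * B \<ge> 0" using B by simp
    have "(\<lambda>N. Dl (\<Psi> N) x s) \<longlonglongrightarrow> Dl \<psi> x s" for s using elim by (intro \<Psi>(5)) simp
    then have "(\<lambda>N. Dl \<psi> x s - Dl (\<Psi> N) x s) \<longlonglongrightarrow> Dl \<psi> x s - Dl \<psi> x s" for s by (intro tendsto_intros)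
    then show "(\<lambda>N. w N x s) \<longlonglongrightarrow> 0" for s by (simp add: w_eq)
   qed
   then have "(\<lambda>N. (ennreal ?c * MD m p a (\<lambda>s. h s x)) * MD m p a (w N x)) \<longlonglongrightarrow> (ennreal ?c * MD m p a (\<lambda>s. h s x)) * 0"
    using elim by (intro ennreal_tendsto_cmult) (simp_all add: ennreal_mult_less_top less_top)
   then have "(\<lambda>N. (ennreal ?c * MD m p a (\<lambda>s. h s x)) * MD m p a (w N x)) \<longlonglongrightarrow> 0" by simp
   note lim = this
   have le: "MD m p a (lz (w N x) (\<lambda>t. h t x)) \<le> (ennreal ?c * MD m p a (\<lambda>s. h s x)) * MD m p a (w N x)" for N
    using MD_lz[OF p, of m a "w N x" "\<lambda>t. h t x"] by (simp only: ac_simps)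
   show ?case
    by (rule tendsto_sandwich[OF always_eventually always_eventually tendsto_const lim]) (use le in auto)
  qed
 qed (use lzmeas hmeas in \<open>auto intro!: G_borel borel_measurable_times\<close>)
 then have "(\<lambda>N. IM m p (\<lambda>x. lz (w N x) (\<lambda>t. h t x))) \<longlonglongrightarrow> 0" by simp
 then have "\<forall>\<^sub>F N in sequentially. IM m p (\<lambda>x. lz (w N x) (\<lambda>t. h t x)) < ennreal \<epsilon>1"
  by (rule order_tendstoD) (use e1 in simp)
 then obtain N where N: "IM m p (\<lambda>x. lz (w N x) (\<lambda>t. h t x)) < ennreal \<epsilon>1"
  unfolding eventually_sequentially by blast
 let ?c3 = "(2 ^ m) powr p * (av_total a m + real (Suc m) * D) powr p"
 have "(\<lambda>n. ennreal ?c3 * IM m p (\<lambda>x s. h s x - Dl (T n h0) x s)) \<longlonglongrightarrow> ennreal ?c3 * 0"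
  by (intro ennreal_tendsto_cmult T_MD_tendsto) simp
 then have "(\<lambda>n. ennreal ?c3 * IM m p (\<lambda>x s. h s x - Dl (T n h0) x s)) \<longlonglongrightarrow> 0" by simp
 then have "\<forall>\<^sub>F n in sequentially. ennreal ?c3 * IM m p (\<lambda>x s. h s x - Dl (T n h0) x s) < ennreal \<epsilon>1"
  by (rule order_tendstoD) (use e1 in simp)
 then obtain n where n: "ennreal ?c3 * IM m p (\<lambda>x s. h s x - Dl (T n h0) x s) < ennreal \<epsilon>1"
  unfolding eventually_sequentially by blast
 define g where "g x = \<Psi> N x * T n h0 x" for x
 have tT: "tame (T n h0)" by (rule bsmooth_tame[OF T_h0_bsmooth])
 have DTm: "bmeas (\<lambda>x. Dl (T n h0) x s)" for s
  by (intro tame_measurable tame_pds tT)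
 have dm: "bmeas (\<lambda>x. h s x - Dl (T n h0) x s)" for s
  by (intro borel_measurable_diff DTm) simp
 have Pm: "bmeas (\<lambda>x. Dl (\<Psi> N) x s)" for s
  by (intro tame_measurable tame_pds tP)
 have eq: "h s x - Dl g x s = lz (w N x) (\<lambda>t. h t x) s + lz (Dl (\<Psi> N) x) (\<lambda>t. h t x - Dl (T n h0) x t) s" for s x
 proof -
  have "Dl g x s = lz (Dl (\<Psi> N) x) (Dl (T n h0) x) s"
   unfolding g_def by (rule pds_rev_mult[OF tP tT])
  moreover have "lz (w N x) (\<lambda>t. h t x) s = h s x - lz (Dl (\<Psi> N) x) (\<lambda>t. h t x) s"
   unfolding w_eq[abs_def] lz_diff_left lz_\<psi>_h ..
  ultimately show ?thesis by (simp add: lz_diff_right)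
 qed
 have "IM m p (\<lambda>x s. h s x - Dl g x s) \<le>
   (\<integral>\<^sup>+x. ennreal (2 powr p) * (MD m p a (lz (w N x) (\<lambda>t. h t x)) + ennreal ?c3 * MD m p a (\<lambda>s. h s x - Dl (T n h0) x s)) \<partial>G)"
 proof (rule nn_integral_mono)
  fix x
  have "MD m p a (\<lambda>s. h s x - Dl g x s) \<le> ennreal (2 powr p) * (MD m p a (lz (w N x) (\<lambda>t. h t x)) + MD m p a (lz (Dl (\<Psi> N) x) (\<lambda>t. h t x - Dl (T n h0) x t)))"
   unfolding eq using p by (intro MD_add) simp
  also have "\<dots> \<le> ennreal (2 powr p) * (MD m p a (lz (w N x) (\<lambda>t. h t x)) + ennreal ?c3 * MD m p a (\<lambda>s. h s x - Dl (T n h0) x s))"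
   by (intro mult_left_mono add_left_mono MD_lz_le \<Psi>) auto
  finally show "MD m p a (\<lambda>s. h s x - Dl g x s) \<le> \<dots>" .
 qed
 also have "\<dots> = ennreal (2 powr p) * (IM m p (\<lambda>x. lz (w N x) (\<lambda>t. h t x)) + ennreal ?c3 * IM m p (\<lambda>x s. h s x - Dl (T n h0) x s))"
 proof -
  have 1: "(\<lambda>x. MD m p a (\<lambda>s. h s x - Dl (T n h0) x s)) \<in> borel_measurable G"
   by (intro G_borel MD_measurable dm)
  have add: "(\<integral>\<^sup>+x. c * (f x + d * u x) \<partial>G) = c * ((\<integral>\<^sup>+x. f x \<partial>G) + d * (\<integral>\<^sup>+x. u x \<partial>G))"
   if "f \<in> borel_measurable G" "u \<in> borel_measurable G" for f u :: "ell2 \<Rightarrow> ennreal" and c d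
   using that by (simp add: nn_integral_cmult nn_integral_add)
  show ?thesis by (rule add[OF G_borel[OF lzmeas] 1])
 qed
 also have "\<dots> \<le> ennreal (2 powr p) * (ennreal \<epsilon>1 + ennreal \<epsilon>1)"
  using N n by (intro mult_left_mono add_mono less_imp_le) auto
 also have "\<dots> = ennreal \<epsilon>"
  using e1 by (simp add: ennreal_mult[symmetric] \<epsilon>1_def flip: ennreal_plus)
 finally have 1: "IM m p (\<lambda>x s. h s x - Dl g x s) \<le> ennreal \<epsilon>" .
 have 2: "bsmooth g" unfolding g_def by (intro bsmooth_mult \<Psi> T_h0_bsmooth)
 have 3: "\<exists>y. norm (x - y) < \<delta> \<and> \<psi> y \<noteq> 0" if "g x \<noteq> 0" for x
  using that by (intro \<Psi>(4)[of N]) (auto simp: g_def)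
 show ?thesis by (rule that[OF 2 3 1])
qed

end

section \<open>Reduction to sorted lists\<close>

lemma bij_mi_of: "bij_betw mi_of (SL m) {\<alpha>. mi_order \<alpha> \<le> m}"
 by (rule bij_betw_byWitness[where f' = mi_list])
  (auto simp: SL_def mi_order_eq mi_list_mi_of sorted_mi_list)

lemma infsum_multi_index:
 fixes F :: "multi_index \<Rightarrow> ennreal"
 shows "infsum F {\<alpha>. mi_order \<alpha> \<le> m} = ssum m (\<lambda>s. F (mi_of s))"
proof -
 have "countable {\<alpha>. mi_order \<alpha> \<le> m}"
  using countable_image[OF countable_SL, of mi_of m] unfolding bij_betw_imp_surj_on[OF bij_mi_of] .
 then have "infsum F {\<alpha>. mi_order \<alpha> \<le> m} = (\<integral>\<^sup>+\<alpha>. F \<alpha> \<partial>count_space {\<alpha>. mi_order \<alpha> \<le> m})"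
  by (rule infsum_eq_count_space)
 then show ?thesis by (simp only: nn_integral_bij_count_space[OF bij_mi_of, symmetric])
qed

lemma mi_power_mi_of: "s \<in> SL m ==> mi_power a (mi_of s) = av a s"
 by (simp add: mi_power_eq av_def SL_def mi_list_mi_of)

context exhaustion
begin

lemma Lp_onI:
 assumes [measurable]: "bmeas f"
  and f: "(\<integral>\<^sup>+x\<in>\<Omega>. ennreal (\<bar>f x\<bar> powr p) \<partial>G) < \<infinity>"
 shows "f \<in> Lp_on p a \<Omega>"
proof -
 note [measurable] = borel_open[OF open_\<Omega>]
 have "integrable G (\<lambda>x. indicator \<Omega> x *\<^sub>R (\<bar>f x\<bar> powr p))"
 proof (rule integrableI_bounded)
  have "(\<integral>\<^sup>+x. ennreal (norm (indicator \<Omega> x *\<^sub>R (\<bar>f x\<bar> powr p))) \<partial>G) = (\<integral>\<^sup>+x\<in>\<Omega>. ennreal (\<bar>f x\<bar> powr p) \<partial>G)"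
   by (intro nn_integral_cong) (auto split: split_indicator)
  then show "(\<integral>\<^sup>+x. ennreal (norm (indicator \<Omega> x *\<^sub>R (\<bar>f x\<bar> powr p))) \<partial>G) < \<infinity>" using f by simp
 qed simp
 then show ?thesis by (simp add: Lp_on_def set_borel_measurable_def set_integrable_def)
qed

lemma ext_eq: "ext f = (\<lambda>x. indicator \<Omega> x *\<^sub>R f x)"
 by (auto simp: ext_def fun_eq_iff)

lemma Lp_onD:
 assumes "f \<in> Lp_on p a \<Omega>" "p \<ge> 1"
 shows "bmeas (ext f)" "Lm p (ext f) < \<infinity>"
proof -
 have "ext f \<in> borel_measurable G"
  using assms unfolding ext_eq Lp_on_def set_borel_measurable_def by blast
 then show "bmeas (ext f)" by (simp only: measurable_cong_sets[OF sets_G refl])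
 have "integrable G (\<lambda>x. indicator \<Omega> x *\<^sub>R (\<bar>f x\<bar> powr p))"
  using assms by (simp add: Lp_on_def set_integrable_def)
 then have "(\<integral>\<^sup>+x. ennreal (norm (indicator \<Omega> x *\<^sub>R (\<bar>f x\<bar> powr p))) \<partial>G) < \<infinity>"
  by (simp add: integrable_iff_bounded)
 also have "(\<lambda>x. ennreal (norm (indicator \<Omega> x *\<^sub>R (\<bar>f x\<bar> powr p)))) = (\<lambda>x. ennreal (\<bar>ext f x\<bar> powr p))"
  using assms(2) by (auto simp: ext_def fun_eq_iff)
 finally show "Lm p (ext f) < \<infinity>" .
qed

text \<open>\<open>weak_D\<close> is an arbitrary choice; by \<open>WD_unique\<close> any other weak
  derivative agrees with it almost everywhere, so that explicit derivatives may be used in the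
  norm.\<close>

lemma weak_D_AE:
 assumes w: "has_weak_D p a \<Omega> (mi_of s) f g" and s: "sorted s" and p: "p \<ge> 1"
 shows "AE x in G. x \<in> \<Omega> \<longrightarrow> weak_D p a \<Omega> (mi_of s) f x = g x"
proof -
 let ?h = "weak_D p a \<Omega> (mi_of s) f"
 have h: "has_weak_D p a \<Omega> (mi_of s) f ?h" unfolding weak_D_def using w by (rule someI[of "has_weak_D p a \<Omega> (mi_of s) f"])
 have L: "g \<in> Lp_on p a \<Omega>" "?h \<in> Lp_on p a \<Omega>" and W: "WD f s g" "WD f s ?h"
  using w h has_weak_D_iff[OF s] by auto
 have i: "integrable G (ext g)" "integrable G (ext ?h)"
  by (rule Lp_integrable(1)[OF Lp_onD(1)[OF L(1) p] p Lp_onD(2)[OF L(1) p]],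
    rule Lp_integrable(1)[OF Lp_onD(1)[OF L(2) p] p Lp_onD(2)[OF L(2) p]])
 have "AE x in G. ext ?h x - ext g x = 0"
 proof (rule WD_unique)
  show "bmeas (\<lambda>x. ext ?h x - ext g x)"
   using Lp_onD(1)[OF L(1) p] Lp_onD(1)[OF L(2) p] by measurable
  show "integrable G (\<lambda>x. ext ?h x - ext g x)" using i by simp
  show "ext ?h x - ext g x = 0" if "x \<notin> \<Omega>" for x using that by (simp add: ext_def)
  fix \<phi> assume p: "\<phi> \<in> test_fun \<Omega>"
  have b: "btest (ext \<phi>)" by (rule btest_ext[OF test_fun_C0[OF p]])
  have 1: "ext u x * ext \<phi> x = u x * ext \<phi> x" for u x by (simp add: ext_def)
  have 2: "(\<integral>x. ?h x * ext \<phi> x \<partial>G) = (\<integral>x. g x * ext \<phi> x \<partial>G)"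
   using W p by (simp add: WD_def)
  have "(\<integral>x. ext ?h x * ext \<phi> x \<partial>G) = (\<integral>x. ext g x * ext \<phi> x \<partial>G)" by (simp only: 1 2)
  then show "(\<integral>x. (ext ?h x - ext g x) * ext \<phi> x \<partial>G) = 0"
   unfolding left_diff_distrib by (subst bint_diff) (auto intro: integrable_mult_btest i b)
 qed
 then show ?thesis by eventually_elim (auto simp: ext_def)
qed

lemma sobolev_sum_eq:
 assumes w: "\<And>s. s \<in> SL m ==> has_weak_D p a \<Omega> (mi_of s) f (w s)" and p: "p \<ge> 1"
 shows "sobolev_sum m p a \<Omega> f = (\<integral>\<^sup>+s. (\<integral>\<^sup>+x\<in>\<Omega>. ennreal (\<bar>av a s * w s x\<bar> powr p) \<partial>G) \<partial>count_space (SL m))"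
 unfolding sobolev_sum_def infsum_multi_index
proof (rule nn_integral_cong)
 fix s assume "s \<in> space (count_space (SL m))"
 then have s: "s \<in> SL m" "sorted s" by (auto simp: SL_def)
 show "(\<integral>\<^sup>+x\<in>\<Omega>. ennreal (\<bar>mi_power a (mi_of s) * weak_D p a \<Omega> (mi_of s) f x\<bar> powr p) \<partial>G) = (\<integral>\<^sup>+x\<in>\<Omega>. ennreal (\<bar>av a s * w s x\<bar> powr p) \<partial>G)"
 proof (rule nn_integral_cong_AE)
  show "AE x in G. ennreal (\<bar>mi_power a (mi_of s) * weak_D p a \<Omega> (mi_of s) f x\<bar> powr p) * indicator \<Omega> x = ennreal (\<bar>av a s * w s x\<bar> powr p) * indicator \<Omega> x"
   using weak_D_AE[OF w[OF s(1)] s(2) p]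
   by eventually_elim (auto simp: mi_power_mi_of[OF s(1)] split: split_indicator)
 qed
qed

lemma MD_ext:
 assumes "p \<ge> 1"
 shows "MD m p a (\<lambda>s. ext (w s) x) = MD m p a (\<lambda>s. w s x) * indicator \<Omega> x"
 using assms by (cases "x \<in> \<Omega>") (auto simp: ext_def MD_def)

lemma ext_measurable: "w \<in> borel_measurable borel ==> ext w \<in> borel_measurable borel"
 unfolding ext_eq using borel_open[OF open_\<Omega>] by measurable

lemma nn_integral_MD_ext:
 assumes p: "p \<ge> 1" and m: "\<And>s. s \<in> SL m ==> ext (w s) \<in> borel_measurable borel"
 shows "(\<integral>\<^sup>+x\<in>\<Omega>. MD m p a (\<lambda>s. w s x) \<partial>G) = (\<integral>\<^sup>+s. (\<integral>\<^sup>+x\<in>\<Omega>. ennreal (\<bar>av a s * w s x\<bar> powr p) \<partial>G) \<partial>count_space (SL m))"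
proof -
 have "(\<integral>\<^sup>+x\<in>\<Omega>. MD m p a (\<lambda>s. w s x) \<partial>G) = IM m p (\<lambda>x s. ext (w s) x)" by (simp only: MD_ext[OF p])
 also have "\<dots> = ssum m (\<lambda>s. Lm p (\<lambda>x. av a s * ext (w s) x))"
  by (rule nn_integral_MD) (use m in simp)
 also have "\<dots> = (\<integral>\<^sup>+s. (\<integral>\<^sup>+x\<in>\<Omega>. ennreal (\<bar>av a s * w s x\<bar> powr p) \<partial>G) \<partial>count_space (SL m))"
  using p by (intro nn_integral_cong) (auto simp: ext_def split: split_indicator)
 finally show ?thesis .
qed

lemma sobolevI:
 assumes p: "p \<ge> 1" and w: "\<And>s. s \<in> SL m ==> w s \<in> borel_measurable borel" and f: "f \<in> Lp_on p a \<Omega>"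
  and W: "\<And>s. s \<in> SL m ==> WD f s (w s)"
  and fin: "(\<integral>\<^sup>+x\<in>\<Omega>. MD m p a (\<lambda>s. w s x) \<partial>G) < \<infinity>"
 shows "f \<in> sobolev m p a \<Omega>" "sobolev_sum m p a \<Omega> f = (\<integral>\<^sup>+x\<in>\<Omega>. MD m p a (\<lambda>s. w s x) \<partial>G)"
proof -
 have fin': "IM m p (\<lambda>x s. ext (w s) x) < \<infinity>" using fin by (simp only: MD_ext[OF p])
 have D: "has_weak_D p a \<Omega> (mi_of s) f (w s)" if s: "s \<in> SL m" for s
 proof -
  have "Lm p (\<lambda>x. ext (w s) x) < \<infinity>"
   by (rule MD_component[OF s fin']) (rule ext_measurable[OF w[OF s]])
  also have "(\<lambda>x. ennreal (\<bar>ext (w s) x\<bar> powr p)) = (\<lambda>x. ennreal (\<bar>w s x\<bar> powr p) * indicator \<Omega> x)"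
   using p by (auto simp: ext_def fun_eq_iff)
  finally have "w s \<in> Lp_on p a \<Omega>" by (rule Lp_onI[OF w[OF s]])
  then show ?thesis using f W[OF s] s by (simp add: has_weak_D_iff SL_def)
 qed
 show eq: "sobolev_sum m p a \<Omega> f = (\<integral>\<^sup>+x\<in>\<Omega>. MD m p a (\<lambda>s. w s x) \<partial>G)"
  by (rule trans[OF sobolev_sum_eq[where w = w, OF D p] nn_integral_MD_ext[symmetric, OF p ext_measurable[OF w]]])
 have "\<exists>g. has_weak_D p a \<Omega> \<alpha> f g" if "mi_order \<alpha> \<le> m" for \<alpha>
  using D[of "mi_list \<alpha>"] that sorted_mi_list[of \<alpha>] by (auto simp: SL_def mi_order_eq)
 then show "f \<in> sobolev m p a \<Omega>" using f fin eq by (simp add: sobolev_def)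
qed

lemma sobolev_funE:
 assumes p: "p \<ge> 1" and f: "f \<in> sobolev m p a \<Omega>"
 obtains v where "sobolev_fun a \<Omega> K m p v" "v [] = ext f"
proof -
 let ?g = "\<lambda>s. weak_D p a \<Omega> (mi_of s) f"
 have D: "has_weak_D p a \<Omega> (mi_of s) f (?g s)" if s: "s \<in> SL m" for s
 proof -
  have "mi_order (mi_of s) \<le> m" using s by (simp add: mi_order_eq SL_def mi_list_mi_of)
  then obtain g where "has_weak_D p a \<Omega> (mi_of s) f g" using f by (auto simp: sobolev_def)
  then show ?thesis unfolding weak_D_def by (rule someI[of "has_weak_D p a \<Omega> (mi_of s) f"])
 qed
 have L: "f \<in> Lp_on p a \<Omega>" using f by (simp add: sobolev_def)
 have Lg: "?g s \<in> Lp_on p a \<Omega>" "WD f s (?g s)" if "s \<in> SL m" for s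
  using D[OF that] that by (auto simp: has_weak_D_iff SL_def)
 have gm: "bmeas (ext (?g s))" if "s \<in> SL m" for s by (rule Lp_onD(1)[OF Lg(1)[OF that] p])
 \<comment> \<open>The entry of order zero is the function itself: \<open>weak_D\<close> of order
   zero determines it only up to a null set. This is why its p-th power is added separately in the
   bound below.\<close>
 define v where "v s = (if s = [] then ext f else if s \<in> SL m then ext (?g s) else (\<lambda>_. 0))" for s
 have fin: "IM m p (\<lambda>x s. ext (?g s) x) < \<infinity>"
 proof -
  have "IM m p (\<lambda>x s. ext (?g s) x) = sobolev_sum m p a \<Omega> f"
   unfolding MD_ext[OF p]
   by (rule trans[OF nn_integral_MD_ext[where w = ?g, OF p gm] sobolev_sum_eq[where w = ?g, OF D p, symmetric]])
  then show ?thesis using f by (simp add: sobolev_def)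
 qed
 have "sobolev_fun a \<Omega> K m p v"
 proof unfold_locales
  show "p \<ge> 1" by (rule p)
  show "bmeas (v s)" for s
   using gm Lp_onD(1)[OF L p] by (simp add: v_def)
  show "v s = (\<lambda>_. 0)" if "s \<notin> SL m" for s
   using that by (auto simp: v_def SL_def)
  show "v s x = 0" if "x \<notin> \<Omega>" for s x using that by (simp add: v_def ext_def)
  show "WD (v []) s (v s)" if s: "s \<in> SL m" for s
  proof (cases "s = []")
   case True
   then show ?thesis by (simp add: WD_def)
  next
   case False
   have "WD (v []) s (v s) \<longleftrightarrow> WD f s (?g s)"
    using s False by (intro WD_cong) (auto simp: v_def ext_def)
   then show ?thesis using Lg(2)[OF s] by simp
  qed
  have "MD m p a (\<lambda>s. v s x) \<le> ennreal (\<bar>ext f x\<bar> powr p) + MD m p a (\<lambda>s. ext (?g s) x)" for x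
  proof -
   have "MD m p a (\<lambda>s. v s x) \<le> ssum m (\<lambda>s. ennreal (\<bar>ext f x\<bar> powr p) * indicator {[]} s + ennreal (\<bar>av a s * ext (?g s) x\<bar> powr p))"
    unfolding MD_def by (rule nn_integral_mono) (auto simp: v_def)
   also have "\<dots> = ennreal (\<bar>ext f x\<bar> powr p) + MD m p a (\<lambda>s. ext (?g s) x)"
    by (subst nn_integral_add) (auto simp: MD_def nn_integral_cmult_indicator SL_def)
   finally show ?thesis .
  qed
  then have "IM m p (\<lambda>x s. v s x) \<le> (\<integral>\<^sup>+x. ennreal (\<bar>ext f x\<bar> powr p) + MD m p a (\<lambda>s. ext (?g s) x) \<partial>G)"
   by (intro nn_integral_mono)
  also have "\<dots> = Lm p (ext f) + IM m p (\<lambda>x s. ext (?g s) x)"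
   using Lp_onD(1)[OF L p] gm by (intro nn_integral_add MD_measurable) simp_all
  also have "\<dots> < \<infinity>" using Lp_onD(2)[OF L p] fin by simp
  finally show "IM m p (\<lambda>x s. v s x) < \<infinity>" .
 qed
 then show ?thesis by (rule that) (simp add: v_def)
qed

section \<open>Smoothness of locally finite sums\<close>

context
 fixes g :: "ell2 \<Rightarrow> real" and \<Gamma> :: "nat \<Rightarrow> ell2 \<Rightarrow> real"
 assumes \<Gamma>: "\<And>k. bsmooth (\<Gamma> k)" and g: "\<And>k x. x \<in> V k ==> g x = \<Gamma> k x"
begin

lemma dds_local: "x \<in> V k ==> dds vs g x = dds vs (\<Gamma> k) x"
 by (rule dds_cong_local[OF open_V _ g])

text \<open>Each \<open>V k\<close> is open and \<open>g\<close> agrees there with a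
  \<open>bsmooth\<close> function, so all derivatives can be computed with that
  representative.\<close>

lemma locally_bsmooth_frechet: "g \<in> frechet_smooth \<Omega>"
 unfolding frechet_smooth_def mem_Collect_eq
proof (intro exI[of _ "\<lambda>k x vs. dds vs g x"] conjI ballI allI impI)
 fix k x assume "x \<in> \<Omega>"
 then obtain n where n: "x \<in> V n" using V_exhausts by blast
 show "bounded_multilinear k (\<lambda>vs. dds vs g x)"
  using bsmooth_bounded_multilinear[OF \<Gamma>, of k n x] by (simp only: dds_local[OF n])
 fix \<epsilon> :: real assume e: "\<epsilon> > 0"
 have "((\<lambda>h. x + h) \<longlongrightarrow> x + 0) (at 0)" by (intro tendsto_intros)
 then have "\<forall>\<^sub>F h in at 0. x + h \<in> V n" by (rule topological_tendstoD[OF _ open_V]) (use n in simp)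
 with bsmooth_frechet[OF \<Gamma> e, of k n x]
 show "\<forall>\<^sub>F h in at 0. \<forall>vs. length vs = k \<longrightarrow>
   \<bar>dds vs g (x + h) - dds vs g x - dds (h # vs) g x\<bar> \<le> \<epsilon> * norm h * pn vs"
 proof eventually_elim
  case (elim h)
  then show ?case by (simp only: dds_local[OF n] dds_local[OF elim(2)] simp_thms)
 qed
qed simp

lemma pds_local: "x \<in> V k ==> pds is g x = pds is (\<Gamma> k) x"
 by (rule pds_cong_local[OF open_V _ g])

lemma pds_g_continuous: "W \<subseteq> \<Omega> ==> continuous_on W (pds is g)"
proof -
 assume W: "W \<subseteq> \<Omega>"
 have "continuous_on (\<Union>n\<in>UNIV. V n) (pds is g)"
 proof (rule continuous_on_open_UN)
  fix n
  show "continuous_on (V n) (pds is g)"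
   by (subst continuous_on_cong[OF refl pds_local])
    (auto intro: tame_continuous tame_pds bsmooth_tame \<Gamma>)
 qed (rule open_V)
 moreover have "W \<subseteq> (\<Union>n\<in>UNIV. V n)" using W V_exhausts by blast
 ultimately show ?thesis by (rule continuous_on_subset)
qed

lemma locally_bsmooth_CF:
 assumes W: "W \<subseteq> \<Omega>" "open W"
 shows "g \<in> CF k W"
 unfolding CF_def mem_Collect_eq
proof (intro conjI allI impI)
 show "pds_exist k W g"
  unfolding pds_exist_def
 proof (intro allI impI ballI)
  fix "is" :: "nat list" and i x assume "x \<in> W"
  then obtain n where n: "x \<in> V n" using W V_exhausts by blast
  have "has_pd i (pds is g) x = has_pd i (pds is (\<Gamma> n)) x"
   unfolding has_pd_eq by (rule dd_cong_local(2)[OF open_V n pds_local])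
  then show "has_pd i (pds is g) x" using tame_has_pd[OF tame_pds[OF bsmooth_tame[OF \<Gamma>]]] by simp
 qed
 fix "is" :: "nat list"
 show "F_continuous W (pds is g)"
  unfolding F_continuous_def
 proof (intro ballI allI)
  fix x n
  let ?S = "{s :: nat \<Rightarrow> real. (\<forall>j\<ge>n. s j = 0) \<and> x + (\<Sum>j<n. s j *\<^sub>R unit_vec j) \<in> W}"
  have "continuous_on ?S (\<lambda>s. x + (\<Sum>j<n. s j *\<^sub>R unit_vec j))"
   by (intro continuous_intros continuous_on_product_coordinates continuous_on_subset[OF continuous_on_product_coordinates]) auto
  then show "continuous_on ?S (\<lambda>s. pds is g (x + (\<Sum>j<n. s j *\<^sub>R unit_vec j)))"
   by (rule continuous_on_compose2[OF pds_g_continuous[OF W(1)]]) auto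
 qed
 show "set_borel_measurable borel W (pds is g)"
  unfolding set_borel_measurable_def
  by (rule borel_measurable_continuous_on_indicator[OF borel_open[OF W(2)] pds_g_continuous[OF W(1)]])
qed

text \<open>A uniformly included set lies in one \<open>V n\<close>, on which a single constant
  bounds all derivatives up to order \<open>k\<close> along unit vectors. Only the finiteness of the
  total weight is then needed, and \<open>MD_le\<close> handles every exponent
  \<open>q\<close>.\<close>

lemma locally_bsmooth_CF_kq:
 assumes q: "q \<ge> 1" and W: "open W" "unif_incl W \<Omega>"
 shows "g \<in> CF_kq a k q W"
proof -
 obtain n where n: "W \<subseteq> V n" using unif_incl_V[OF W(2)] by blast
 obtain C where C: "C \<ge> 0" "\<And>x vs. norm x < real (n + K) ==> length vs \<le> k ==> \<bar>dds vs (\<Gamma> n) x\<bar> \<le> C * pn vs"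
  using \<Gamma>[of n] unfolding bsmooth_def by blast
 let ?B = "C * av_total a k"
 have B: "?B \<ge> 0" using C av_total(1)[OF a_pos a_summable, of k] by simp
 have "(\<Sum>\<^sub>\<infinity>\<alpha>\<in>{\<alpha>. mi_order \<alpha> \<le> k}. ennreal (\<bar>mi_power a \<alpha> * Dmi \<alpha> g x\<bar> powr q)) \<le> ennreal (?B powr (q - 1)) * ennreal ?B"
  if x: "x \<in> W" for x
 proof -
  have xn: "x \<in> V n" using x n by blast
  let ?u = "\<lambda>s. pds s (\<Gamma> n) x"
  have "(\<Sum>\<^sub>\<infinity>\<alpha>\<in>{\<alpha>. mi_order \<alpha> \<le> k}. ennreal (\<bar>mi_power a \<alpha> * Dmi \<alpha> g x\<bar> powr q)) = MD k q a ?u"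
   unfolding infsum_multi_index MD_def
   by (intro nn_integral_cong) (auto simp: mi_power_mi_of Dmi_eq_pds pds_local[OF xn] mi_list_mi_of SL_def)
  moreover have I: "(\<integral>\<^sup>+s. ennreal (av a s * \<bar>?u s\<bar>) \<partial>count_space (SL k)) \<le> ennreal ?B"
  proof -
   have "(\<integral>\<^sup>+s. ennreal (av a s * \<bar>?u s\<bar>) \<partial>count_space (SL k)) \<le> (\<integral>\<^sup>+s. ennreal C * ennreal (av a s) \<partial>count_space (SL k))"
   proof (rule nn_integral_mono)
    fix s assume "s \<in> space (count_space (SL k))"
    then have "\<bar>?u s\<bar> \<le> C"
     using C(2)[of x "map unit_vec s"] V_bounded[OF xn] by (simp add: pds_eq_dds SL_def prod_list_norm_unit del: map_map)
    then have "av a s * \<bar>?u s\<bar> \<le> C * av a s"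
     using av_pos[of a s, OF a_pos] by (simp add: mult.commute mult_left_mono)
    then show "ennreal (av a s * \<bar>?u s\<bar>) \<le> ennreal C * ennreal (av a s)"
     using C(1) av_pos[of a s, OF a_pos] by (simp add: ennreal_mult[symmetric] ennreal_leI)
   qed
   also have "\<dots> = ennreal C * (\<integral>\<^sup>+s. ennreal (av a s) \<partial>count_space (SL k))" by (rule nn_integral_cmult) simp
   also have "\<dots> \<le> ennreal C * ennreal (av_total a k)" by (intro mult_left_mono av_total a_pos a_summable) simp
   also have "\<dots> = ennreal ?B" using C(1) av_total(1)[OF a_pos a_summable, of k] by (simp add: ennreal_mult)
   finally show ?thesis .
  qed
  moreover have "MD k q a ?u \<le> ennreal (?B powr (q - 1)) * ennreal ?B"
   by (rule order_trans[OF MD_le[OF a_pos q I B]]) (intro mult_left_mono I, simp)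
  ultimately show ?thesis by simp
 qed
 then have "(SUP x\<in>W. \<Sum>\<^sub>\<infinity>\<alpha>\<in>{\<alpha>. mi_order \<alpha> \<le> k}. ennreal (\<bar>mi_power a \<alpha> * Dmi \<alpha> g x\<bar> powr q)) \<le> ennreal (?B powr (q - 1)) * ennreal ?B"
  by (intro SUP_least)
 also have "\<dots> < \<infinity>" by (simp add: ennreal_mult_less_top)
 finally show ?thesis
  using locally_bsmooth_CF[OF _ W(1), of k] n V_subset by (auto simp: CF_kq_def)
qed

lemma locally_bsmooth_CF_infty_loc: "g \<in> CF_infty_loc a \<Omega>"
 using locally_bsmooth_CF[OF order_refl open_\<Omega>] locally_bsmooth_CF_kq
 by (auto simp: CF_infty_loc_def CF_kq_loc_def)

end

end

section \<open>Gluing\<close>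

context sobolev_fun
begin

text \<open>\<open>w\<close> is the jet of the error \<open>v [] - g\<close>. It is returned instead
  of the jet of \<open>g\<close> because the smallness concerns \<open>w\<close>, and the weak
  derivatives of \<open>g\<close> are recovered as \<open>v - w\<close>.\<close>

lemma glued_approximation:
 assumes \<epsilon>: "\<epsilon> > 0"
 obtains g w where "g \<in> frechet_smooth \<Omega>" "g \<in> CF_infty_loc a \<Omega>" "bmeas g"
  "\<And>s. bmeas (w s)" "\<And>x. x \<in> \<Omega> ==> w [] x = v [] x - g x"
  "\<And>s. s \<in> SL m ==> WD (\<lambda>x. v [] x - g x) s (w s)"
  "\<And>s. s \<in> SL m ==> WD g s (\<lambda>x. v s x - w s x)"
  "(\<integral>\<^sup>+x\<in>\<Omega>. MD m p a (\<lambda>s. w s x) \<partial>G) \<le> ennreal \<epsilon>"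
proof -
 obtain \<tau> \<psi> :: "nat \<Rightarrow> ell2 \<Rightarrow> real" and C :: "nat \<Rightarrow> real" where
  \<tau>: "\<And>j. tame (\<tau> j)" and \<psi>: "\<And>j. tame (\<psi> j)" and C: "\<And>j. C j \<ge> 0"
  and S\<tau>: "\<And>j k x. k \<le> m ==> Sq a k (\<tau> j) x \<le> ennreal (C j)"
  and S\<psi>: "\<And>j k x. k \<le> m ==> Sq a k (\<psi> j) x \<le> ennreal (C j)"
  and \<tau>1: "\<And>j x. \<tau> j x \<noteq> 0 ==> x \<in> V (Suc j) \<and> \<psi> j x = 1"
  and \<tau>0: "\<And>j k x. x \<in> V k ==> k < j ==> \<tau> j x = 0"
  and \<tau>_sum: "\<And>J x. x \<in> V J ==> (\<Sum>j\<le>J. \<tau> j x) = 1"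
  and \<psi>V: "\<And>j x. \<psi> j x \<noteq> 0 ==> x \<in> V (j + 2)"
  and \<psi>0: "\<And>j k x. x \<in> V k ==> k + 2 \<le> j ==> \<psi> j x = 0"
  by (rule partition[where m = m]) (rule that, assumption+)
 \<comment> \<open>These are the weights of \<open>MD_sum_le\<close>; dividing by them makes the
   weighted errors a geometric series with sum \<open>\<epsilon>\<close>.\<close>
 define c where "c j = (2 ^ Suc j) powr p" for j :: nat
 have c: "c j > 0" for j by (simp add: c_def)
 define \<epsilon>' where "\<epsilon>' j = \<epsilon> * (1 / 2) ^ Suc j / c j" for j
 have e': "\<epsilon>' j > 0" for j using \<epsilon> c by (simp add: \<epsilon>'_def)
 have loc: "localised a \<Omega> K m p v (\<tau> j) (\<psi> j) (C j) (j + 2)" for j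
  by unfold_locales (use \<tau> \<psi> C S\<tau> S\<psi> \<tau>1 \<psi>V in auto)
 define h where "h j = localised.h v (\<tau> j)" for j
 have h: "h j s x = lz (Dl (\<tau> j) x) (\<lambda>t. v t x) s" for j s x
  unfolding h_def by (rule localised.h_def[OF loc[of j]])
 have h0_eq: "localised.h0 v (\<tau> j) = (\<lambda>x. \<tau> j x * v [] x)" for j
  using localised.h0_def[OF loc[of j]] by (simp add: fun_eq_iff)
 have hm: "bmeas (h j s)" and hi: "integrable G (h j s)" for j s
  unfolding h_def by (rule localised.h_measurable[OF loc[of j]], rule localised.h_integrable[OF loc[of j]])
 have hW: "s \<in> SL m ==> WD (\<lambda>x. \<tau> j x * v [] x) s (h j s)" for j s
  unfolding h_def h0_eq[symmetric] by (rule localised.h_WD[OF loc[of j]])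
 have h0i: "integrable G (\<lambda>x. \<tau> j x * v [] x)" for j
  unfolding h0_eq[symmetric] by (rule localised.h0_integrable[OF loc[of j]])
 have "\<exists>g. bsmooth g \<and> (\<forall>x. g x \<noteq> 0 \<longrightarrow> (\<exists>y. norm (x - y) < \<eta> (j + 2) \<and> \<psi> j y \<noteq> 0)) \<and>
   (IM m p (\<lambda>x s. h j s x - Dl g x s)) \<le> ennreal (\<epsilon>' j)" for j
 proof -
  obtain g where "bsmooth g" "\<And>x. g x \<noteq> 0 ==> \<exists>y. norm (x - y) < \<eta> (j + 2) \<and> \<psi> j y \<noteq> 0"
   "IM m p (\<lambda>x s. h j s x - Dl g x s) \<le> ennreal (\<epsilon>' j)"
   by (rule localised.local_approximation[OF loc[of j] \<eta>(1)[of "j + 2"] e'[of j], folded h_def]) (rule that, assumption+)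
  then show ?thesis by (intro exI[of _ g] conjI allI impI)
 qed
 then obtain g where "\<forall>j. bsmooth (g j) \<and> (\<forall>x. g j x \<noteq> 0 \<longrightarrow> (\<exists>y. norm (x - y) < \<eta> (j + 2) \<and> \<psi> j y \<noteq> 0)) \<and>
   (IM m p (\<lambda>x s. h j s x - Dl (g j) x s)) \<le> ennreal (\<epsilon>' j)"
  using choice[of "\<lambda>j g. bsmooth g \<and> (\<forall>x. g x \<noteq> 0 \<longrightarrow> (\<exists>y. norm (x - y) < \<eta> (j + 2) \<and> \<psi> j y \<noteq> 0)) \<and>
   (IM m p (\<lambda>x s. h j s x - Dl g x s)) \<le> ennreal (\<epsilon>' j)"] by blast
 then have g: "\<And>j. bsmooth (g j)" "\<And>j x. g j x \<noteq> 0 ==> \<exists>y. norm (x - y) < \<eta> (j + 2) \<and> \<psi> j y \<noteq> 0"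
  and gMD: "\<And>j. IM m p (\<lambda>x s. h j s x - Dl (g j) x s) \<le> ennreal (\<epsilon>' j)" by blast+
 have gt: "tame (g j)" for j by (rule bsmooth_tame[OF g(1)])
 have gV: "x \<in> V (j + 3)" if "g j x \<noteq> 0" for j x
 proof -
  obtain y where y: "norm (x - y) < \<eta> (j + 2)" "\<psi> j y \<noteq> 0" using g(2)[OF \<open>g j x \<noteq> 0\<close>] by blast
  show ?thesis using V_near[OF \<psi>V[OF y(2)] y(1)] by (simp add: numeral_eq_Suc)
 qed
 have g0: "g j x = 0" if x: "x \<in> V k" and k: "k + 3 \<le> j" for j k x
 proof (rule ccontr)
  assume "g j x \<noteq> 0"
  then obtain y where y: "norm (x - y) < \<eta> (j + 2)" "\<psi> j y \<noteq> 0" using g(2) by blast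
  \<comment> \<open>The gaps decrease, so \<open>y\<close> is within \<open>\<eta> k\<close> of a
    point of \<open>V k\<close> and lies in \<open>V (k + 1)\<close>, where \<open>\<psi> j\<close>
    vanishes as soon as \<open>k + 3 \<le> j\<close>.\<close>
  have "norm (y - x) < \<eta> k" using y(1) \<eta>_antimono[of k "j + 2"] k by (simp add: norm_minus_commute)
  then have "y \<in> V (Suc k)" by (rule V_near[OF x])
  then show False using \<psi>0[of y "Suc k" j] y(2) k by simp
 qed
 have gb: "btest (g j)" for j by (rule tame_supp_btest[OF gt gV])
 define e where "e j s x = h j s x - Dl (g j) x s" for j s x
 have em [measurable]: "bmeas (e j s)" for j s
  unfolding e_def[abs_def] by (intro borel_measurable_diff hm tame_measurable tame_pds gt)
 have ei: "integrable G (e j s)" for j s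
  unfolding e_def[abs_def] by (intro Bochner_Integration.integrable_diff hi btest_integrable btest_pds gb)
 have diffi: "integrable G (\<lambda>x. \<tau> j x * v [] x - g j x)" for j
  by (intro Bochner_Integration.integrable_diff h0i btest_integrable gb)
 have eW: "(\<integral>x. (\<tau> j x * v [] x - g j x) * foldr (delta a) s (ext \<phi>) x \<partial>G) = (- 1) ^ length s * (\<integral>x. e j s x * ext \<phi> x \<partial>G)"
  if s: "s \<in> SL m" and \<phi>: "\<phi> \<in> test_fun \<Omega>" for j s \<phi>
 proof -
  have b: "btest (ext \<phi>)" by (rule btest_ext[OF test_fun_C0[OF \<phi>]])
  have 1: "(\<integral>x. (\<tau> j x * v [] x) * foldr (delta a) s (ext \<phi>) x \<partial>G) = (- 1) ^ length s * (\<integral>x. h j s x * ext \<phi> x \<partial>G)"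
   using hW[OF s] \<phi> unfolding WD_def by blast
  have 2: "(\<integral>x. g j x * foldr (delta a) s (ext \<phi>) x \<partial>G) = (- 1) ^ length s * (\<integral>x. Dl (g j) x s * ext \<phi> x \<partial>G)"
   using WD_tame[OF gt, of j s] \<phi> unfolding WD_def by blast
  have "(\<integral>x. (\<tau> j x * v [] x - g j x) * foldr (delta a) s (ext \<phi>) x \<partial>G) =
    (\<integral>x. (\<tau> j x * v [] x) * foldr (delta a) s (ext \<phi>) x \<partial>G) - (\<integral>x. g j x * foldr (delta a) s (ext \<phi>) x \<partial>G)"
   unfolding left_diff_distrib
   by (intro bint_diff integrable_mult_btest h0i btest_integrable gb btest_deltas b)
  also have "\<dots> = (- 1) ^ length s * ((\<integral>x. h j s x * ext \<phi> x \<partial>G) - (\<integral>x. Dl (g j) x s * ext \<phi> x \<partial>G))"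
   unfolding 1 2 by (simp only: right_diff_distrib)
  also have "(\<integral>x. h j s x * ext \<phi> x \<partial>G) - (\<integral>x. Dl (g j) x s * ext \<phi> x \<partial>G) = (\<integral>x. e j s x * ext \<phi> x \<partial>G)"
   unfolding e_def left_diff_distrib
   by (intro bint_diff[symmetric] integrable_mult_btest hi btest_integrable btest_pds gb b)
  finally show ?thesis .
 qed
 have e0: "e j s x = 0" if x: "x \<in> V k" and k: "k + 3 \<le> j" for j k s x
 proof -
  have "Dl (\<tau> j) x r = 0" for r
   using pds_cong_local[OF open_V x, of "\<tau> j" "\<lambda>_. 0" "rev r"] \<tau>0[of _ k j] k by simp
  moreover have "Dl (g j) x r = 0" for r
   using pds_cong_local[OF open_V x, of "g j" "\<lambda>_. 0" "rev r"] g0[OF _ k] by simp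
  ultimately show ?thesis by (simp add: e_def h lz_zero_left)
 qed
 define gg where "gg x = suminf (\<lambda>j. g j x)" for x
 define w where "w s x = suminf (\<lambda>j. e j s x)" for s x
 have gg: "gg x = (\<Sum>j<k + 3. g j x)" if "x \<in> V k" for x k
  unfolding gg_def using g0[OF that] by (intro suminf_finite) auto
 have w: "w s x = (\<Sum>j<k + 3. e j s x)" if "x \<in> V k" for s x k
  unfolding w_def using e0[OF that] by (intro suminf_finite) auto
 have ggm: "bmeas gg"
  unfolding gg_def[abs_def] by (intro borel_measurable_suminf tame_measurable gt)
 have wm: "bmeas (w s)" for s
  unfolding w_def[abs_def] by (intro borel_measurable_suminf em)
 \<comment> \<open>On \<open>V k\<close> the \<open>\<tau> j\<close> stop at \<open>j = k\<close>,
   but the approximants \<open>g j\<close> reach as far as \<open>j = k + 2\<close>; both sums are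
   taken over the longer range.\<close>
 have \<tau>_sum3: "(\<Sum>j<k + 3. \<tau> j x) = 1" if "x \<in> V k" for x k
 proof -
  have "(\<Sum>j<k + 3. \<tau> j x) = (\<Sum>j\<le>k. \<tau> j x)"
   using \<tau>0[OF that] by (intro sum.mono_neutral_right) auto
  then show ?thesis using \<tau>_sum[OF that] by simp
 qed
 have diff: "v [] x - gg x = (\<Sum>j<k + 3. \<tau> j x * v [] x - g j x)" if "x \<in> V k" for x k
  unfolding gg[OF that] sum_subtractf sum_distrib_right[symmetric] \<tau>_sum3[OF that] by simp
 have wnil: "w [] x = v [] x - gg x" if x: "x \<in> \<Omega>" for x
 proof -
  obtain k where k: "x \<in> V k" using V_exhausts[OF x] by blast
  show ?thesis unfolding w[OF k] diff[OF k] by (simp add: e_def h lz_def pds_def)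
 qed
 have wW: "(\<integral>x. (v [] x - gg x) * foldr (delta a) s (ext \<phi>) x \<partial>G) = (- 1) ^ length s * (\<integral>x. w s x * ext \<phi> x \<partial>G)
   \<and> integrable G (\<lambda>x. (v [] x - gg x) * foldr (delta a) s (ext \<phi>) x) \<and> integrable G (\<lambda>x. w s x * ext \<phi> x)"
  if s: "s \<in> SL m" and \<phi>: "\<phi> \<in> test_fun \<Omega>" for s \<phi>
 proof -
  let ?d = "foldr (delta a) s (ext \<phi>)"
  have b: "btest (ext \<phi>)" by (rule btest_ext[OF test_fun_C0[OF \<phi>]])
  obtain S n where S: "closed S" "S \<subseteq> V n" "\<And>x. x \<notin> S ==> ext \<phi> x = 0"
   by (rule test_fun_support[OF test_fun_C0[OF \<phi>]]) (rule that, assumption+)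
  have d0: "?d x = 0" if "x \<notin> S" for x
  proof -
   have z: "foldr (delta a) s (\<lambda>_. 0) = (\<lambda>_. 0)"
    by (induction s) (auto simp: delta_def[abs_def] pd_eq_dd)
   have "?d x = foldr (delta a) s (\<lambda>_. 0) x"
    using that S by (intro deltas_cong_local[of "- S"]) (auto simp: open_Compl)
   then show ?thesis by (simp add: z)
  qed
  \<comment> \<open>Integrability of \<open>gg\<close> over the whole space is not established here.
    Since the test function lives in one \<open>V n\<close>, only finitely many summands, each
    integrable, enter.\<close>
  have 1: "(v [] x - gg x) * ?d x = (\<Sum>j<n + 3. (\<tau> j x * v [] x - g j x) * ?d x)" for x
  proof (cases "x \<in> S")
   case True
   then have "x \<in> V n" using S by blast
   then show ?thesis by (simp only: diff sum_distrib_right)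
  qed (simp add: d0)
  have 2: "w s x * ext \<phi> x = (\<Sum>j<n + 3. e j s x * ext \<phi> x)" for x
  proof (cases "x \<in> S")
   case True
   then have "x \<in> V n" using S by blast
   then show ?thesis by (simp only: w sum_distrib_right)
  qed (simp add: S(3))
  have i1: "integrable G (\<lambda>x. (\<tau> j x * v [] x - g j x) * ?d x)" for j
   by (intro integrable_mult_btest diffi btest_deltas b)
  have i2: "integrable G (\<lambda>x. e j s x * ext \<phi> x)" for j
   by (intro integrable_mult_btest ei b)
  have "(\<integral>x. (v [] x - gg x) * ?d x \<partial>G) = (\<Sum>j<n + 3. (\<integral>x. (\<tau> j x * v [] x - g j x) * ?d x \<partial>G))"
   unfolding 1 by (intro Bochner_Integration.integral_sum i1)
  also have "\<dots> = (- 1) ^ length s * (\<Sum>j<n + 3. (\<integral>x. e j s x * ext \<phi> x \<partial>G))"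
   unfolding eW[OF s \<phi>] by (simp only: sum_distrib_left)
  also have "(\<Sum>j<n + 3. (\<integral>x. e j s x * ext \<phi> x \<partial>G)) = (\<integral>x. w s x * ext \<phi> x \<partial>G)"
   unfolding 2 by (intro Bochner_Integration.integral_sum[symmetric] i2)
  finally show ?thesis unfolding 1 2 using i1 i2 by (intro conjI Bochner_Integration.integrable_sum)
 qed
 have WD1: "WD (\<lambda>x. v [] x - gg x) s (w s)" if "s \<in> SL m" for s
  using wW[OF that] unfolding WD_def by blast
 have WD2: "WD gg s (\<lambda>x. v s x - w s x)" if s: "s \<in> SL m" for s
  unfolding WD_def
 proof
  fix \<phi> assume \<phi>: "\<phi> \<in> test_fun \<Omega>"
  let ?d = "foldr (delta a) s (ext \<phi>)"
  have b: "btest (ext \<phi>)" by (rule btest_ext[OF test_fun_C0[OF \<phi>]])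
  note W = wW[OF s \<phi>]
  have "(\<integral>x. gg x * ?d x \<partial>G) = (\<integral>x. v [] x * ?d x - (v [] x - gg x) * ?d x \<partial>G)" by (simp add: left_diff_distrib)
  also have "\<dots> = (\<integral>x. v [] x * ?d x \<partial>G) - (\<integral>x. (v [] x - gg x) * ?d x \<partial>G)"
   by (rule bint_diff[OF integrable_mult_btest[OF v_integrable btest_deltas[OF b]] W[THEN conjunct2, THEN conjunct1]])
  also have "\<dots> = (- 1) ^ length s * ((\<integral>x. v s x * ext \<phi> x \<partial>G) - (\<integral>x. w s x * ext \<phi> x \<partial>G))"
   using W v_WD[OF s] \<phi> unfolding WD_def by (simp add: right_diff_distrib)
  also have "(\<integral>x. v s x * ext \<phi> x \<partial>G) - (\<integral>x. w s x * ext \<phi> x \<partial>G) = (\<integral>x. (v s x - w s x) * ext \<phi> x \<partial>G)"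
   unfolding left_diff_distrib
   by (rule bint_diff[symmetric, OF integrable_mult_btest[OF v_integrable b] W[THEN conjunct2, THEN conjunct2]])
  finally show "(\<integral>x. gg x * ?d x \<partial>G) = (- 1) ^ length s * (\<integral>x. (v s x - w s x) * ext \<phi> x \<partial>G)" .
 qed
 have \<Gamma>: "bsmooth (\<lambda>x. \<Sum>j<k + 3. g j x)" for k by (intro bsmooth_sum g)
 have MDm: "(\<lambda>x. MD m p a (\<lambda>s. e j s x)) \<in> borel_measurable G" for j
  using MD_measurable[of m "\<lambda>x s. e j s x" borel p a] by simp
 have "(\<integral>\<^sup>+x\<in>\<Omega>. MD m p a (\<lambda>s. w s x) \<partial>G) \<le> (\<integral>\<^sup>+x. suminf (\<lambda>j. ennreal (c j) * MD m p a (\<lambda>s. e j s x)) \<partial>G)"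
 proof (rule nn_integral_mono)
  fix x
  show "MD m p a (\<lambda>s. w s x) * indicator \<Omega> x \<le> suminf (\<lambda>j. ennreal (c j) * MD m p a (\<lambda>s. e j s x))"
  proof (cases "x \<in> \<Omega>")
   case True
   then obtain k where k: "x \<in> V k" using V_exhausts by blast
   have "MD m p a (\<lambda>s. w s x) \<le> (\<Sum>j<k + 3. ennreal (c j) * MD m p a (\<lambda>s. e j s x))"
    unfolding w[OF k] c_def using p by (intro MD_sum_le) simp
   also have "\<dots> \<le> suminf (\<lambda>j. ennreal (c j) * MD m p a (\<lambda>s. e j s x))"
    by (rule sum_le_suminf) auto
   finally show ?thesis using True by simp
  qed simp
 qed
 also have "\<dots> = suminf (\<lambda>j. ennreal (c j) * IM m p (\<lambda>x s. e j s x))"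
  by (subst nn_integral_suminf) (use MDm in \<open>auto simp: nn_integral_cmult\<close>)
 also have "\<dots> \<le> suminf (\<lambda>j. ennreal (\<epsilon> * (1 / 2) ^ Suc j))"
 proof (intro suminf_le)
  fix j
  have "ennreal (c j) * IM m p (\<lambda>x s. e j s x) \<le> ennreal (c j) * ennreal (\<epsilon>' j)"
   unfolding e_def by (intro mult_left_mono gMD) simp
  also have "\<dots> = ennreal (\<epsilon> * (1 / 2) ^ Suc j)"
   using c[of j] e'[of j] by (simp add: ennreal_mult[symmetric] less_imp_le \<epsilon>'_def)
  finally show "ennreal (c j) * IM m p (\<lambda>x s. e j s x) \<le> ennreal (\<epsilon> * (1 / 2) ^ Suc j)" .
 qed auto
 also have "\<dots> = ennreal \<epsilon>"
 proof (rule suminf_ennreal_eq)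
  show "(\<lambda>j. \<epsilon> * (1 / 2) ^ Suc j) sums \<epsilon>" using sums_mult[OF power_half_series, of \<epsilon>] by simp
 qed (use \<epsilon> in auto)
 finally have le: "(\<integral>\<^sup>+x\<in>\<Omega>. MD m p a (\<lambda>s. w s x) \<partial>G) \<le> ennreal \<epsilon>" .
 show ?thesis
  by (rule that[OF locally_bsmooth_frechet[OF \<Gamma> gg] locally_bsmooth_CF_infty_loc[OF \<Gamma> gg] ggm wm wnil WD1 WD2 le])
qed

end

theorem theorem1p1:
  fixes a :: "nat \<Rightarrow> real" and \<Omega> :: "ell2 set" and m :: nat and p :: real
  assumes "\<And>i. a i > 0" and "summable a"
    and "open \<Omega>" and "\<Omega> \<noteq> {}"
    and "m \<ge> 1" and "p \<ge> 1"
  shows "\<forall>f \<in> sobolev m p a \<Omega>. \<forall>\<epsilon>>0.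
           \<exists>g \<in> frechet_smooth \<Omega> \<inter> sobolev m p a \<Omega> \<inter> CF_infty_loc a \<Omega>.
             sobolev_norm m p a \<Omega> (\<lambda>x. f x - g x) < \<epsilon>"
proof (intro ballI allI impI)
 fix f and \<epsilon> :: real assume f: "f \<in> sobolev m p a \<Omega>" and e: "\<epsilon> > 0"
 obtain x where "x \<in> \<Omega>" using assms(4) by blast
 then obtain c where c: "c > 0" "x \<in> Vset \<Omega> c" using Vset_exhausts[OF assms(3)] by blast
 \<comment> \<open>\<open>K \<ge> c\<close> makes the first set of the exhaustion non-empty, and
   \<open>K \<ge> 1\<close> keeps its radii positive and at most 1.\<close>
 obtain K where K: "real K \<ge> max c 1" using real_arch_simple by blast
 have "Vset \<Omega> c \<subseteq> Vset \<Omega> (real K)" using c K by (intro Vset_mono) auto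
 then interpret exhaustion a \<Omega> K using assms c K by unfold_locales auto
 obtain v where v: "sobolev_fun a \<Omega> K m p v" "v [] = ext f" by (rule sobolev_funE[OF assms(6) f])
 interpret sobolev_fun a \<Omega> K m p v by (rule v(1))
 \<comment> \<open>The lemma bounds the p-th power of the norm by a weak inequality; half of
   \<open>\<epsilon>\<close> leaves room for the strict one.\<close>
 define \<epsilon>' where "\<epsilon>' = (\<epsilon> / 2) powr p"
 have e': "\<epsilon>' > 0" using e by (simp add: \<epsilon>'_def)
 obtain g w where g: "g \<in> frechet_smooth \<Omega>" "g \<in> CF_infty_loc a \<Omega>" "bmeas g"
  and wm: "\<And>s. bmeas (w s)" and wnil: "\<And>x. x \<in> \<Omega> ==> w [] x = v [] x - g x"
  and W: "\<And>s. s \<in> SL m ==> WD (\<lambda>x. v [] x - g x) s (w s)"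
  "\<And>s. s \<in> SL m ==> WD g s (\<lambda>x. v s x - w s x)"
  and le: "(\<integral>\<^sup>+x\<in>\<Omega>. MD m p a (\<lambda>s. w s x) \<partial>G) \<le> ennreal \<epsilon>'"
  by (rule glued_approximation[OF e']) (rule that, assumption+)
 have nil: "[] \<in> SL m" by (simp add: SL_def)
 have vx: "v [] x = f x" if "x \<in> \<Omega>" for x using that by (simp add: v(2) ext_def)
 have wfin: "(\<integral>\<^sup>+x\<in>\<Omega>. MD m p a (\<lambda>s. w s x) \<partial>G) < \<infinity>" using le by (rule le_less_trans) simp
 have fin: "(\<integral>\<^sup>+x\<in>\<Omega>. MD m p a (\<lambda>s. v s x - w s x) \<partial>G) < \<infinity>"
 proof -
  note [measurable] = borel_open[OF assms(3)]
  have m1 [measurable]: "bmeas (\<lambda>x. MD m p a (\<lambda>s. v s x))" by (intro MD_measurable v_meas)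
  have m2 [measurable]: "bmeas (\<lambda>x. MD m p a (\<lambda>s. w s x))" by (intro MD_measurable wm)
  have "(\<integral>\<^sup>+x\<in>\<Omega>. MD m p a (\<lambda>s. v s x - w s x) \<partial>G) \<le>
    (\<integral>\<^sup>+x. ennreal (2 powr p) * (MD m p a (\<lambda>s. v s x) + MD m p a (\<lambda>s. w s x) * indicator \<Omega> x) \<partial>G)"
  proof (rule nn_integral_mono)
   fix x
   show "MD m p a (\<lambda>s. v s x - w s x) * indicator \<Omega> x \<le> ennreal (2 powr p) * (MD m p a (\<lambda>s. v s x) + MD m p a (\<lambda>s. w s x) * indicator \<Omega> x)"
    using MD_diff[of p m a "\<lambda>s. v s x" "\<lambda>s. w s x"] p by (auto split: split_indicator)
  qed
  also have "\<dots> = ennreal (2 powr p) * (IM m p (\<lambda>x s. v s x) + (\<integral>\<^sup>+x\<in>\<Omega>. MD m p a (\<lambda>s. w s x) \<partial>G))"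
   by (subst nn_integral_cmult, simp, subst nn_integral_add) simp_all
  also have "\<dots> < \<infinity>" using v_MD wfin by (simp add: ennreal_mult_less_top)
  finally show ?thesis .
 qed
 \<comment> \<open>Membership in L^p is read off from the order-zero term of a finite jet sum; it
   serves both for \<open>g\<close> and for the difference.\<close>
 have Lp_nil: "u \<in> Lp_on p a \<Omega>" if u: "\<And>x. x \<in> \<Omega> ==> u x = z [] x" "\<And>s. bmeas (z s)"
  "(\<integral>\<^sup>+x\<in>\<Omega>. MD m p a (\<lambda>s. z s x) \<partial>G) < \<infinity>" for u z
 proof -
  have "ext u = ext (z [])" using u(1) by (auto simp: ext_def)
  moreover have "Lm p (\<lambda>x. ext (z []) x) < \<infinity>"
   using u(3) unfolding MD_ext[OF p, symmetric] by (rule MD_component[OF nil]) (rule ext_measurable[OF u(2)])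
  moreover have "bmeas (ext (z []))" by (rule ext_measurable[OF u(2)])
  ultimately have u': "bmeas (ext u)" "Lm p (ext u) < \<infinity>"
   by (simp_all only:)
  then have "set_borel_measurable G \<Omega> u"
   unfolding set_borel_measurable_def ext_eq[symmetric] by (simp only: measurable_cong_sets[OF sets_G refl])
  moreover have "integrable G (\<lambda>x. \<bar>ext u x\<bar> powr p)" by (rule Lp_integrable(2)[OF u'(1) p u'(2)])
  moreover have "(\<lambda>x. \<bar>ext u x\<bar> powr p) = (\<lambda>x. indicator \<Omega> x *\<^sub>R (\<bar>u x\<bar> powr p))"
   using p by (auto simp: ext_def fun_eq_iff)
  ultimately show ?thesis by (simp add: Lp_on_def set_integrable_def)
 qed
 have Lg: "g \<in> Lp_on p a \<Omega>"
  by (rule Lp_nil[of g "\<lambda>s x. v s x - w s x"]) (use wnil v_meas wm fin in auto)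
 have gS: "g \<in> sobolev m p a \<Omega>"
  by (rule sobolevI(1)[OF p _ Lg W(2) fin]) (use v_meas wm in auto)
 have Ld: "(\<lambda>x. f x - g x) \<in> Lp_on p a \<Omega>"
  by (rule Lp_nil[of _ w]) (use wnil vx wm wfin in auto)
 have Wd: "WD (\<lambda>x. f x - g x) s (w s)" if "s \<in> SL m" for s
  using W(1)[OF that] WD_cong[of "\<lambda>x. f x - g x" "\<lambda>x. v [] x - g x" "w s" "w s" s] vx by simp
 have "sobolev_sum m p a \<Omega> (\<lambda>x. f x - g x) \<le> ennreal \<epsilon>'"
  by (rule ord_eq_le_trans[OF sobolevI(2)[where w = w, OF p wm Ld Wd wfin] le])
 then have "enn2real (sobolev_sum m p a \<Omega> (\<lambda>x. f x - g x)) \<le> \<epsilon>'"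
  using e' by (intro enn2real_leI) auto
 then have "sobolev_norm m p a \<Omega> (\<lambda>x. f x - g x) \<le> \<epsilon>' powr (1 / p)"
  unfolding sobolev_norm_def using p by (intro powr_mono2) auto
 also have "\<dots> = \<epsilon> / 2" using e p by (simp add: \<epsilon>'_def powr_powr)
 finally have "sobolev_norm m p a \<Omega> (\<lambda>x. f x - g x) < \<epsilon>" using e by simp
 then show "\<exists>g \<in> frechet_smooth \<Omega> \<inter> sobolev m p a \<Omega> \<inter> CF_infty_loc a \<Omega>. sobolev_norm m p a \<Omega> (\<lambda>x. f x - g x) < \<epsilon>"
  using g gS by blast
qed

end
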